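(* Let $m,n\geq 1$ be integers, let $\Omega\subset\mathbb{R}^n$ be an open set, let $p>1$, and let $F\colon\mathbb{R}^{m\times n}\to\mathbb{R}$ be quasiconcave and $p$-homogeneous. (i) If $u\colon\Omega\to\mathbb{R}^m$ is weakly differentiable with $Du\in L^p_{\mathrm{loc}}(\Omega,\mathbb{R}^{m\times n})$ and $F(Du)\geq 0$ a.e. in $\Omega$, then $F(Du)\in L\log L_{\mathrm{loc}}(\Omega)$. Moreover, for all open sets $\omega\Subset\tilde\omega\Subset\Omega$, $$\|F(Du)\|_{L\log L(\omega)}\leq C\big(\|Du\|_{L^p(\tilde\omega)},\omega,\tilde\omega\big),$$ where, for fixed $F,p,m,n$, the right-hand side is a finite constant depending on $u$ only through $\|Du\|_{L^p(\tilde\omega)}$. (ii) For every $c>0$ there exists $\varepsilon_0>0$ such that for all $\varepsilon\in(0,\varepsilon_0)$ the following holds: if $u\colon\Omega\to\mathbb{R}^m$ is weakly differentiable with $Du\in L^p_{\mathrm{loc}}(\Omega,\mathbb{R}^{m\times n})$ and $F(Du)\geq c|Du|^p$ a.e. in $\Omega$, then $Du\in L^{p+\varepsilon}_{\mathrm{loc}}(\Omega,\mathbb{R}^{m\times n})$. Moreover, for all open sets $\omega\Subset\tilde\omega\Subset\Omega$, $$\|Du\|_{L^{p+\varepsilon}(\omega)}\leq C\big(\|Du\|_{L^p(\tilde\omega)},\omega,\tilde\omega\big),$$ where, for fixed $F,p,m,n,c,\varepsilon$, the right-hand side is a finite constant depending on $u$ only through $\|Du\|_{L^p(\tilde\ome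ga)}$.
   Context: Quasiconcavity: a function $F\colon\mathbb{R}^{m\times n}\to\mathbb{R}$ (Borel measurable and locally bounded, so that the integrals below make sense) is quasiconcave if, for a cube $Q\subset\mathbb{R}^n$, $$\frac{1}{|Q|}\int_Q F(D\varphi)\,dx\leq F\left(\frac{1}{|Q|}\int_Q D\varphi\,dx\right)$$ for all $\varphi\in C^\infty(\mathbb{R}^n,\mathbb{R}^m)$ such that $D\varphi$ is $Q$-periodic (by translation and scaling the choice of cube is immaterial). $p$-homogeneity: $F(tz)=t^pF(z)$ for all $t>0$ and $z\in\mathbb{R}^{m\times n}$. $|\cdot|$ on matrices is the operator norm. $Du$ is the weak gradient of $u$. $L\log L$: for an open set $\omega$, a measurable $f$ belongs to $L\log L(\omega)$ if $\int_\omega|f|\log(2+|f|)\,dx<\infty$; $\|f\|_{L\log L(\omega)}$ denotes the Luxemburg norm $\inf\{\lambda>0:\int_\omega\frac{|f|}{\lambda}\log(2+\frac{|f|}{\lambda})\,dx\leq 1\}$. $L\log L_{\mathrm{loc}}(\Omega)$ consists of the functions belonging to $L\log L(\omega)$ for every open $\omega\Subset\Omega$. The notation $\omega\Subset\tilde\omega$ means that the closure of $\omega$ is compact and contained in $\tilde\omega$. *)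

theory Defs
  imports "HOL-Analysis.Analysis"
begin

definition op_norm :: "real^'n^'m \<Rightarrow> real"
  where "op_norm A = onorm ((*v) A)"

definition compactly_contained :: "'a::topological_space set \<Rightarrow> 'a set \<Rightarrow> bool"  (infix \<open>\<Subset>\<close> 50)
  where "A \<Subset> B \<longleftrightarrow> compact (closure A) \<and> closure A \<subseteq> B"

text \<open>Class \<open>C\<^sup>k\<close> on the whole space. Iterating directional rather than total derivatives keeps
  the codomain fixed.\<close>

primrec Ck :: "nat \<Rightarrow> ('a::real_normed_vector \<Rightarrow> 'b::real_normed_vector) \<Rightarrow> bool" where
  "Ck 0 f \<longleftrightarrow> continuous_on UNIV f"
| "Ck (Suc k) f \<longleftrightarrow>
     (\<forall>x. f differentiable at x) \<and> (\<forall>v. Ck k (\<lambda>x. frechet_derivative f (at x) v))"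

definition smooth :: "('a::real_normed_vector \<Rightarrow> 'b::real_normed_vector) \<Rightarrow> bool"
  where "smooth f \<longleftrightarrow> (\<forall>k. Ck k f)"

definition gradient :: "(real^'n \<Rightarrow> real^'m) \<Rightarrow> real^'n \<Rightarrow> real^'n^'m"
  where "gradient \<phi> x = matrix (frechet_derivative \<phi> (at x))"

definition cube :: "real^'n \<Rightarrow> real \<Rightarrow> (real^'n) set"
  where "cube a l = cbox a (\<chi> i. a $ i + l)"

definition mean_value :: "(real^'n) set \<Rightarrow> (real^'n \<Rightarrow> 'b::{banach,second_countable_topology}) \<Rightarrow> 'b"
  where "mean_value Q f = (1 / measure lborel Q) *\<^sub>R (LINT x:Q|lborel. f x)"

text \<open>The choice of the cube is immaterial, by translation and scaling. Since \<open>F\<close> is Borel and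
  locally bounded and the gradients are continuous, all integrals below exist.\<close>

definition quasiconcave :: "(real^'n^'m \<Rightarrow> real) \<Rightarrow> bool"
  where "quasiconcave F \<longleftrightarrow>
    F \<in> borel_measurable borel \<and>
    (\<forall>K. compact K \<longrightarrow> bounded (F ` K)) \<and>
    (\<exists>a l. l > 0 \<and>
      (\<forall>\<phi> :: real^'n \<Rightarrow> real^'m.
         smooth \<phi> \<and> (\<forall>x j. gradient \<phi> (x + l *\<^sub>R axis j 1) = gradient \<phi> x) \<longrightarrow>
         mean_value (cube a l) (\<lambda>x. F (gradient \<phi> x)) \<le> F (mean_value (cube a l) (gradient \<phi>))))"

definition pos_homogeneous :: "real \<Rightarrow> (real^'n^'m \<Rightarrow> real) \<Rightarrow> bool"
  where "pos_homogeneous p F \<longleftrightarrow> (\<forall>t>0. \<forall>z. F (t *\<^sub>R z) = t powr p * F z)"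

definition L1_loc :: "(real^'n) set \<Rightarrow> (real^'n \<Rightarrow> 'b::{banach,second_countable_topology}) \<Rightarrow> bool"
  where "L1_loc \<Omega> f \<longleftrightarrow> (\<forall>K. compact K \<and> K \<subseteq> \<Omega> \<longrightarrow> set_integrable lebesgue K f)"

definition test_function :: "(real^'n) set \<Rightarrow> (real^'n \<Rightarrow> real) \<Rightarrow> bool"
  where "test_function \<Omega> \<psi> \<longleftrightarrow> smooth \<psi> \<and> {x. \<psi> x \<noteq> 0} \<Subset> \<Omega>"

text \<open>\<open>G\<close> is a representative of the weak gradient of \<open>u\<close> on \<open>\<Omega>\<close>; \<open>u\<close> is weakly
  differentiable on \<open>\<Omega>\<close> iff such a \<open>G\<close> exists. Values outside \<open>\<Omega>\<close> play no role.\<close>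

definition weak_gradient ::
    "(real^'n) set \<Rightarrow> (real^'n \<Rightarrow> real^'m) \<Rightarrow> (real^'n \<Rightarrow> real^'n^'m) \<Rightarrow> bool"
  where "weak_gradient \<Omega> u G \<longleftrightarrow> L1_loc \<Omega> u \<and> L1_loc \<Omega> G \<and>
    (\<forall>\<psi> i j. test_function \<Omega> \<psi> \<longrightarrow>
      (LINT x:\<Omega>|lebesgue. u x $ i * frechet_derivative \<psi> (at x) (axis j 1)) =
      - (LINT x:\<Omega>|lebesgue. G x $ i $ j * \<psi> x))"

definition in_Lp :: "real \<Rightarrow> (real^'n) set \<Rightarrow> (real^'n \<Rightarrow> real^'n^'m) \<Rightarrow> bool"
  where "in_Lp p \<omega> f \<longleftrightarrow>
    set_borel_measurable lebesgue \<omega> f \<and> set_integrable lebesgue \<omega> (\<lambda>x. op_norm (f x) powr p)"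

definition in_Lp_loc :: "real \<Rightarrow> (real^'n) set \<Rightarrow> (real^'n \<Rightarrow> real^'n^'m) \<Rightarrow> bool"
  where "in_Lp_loc p \<Omega> f \<longleftrightarrow> (\<forall>\<omega>. open \<omega> \<and> \<omega> \<Subset> \<Omega> \<longrightarrow> in_Lp p \<omega> f)"

text \<open>Meaningful only under \<open>in_Lp p \<omega> f\<close>: the Bochner integral of a non-integrable function is 0.\<close>

definition Lp_norm :: "real \<Rightarrow> (real^'n) set \<Rightarrow> (real^'n \<Rightarrow> real^'n^'m) \<Rightarrow> real"
  where "Lp_norm p \<omega> f = (LINT x:\<omega>|lebesgue. op_norm (f x) powr p) powr (1 / p)"

definition in_LlogL :: "(real^'n) set \<Rightarrow> (real^'n \<Rightarrow> real) \<Rightarrow> bool"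
  where "in_LlogL \<omega> f \<longleftrightarrow> set_borel_measurable lebesgue \<omega> f \<and>
    (\<integral>\<^sup>+x\<in>\<omega>. ennreal (\<bar>f x\<bar> * ln (2 + \<bar>f x\<bar>)) \<partial>lebesgue) < \<infinity>"

definition in_LlogL_loc :: "(real^'n) set \<Rightarrow> (real^'n \<Rightarrow> real) \<Rightarrow> bool"
  where "in_LlogL_loc \<Omega> f \<longleftrightarrow> (\<forall>\<omega>. open \<omega> \<and> \<omega> \<Subset> \<Omega> \<longrightarrow> in_LlogL \<omega> f)"

text \<open>The Luxemburg norm, with value \<open>\<infinity>\<close> if no \<open>s\<close> is admissible.\<close>

definition LlogL_norm :: "(real^'n) set \<Rightarrow> (real^'n \<Rightarrow> real) \<Rightarrow> ennreal"
  where "LlogL_norm \<omega> f = Inf {ennreal s |s. s > 0 \<and>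
    (\<integral>\<^sup>+x\<in>\<omega>. ennreal (\<bar>f x\<bar> / s * ln (2 + \<bar>f x\<bar> / s)) \<partial>lebesgue) \<le> 1}"

end

theory Submission
  imports Defs
begin

text \<open>Quasiconcavity gives \<open>\<integral> F (D \<phi>) \<le> 0\<close> for compactly supported \<open>\<phi>\<close>. Testing with
  \<open>\<eta> (u - mean u)\<close>, and using that \<open>F\<close> is locally Lipschitz and \<open>p\<close>-homogeneous, one bounds
  \<open>\<integral> \<eta>\<^sup>p F (D u)\<close> by error terms of the form \<open>\<bar>u - mean u\<bar> \<bar>D u\<bar>\<^bsup>p - 1\<^esup>\<close>, which a Sobolev--Poincare inequality
  turns into a reverse Hoelder inequality: the mean of \<open>F (D u)\<close> on a ball is bounded by a power of the
  mean of \<open>\<bar>D u\<bar>\<^bsup>q\<^esup>\<close>, \<open>q < p\<close>, on a larger ball. A Vitali covering of the set where \<open>F (D u) > l\<close> yields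
  \<open>\<integral>\<^bsub>F (D u) > l\<^esub> F (D u) \<le> C l\<^bsup>1 - q / p\<^esup> \<integral>\<^bsub>\<bar>D u\<bar>\<^sup>p > c l\<^esub> \<bar>D u\<bar>\<^sup>q\<close> for all large levels \<open>l\<close>. Integrating against
  \<open>dl / l\<close> gives (i). Against \<open>l\<^bsup>e - 1\<^esup> dl\<close> the right-hand side carries a factor \<open>e\<close>, so under
  \<open>F (D u) \<ge> c \<bar>D u\<bar>\<^sup>p\<close> it is absorbed for small \<open>e\<close>, which is Gehring's argument for (ii).\<close>

subsection \<open>Smooth functions\<close>

text \<open>Two obstacles shape the proof. First, quasiconcavity gives no continuity of
  \<open>F\<close> directly, while the error terms compare \<open>F\<close> at nearby matrices.
  Concavity along the matrix units, together with local boundedness and homogeneity, supplies a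
  Lipschitz bound with growth exponent \<open>p - 1\<close>. Second, the sign of
  \<open>F (D u)\<close> may be lost under mollification. The reverse Hoelder inequality is
  therefore proved for smooth maps as a bound on a signed integral with a cutoff, and the sign is
  used only after the smoothing has been removed.

  The exponent \<open>q = p - \<delta>\<close> can lie below \<open>p\<close> because the Sobolev
  gain for \<open>u - mean u\<close> pays for a small loss in the gradient; \<open>\<delta>\<close>
  depends on \<open>n\<close> and \<open>p\<close> alone.

  In (ii) the absorbed term must be finite beforehand, so \<open>F (D u)\<close> is truncated at a
  height that tends to infinity at the end; and that term lives on a larger ball than the left-hand
  side, so the absorption is an iteration over radii. The balls covering \<omega> are selected from
  the two open sets alone, before \<open>u\<close> is given; this is why the constants see
  \<open>u\<close> only through its norm.\<close>

lemma Ck_SucI: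
  assumes "\<And>x. (f has_derivative f' x) (at x)" "\<And>v. Ck k (\<lambda>x. f' x v)"
  shows "Ck (Suc k) f"
proof -
  have "frechet_derivative f (at x) = f' x" for x
    using assms(1) frechet_derivative_at by metis
  then show ?thesis
    using assms by (auto simp: differentiable_def)
qed

lemma Ck_SucD:
  assumes "Ck (Suc k) f"
  shows "(f has_derivative frechet_derivative f (at x)) (at x)"
    "Ck k (\<lambda>x. frechet_derivative f (at x) v)"
  using assms frechet_derivative_works by auto

lemma Ck_Suc_imp_Ck: "Ck (Suc k) f \<Longrightarrow> Ck k f"
proof (induction k arbitrary: f)
  case 0
  then show ?case
    using differentiable_imp_continuous_within by (auto simp: continuous_on_eq_continuous_at)
next
  case (Suc k)
  then show ?case by auto
qed

lemma Ck_imp_continuous: "Ck k f \<Longrightarrow> continuous_on UNIV f"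
  by (induction k) (auto simp del: Ck.simps(2) simp: Ck.simps(1) dest: Ck_Suc_imp_Ck)

lemma Ck_const: "Ck k (\<lambda>x. c)"
  by (induction k arbitrary: c) (auto intro!: Ck_SucI[where f' = "\<lambda>x v. 0"])

lemma Ck_bounded_linear_comp:
  assumes "bounded_linear L"
  shows "Ck k f \<Longrightarrow> Ck k (\<lambda>x. L (f x))"
proof (induction k arbitrary: f)
  case 0
  then show ?case
    using bounded_linear.continuous_on[OF assms] by auto
next
  case (Suc k)
  show ?case
    by (rule Ck_SucI[OF bounded_linear.has_derivative[OF assms Ck_SucD(1)[OF Suc.prems]]])
      (rule Suc.IH[OF Ck_SucD(2)[OF Suc.prems]])
qed

lemma Ck_add:
  "Ck k f \<Longrightarrow> Ck k g \<Longrightarrow> Ck k (\<lambda>x. f x + g x)"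
proof (induction k arbitrary: f g)
  case 0
  then show ?case by (auto intro: continuous_intros)
next
  case (Suc k)
  show ?case
    by (rule Ck_SucI[OF has_derivative_add[OF Ck_SucD(1)[OF Suc.prems(1)] Ck_SucD(1)[OF Suc.prems(2)]]])
      (rule Suc.IH[OF Ck_SucD(2)[OF Suc.prems(1)] Ck_SucD(2)[OF Suc.prems(2)]])
qed

lemma Ck_bilinear:
  assumes "bounded_bilinear B"
  shows "Ck k f \<Longrightarrow> Ck k g \<Longrightarrow> Ck k (\<lambda>x. B (f x) (g x))"
proof (induction k arbitrary: f g)
  case 0
  then show ?case using bounded_bilinear.continuous_on[OF assms] by auto
next
  case (Suc k)
  show ?case
    by (rule Ck_SucI[OF bounded_bilinear.FDERIV[OF assms Ck_SucD(1)[OF Suc.prems(1)] Ck_SucD(1)[OF Suc.prems(2)]]])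
      (intro Ck_add Suc.IH Ck_SucD(2)[OF Suc.prems(1)] Ck_SucD(2)[OF Suc.prems(2)]
        Ck_Suc_imp_Ck[OF Suc.prems(1)] Ck_Suc_imp_Ck[OF Suc.prems(2)])
qed

lemma Ck_bounded_linear: "bounded_linear L \<Longrightarrow> Ck k L"
proof (induction k)
  case 0
  then show ?case using bounded_linear.continuous_on continuous_on_id by fastforce
next
  case (Suc k)
  then show ?case
    by (intro Ck_SucI[where f' = "\<lambda>x. L"] bounded_linear_imp_has_derivative Ck_const)
qed

lemma Ck_scaleR: "Ck k f \<Longrightarrow> Ck k g \<Longrightarrow> Ck k (\<lambda>x. f x *\<^sub>R g x)"
  by (rule Ck_bilinear[OF bounded_bilinear_scaleR])

lemma Ck_mult:
  fixes f g :: "'a::real_normed_vector \<Rightarrow> real"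
  shows "Ck k f \<Longrightarrow> Ck k g \<Longrightarrow> Ck k (\<lambda>x. f x * g x)"
  by (rule Ck_bilinear[OF bounded_bilinear_mult])

lemma Ck_diff: "Ck k f \<Longrightarrow> Ck k g \<Longrightarrow> Ck k (\<lambda>x. f x - g x)"
  using Ck_add[of k f "\<lambda>x. - g x"] Ck_bounded_linear_comp[OF bounded_linear_minus[OF bounded_linear_ident], of k g]
  by simp

lemma Ck_comp_affine:
  assumes "bounded_linear L"
  shows "Ck k f \<Longrightarrow> Ck k (\<lambda>x. f (a + L x))"
proof (induction k arbitrary: f)
  case 0
  have "continuous_on UNIV (\<lambda>x. a + L x)"
    using bounded_linear.continuous_on[OF assms continuous_on_id] by (intro continuous_intros)
  then show ?case
    using 0 continuous_on_compose2[of UNIV f UNIV "\<lambda>x. a + L x"] by auto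
next
  case (Suc k)
  have L: "((\<lambda>x. a + L x) has_derivative L) (at x)" for x
    using has_derivative_add[OF has_derivative_const bounded_linear_imp_has_derivative[OF assms]] by auto
  show ?case
    by (rule Ck_SucI[OF has_derivative_compose[OF L Ck_SucD(1)[OF Suc.prems]]])
      (rule Suc.IH[OF Ck_SucD(2)[OF Suc.prems]])
qed

text \<open>Since \<open>h\<close> has a real argument, a directional derivative of the composition
  is the product of \<open>h'\<close> at \<open>f x\<close> with a directional derivative of
  \<open>f\<close>. The induction varies both functions and is applied to \<open>h'\<close> composed
  with \<open>f\<close>.\<close>

lemma Ck_comp_real:
  fixes h :: "real \<Rightarrow> real"
  shows "Ck k h \<Longrightarrow> Ck k f \<Longrightarrow> Ck k (\<lambda>x. h (f x))"
proof (induction k arbitrary: h f)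
  case 0
  then show ?case using continuous_on_compose2[of UNIV h UNIV f] by auto
next
  case (Suc k)
  have eq: "frechet_derivative h (at t) s = s * frechet_derivative h (at t) 1" for t s
    using linear_scale[OF has_derivative_linear[OF Ck_SucD(1)[OF Suc.prems(1)]], of t s 1] by simp
  show ?case
  proof (rule Ck_SucI[OF has_derivative_compose[OF Ck_SucD(1)[OF Suc.prems(2)] Ck_SucD(1)[OF Suc.prems(1)]]])
    show "Ck k (\<lambda>x. frechet_derivative h (at (f x)) (frechet_derivative f (at x) v))" for v
      unfolding eq[of _ "frechet_derivative f (at _) v"]
      by (intro Ck_mult Suc.IH[of "\<lambda>t. frechet_derivative h (at t) 1"] Ck_SucD(2)[OF Suc.prems(1)]
          Ck_SucD(2)[OF Suc.prems(2)] Ck_Suc_imp_Ck[OF Suc.prems(2)])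
  qed
qed

lemma Ck_inverse:
  fixes f :: "'a::real_normed_vector \<Rightarrow> real"
  assumes "\<And>x. f x \<noteq> 0"
  shows "Ck k f \<Longrightarrow> Ck k (\<lambda>x. inverse (f x))"
proof (induction k)
  case 0
  then show ?case using assms by (auto intro: continuous_intros)
next
  case (Suc k)
  have "Ck k (\<lambda>x. (-1) * (inverse (f x) * frechet_derivative f (at x) v * inverse (f x)))" for v
    by (intro Ck_mult Suc.IH Ck_const Ck_SucD(2)[OF Suc.prems] Ck_Suc_imp_Ck[OF Suc.prems])
  then show ?case
    using assms by (intro Ck_SucI[OF Deriv.has_derivative_inverse[OF _ Ck_SucD(1)[OF Suc.prems]]]) auto
qed

text \<open>Meant for functions glued from smooth pieces, such as a periodic extension. Agreement on
  an open set passes to the derivatives, so every directional derivative inherits the local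
  hypothesis.\<close>

lemma Ck_local:
  assumes "\<And>x. \<exists>S g. open S \<and> x \<in> S \<and> Ck k g \<and> (\<forall>y\<in>S. f y = g y)"
  shows "Ck k f"
  using assms
proof (induction k arbitrary: f)
  case 0
  have "isCont f x" for x
  proof -
    obtain S g where S: "open S" "x \<in> S" "Ck 0 g" "\<forall>y\<in>S. f y = g y" using 0 by blast
    then have "isCont g x" by (simp add: continuous_on_eq_continuous_at)
    moreover have "\<forall>\<^sub>F y in nhds x. f y = g y"
      using S by (auto simp: eventually_nhds)
    ultimately show ?thesis using isCont_cong by blast
  qed
  then show ?case by (simp add: continuous_on_eq_continuous_at)
next
  case (Suc k)
  have *: "\<exists>S g. open S \<and> x \<in> S \<and> Ck (Suc k) g \<and> (\<forall>y\<in>S. (f has_derivative frechet_derivative g (at y)) (at y))" for x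
  proof -
    obtain S g where S: "open S" "x \<in> S" "Ck (Suc k) g" "\<forall>y\<in>S. f y = g y" using Suc.prems by blast
    then have "(f has_derivative frechet_derivative g (at y)) (at y)" if "y \<in> S" for y
      using has_derivative_transform_within_open[OF Ck_SucD(1)[OF S(3)] S(1) that] S(4) by simp
    then show ?thesis using S by blast
  qed
  have "Ck k (\<lambda>x. frechet_derivative f (at x) v)" for v
  proof (rule Suc.IH)
    fix x
    obtain S g where S: "open S" "x \<in> S" "Ck (Suc k) g"
      "\<forall>y\<in>S. (f has_derivative frechet_derivative g (at y)) (at y)"
      using * by blast
    have "\<forall>y\<in>S. frechet_derivative f (at y) v = frechet_derivative g (at y) v"
      using S(4) frechet_derivative_at by metis
    then show "\<exists>S g. open S \<and> x \<in> S \<and> Ck k g \<and> (\<forall>y\<in>S. frechet_derivative f (at y) v = g y)"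
      using S Ck_SucD(2) by (intro exI[of _ S] exI[of _ "\<lambda>x. frechet_derivative g (at x) v"]) auto
  qed
  moreover have "f differentiable at x" for x
    using *[of x] by (auto simp: differentiable_def)
  ultimately show ?case by simp
qed

lemma Ck_real_SucI:
  fixes f :: "real \<Rightarrow> real"
  assumes "\<And>x. (f has_real_derivative f' x) (at x)" "Ck k f'"
  shows "Ck (Suc k) f"
  using assms by (intro Ck_SucI[where f' = "\<lambda>x v. f' x * v"])
    (auto simp: has_field_derivative_def intro: Ck_mult Ck_const)

section \<open>Special smooth functions: sine, flat functions, a bump, a smooth sign\<close>

lemma Ck_sin_cos: "Ck k (sin :: real \<Rightarrow> real) \<and> Ck k (cos :: real \<Rightarrow> real)"
proof (induction k)
  case 0
  then show ?case by (auto intro: continuous_intros)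
next
  case (Suc k)
  have "Ck (Suc k) (sin :: real \<Rightarrow> real)"
    by (rule Ck_real_SucI[OF DERIV_sin]) (use Suc in auto)
  moreover have "Ck (Suc k) (cos :: real \<Rightarrow> real)"
    using Suc Ck_diff[of k "\<lambda>x. 0" sin] by (intro Ck_real_SucI[OF DERIV_cos]) (auto simp: Ck_const)
  ultimately show ?case by blast
qed

text \<open>For \<open>m = 0\<close> this is Cauchy's flat function. The powers of
  \<open>inverse t\<close> are carried along because the family is then closed under differentiation
  up to linear combinations, so that smoothness is a single induction over the order.\<close>

definition flat_exp :: "nat \<Rightarrow> real \<Rightarrow> real"
  where "flat_exp m t = (if t > 0 then exp (- inverse t) * inverse t ^ m else 0)"

lemma flat_exp_nonneg: "0 \<le> flat_exp m t"
  by (simp add: flat_exp_def)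

text \<open>One term of the exponential series, of order \<open>m + 2\<close>, already beats
  \<open>inverse t ^ m\<close> with two powers of \<open>t\<close> to spare; the spare square makes
  the difference quotient at 0 vanish.\<close>

lemma flat_exp_le: "flat_exp m t \<le> fact (m + 2) * t\<^sup>2"
proof (cases "t > 0")
  case True
  have "inverse t ^ (m + 2) / fact (m + 2) \<le> exp (inverse t)"
  proof -
    have "(\<Sum>n\<in>{m+2}. inverse t ^ n /\<^sub>R fact n) \<le> (\<Sum>n. inverse t ^ n /\<^sub>R fact n)"
      using True by (intro sum_le_suminf summable_exp_generic) auto
    then show ?thesis by (simp add: exp_def field_simps)
  qed
  then have "inverse t ^ (m + 2) \<le> fact (m + 2) * exp (inverse t)"
    by (simp only: divide_le_eq fact_gt_zero if_True mult.commute)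
  then have "inverse t ^ (m + 2) * exp (- inverse t) \<le> fact (m + 2) * exp (inverse t) * exp (- inverse t)"
    by (intro mult_right_mono) auto
  then have "inverse t ^ (m + 2) * exp (- inverse t) \<le> fact (m + 2)"
    by (simp only: mult.assoc exp_minus_inverse mult_1_right)
  then have "t\<^sup>2 * (inverse t ^ (m + 2) * exp (- inverse t)) \<le> t\<^sup>2 * fact (m + 2)"
    by (intro mult_left_mono) auto
  moreover have "t\<^sup>2 * (inverse t ^ (m + 2) * exp (- inverse t)) = exp (- inverse t) * inverse t ^ m"
  proof -
    have "t * inverse t = 1" using True by simp
    then have "t * (t * (inverse t * (inverse t * (inverse t ^ m * exp (- inverse t))))) = inverse t ^ m * exp (- inverse t)"
      by (metis mult.left_commute mult_1_left mult.assoc)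
    then show ?thesis by (simp add: power_add power2_eq_square mult_ac)
  qed
  ultimately show ?thesis using True by (simp only: flat_exp_def if_True mult.commute)
qed (auto simp: flat_exp_def)

lemma flat_exp_DERIV:
  "(flat_exp m has_real_derivative (flat_exp (m + 2) t - real m * flat_exp (m + 1) t)) (at t)"
proof -
  consider "t > 0" | "t < 0" | "t = 0" by linarith
  then show ?thesis
  proof cases
    case 1
    have "((\<lambda>t. exp (- inverse t) * inverse t ^ m) has_real_derivative
        (flat_exp (m + 2) t - real m * flat_exp (m + 1) t)) (at t)"
    proof (cases m)
      case 0
      then show ?thesis
        using 1 by (auto intro!: derivative_eq_intros simp: flat_exp_def power2_eq_square algebra_simps)
    next
      case (Suc j)
      show ?thesis
        unfolding Suc
        by (rule DERIV_cong[OF DERIV_mult[OF DERIV_fun_exp[OF DERIV_minus[OF DERIV_inverse]]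
                DERIV_power_Suc[OF DERIV_inverse]]])
          (use 1 in \<open>auto simp: flat_exp_def algebra_simps power2_eq_square\<close>)
    qed
    then show ?thesis
      by (rule has_field_derivative_transform_within_open[of _ _ _ "{0<..}"]) (use 1 in \<open>auto simp: flat_exp_def\<close>)
  next
    case 2
    have "((\<lambda>t. 0) has_real_derivative 0) (at t)" by simp
    then have "(flat_exp m has_real_derivative 0) (at t)"
      by (rule has_field_derivative_transform_within_open[of _ _ _ "{..<0}"]) (use 2 in \<open>auto simp: flat_exp_def\<close>)
    then show ?thesis using 2 by (simp add: flat_exp_def)
  next
    case 3
    have "((\<lambda>h. (flat_exp m (0 + h) - flat_exp m 0) / h) \<longlongrightarrow> 0) (at 0)"
    proof (rule Lim_null_comparison)
      show "((\<lambda>h::real. fact (m + 2) * \<bar>h\<bar>) \<longlongrightarrow> 0) (at 0)"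
        by (rule tendsto_eq_intros refl | simp)+
      have "norm ((flat_exp m (0 + h) - flat_exp m 0) / h) \<le> fact (m + 2) * \<bar>h\<bar>" if "h \<noteq> 0" for h
      proof -
        have "flat_exp m h / \<bar>h\<bar> \<le> fact (m + 2) * h\<^sup>2 / \<bar>h\<bar>"
          by (intro divide_right_mono flat_exp_le) simp
        also have "\<dots> = fact (m + 2) * \<bar>h\<bar>"
          using that by (simp add: power2_eq_square abs_if)
        finally show ?thesis
          using flat_exp_nonneg[of m h] by (simp add: flat_exp_def[of m 0])
      qed
      then show "\<forall>\<^sub>F h in at 0. norm ((flat_exp m (0 + h) - flat_exp m 0) / h) \<le> fact (m + 2) * \<bar>h\<bar>"
        by (auto simp: eventually_at intro: exI[of _ 1])
    qed
    then show ?thesis using 3 by (simp add: DERIV_def flat_exp_def)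
  qed
qed

lemma Ck_flat_exp: "Ck k (flat_exp m)"
proof -
  have "Ck (Suc k) (flat_exp m)"
  proof (induction k arbitrary: m)
    case 0
    have "continuous_on UNIV (flat_exp m)" for m
      using DERIV_isCont[OF flat_exp_DERIV] by (simp add: continuous_on_eq_continuous_at)
    then show ?case
      by (intro Ck_real_SucI[OF flat_exp_DERIV]) (auto intro!: continuous_intros)
  next
    case (Suc k)
    show ?case
      by (rule Ck_real_SucI[OF flat_exp_DERIV]) (intro Ck_diff Ck_mult Ck_const Suc)
  qed
  then show ?thesis by (rule Ck_Suc_imp_Ck)
qed

text \<open>Built from the squared norm, since the norm itself is not differentiable at the
  origin.\<close>

definition bump :: "real^'n \<Rightarrow> real"
  where "bump x = flat_exp 0 (1 - x \<bullet> x)"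

lemma smooth_bump: "smooth bump"
  unfolding smooth_def bump_def[abs_def]
proof
  fix k
  have id: "Ck k (\<lambda>x. x)"
    by (rule Ck_bounded_linear[OF bounded_linear_ident])
  show "Ck k (\<lambda>x. flat_exp 0 (1 - x \<bullet> x))"
    by (rule Ck_comp_real[OF Ck_flat_exp Ck_diff[OF Ck_const Ck_bilinear[OF bounded_bilinear_inner id id]]])
qed

lemma inner_less_1_iff: "x \<bullet> x < 1 \<longleftrightarrow> norm x < (1::real)"
  by (simp add: norm_eq_sqrt_inner)

lemma bump_nonneg: "0 \<le> bump x"
  by (simp add: bump_def flat_exp_nonneg)

lemma bump_eq_0_iff: "bump x = 0 \<longleftrightarrow> 1 \<le> norm x"
  using inner_less_1_iff[of x] by (auto simp: bump_def flat_exp_def)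

text \<open>On the half ball \<open>1 - x \<bullet> x\<close> is at least 3/4, and 4/3 is rounded up
  to 2. This bound is what allows the cutoff to be discarded on a smaller ball.\<close>

lemma bump_lower:
  assumes "norm x \<le> 1/2"
  shows "exp (-2) \<le> bump x"
proof -
  have "x \<bullet> x \<le> 1/4"
    using power_mono[OF assms norm_ge_zero, of 2]
    by (simp add: power2_norm_eq_inner[symmetric] power_divide)
  then have "exp (-2) \<le> exp (- inverse (1 - x \<bullet> x))" "1 - x \<bullet> x > 0"
    by (auto simp: field_simps)
  then show ?thesis by (simp add: bump_def flat_exp_def)
qed

lemma bump_le_1: "bump x \<le> 1"
  by (simp add: bump_def flat_exp_def)

text \<open>An odd transition between the constants -1 and 1. Its dilations
  \<open>smooth_sgn (k * y)\<close> become equal to \<open>sgn y\<close> for large \<open>k\<close>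
  at every \<open>y\<close>, including \<open>y = 0\<close>.\<close>

definition smooth_sgn :: "real \<Rightarrow> real"
  where "smooth_sgn y = (flat_exp 0 (1 + y) - flat_exp 0 (1 - y)) / (flat_exp 0 (1 + y) + flat_exp 0 (1 - y))"

lemma flat_exp_add_pos: "flat_exp 0 (1 + y) + flat_exp 0 (1 - y) > 0"
proof (cases "y > -1")
  case True
  then have "flat_exp 0 (1 + y) > 0" by (simp add: flat_exp_def)
  then show ?thesis using flat_exp_nonneg[of 0 "1 - y"] by linarith
next
  case False
  then have "flat_exp 0 (1 - y) > 0" by (simp add: flat_exp_def)
  then show ?thesis using flat_exp_nonneg[of 0 "1 + y"] by linarith
qed

lemma Ck_smooth_sgn: "Ck k smooth_sgn"
proof -
  have p: "Ck k (\<lambda>y. flat_exp 0 (1 + y))"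
    using Ck_comp_affine[OF bounded_linear_ident Ck_flat_exp] .
  have m: "Ck k (\<lambda>y. flat_exp 0 (1 - y))"
    using Ck_comp_affine[OF bounded_linear_minus[OF bounded_linear_ident] Ck_flat_exp, of k 0 1] by simp
  show ?thesis
    unfolding smooth_sgn_def[abs_def] divide_inverse
    by (rule Ck_mult[OF Ck_diff[OF p m] Ck_inverse[OF less_imp_neq[OF flat_exp_add_pos, symmetric] Ck_add[OF p m]]])
qed

lemma smooth_sgn_simps:
  "smooth_sgn (-y) = - smooth_sgn y"
  "y \<ge> 1 \<Longrightarrow> smooth_sgn y = 1"
  "y \<le> -1 \<Longrightarrow> smooth_sgn y = -1"
  "\<bar>smooth_sgn y\<bar> \<le> 1"
proof -
  show "smooth_sgn (-y) = - smooth_sgn y"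
    unfolding smooth_sgn_def minus_divide_left minus_diff_eq
    by (simp add: add.commute[of "flat_exp 0 (1 - y)"])
  show "y \<ge> 1 \<Longrightarrow> smooth_sgn y = 1" "y \<le> -1 \<Longrightarrow> smooth_sgn y = -1"
    unfolding smooth_sgn_def by (auto simp: flat_exp_def)
  show "\<bar>smooth_sgn y\<bar> \<le> 1"
    unfolding smooth_sgn_def using flat_exp_add_pos[of y] flat_exp_nonneg[of 0 "1+y"] flat_exp_nonneg[of 0 "1-y"]
    by (simp add: abs_le_iff pos_divide_le_eq pos_le_divide_eq minus_divide_left)
qed

subsection \<open>Affine changes of variables\<close>

lemma nn_integral_lborel_affine:
  fixes t :: "'a::euclidean_space"
  assumes "f \<in> borel_measurable borel" "c \<noteq> 0"
  shows "(\<integral>\<^sup>+x. f x \<partial>lborel) = ennreal (\<bar>c\<bar> ^ DIM('a)) * (\<integral>\<^sup>+x. f (t + c *\<^sub>R x) \<partial>lborel)"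
  by (subst lborel_affine[OF assms(2), of t])
    (use assms in \<open>simp add: nn_integral_density nn_integral_distr nn_integral_cmult\<close>)

lemma integral_lborel_affine:
  fixes t :: "'a::euclidean_space" and f :: "'a \<Rightarrow> 'b::{banach, second_countable_topology}"
  assumes "f \<in> borel_measurable borel" "c \<noteq> 0"
  shows "integral\<^sup>L lborel f = (\<bar>c\<bar> ^ DIM('a)) *\<^sub>R (LINT x|lborel. f (t + c *\<^sub>R x))"
  by (subst lborel_affine[OF assms(2), of t])
    (use assms in \<open>simp add: integral_density integral_distr\<close>)

lemma integrable_lborel_affine:
  fixes t :: "'a::euclidean_space" and f :: "'a \<Rightarrow> 'b::{banach, second_countable_topology}"
  assumes "integrable lborel f" "c \<noteq> 0"
  shows "integrable lborel (\<lambda>x. f (t + c *\<^sub>R x))"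
proof -
  have f: "f \<in> borel_measurable borel" using assms by auto
  have "integrable (density (distr lborel borel (\<lambda>x. t + c *\<^sub>R x)) (\<lambda>_. ennreal (\<bar>c\<bar> ^ DIM('a)))) f"
    using assms(1) lborel_affine[OF assms(2), of t] by simp
  then have "integrable (distr lborel borel (\<lambda>x. t + c *\<^sub>R x)) (\<lambda>x. (\<bar>c\<bar> ^ DIM('a)) *\<^sub>R f x)"
    using f by (subst (asm) integrable_density) auto
  then have "integrable lborel (\<lambda>x. (\<bar>c\<bar> ^ DIM('a)) *\<^sub>R f (t + c *\<^sub>R x))"
    using f by (subst (asm) integrable_distr_eq) auto
  then have "integrable lborel (\<lambda>x. inverse (\<bar>c\<bar> ^ DIM('a)) *\<^sub>R (\<bar>c\<bar> ^ DIM('a)) *\<^sub>R f (t + c *\<^sub>R x))"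
    by (rule integrable_scaleR_right)
  then show ?thesis
    using assms(2) by simp
qed

subsection \<open>Local Lipschitz continuity of quasiconcave functions\<close>

lemma gradient_eq: "(\<phi> has_derivative \<phi>') (at x) \<Longrightarrow> gradient \<phi> x = matrix \<phi>'"
  unfolding gradient_def using frechet_derivative_at by metis

lemma gradient_nth: "gradient \<phi> x $ i $ j = frechet_derivative \<phi> (at x) (axis j 1) $ i"
  by (simp add: gradient_def matrix_def)

lemma smooth_has_derivative:
  "smooth \<phi> \<Longrightarrow> (\<phi> has_derivative frechet_derivative \<phi> (at x)) (at x)"
  unfolding smooth_def using Ck_SucD(1) by blast

lemma smooth_continuous_frechet:
  "smooth \<phi> \<Longrightarrow> continuous_on UNIV (\<lambda>x. frechet_derivative \<phi> (at x) v)"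
  unfolding smooth_def using Ck_SucD(2) Ck_imp_continuous by blast

lemma smooth_imp_continuous: "smooth \<phi> \<Longrightarrow> continuous_on UNIV \<phi>"
  unfolding smooth_def using Ck_imp_continuous by blast

lemma smooth_continuous_gradient:
  assumes "smooth \<phi>" shows "continuous_on UNIV (gradient \<phi>)"
proof -
  have "continuous_on UNIV (\<lambda>x. \<chi> i j. frechet_derivative \<phi> (at x) (axis j 1) $ i)"
    by (intro continuous_intros smooth_continuous_frechet assms)
  then show ?thesis by (simp add: gradient_def[abs_def] matrix_def)
qed

lemma smooth_frechet_eq_gradient:
  assumes "smooth \<phi>" shows "frechet_derivative \<phi> (at x) v = gradient \<phi> x *v v"
  unfolding gradient_def
  using fun_cong[OF matrix_vector_mul(2)[OF has_derivative_linear[OF smooth_has_derivative[OF assms]]]] by simp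

text \<open>The perturbation depends on one coordinate and points in one fixed direction, so the
  gradient moves only along the line through \<open>A\<close> spanned by a matrix unit.\<close>

lemma shear_gradient:
  fixes A :: "real^'n^'m" and i :: 'm and j :: 'n
  assumes h: "\<And>t. (h has_real_derivative s t) (at t)" and s: "\<And>k. Ck k s"
  defines "\<phi> \<equiv> \<lambda>x. A *v x + h (x $ j) *\<^sub>R axis i 1"
  shows "smooth \<phi>" "gradient \<phi> x = A + s (x $ j) *\<^sub>R axis i (axis j 1)"
proof -
  have h': "Ck k h" for k
    using Ck_real_SucI[OF h s[of k]] by (rule Ck_Suc_imp_Ck)
  show "smooth \<phi>"
    unfolding smooth_def \<phi>_def
    by (rule allI, rule Ck_add[OF Ck_bounded_linear[OF matrix_vector_mul_bounded_linear]
          Ck_scaleR[OF Ck_comp_real[OF h' Ck_bounded_linear[OF bounded_linear_vec_nth]] Ck_const]])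
  have "(\<phi> has_derivative (\<lambda>v. A *v v + (s (x $ j) * v $ j) *\<^sub>R axis i 1)) (at x)"
    unfolding \<phi>_def
    by (intro has_derivative_add has_derivative_scaleR_left
        bounded_linear_imp_has_derivative[OF matrix_vector_mul_bounded_linear]
        has_derivative_compose[OF bounded_linear_imp_has_derivative[OF bounded_linear_vec_nth]
          h[unfolded has_field_derivative_def]])
  from gradient_eq[OF this] show "gradient \<phi> x = A + s (x $ j) *\<^sub>R axis i (axis j 1)"
    by (auto simp: vec_eq_iff matrix_def axis_def matrix_vector_mult_def if_distrib cong: if_cong)
qed

lemma measure_cube_pos: "l > 0 \<Longrightarrow> measure lborel (cube a l) > 0"
  unfolding cube_def by (subst measure_lborel_cbox_eq) (auto simp: Basis_vec_def inner_axis intro!: prod_pos)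

lemma cube_measurable [measurable]: "cube a l \<in> sets borel"
  by (simp add: cube_def)

lemma emeasure_cube_finite: "emeasure lborel (cube a l) < \<infinity>"
  unfolding cube_def using emeasure_lborel_cbox_finite by (metis less_top infinity_ennreal_def)

text \<open>The test maps are \<open>A x + d h (x\<^sub>j) e\<^sub>i\<close> with \<open>h'\<close> a smooth odd approximation of a square wave on the
  cube, whose gradients take essentially the two values \<open>A \<plusminus> d E\<^sub>i\<^sub>j\<close> on halves of the cube.\<close>

lemma quasiconcave_midpoint:
  fixes F :: "real^'n^'m \<Rightarrow> real"
  assumes "quasiconcave F"
  shows "F (A + d *\<^sub>R axis i (axis j 1)) + F (A - d *\<^sub>R axis i (axis j 1)) \<le> 2 * F A"
proof -
  define E :: "real^'n^'m" where "E = axis i (axis j 1)"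
  obtain a l where l: "l > 0" and Q: "\<And>\<phi> :: real^'n \<Rightarrow> real^'m. smooth \<phi> \<Longrightarrow>
      (\<And>x j. gradient \<phi> (x + l *\<^sub>R axis j 1) = gradient \<phi> x) \<Longrightarrow>
      mean_value (cube a l) (\<lambda>x. F (gradient \<phi> x)) \<le> F (mean_value (cube a l) (gradient \<phi>))"
    and [measurable]: "F \<in> borel_measurable borel" and bdd: "\<And>K. compact K \<Longrightarrow> bounded (F ` K)"
    using assms unfolding quasiconcave_def by blast
  have "bounded (F ` cball 0 (norm A + \<bar>d\<bar>))" by (intro bdd) simp
  then obtain M where "\<forall>y\<in>F ` cball 0 (norm A + \<bar>d\<bar>). norm y \<le> M"
    unfolding bounded_iff by blast
  then have M: "\<bar>F z\<bar> \<le> M" if "norm z \<le> norm A + \<bar>d\<bar>" for z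
    using that by simp
  have nE: "norm E = 1" by (simp add: E_def)
  have ME: "\<bar>F (A + r *\<^sub>R E)\<bar> \<le> M" if "\<bar>r\<bar> \<le> \<bar>d\<bar>" for r
    using norm_triangle_ineq[of A "r *\<^sub>R E"] that nE by (intro M) simp
  \<comment> \<open>A sine of period \<open>l\<close>, centred in the cube in direction
    \<open>j\<close>: negative on one half of the side and positive on the other. Sharpening it with
    \<open>smooth_sgn (k * _)\<close> keeps both smoothness and periodicity.\<close>
  define \<theta> where "\<theta> t = sin (2 * pi * (t - (a $ j + l / 2)) / l)" for t
  define s where "s k t = d * smooth_sgn (real k * \<theta> t)" for k :: nat and t
  have Ck_s: "Ck k' (s k)" for k k'
  proof -
    have "Ck k' (\<lambda>t. sin ((- 2 * pi * (a $ j + l / 2) / l) + (2 * pi / l) * t))"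
      by (rule Ck_comp_affine[OF bounded_linear_mult_right]) (simp add: Ck_sin_cos)
    moreover have "(- 2 * pi * (a $ j + l / 2) / l) + (2 * pi / l) * t = 2 * pi * (t - (a $ j + l / 2)) / l" for t
      using l by (simp add: field_simps)
    ultimately have "Ck k' \<theta>" unfolding \<theta>_def[abs_def] by simp
    then show ?thesis
      unfolding s_def[abs_def] by (intro Ck_mult Ck_const Ck_comp_real[OF Ck_smooth_sgn])
  qed
  have s_le: "\<bar>s k t\<bar> \<le> \<bar>d\<bar>" for k t
    using smooth_sgn_simps(4) by (simp add: s_def abs_mult mult_left_le)
  have s_per: "s k (t + l) = s k t" for k t
  proof -
    have "2 * pi * (t + l - (a $ j + l / 2)) / l = 2 * pi * (t - (a $ j + l / 2)) / l + 2 * pi"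
      using l by (simp add: field_simps)
    then show ?thesis by (simp add: s_def \<theta>_def)
  qed
  \<comment> \<open>The point reflection \<open>x \<mapsto> c - x\<close> maps the cube onto itself
    and reverses the sign of \<open>\<theta>\<close>.\<close>
  define c where "c = (\<chi> i. 2 * a $ i + l)"
  have c_\<theta>: "\<theta> ((c - x) $ j) = - \<theta> (x $ j)" for x
  proof -
    have "2 * pi * ((c - x) $ j - (a $ j + l / 2)) / l = - (2 * pi * (x $ j - (a $ j + l / 2)) / l)"
      using l by (simp add: c_def field_simps)
    then show ?thesis by (simp add: \<theta>_def)
  qed
  have c_cube: "indicator (cube a l) (c - x) = (indicator (cube a l) x :: real)" for x
    by (auto simp: cube_def mem_box_cart c_def indicator_def algebra_simps)
  have refl: "(LINT x:cube a l|lborel. f x) = (LINT x:cube a l|lborel. f (c - x))"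
    if "f \<in> borel_measurable borel" for f :: "real^'n \<Rightarrow> 'b::{banach, second_countable_topology}"
    unfolding set_lebesgue_integral_def
    by (subst integral_lborel_affine[of _ "-1" c]) (use that in \<open>auto simp: c_cube\<close>)
  have cont_s: "continuous_on UNIV (s k)" for k
    using Ck_s Ck_imp_continuous by blast
  have ms[measurable]: "s k \<in> borel_measurable borel" for k
    using cont_s by (rule borel_measurable_continuous_onI)
  have m\<theta>[measurable]: "\<theta> \<in> borel_measurable borel"
    unfolding \<theta>_def by measurable
  have cubeint: "set_integrable lborel (cube a l) g"
    if "g \<in> borel_measurable borel" "\<And>x. norm (g x) \<le> B" for g :: "real^'n \<Rightarrow> 'b::{banach, second_countable_topology}" and B
    unfolding set_integrable_def
  proof (rule integrableI_bounded_set_indicator)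
    show "AE x in lborel. x \<in> cube a l \<longrightarrow> norm (g x) \<le> B" using that by simp
  qed (use that emeasure_cube_finite in auto)
  have mean_const: "(LINT x:cube a l|lborel. z) = measure lborel (cube a l) *\<^sub>R z"
    for z :: "'b::{banach, second_countable_topology}"
    unfolding set_lebesgue_integral_def using emeasure_cube_finite[of a l] by (subst integral_scaleR_left) auto
  have step: "(LINT x:cube a l|lborel. F (A + s k (x $ j) *\<^sub>R E)) \<le> measure lborel (cube a l) * F A" for k
  proof -
    have "\<And>x::real. isCont (s k) x"
      using cont_s by (simp add: continuous_on_eq_continuous_at)
    then obtain h where h: "\<And>t. (h has_vector_derivative s k t) (at t)"
      using einterval_antiderivative[of "-\<infinity>" "\<infinity>" "s k"] by auto
    define \<phi> where "\<phi> = (\<lambda>x. A *v x + h (x $ j) *\<^sub>R axis i 1)"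
    have sm: "smooth \<phi>" and gr: "gradient \<phi> x = A + s k (x $ j) *\<^sub>R E" for x
      using shear_gradient[of h "s k" A j i] h Ck_s unfolding \<phi>_def E_def
      by (auto simp: has_real_derivative_iff_has_vector_derivative)
    have per: "gradient \<phi> (x + l *\<^sub>R axis j' 1) = gradient \<phi> x" for x j'
      unfolding gr by (auto simp: axis_def s_per)
    \<comment> \<open>The reflection makes the mean of the profile vanish exactly for every
      \<open>k\<close>, so the mean gradient is \<open>A\<close> and not just an approximation of
      it.\<close>
    have int_s: "(LINT x:cube a l|lborel. s k (x $ j)) = 0"
    proof -
      have "(LINT x:cube a l|lborel. s k (x $ j)) = (LINT x:cube a l|lborel. s k ((c - x) $ j))"
        by (rule refl) measurable
      also have "\<dots> = (LINT x:cube a l|lborel. - s k (x $ j))"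
        unfolding s_def c_\<theta> using smooth_sgn_simps(1) by simp
      also have "\<dots> = - (LINT x:cube a l|lborel. s k (x $ j))"
        unfolding set_lebesgue_integral_def by simp
      finally show ?thesis by simp
    qed
    have "(LINT x:cube a l|lborel. A + s k (x $ j) *\<^sub>R E)
        = (LINT x:cube a l|lborel. A) + (LINT x:cube a l|lborel. s k (x $ j) *\<^sub>R E)"
      using s_le nE by (intro set_integral_add(2) cubeint[of _ "norm A"] cubeint[of _ "\<bar>d\<bar>"]) auto
    also have "(LINT x:cube a l|lborel. s k (x $ j) *\<^sub>R E) = 0"
    proof -
      have "set_integrable lborel (cube a l) (\<lambda>x. s k (x $ j))"
        using s_le by (intro cubeint[of _ "\<bar>d\<bar>"]) auto
      then show ?thesis
        using int_s integral_scaleR_left[of E lborel "\<lambda>x. indicat_real (cube a l) x *\<^sub>R s k (x $ j)"]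
        unfolding set_lebesgue_integral_def set_integrable_def by simp
    qed
    finally have "mean_value (cube a l) (gradient \<phi>) = A"
      using measure_cube_pos[OF l, of a] unfolding mean_value_def gr mean_const by simp
    then show ?thesis
      using Q[OF sm per] measure_cube_pos[OF l, of a] unfolding mean_value_def gr
      by (simp add: field_simps)
  qed
  define f where "f x = F (A + (d * sgn (\<theta> (x $ j))) *\<^sub>R E)" for x :: "real^'n"
  have [measurable]: "f \<in> borel_measurable borel"
    unfolding f_def by measurable
  have sgn_le: "\<bar>d * sgn r\<bar> \<le> \<bar>d\<bar>" for r :: real
    by (simp add: sgn_if)
  have "(\<lambda>k. LINT x:cube a l|lborel. F (A + s k (x $ j) *\<^sub>R E)) \<longlonglongrightarrow> (LINT x:cube a l|lborel. f x)"
    unfolding set_lebesgue_integral_def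
  proof (rule integral_dominated_convergence[where w = "\<lambda>x. indicator (cube a l) x * M"])
    show "integrable lborel (\<lambda>x. indicator (cube a l) x * M)"
      using cubeint[of "\<lambda>x. M" "\<bar>M\<bar>"] unfolding set_integrable_def by simp
    \<comment> \<open>Continuity of \<open>F\<close> is not known at this stage. The limit exists
      because, at each fixed \<open>x\<close>, the arguments of \<open>F\<close> are eventually
      constant.\<close>
    have "(\<lambda>k. F (A + s k (x $ j) *\<^sub>R E)) \<longlonglongrightarrow> f x" for x
    proof -
      obtain k0 :: nat where k0: "\<theta> (x $ j) \<noteq> 0 \<Longrightarrow> real k0 * \<bar>\<theta> (x $ j)\<bar> \<ge> 1"
        using reals_Archimedean3[of "\<bar>\<theta> (x $ j)\<bar>"] by (metis less_imp_le zero_less_abs_iff)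
      have "smooth_sgn (real k * \<theta> (x $ j)) = sgn (\<theta> (x $ j))" if "k \<ge> k0" for k
      proof (cases "\<theta> (x $ j) = 0")
        case True
        then show ?thesis using smooth_sgn_simps(1)[of 0] by simp
      next
        case False
        have "real k0 * \<bar>\<theta> (x $ j)\<bar> \<le> real k * \<bar>\<theta> (x $ j)\<bar>"
          using that by (intro mult_right_mono) auto
        then have "real k * \<bar>\<theta> (x $ j)\<bar> \<ge> 1" using k0[OF False] by simp
        then show ?thesis
          using False by (cases "\<theta> (x $ j) > 0") (auto intro!: smooth_sgn_simps)
      qed
      then have "\<forall>\<^sub>F k in sequentially. F (A + s k (x $ j) *\<^sub>R E) = f x"
        unfolding f_def s_def eventually_sequentially by (intro exI[of _ k0]) simp
      then show ?thesis by (rule tendsto_eventually)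
    qed
    then show "AE x in lborel. (\<lambda>k. indicat_real (cube a l) x *\<^sub>R F (A + s k (x $ j) *\<^sub>R E)) \<longlonglongrightarrow> indicat_real (cube a l) x *\<^sub>R f x"
      by (intro always_eventually allI tendsto_intros)
    show "AE x in lborel. norm (indicat_real (cube a l) x *\<^sub>R F (A + s k (x $ j) *\<^sub>R E)) \<le> indicator (cube a l) x * M" for k
      using ME[OF s_le] by (intro always_eventually) (auto simp: indicator_def)
  qed measurable
  then have *: "(LINT x:cube a l|lborel. f x) \<le> measure lborel (cube a l) * F A"
    using step by (intro LIMSEQ_le_const2) auto
  \<comment> \<open>Adding the reflected integrand replaces the computation of the volumes of the
    two halves: off finitely many hyperplanes one of \<open>f x\<close>, \<open>f (c - x)\<close> is
    the value at \<open>A + d E\<close> and the other the value at \<open>A - d E\<close>.\<close>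
  have "2 * (LINT x:cube a l|lborel. f x) = (LINT x:cube a l|lborel. f x) + (LINT x:cube a l|lborel. f (c - x))"
    using refl[of f] by simp
  also have "\<dots> = (LINT x:cube a l|lborel. f x + f (c - x))"
    using ME[OF sgn_le] by (intro set_integral_add(2)[symmetric] cubeint[of _ M]) (auto simp: f_def)
  also have "\<dots> = (LINT x:cube a l|lborel. F (A + d *\<^sub>R E) + F (A - d *\<^sub>R E))"
  proof -
    have 1: "{x :: real^'n. x $ j = r} \<in> null_sets lebesgue" for r
      using negligible_standard_hyperplane[of "axis j 1 :: real^'n" r, OF axis_in_Basis_iff[THEN iffD2]]
      by (simp add: negligible_iff_null_sets inner_axis)
    have 2: "AE x :: real^'n in lborel. x $ j \<noteq> r" for r
    proof -
      have "{x :: real^'n. x $ j = r} \<in> sets lborel" by measurable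
      then have "{x :: real^'n. x $ j = r} \<in> null_sets lborel"
        using 1[of r] by (simp add: null_sets_def)
      then show ?thesis by (rule AE_I') auto
    qed
    have eq: "f x + f (c - x) = F (A + d *\<^sub>R E) + F (A - d *\<^sub>R E)"
      if x: "x \<in> cube a l" "x $ j \<noteq> a $ j" "x $ j \<noteq> a $ j + l" "x $ j \<noteq> a $ j + l / 2" for x
    proof -
      have "x $ j > a $ j" "x $ j < a $ j + l"
        using x by (auto simp: cube_def mem_box_cart less_le)
      then have "\<theta> (x $ j) \<noteq> 0"
      proof -
        define r where "r = 2 * pi * (x $ j - (a $ j + l / 2)) / l"
        have "\<bar>x $ j - (a $ j + l / 2)\<bar> < l / 2" using \<open>x $ j > a $ j\<close> \<open>x $ j < a $ j + l\<close> by linarith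
        then have "2 * pi * \<bar>x $ j - (a $ j + l / 2)\<bar> < 2 * pi * (l / 2)" by (intro mult_strict_left_mono) auto
        then have "\<bar>r\<bar> < pi" using l by (simp add: r_def abs_mult pos_divide_less_eq)
        moreover have "r \<noteq> 0" using x l by (simp add: r_def)
        ultimately have "sin r \<noteq> 0"
          using sin_gt_zero[of r] sin_gt_zero[of "-r"] by (cases "r > 0") (auto simp: abs_less_iff)
        then show ?thesis by (simp add: \<theta>_def r_def)
      qed
      then show ?thesis
        unfolding f_def c_\<theta> by (cases "\<theta> (x $ j) > 0") (auto simp: sgn_if)
    qed
    have "AE x in lborel. x \<in> cube a l \<longrightarrow> f x + f (c - x) = F (A + d *\<^sub>R E) + F (A - d *\<^sub>R E)"
      using 2[of "a $ j"] 2[of "a $ j + l"] 2[of "a $ j + l / 2"] by eventually_elim (use eq in blast)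
    then show ?thesis
      by (intro set_lebesgue_integral_cong_AE) measurable
  qed
  also have "\<dots> = measure lborel (cube a l) * (F (A + d *\<^sub>R E) + F (A - d *\<^sub>R E))"
    by (simp add: mean_const)
  finally have "measure lborel (cube a l) * (F (A + d *\<^sub>R E) + F (A - d *\<^sub>R E)) \<le> measure lborel (cube a l) * (2 * F A)"
    using * by simp
  then show ?thesis
    using measure_cube_pos[OF l, of a] unfolding E_def by simp
qed

text \<open>Midpoint concavity makes increments grow at most linearly under doubling. If a short
  step lost too much, doubling it up to length about 1 would lose more than \<open>2 * M\<close>,
  which the bound on \<open>F\<close> forbids. Exchanging the endpoints turns the lower bound into a
  two-sided one.\<close>

lemma midpoint_concave_direction_lipschitz:
  fixes F :: "'a::real_normed_vector \<Rightarrow> real"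
  assumes mid: "\<And>z t. F (z + t *\<^sub>R e) + F (z - t *\<^sub>R e) \<le> 2 * F z"
    and M: "\<And>z. norm z \<le> K + 1 \<Longrightarrow> \<bar>F z\<bar> \<le> M" and e: "norm e = 1"
    and x: "norm x \<le> K" "norm (x + h *\<^sub>R e) \<le> K"
  shows "\<bar>F (x + h *\<^sub>R e) - F x\<bar> \<le> 4 * M * \<bar>h\<bar>"
proof -
  have M0: "0 \<le> M"
    using M[of x] x(1) by auto
  have double: "F (x + (2 ^ j * h) *\<^sub>R e) - F x \<le> 2 ^ j * (F (x + h *\<^sub>R e) - F x)" for x h and j :: nat
  proof (induction j)
    case (Suc j)
    define t where "t = 2 ^ j * h"
    have t: "2 ^ Suc j * h = t + t" by (simp add: t_def)
    have "F (x + (t + t) *\<^sub>R e) + F x \<le> 2 * F (x + t *\<^sub>R e)"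
      using mid[of "x + t *\<^sub>R e" t] by (simp only: scaleR_add_left add.assoc add_diff_cancel)
    moreover have "F (x + t *\<^sub>R e) - F x \<le> 2 ^ j * (F (x + h *\<^sub>R e) - F x)"
      using Suc by (simp add: t_def)
    ultimately have "F (x + (t + t) *\<^sub>R e) - F x \<le> 2 * (2 ^ j * (F (x + h *\<^sub>R e) - F x))"
      by linarith
    then show ?case unfolding t by (simp only: power_Suc mult.assoc)
  qed simp
  have lower: "F (x + h *\<^sub>R e) - F x \<ge> - (4 * M * \<bar>h\<bar>)"
    if x: "norm x \<le> K" "norm (x + h *\<^sub>R e) \<le> K" for x h
  proof (cases "\<bar>h\<bar> \<le> 1 \<and> h \<noteq> 0")
    case True
    \<comment> \<open>The number of doublings that brings the step length into the interval from 1/2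
      to 1; the upper end keeps the enlarged point inside the ball of radius
      \<open>K + 1\<close>.\<close>
    define j where "j = (LEAST j::nat. 1/2 < 2 ^ j * \<bar>h\<bar>)"
    obtain j0 :: nat where "1 / (2 * \<bar>h\<bar>) < 2 ^ j0"
      using real_arch_pow[of 2 "1 / (2 * \<bar>h\<bar>)"] by auto
    then have "1/2 < 2 ^ j0 * \<bar>h\<bar>" using True by (simp add: field_simps)
    then have j1: "1/2 < 2 ^ j * \<bar>h\<bar>" unfolding j_def by (rule LeastI)
    have j2: "2 ^ j * \<bar>h\<bar> \<le> 1"
    proof (cases j)
      case 0
      then show ?thesis using True by simp
    next
      case (Suc i)
      then have "\<not> 1/2 < 2 ^ i * \<bar>h\<bar>" using not_less_Least[of i "\<lambda>j. 1/2 < 2 ^ j * \<bar>h\<bar>"] by (simp add: j_def)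
      then show ?thesis using Suc by simp
    qed
    have "norm (x + (2 ^ j * h) *\<^sub>R e) \<le> K + 1"
      using norm_triangle_ineq[of x "(2 ^ j * h) *\<^sub>R e"] x(1) j2 e by (simp add: abs_mult)
    then have "- (2 * M) \<le> F (x + (2 ^ j * h) *\<^sub>R e) - F x"
      using M[of x] M[of "x + (2 ^ j * h) *\<^sub>R e"] x(1) by auto
    then have "- (2 * M) \<le> 2 ^ j * (F (x + h *\<^sub>R e) - F x)"
      using double[of x j h] by linarith
    moreover have "2 * M \<le> 2 ^ j * (4 * M * \<bar>h\<bar>)"
      using mult_left_mono[OF less_imp_le[OF j1], of "4 * M"] M0 by (simp add: mult_ac)
    ultimately have "2 ^ j * (- (4 * M * \<bar>h\<bar>)) \<le> 2 ^ j * (F (x + h *\<^sub>R e) - F x)"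
      unfolding mult_minus_right by linarith
    then show ?thesis by (rule mult_left_le_imp_le) simp
  next
    case False
    show ?thesis
    proof (cases "h = 0")
      case h: False
      have "2 * M * 1 \<le> 4 * M * \<bar>h\<bar>" using False h M0 by (intro mult_mono) auto
      then show ?thesis using M[of x] M[of "x + h *\<^sub>R e"] x by auto
    qed simp
  qed
  show ?thesis
    using lower[OF x] lower[of "x + h *\<^sub>R e" "-h"] x by auto
qed

text \<open>One coordinate is changed at a time. The intermediate points may leave the ball of
  radius \<open>K\<close>, but each of the coordinate changes has size at most \<open>2 * K\<close>,
  which explains the enlarged radius in the hypothesis.\<close>

lemma lipschitz_of_Basis_directions:
  fixes F :: "'a::euclidean_space \<Rightarrow> real"
  assumes dir: "\<And>x h b. b \<in> Basis \<Longrightarrow> norm x \<le> (2 * real DIM('a) + 1) * K \<Longrightarrow>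
      norm (x + h *\<^sub>R b) \<le> (2 * real DIM('a) + 1) * K \<Longrightarrow> \<bar>F (x + h *\<^sub>R b) - F x\<bar> \<le> L * \<bar>h\<bar>"
    and L: "L \<ge> 0" and xy: "norm x \<le> K" "norm y \<le> K"
  shows "\<bar>F y - F x\<bar> \<le> real DIM('a) * L * norm (y - x)"
proof -
  define z where "z S = x + (\<Sum>b\<in>S. ((y - x) \<bullet> b) *\<^sub>R b)" for S
  have d: "norm (y - x) \<le> 2 * K" using norm_triangle_ineq4[of y x] xy by simp
  have z: "norm (z S) \<le> (2 * real DIM('a) + 1) * K" if "S \<subseteq> Basis" for S
  proof -
    have K: "K \<ge> 0" using xy(1) norm_ge_zero order_trans by blast
    have "norm (\<Sum>b\<in>S. ((y - x) \<bullet> b) *\<^sub>R b) \<le> of_nat (card S) * (2 * K)"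
    proof (rule sum_norm_bound)
      fix b assume "b \<in> S"
      then have "b \<in> Basis" using that by blast
      then show "norm (((y - x) \<bullet> b) *\<^sub>R b) \<le> 2 * K"
        using Basis_le_norm[of b "y - x"] d by simp
    qed
    also have "\<dots> \<le> real DIM('a) * (2 * K)"
      using card_mono[OF finite_Basis that] K by (intro mult_right_mono) auto
    finally have "norm (z S) \<le> K + real DIM('a) * (2 * K)"
      unfolding z_def using norm_triangle_ineq[of x] xy(1) by (meson add_mono order_trans)
    then show ?thesis by (simp add: algebra_simps)
  qed
  have "\<bar>F (z S) - F x\<bar> \<le> real (card S) * (L * norm (y - x))" if "S \<subseteq> Basis" for S
    using finite_subset[OF that finite_Basis] that
  proof (induction S rule: finite_induct)
    case empty
    then show ?case by (simp add: z_def)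
  next
    case (insert b S)
    have zb: "z (insert b S) = z S + ((y - x) \<bullet> b) *\<^sub>R b"
      using insert by (simp add: z_def)
    have "\<bar>F (z (insert b S)) - F (z S)\<bar> \<le> L * \<bar>(y - x) \<bullet> b\<bar>"
      unfolding zb using insert z[of S] z[of "insert b S"] by (intro dir) (auto simp: zb)
    also have "\<dots> \<le> L * norm (y - x)"
      using insert L by (intro mult_left_mono Basis_le_norm) auto
    finally show ?case using insert by (simp add: algebra_simps)
  qed
  from this[of Basis] have "\<bar>F (z Basis) - F x\<bar> \<le> real DIM('a) * (L * norm (y - x))" by simp
  moreover have "z Basis = y" by (simp add: z_def euclidean_representation)
  ultimately show ?thesis by (simp add: mult.assoc)
qed

lemma pos_homogeneous_0:
  assumes "p > 1" "pos_homogeneous p F" shows "F 0 = 0"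
proof -
  have "F (2 *\<^sub>R 0) = 2 powr p * F 0"
    using assms(2) unfolding pos_homogeneous_def by (metis zero_less_numeral)
  moreover have "(2::real) powr p > 2 powr 0" using assms(1) by (subst powr_less_cancel_iff) auto
  ultimately show ?thesis using assms(1) by auto
qed

text \<open>The standard basis of the matrix space consists of matrix units, the directions of
  \<open>quasiconcave_midpoint\<close>. This gives a Lipschitz constant on the unit ball, and
  homogeneity transports it to all scales; one power of the scale is used up by the increment,
  leaving \<open>p - 1\<close>.\<close>

lemma quasiconcave_homogeneous_lipschitz:
  fixes F :: "real^'n^'m \<Rightarrow> real"
  assumes "p > 1" "quasiconcave F" "pos_homogeneous p F"
  obtains L where "L > 0" "\<And>x y. \<bar>F y - F x\<bar> \<le> L * norm (y - x) * (norm x + norm y) powr (p - 1)"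
proof -
  define D where "D = real DIM(real^'n^'m)"
  have "bounded (F ` cball 0 (2 * D + 1 + 1))"
    using assms(2) unfolding quasiconcave_def by (meson compact_cball)
  then obtain M where "\<forall>y\<in>F ` cball 0 (2 * D + 1 + 1). norm y \<le> M"
    unfolding bounded_iff by blast
  then have M: "\<bar>F z\<bar> \<le> M" if "norm z \<le> 2 * D + 1 + 1" for z
    using that by simp
  have M0: "M \<ge> 0" using M[of 0] by (simp add: D_def)
  have dir: "\<bar>F (x + h *\<^sub>R b) - F x\<bar> \<le> 4 * M * \<bar>h\<bar>"
    if "b \<in> Basis" "norm x \<le> 2 * D + 1" "norm (x + h *\<^sub>R b) \<le> 2 * D + 1" for x h b
  proof (rule midpoint_concave_direction_lipschitz[where K = "2 * D + 1"])
    have "\<exists>i j. b = axis i (axis j 1)"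
      using that(1) by (auto simp: Basis_vec_def)
    then obtain i j where b: "b = axis i (axis j 1)" by blast
    show "F (z + t *\<^sub>R b) + F (z - t *\<^sub>R b) \<le> 2 * F z" for z t
      unfolding b by (rule quasiconcave_midpoint[OF assms(2)])
  qed (use that M in auto)
  have unit: "\<bar>F y - F x\<bar> \<le> D * (4 * M) * norm (y - x)" if "norm x \<le> 1" "norm y \<le> 1" for x y
    unfolding D_def using dir M0 that by (intro lipschitz_of_Basis_directions[where K = 1]) (auto simp: D_def)
  \<comment> \<open>The added 1 keeps the constant positive even if \<open>M = 0\<close>.\<close>
  have "\<bar>F y - F x\<bar> \<le> (D * (4 * M) + 1) * norm (y - x) * (norm x + norm y) powr (p - 1)" for x y
  proof (cases "norm x + norm y = 0")
    case True
    then have "x = 0" "y = 0" using norm_ge_zero[of x] norm_ge_zero[of y] by (auto simp: add_nonneg_eq_0_iff)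
    then show ?thesis by simp
  next
    case False
    \<comment> \<open>Dividing both points by the sum of their norms puts them into the unit ball
      simultaneously.\<close>
    define R where "R = norm x + norm y"
    have R: "R > 0" using False norm_ge_zero[of x] norm_ge_zero[of y] by (auto simp: R_def less_le)
    have sc: "F z = R powr p * F ((1 / R) *\<^sub>R z)" for z
      using assms(3) R unfolding pos_homogeneous_def by (metis scaleR_scaleR divide_self_if less_irrefl scaleR_one times_divide_eq_right mult.right_neutral)
    have "\<bar>F y - F x\<bar> = R powr p * \<bar>F ((1 / R) *\<^sub>R y) - F ((1 / R) *\<^sub>R x)\<bar>"
      unfolding sc[of x] sc[of y] using R by (simp add: abs_mult flip: right_diff_distrib)
    also have "\<dots> \<le> R powr p * (D * (4 * M) * norm ((1 / R) *\<^sub>R y - (1 / R) *\<^sub>R x))"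
      using R by (intro mult_left_mono unit) (auto simp: R_def field_simps)
    also have "\<dots> = D * (4 * M) * norm (y - x) * (R powr p / R)"
      using R by (simp flip: scaleR_diff_right)
    also have "R powr p / R = R powr (p - 1)"
      using R by (simp add: powr_diff)
    also have "D * (4 * M) * norm (y - x) * R powr (p - 1) \<le> (D * (4 * M) + 1) * norm (y - x) * R powr (p - 1)"
      by (intro mult_right_mono) auto
    finally show ?thesis by (simp add: R_def)
  qed
  moreover have "D * (4 * M) + 1 > 0" using M0 by (simp add: D_def add_nonneg_pos)
  ultimately show ?thesis using that by blast
qed

subsection \<open>Compactly supported test functions\<close>

lemma compact_support_bounded:
  fixes f :: "real^'n \<Rightarrow> 'b::real_normed_vector"
  assumes "continuous_on UNIV f" "\<And>x. norm (x - c) \<ge> r \<Longrightarrow> f x = 0"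
  obtains B where "B \<ge> 0" "\<And>x. norm (f x) \<le> B"
proof -
  have "bounded (f ` cball c r)"
    using assms(1) by (intro compact_imp_bounded compact_continuous_image compact_cball) (auto intro: continuous_on_subset)
  then obtain B where B: "\<forall>y\<in>f ` cball c r. norm y \<le> B"
    unfolding bounded_iff by blast
  have "norm (f x) \<le> max B 0" for x
  proof (cases "norm (x - c) \<ge> r")
    case False
    then have "f x \<in> f ` cball c r" by (auto simp: dist_norm norm_minus_commute)
    then have "norm (f x) \<le> B" using B by blast
    then show ?thesis by simp
  qed (use assms(2) in simp)
  then show ?thesis using that[of "max B 0"] by simp
qed

lemma integrable_bounded_support:
  fixes f :: "'a::euclidean_space \<Rightarrow> 'b::{banach, second_countable_topology}"
  assumes "f \<in> borel_measurable borel" "\<And>x. norm (x - c) > r \<Longrightarrow> f x = 0" "\<And>x. norm (f x) \<le> B"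
  shows "integrable lborel f"
proof (rule integrableI_bounded_set[where A = "cball c r" and B = B])
  show "AE x in lborel. x \<notin> cball c r \<longrightarrow> f x = 0"
    using assms(2) by (auto simp: dist_norm norm_minus_commute)
  show "emeasure lborel (cball c r) < \<infinity>" by (rule emeasure_bounded_finite) simp
qed (use assms in auto)

text \<open>Translation invariance makes the integral of every difference quotient vanish. The
  quotients are bounded by the mean value theorem and have supports in a common ball, so dominated
  convergence transfers this to the derivative.\<close>

lemma integral_derivative_compact_support:
  fixes f :: "real^'n \<Rightarrow> real"
  assumes f: "smooth f" "\<And>x. norm (x - c) \<ge> r \<Longrightarrow> f x = 0"
  shows "(LINT x|lborel. frechet_derivative f (at x) v) = 0"
proof -
  define f' where "f' x = frechet_derivative f (at x) v" for x
  have cf: "continuous_on UNIV f" and cf': "continuous_on UNIV f'"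
    using f(1) by (auto simp: f'_def intro: smooth_imp_continuous smooth_continuous_frechet)
  have [measurable]: "f \<in> borel_measurable borel" "f' \<in> borel_measurable borel"
    using cf cf' by (auto intro: borel_measurable_continuous_onI)
  have f'0: "f' x = 0" if "norm (x - c) > r" for x
  proof -
    have "(f has_derivative (\<lambda>_. 0)) (at x)"
    proof (rule has_derivative_transform_within_open)
      show "((\<lambda>_. 0) has_derivative (\<lambda>_. 0)) (at x)" by simp
      show "open {x. norm (x - c) > r}" by (intro open_Collect_less continuous_intros)
    qed (use that f(2) in auto)
    then have "frechet_derivative f (at x) = (\<lambda>_. 0)" using frechet_derivative_at by metis
    then show ?thesis by (simp add: f'_def)
  qed
  obtain B where B: "B \<ge> 0" "\<And>x. norm (f' x) \<le> B"
    by (rule compact_support_bounded[OF cf', where c = c and r = "r + 1"]) (auto intro!: f'0)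
  obtain B2 where B2: "\<And>x. norm (f x) \<le> B2"
    using compact_support_bounded[OF cf f(2)] by blast
  have int_f: "integrable lborel f"
    by (rule integrable_bounded_support[where c = c and r = r and B = B2]) (use f B2 in auto)
  define t where "t k = 1 / real (Suc k)" for k
  have t: "0 < t k" "t k \<le> 1" for k by (auto simp: t_def)
  have t0: "t \<longlonglongrightarrow> 0" unfolding t_def[abs_def] using LIMSEQ_inverse_real_of_nat by (simp add: inverse_eq_divide)
  define q where "q k x = (f (x + t k *\<^sub>R v) - f x) / t k" for k x
  have along: "((\<lambda>s. f (x + s *\<^sub>R v)) has_real_derivative f' (x + s *\<^sub>R v)) (at s)" for x s
  proof -
    have "((\<lambda>s. x + s *\<^sub>R v) has_derivative (\<lambda>s. s *\<^sub>R v)) (at s)"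
      by (auto intro!: derivative_eq_intros)
    from has_derivative_compose[OF this smooth_has_derivative[OF f(1)]]
    have "((\<lambda>s. f (x + s *\<^sub>R v)) has_derivative (\<lambda>h. frechet_derivative f (at (x + s *\<^sub>R v)) (h *\<^sub>R v))) (at s)" .
    moreover have "(\<lambda>h. frechet_derivative f (at (x + s *\<^sub>R v)) (h *\<^sub>R v)) = (*) (f' (x + s *\<^sub>R v))"
      using linear_scale[OF has_derivative_linear[OF smooth_has_derivative[OF f(1)]]]
      by (auto simp: f'_def mult.commute)
    ultimately show ?thesis
      unfolding has_field_derivative_def by simp
  qed
  have q_le: "norm (q k x) \<le> B" for k x
  proof -
    obtain s where "f (x + t k *\<^sub>R v) - f (x + 0 *\<^sub>R v) = (t k - 0) * f' (x + s *\<^sub>R v)"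
      using MVT2[of 0 "t k" "\<lambda>s. f (x + s *\<^sub>R v)" "\<lambda>s. f' (x + s *\<^sub>R v)"] along t by blast
    then have "q k x = f' (x + s *\<^sub>R v)" using t[of k] by (simp add: q_def)
    then show ?thesis using B by simp
  qed
  have q0: "q k x = 0" if "norm (x - c) > r + norm v" for k x
  proof -
    have "norm (t k *\<^sub>R v) \<le> norm v" using t[of k] by (simp add: mult_left_le_one_le)
    moreover have "norm (x - c) \<le> norm (x + t k *\<^sub>R v - c) + norm (t k *\<^sub>R v)"
      using norm_triangle_ineq4[of "x + t k *\<^sub>R v - c" "t k *\<^sub>R v"] by simp
    ultimately have "norm (x + t k *\<^sub>R v - c) \<ge> r" "norm (x - c) \<ge> r"
      using that norm_ge_zero[of v] by linarith+
    then show ?thesis using f(2) by (simp add: q_def)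
  qed
  have mq: "q k \<in> borel_measurable lborel" for k
    unfolding q_def by measurable
  have mf': "f' \<in> borel_measurable lborel"
    by measurable
  have lim: "(\<lambda>k. LINT x|lborel. q k x) \<longlonglongrightarrow> (LINT x|lborel. f' x)"
  proof (rule integral_dominated_convergence[where w = "\<lambda>x. indicator (cball c (r + norm v)) x * B"])
    show "integrable lborel (\<lambda>x. indicator (cball c (r + norm v)) x * B)"
    proof (rule integrable_bounded_support[where c = c and r = "r + norm v" and B = B])
      show "(\<lambda>x. indicator (cball c (r + norm v)) x * B) \<in> borel_measurable borel"
        by (intro borel_measurable_times borel_measurable_indicator borel_measurable_const) auto
    qed (use B(1) in \<open>auto simp: dist_norm norm_minus_commute indicator_def\<close>)
    have "(\<lambda>k. q k x) \<longlonglongrightarrow> f' x" for x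
    proof -
      have D: "((\<lambda>h. (f (x + h *\<^sub>R v) - f x) / h) \<longlongrightarrow> f' x) (at 0)"
        using along[of x 0] unfolding DERIV_def by simp
      have T: "filterlim t (at 0) sequentially"
        using t(1) t0 by (intro filterlim_atI) (auto simp: less_imp_neq[symmetric])
      show ?thesis
        unfolding q_def by (rule filterlim_compose[OF D T])
    qed
    then show "AE x in lborel. (\<lambda>k. q k x) \<longlonglongrightarrow> f' x" by simp
    show "AE x in lborel. norm (q k x) \<le> indicator (cball c (r + norm v)) x * B" for k
      using q_le q0 by (auto simp: indicator_def dist_norm norm_minus_commute)
  qed (fact mq mf')+
  have "(LINT x|lborel. q k x) = 0" for k
  proof -
    have i: "integrable lborel (\<lambda>x. f (x + t k *\<^sub>R v))"
      using integrable_lborel_affine[OF int_f, of 1 "t k *\<^sub>R v"] by (simp add: add.commute)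
    have "(LINT x|lborel. f (x + t k *\<^sub>R v)) = (LINT x|lborel. f x)"
      using integral_lborel_affine[of f 1 "t k *\<^sub>R v"] by (simp add: add.commute)
    then show ?thesis unfolding q_def using i int_f by simp
  qed
  then have "(LINT x|lborel. f' x) = 0"
    using lim by (simp add: LIMSEQ_const_iff)
  then show ?thesis by (simp add: f'_def)
qed

lemma gradient_cong_open:
  assumes "open S" "x \<in> S" "\<And>y. y \<in> S \<Longrightarrow> f y = g y" "smooth g"
  shows "gradient f x = gradient g x"
proof -
  have "(f has_derivative frechet_derivative g (at x)) (at x)"
    using smooth_has_derivative[OF assms(4)] assms(1,2)
    by (rule has_derivative_transform_within_open) (use assms(3) in auto)
  then have "gradient f x = matrix (frechet_derivative g (at x))" by (rule gradient_eq)
  then show ?thesis by (simp only: gradient_def[of g x])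
qed

lemma smooth_const: "smooth (\<lambda>x. c)"
  by (simp add: smooth_def Ck_const)

lemma gradient_const: "gradient (\<lambda>x. c) x = 0"
  using gradient_eq[OF has_derivative_const[of c "at x"]] by (simp add: vec_eq_iff matrix_def)

lemma gradient_outside_support:
  assumes "\<And>x. norm (x - c) \<ge> r \<Longrightarrow> \<phi> x = 0" "norm (x - c) > r"
  shows "gradient \<phi> x = 0"
proof -
  have "gradient \<phi> x = gradient (\<lambda>_. 0) x"
  proof (rule gradient_cong_open)
    show "open {x. norm (x - c) > r}" by (intro open_Collect_less continuous_intros)
  qed (use assms smooth_const in auto)
  then show ?thesis by (simp add: gradient_const)
qed

lemma integral_gradient_compact_support:
  fixes \<phi> :: "real^'n \<Rightarrow> real^'m"
  assumes \<phi>: "smooth \<phi>" "\<And>x. norm (x - c) \<ge> r \<Longrightarrow> \<phi> x = 0"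
  shows "integrable lborel (gradient \<phi>)" "(LINT x|lborel. gradient \<phi> x) = 0"
proof -
  have cont: "continuous_on UNIV (gradient \<phi>)"
    by (rule smooth_continuous_gradient[OF \<phi>(1)])
  have g0: "gradient \<phi> x = 0" if "norm (x - c) > r" for x
    using \<phi>(2) that by (rule gradient_outside_support)
  have "\<And>x. norm (x - c) \<ge> r + 1 \<Longrightarrow> gradient \<phi> x = 0" using g0 by force
  then obtain B where B: "\<And>x. norm (gradient \<phi> x) \<le> B"
    using compact_support_bounded[OF cont, where c = c and r = "r + 1"] by metis
  show int: "integrable lborel (gradient \<phi>)"
    using borel_measurable_continuous_onI[OF cont] g0 B by (rule integrable_bounded_support)
  have "(LINT x|lborel. gradient \<phi> x) $ i $ j = 0" for i j
  proof -
    have sm: "smooth (\<lambda>x. \<phi> x $ i)"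
      using \<phi>(1) unfolding smooth_def by (intro allI Ck_bounded_linear_comp[OF bounded_linear_vec_nth]) auto
    have "frechet_derivative (\<lambda>x. \<phi> x $ i) (at x) = (\<lambda>v. frechet_derivative \<phi> (at x) v $ i)" for x
      using bounded_linear.has_derivative[OF bounded_linear_vec_nth smooth_has_derivative[OF \<phi>(1)]]
      by (metis frechet_derivative_at)
    then have eq: "gradient \<phi> x $ i $ j = frechet_derivative (\<lambda>x. \<phi> x $ i) (at x) (axis j 1)" for x
      by (simp add: gradient_nth)
    have bl: "bounded_linear (\<lambda>A :: real^'n^'m. A $ i $ j)"
      by (rule bounded_linear_compose[OF bounded_linear_vec_nth bounded_linear_vec_nth])
    have "(LINT x|lborel. gradient \<phi> x) $ i $ j = (LINT x|lborel. gradient \<phi> x $ i $ j)"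
      using integral_bounded_linear[OF bl int] by simp
    also have "\<dots> = 0"
      unfolding eq by (rule integral_derivative_compact_support[OF sm, where c = c and r = r]) (simp add: \<phi>(2))
    finally show ?thesis .
  qed
  then show "(LINT x|lborel. gradient \<phi> x) = 0"
    by (simp add: vec_eq_iff)
qed

text \<open>A map supported in the interior of the cube is extended periodically by composing with the
  reduction of each coordinate modulo the side length.\<close>

lemma quasiconcave_compact_support:
  fixes F :: "real^'n^'m \<Rightarrow> real"
  assumes "quasiconcave F" and F0: "F 0 = 0"
  obtains c :: "real^'n" and r where "r > 0"
    "\<And>\<phi> :: real^'n \<Rightarrow> real^'m. smooth \<phi> \<Longrightarrow> (\<And>x. norm (x - c) \<ge> r \<Longrightarrow> \<phi> x = 0) \<Longrightarrow>
       (LINT x|lborel. F (gradient \<phi> x)) \<le> 0"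
proof -
  obtain a l where l: "l > 0" and Q: "\<And>\<phi> :: real^'n \<Rightarrow> real^'m. smooth \<phi> \<Longrightarrow>
      (\<And>x j. gradient \<phi> (x + l *\<^sub>R axis j 1) = gradient \<phi> x) \<Longrightarrow>
      mean_value (cube a l) (\<lambda>x. F (gradient \<phi> x)) \<le> F (mean_value (cube a l) (gradient \<phi>))"
    and [measurable]: "F \<in> borel_measurable borel"
    using assms(1) unfolding quasiconcave_def by blast
  define c :: "real^'n" where "c = (\<chi> i. a $ i + l / 2)"
  \<comment> \<open>The integer vector that locates the copy of the cube containing
    \<open>x\<close>; \<open>red\<close> translates that copy back to the fundamental cube.\<close>
  define k :: "real^'n \<Rightarrow> real^'n" where "k x = (\<chi> i. of_int \<lfloor>(x $ i - a $ i) / l\<rfloor>)" for x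
  define red where "red x = x - l *\<^sub>R k x" for x
  have red_nth: "red x $ i = x $ i - l * of_int \<lfloor>(x $ i - a $ i) / l\<rfloor>" for x i
    by (simp add: red_def k_def)
  have "(LINT x|lborel. F (gradient \<phi> x)) \<le> 0"
    \<comment> \<open>The support radius \<open>l / 4\<close> leaves a margin of the same width
      between the support and the faces of the cube.\<close>
    if sm: "smooth \<phi>" and supp: "\<And>x. norm (x - c) \<ge> l / 4 \<Longrightarrow> \<phi> x = 0" for \<phi> :: "real^'n \<Rightarrow> real^'m"
  proof -
    define \<psi> where "\<psi> x = \<phi> (red x)" for x
    \<comment> \<open>Close to a face the integer part may jump between \<open>y\<close> and
      \<open>x\<close>. In either case the fractional part is at distance at least 1/4 from 1/2, so
      the reduced point lies outside the support.\<close>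
    have bdry: "\<psi> y = 0" if x: "red x $ i = a $ i" and y: "\<bar>y $ i - x $ i\<bar> < l / 4" for x y i
    proof -
      define N where "N = \<lfloor>(x $ i - a $ i) / l\<rfloor>"
      define s where "s = (y $ i - a $ i) / l"
      have "x $ i = a $ i + l * N" using x unfolding red_nth N_def by simp
      then have ys: "\<bar>s - N\<bar> < 1 / 4"
        using y l by (simp add: s_def abs_less_iff field_simps)
      have "\<bar>(s - \<lfloor>s\<rfloor>) - 1/2\<bar> \<ge> 1/4"
      proof (cases "s \<ge> N")
        case True
        then have "\<lfloor>s\<rfloor> = N" using ys by (intro floor_unique) auto
        then show ?thesis using ys True by simp
      next
        case False
        then have "\<lfloor>s\<rfloor> = N - 1" using ys by (intro floor_unique) auto
        then show ?thesis using ys False by simp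
      qed
      moreover have "red y $ i - c $ i = l * ((s - \<lfloor>s\<rfloor>) - 1/2)"
        using l by (simp add: red_nth c_def s_def field_simps)
      ultimately have "\<bar>(red y - c) $ i\<bar> \<ge> l * (1/4)"
        using l by (simp add: abs_mult del: mult_1_right)
      then have "norm (red y - c) \<ge> l / 4"
        using component_le_norm_cart[of "red y - c" i] by simp
      then show ?thesis unfolding \<psi>_def by (rule supp)
    qed
    have inner: "\<psi> y = \<phi> (- l *\<^sub>R k x + y)"
      if "y \<in> box (\<chi> i. a $ i + l * k x $ i) (\<chi> i. a $ i + l * (k x $ i + 1))" for x y
    proof -
      have "\<lfloor>(y $ i - a $ i) / l\<rfloor> = \<lfloor>(x $ i - a $ i) / l\<rfloor>" for i
      proof (rule floor_unique)
        have "a $ i + l * k x $ i < y $ i" "y $ i < a $ i + l * (k x $ i + 1)"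
          using that by (auto simp: mem_box_cart)
        then show "of_int \<lfloor>(x $ i - a $ i) / l\<rfloor> \<le> (y $ i - a $ i) / l"
          "(y $ i - a $ i) / l < of_int \<lfloor>(x $ i - a $ i) / l\<rfloor> + 1"
          using l by (auto simp: k_def field_simps)
      qed
      then have "k y = k x" by (simp add: k_def)
      then show ?thesis by (simp add: \<psi>_def red_def)
    qed
    have red_bounds: "a $ i \<le> red x $ i" "red x $ i < a $ i + l" for x i
    proof -
      define t where "t = (x $ i - a $ i) / l"
      have x: "x $ i = a $ i + l * t" using l by (simp add: t_def)
      have "l * of_int \<lfloor>t\<rfloor> \<le> l * t" "l * t < l * (of_int \<lfloor>t\<rfloor> + 1)"
        using l by (auto intro!: mult_left_mono mult_strict_left_mono)
      then show "a $ i \<le> red x $ i" "red x $ i < a $ i + l"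
        unfolding red_nth t_def[symmetric] by (simp_all add: x algebra_simps)
    qed
    \<comment> \<open>Near a point whose reduction lies on a lower face the extension is zero;
      elsewhere the integer vector is locally constant and the extension is a translate of
      \<open>\<phi>\<close>.\<close>
    have "\<exists>S g. open S \<and> x \<in> S \<and> smooth g \<and> (\<forall>y\<in>S. \<psi> y = g y)" for x
    proof (cases "\<exists>i. red x $ i = a $ i")
      case True
      then obtain i where i: "red x $ i = a $ i" by blast
      have "open {y. \<bar>y $ i - x $ i\<bar> < l / 4}"
        by (intro open_Collect_less continuous_intros)
      then show ?thesis
        using bdry[OF i] l smooth_const[of 0] by (intro exI[of _ "{y. \<bar>y $ i - x $ i\<bar> < l / 4}"] exI[of _ "\<lambda>_. 0"]) auto
    next
      case False
      have "x $ i > a $ i + l * k x $ i \<and> x $ i < a $ i + l * (k x $ i + 1)" for i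
      proof -
        have "red x $ i = x $ i - l * k x $ i" by (simp add: red_def)
        moreover have "a $ i < red x $ i" "red x $ i < a $ i + l"
          using red_bounds[where x = x and i = i] False by (auto simp: less_le dest: sym[of "a $ i"])
        ultimately show ?thesis by (simp add: algebra_simps)
      qed
      then have "x \<in> box (\<chi> i. a $ i + l * k x $ i) (\<chi> i. a $ i + l * (k x $ i + 1))"
        by (simp add: mem_box_cart)
      moreover have "smooth (\<lambda>y. \<phi> (- l *\<^sub>R k x + y))"
        using sm Ck_comp_affine[OF bounded_linear_ident] unfolding smooth_def by blast
      ultimately show ?thesis
        using inner[of _ x] open_box by blast
    qed
    then have sm\<psi>: "smooth \<psi>"
      unfolding smooth_def[of \<psi>] by (intro allI Ck_local) (metis smooth_def)
    have per: "gradient \<psi> (x + l *\<^sub>R axis j 1) = gradient \<psi> x" for x j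
    proof -
      have "red (x + l *\<^sub>R axis j 1) $ i = red x $ i" for x i
      proof (cases "i = j")
        case True
        have "((x + l *\<^sub>R axis j 1) $ i - a $ i) / l = (x $ i - a $ i) / l + 1"
          using True l by (simp add: field_simps)
        then have "\<lfloor>((x + l *\<^sub>R axis j 1) $ i - a $ i) / l\<rfloor> = \<lfloor>(x $ i - a $ i) / l\<rfloor> + 1"
          by simp
        then show ?thesis
          unfolding red_nth using True by (simp add: algebra_simps)
      next
        case False
        then show ?thesis unfolding red_nth by (simp add: axis_def)
      qed
      then have "red (x + l *\<^sub>R axis j 1) = red x" for x by (simp add: vec_eq_iff)
      then have eq: "(\<lambda>y. \<psi> (y + l *\<^sub>R axis j 1)) = \<psi>" by (simp add: \<psi>_def fun_eq_iff)
      have "((\<lambda>y. y + l *\<^sub>R axis j 1) has_derivative (\<lambda>h. h)) (at x)"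
        by (auto intro!: derivative_eq_intros)
      from has_derivative_compose[OF this smooth_has_derivative[OF sm\<psi>]]
      have "(\<psi> has_derivative frechet_derivative \<psi> (at (x + l *\<^sub>R axis j 1))) (at x)"
        unfolding eq .
      then show ?thesis using gradient_eq gradient_def by metis
    qed
    have far: "gradient \<phi> x = 0" if x: "x \<notin> box a (\<chi> i. a $ i + l)" for x
    proof -
      obtain i where i: "\<not> (a $ i < x $ i \<and> x $ i < a $ i + l)"
        using x by (auto simp: mem_box_cart)
      then have "\<bar>(x - c) $ i\<bar> \<ge> l / 2"
        unfolding c_def vector_minus_component vec_lambda_beta by linarith
      then have "norm (x - c) > l / 4"
        using component_le_norm_cart[of "x - c" i] l by linarith
      with supp show ?thesis by (rule gradient_outside_support)
    qed
    have gr: "gradient \<psi> x = gradient \<phi> x" if x: "x \<in> cube a l" for x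
    proof (cases "x \<in> box a (\<chi> i. a $ i + l)")
      case True
      show ?thesis
      proof (rule gradient_cong_open[OF open_box True _ sm])
        fix y assume y: "y \<in> box a (\<chi> i. a $ i + l)"
        have "\<lfloor>(y $ i - a $ i) / l\<rfloor> = 0" for i
        proof (rule floor_unique)
          have "a $ i < y $ i" "y $ i < a $ i + l" using y by (auto simp: mem_box_cart)
          then show "of_int 0 \<le> (y $ i - a $ i) / l" "(y $ i - a $ i) / l < of_int 0 + 1"
            using l by (simp_all add: field_simps)
        qed
        then show "\<psi> y = \<phi> y" by (simp add: \<psi>_def red_def k_def zero_vec_def[symmetric])
      qed
    next
      case False
      then obtain i where i: "\<not> (a $ i < x $ i \<and> x $ i < a $ i + l)"
        by (auto simp: mem_box_cart)
      then have "x $ i = a $ i \<or> x $ i = a $ i + l"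
        using x unfolding cube_def mem_box_cart vec_lambda_beta by (meson antisym not_less)
      then have r: "red x $ i = a $ i" using l by (auto simp: red_nth)
      have "gradient \<psi> x = gradient (\<lambda>_. 0) x"
      proof (rule gradient_cong_open)
        show "open {y. \<bar>y $ i - x $ i\<bar> < l / 4}" by (intro open_Collect_less continuous_intros)
      qed (use bdry[OF r] l smooth_const in auto)
      then show ?thesis using far[OF False] by (simp add: gradient_const)
    qed
    \<comment> \<open>Used twice: with the identity, to see that the mean gradient over the cube is
      0, and with \<open>F\<close>, where \<open>h 0 = 0\<close> is \<open>F0\<close>.\<close>
    have set_int: "(LINT x:cube a l|lborel. h (gradient \<psi> x)) = (LINT x|lborel. h (gradient \<phi> x))"
      if "h 0 = 0" for h :: "real^'n^'m \<Rightarrow> 'b::{banach, second_countable_topology}"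
      unfolding set_lebesgue_integral_def
    proof (rule Bochner_Integration.integral_cong[OF refl])
      fix x
      show "indicat_real (cube a l) x *\<^sub>R h (gradient \<psi> x) = h (gradient \<phi> x)"
      proof (cases "x \<in> cube a l")
        case False
        then have "x \<notin> box a (\<chi> i. a $ i + l)"
          using box_subset_cbox unfolding cube_def by blast
        then show ?thesis using False that far by simp
      qed (simp add: gr)
    qed
    have "mean_value (cube a l) (gradient \<psi>) = 0"
      using set_int[of "\<lambda>z. z"] integral_gradient_compact_support(2)[OF sm, where c = c and r = "l / 4"] supp
      unfolding mean_value_def by simp
    then have "mean_value (cube a l) (\<lambda>x. F (gradient \<psi> x)) \<le> 0"
      using Q[OF sm\<psi> per] F0 by simp
    then show ?thesis
      using set_int[of F, OF F0] measure_cube_pos[OF l, of a]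
      unfolding mean_value_def by (simp add: mult_le_0_iff divide_le_0_iff)
  qed
  then show ?thesis using that[of "l / 4" c] l by simp
qed

subsection \<open>A Sobolev-Poincare inequality on balls\<close>

lemma norm_matrix_vector_mult_le:
  fixes A :: "real^'n^'m"
  shows "norm (A *v w) \<le> norm A * norm w"
proof -
  have "norm (A *v w) = L2_set (\<lambda>i. \<bar>A $ i \<bullet> w\<bar>) UNIV"
    by (simp add: norm_vec_def matrix_vector_mul_component)
  also have "\<dots> \<le> L2_set (\<lambda>i. norm (A $ i) * norm w) UNIV"
    by (intro L2_set_mono Cauchy_Schwarz_ineq2) auto
  also have "\<dots> = norm A * norm w"
    by (simp add: norm_vec_def L2_set_left_distrib)
  finally show ?thesis .
qed

text \<open>The graph of the convex function \<open>a powr q\<close> lies above its tangent at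
  \<open>m\<close>. Subtraction is avoided so that the inequality can be integrated in the extended
  nonnegative reals.\<close>

lemma powr_tangent:
  fixes a m q :: real
  assumes "a \<ge> 0" "m \<ge> 0" "q \<ge> 1"
  shows "q * m powr (q - 1) * a \<le> a powr q + (q - 1) * m powr q"
proof (cases "q = 1")
  case True
  then show ?thesis using assms by (cases "m = 0") auto
next
  case False
  then have q: "q > 1" using assms by simp
  have "a * m powr (q - 1) \<le> a powr q / q + (m powr (q - 1)) powr (q / (q - 1)) / (q / (q - 1))"
    using q assms by (intro Youngs_inequality) (auto simp: field_simps)
  also have "(m powr (q - 1)) powr (q / (q - 1)) = m powr q"
    using q by (simp add: powr_powr)
  finally have "q * (a * m powr (q - 1)) \<le> q * (a powr q / q + m powr q / (q / (q - 1)))"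
    using q by (intro mult_left_mono) auto
  also have "\<dots> = a powr q + (q - 1) * m powr q"
    using q by (simp add: distrib_left)
  finally show ?thesis by (simp add: mult_ac)
qed

text \<open>Jensen's inequality for a power, obtained by integrating the tangent inequality at the
  mean value \<open>i / W\<close>. Only a lower bound \<open>i\<close> of the integral enters, so an
  infinite integral causes no difficulty.\<close>

lemma nn_integral_power_mean:
  assumes q: "q \<ge> 1" and S: "S \<in> sets M" "emeasure M S = ennreal W" "W > 0"
    and f: "f \<in> borel_measurable M" "\<And>x. x \<in> S \<Longrightarrow> 0 \<le> f x"
    and i: "i \<ge> 0" "ennreal i \<le> (\<integral>\<^sup>+x\<in>S. ennreal (f x) \<partial>M)"
  shows "ennreal (i powr q) \<le> ennreal (W powr (q - 1)) * (\<integral>\<^sup>+x\<in>S. ennreal (f x powr q) \<partial>M)"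
proof (cases "(\<integral>\<^sup>+x\<in>S. ennreal (f x powr q) \<partial>M)")
  case top
  then show ?thesis using S(3) by (simp add: ennreal_mult_top)
next
  case (real J)
  define m where "m = i / W"
  have m: "m \<ge> 0" using i S by (simp add: m_def)
  have "ennreal (q * m powr (q - 1) * i) = ennreal (q * m powr (q - 1)) * ennreal i"
    using q i by (intro ennreal_mult) auto
  also have "\<dots> \<le> ennreal (q * m powr (q - 1)) * (\<integral>\<^sup>+x\<in>S. ennreal (f x) \<partial>M)"
    using i by (intro mult_left_mono) auto
  also have "\<dots> = (\<integral>\<^sup>+x. ennreal (q * m powr (q - 1)) * (ennreal (f x) * indicator S x) \<partial>M)"
    using S f by (intro nn_integral_cmult[symmetric]) auto
  also have "\<dots> \<le> (\<integral>\<^sup>+x. ennreal (f x powr q) * indicator S x + ennreal ((q - 1) * m powr q) * indicator S x \<partial>M)"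
  proof (intro nn_integral_mono)
    fix x
    show "ennreal (q * m powr (q - 1)) * (ennreal (f x) * indicator S x)
        \<le> ennreal (f x powr q) * indicator S x + ennreal ((q - 1) * m powr q) * indicator S x"
      using powr_tangent[of "f x" m q] f(2)[of x] m q
      by (auto simp: indicator_def simp flip: ennreal_mult ennreal_plus intro!: ennreal_leI)
  qed
  also have "\<dots> = (\<integral>\<^sup>+x\<in>S. ennreal (f x powr q) \<partial>M) + ennreal ((q - 1) * m powr q) * emeasure M S"
    using S f by (subst nn_integral_add) (auto simp: nn_integral_cmult_indicator)
  also have "\<dots> = ennreal (J + (q - 1) * m powr q * W)"
    using real S q m by (simp flip: ennreal_mult ennreal_plus)
  finally have "ennreal (q * m powr (q - 1) * i) \<le> ennreal (J + (q - 1) * m powr q * W)" .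
  then have "q * m powr (q - 1) * i \<le> J + (q - 1) * m powr q * W"
    using real q m S by (subst (asm) ennreal_le_iff) auto
  moreover have E: "q * m powr (q - 1) * i = q * (W * m powr q)"
  proof (cases "m = 0")
    case False
    then show ?thesis using m S i by (simp add: powr_diff m_def)
  qed simp
  ultimately have "q * (W * m powr q) \<le> J + (q - 1) * m powr q * W"
    by linarith
  then have "W * m powr q \<le> J"
    by (simp add: algebra_simps)
  moreover have "i powr q = W powr (q - 1) * (W * m powr q)"
    using S i by (simp add: m_def powr_divide powr_diff)
  ultimately have "i powr q \<le> W powr (q - 1) * J"
    by (simp add: mult_left_mono)
  then show ?thesis using real by (simp flip: ennreal_mult add: ennreal_leI)
qed

text \<open>The fundamental theorem of calculus on the segment from \<open>x\<close> to
  \<open>y\<close>. The quadratic parametrisation starts at \<open>x\<close> with speed zero, which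
  provides the weight \<open>t\<close> in the integrand.\<close>

lemma smooth_segment_bound:
  fixes v :: "real^'n \<Rightarrow> real^'m"
  assumes "smooth v"
  shows "ennreal (norm (v x - v y))
    \<le> (\<integral>\<^sup>+t\<in>{0..1}. ennreal (2 * t * norm (x - y) * norm (gradient v (x + t\<^sup>2 *\<^sub>R (y - x)))) \<partial>lborel)"
proof -
  define \<gamma> where "\<gamma> t = x + t\<^sup>2 *\<^sub>R (y - x)" for t
  define h where "h t = 2 * t * norm (x - y) * norm (gradient v (\<gamma> t))" for t
  have c\<gamma>: "continuous_on UNIV \<gamma>" unfolding \<gamma>_def by (intro continuous_intros)
  have ch: "continuous_on {0..1} h"
    unfolding h_def
    by (intro continuous_intros continuous_on_compose2[OF smooth_continuous_gradient[OF assms], of _ \<gamma>]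
        continuous_on_subset[OF c\<gamma>]) auto
  have "((\<lambda>t. v (\<gamma> t)) has_vector_derivative (2 * t) *\<^sub>R frechet_derivative v (at (\<gamma> t)) (y - x)) (at t within {0..1})" for t
  proof -
    have "(\<gamma> has_derivative (\<lambda>s. (2 * t * s) *\<^sub>R (y - x))) (at t within {0..1})"
      unfolding \<gamma>_def by (auto intro!: derivative_eq_intros)
    from has_derivative_compose[OF this smooth_has_derivative[OF assms]]
    have "((\<lambda>t. v (\<gamma> t)) has_derivative (\<lambda>s. frechet_derivative v (at (\<gamma> t)) ((2 * t * s) *\<^sub>R (y - x)))) (at t within {0..1})" .
    then show ?thesis
      unfolding has_vector_derivative_def
      using linear_scale[OF has_derivative_linear[OF smooth_has_derivative[OF assms]]]
      by (simp add: mult_ac)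
  qed
  then have I: "((\<lambda>t. (2 * t) *\<^sub>R frechet_derivative v (at (\<gamma> t)) (y - x)) has_integral (v (\<gamma> 1) - v (\<gamma> 0))) {0..1}"
    by (intro fundamental_theorem_of_calculus) auto
  have h_int: "h integrable_on {0..1}" using ch by (rule integrable_continuous_interval)
  have "norm (v (\<gamma> 1) - v (\<gamma> 0)) \<le> integral {0..1} h"
    unfolding integral_unique[OF I, symmetric]
  proof (rule integral_norm_bound_integral)
    show "(\<lambda>t. (2 * t) *\<^sub>R frechet_derivative v (at (\<gamma> t)) (y - x)) integrable_on {0..1}"
      using I by blast
    fix t :: real assume "t \<in> {0..1}"
    then show "norm ((2 * t) *\<^sub>R frechet_derivative v (at (\<gamma> t)) (y - x)) \<le> h t"
      using norm_matrix_vector_mult_le[of "gradient v (\<gamma> t)" "y - x"]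
      unfolding smooth_frechet_eq_gradient[OF assms] h_def
      by (simp add: mult.assoc norm_minus_commute[of y x] mult.commute[of "norm (x - y)"] mult_left_mono)
  qed (rule h_int)
  then have "ennreal (norm (v x - v y)) \<le> ennreal (integral {0..1} h)"
    by (simp add: \<gamma>_def norm_minus_commute ennreal_leI)
  also have "\<dots> = (\<integral>\<^sup>+t. ennreal (indicator {0..1} t * h t) \<partial>lborel)"
    by (rule nn_integral_has_integral_lebesgue[OF _ integrable_integral[OF h_int], symmetric]) (simp add: h_def)
  also have "\<dots> = (\<integral>\<^sup>+t\<in>{0..1}. ennreal (h t) \<partial>lborel)"
    by (intro nn_integral_cong) (auto simp: indicator_def)
  finally show ?thesis by (simp add: h_def \<gamma>_def)
qed

text \<open>Points are joined by the path \<open>x + t\<^sup>2 (y - x)\<close>: the factor \<open>t\<^bsup>q k\<^esup>\<close> coming from its speed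
  compensates the factor \<open>t\<^bsup>- 2 n (k - 1)\<^esup>\<close> of the change of variables, because \<open>2 n (k - 1) \<le> q k\<close>.\<close>

lemma poincare_sobolev_ball:
  fixes c :: "real^'n" and r q k :: real
  assumes r: "r > 0" and q: "q \<ge> 1" and k: "k \<ge> 1" "2 * real CARD('n) * (k - 1) \<le> q * k"
  obtains C where "C \<ge> 0" "\<And>v :: real^'n \<Rightarrow> real^'m. smooth v \<Longrightarrow>
      (\<integral>\<^sup>+x\<in>ball c r. ennreal (norm (gradient v x) powr q) \<partial>lborel) \<le> 1 \<Longrightarrow>
      (\<integral>\<^sup>+x\<in>ball c r. ennreal (norm (v x - mean_value (ball c r) v) powr (q * k)) \<partial>lborel) \<le> ennreal C"
proof -
  define B where "B = ball c r"
  define \<beta> where "\<beta> = measure lborel B"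
  define n where "n = CARD('n)"
  define D where "D = 2 * r"
  have B[measurable]: "B \<in> sets borel" by (simp add: B_def)
  have \<beta>: "\<beta> > 0" using r content_ball_pos[of r c] by (simp add: \<beta>_def B_def)
  have eB: "emeasure lborel B = ennreal \<beta>"
    unfolding \<beta>_def B_def using emeasure_lborel_ball_finite[of c r] by (intro emeasure_eq_ennreal_measure) auto
  define C where "C = \<beta> powr (1 - k) * (2 * D) powr (q * k) * 2 ^ n"
  have C0: "C \<ge> 0" by (simp add: C_def)
  have "(\<integral>\<^sup>+x\<in>B. ennreal (norm (v x - mean_value B v) powr (q * k)) \<partial>lborel) \<le> ennreal C"
    if sm: "smooth v" and N: "(\<integral>\<^sup>+x\<in>B. ennreal (norm (gradient v x) powr q) \<partial>lborel) \<le> 1" for v :: "real^'n \<Rightarrow> real^'m"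
  proof -
    define g where "g x = norm (gradient v x)" for x
    define f where "f z = indicator B z * g z powr q" for z
    define P where "P x t y = x + t\<^sup>2 *\<^sub>R (y - x)" for x y :: "real^'n" and t :: real
    define w where "w x = norm (v x - mean_value B v)" for x
    have cv: "continuous_on UNIV v" using sm by (rule smooth_imp_continuous)
    have cg: "continuous_on UNIV g"
      unfolding g_def using smooth_continuous_gradient[OF sm] by (intro continuous_intros)
    have [measurable]: "v \<in> borel_measurable borel" "g \<in> borel_measurable borel"
      using cv cg by (auto intro: borel_measurable_continuous_onI)
    have [measurable]: "f \<in> borel_measurable borel" unfolding f_def by measurable
    have [measurable]: "w \<in> borel_measurable borel" unfolding w_def by measurable
    have f0: "f z \<ge> 0" for z by (simp add: f_def)
    have Nf: "(\<integral>\<^sup>+z. ennreal (f z) \<partial>lborel) \<le> 1"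
      using N by (simp add: f_def g_def indicator_mult_ennreal mult.commute)
    have PB: "P x t y \<in> B" if "x \<in> B" "y \<in> B" "t \<in> {0..1}" for x y t
    proof -
      have "t\<^sup>2 \<le> 1" using that(3) by (simp add: power_le_one)
      then have "(1 - t\<^sup>2) *\<^sub>R x + t\<^sup>2 *\<^sub>R y \<in> B"
        using that convex_ball[of c r] unfolding B_def by (intro convexD) auto
      then show ?thesis by (simp add: P_def algebra_simps)
    qed
    \<comment> \<open>The part of the gradient mass found in the ball after contracting it towards
      \<open>x\<close> by the factor \<open>t\<^sup>2\<close>.\<close>
    define H where "H t x = (\<integral>\<^sup>+y\<in>B. ennreal (f (P x t y)) \<partial>lborel)" for t x
    have Hm1[measurable]: "(\<lambda>t. H t x) \<in> borel_measurable borel" for x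
      unfolding H_def P_def by measurable
    have Hm2[measurable]: "(\<lambda>x. H t x) \<in> borel_measurable borel" for t
      unfolding H_def P_def by measurable
    have Hm'[measurable]: "(\<lambda>z. H (fst z) (snd z)) \<in> borel_measurable (borel \<Otimes>\<^sub>M borel)"
      unfolding H_def P_def by measurable
    have Hm[measurable]: "(\<lambda>z. H (snd z) (fst z)) \<in> borel_measurable (borel \<Otimes>\<^sub>M borel)"
      unfolding H_def P_def by measurable
    \<comment> \<open>Substitution turns a contraction by \<open>a\<close> into the factor
      \<open>a\<close> to the power \<open>- n\<close>, and the total mass of \<open>f\<close> is at
      most 1.\<close>
    have scale: "(\<integral>\<^sup>+y. ennreal (f (z + a *\<^sub>R y)) \<partial>lborel) \<le> ennreal (inverse (a ^ n))" if "a > 0" for z a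
    proof -
      have "ennreal (inverse (a ^ n)) * (\<integral>\<^sup>+y. ennreal (f y) \<partial>lborel)
          = ennreal (inverse (a ^ n)) * (ennreal (a ^ n) * (\<integral>\<^sup>+y. ennreal (f (z + a *\<^sub>R y)) \<partial>lborel))"
        using that by (subst nn_integral_lborel_affine[of _ a z]) (auto simp: n_def)
      also have "\<dots> = (\<integral>\<^sup>+y. ennreal (f (z + a *\<^sub>R y)) \<partial>lborel)"
        using that by (simp add: mult.assoc[symmetric] flip: ennreal_mult)
      finally show ?thesis
        using mult_left_mono[OF Nf, of "ennreal (inverse (a ^ n))"] by simp
    qed
    have H_le: "H t x \<le> ennreal (inverse ((t\<^sup>2) ^ n))" if "0 < t" for t x
    proof -
      have "H t x \<le> (\<integral>\<^sup>+y. ennreal (f ((x - t\<^sup>2 *\<^sub>R x) + t\<^sup>2 *\<^sub>R y)) \<partial>lborel)"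
        unfolding H_def P_def by (intro nn_integral_mono) (auto simp: indicator_def algebra_simps)
      also have "\<dots> \<le> ennreal (inverse ((t\<^sup>2) ^ n))"
        using that by (intro scale) simp
      finally show ?thesis .
    qed
    \<comment> \<open>The path point is \<open>(1 - t\<^sup>2) x + t\<^sup>2 y\<close>, and one of
      the two coefficients is at least 1/2. Substituting in the corresponding variable gives the
      same bound \<open>2 ^ n\<close> in both cases, without a singularity at
      \<open>t = 0\<close>.\<close>
    have H_int: "(\<integral>\<^sup>+x\<in>B. H t x \<partial>lborel) \<le> ennreal (2 ^ n * \<beta>)" if t: "t \<in> {0..1}" for t
    proof (cases "t\<^sup>2 \<ge> 1/2")
      case True
      have "t > 0" using True t by (cases "t = 0") auto
      have "inverse ((t\<^sup>2) ^ n) \<le> inverse ((1/2) ^ n)"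
        using True by (intro le_imp_inverse_le power_mono) auto
      then have "H t x \<le> ennreal (2 ^ n)" for x
        using H_le[OF \<open>t > 0\<close>, of x] by (simp add: power_divide) (meson ennreal_leI order_trans)
      then have "(\<integral>\<^sup>+x\<in>B. H t x \<partial>lborel) \<le> (\<integral>\<^sup>+x. ennreal (2 ^ n) * indicator B x \<partial>lborel)"
        by (intro nn_integral_mono mult_right_mono) auto
      also have "\<dots> = ennreal (2 ^ n * \<beta>)"
        using \<beta> by (simp add: nn_integral_cmult_indicator eB flip: ennreal_mult)
      finally show ?thesis .
    next
      case False
      define a where "a = 1 - t\<^sup>2"
      have a: "a \<ge> 1/2" using False by (simp add: a_def)
      have "(\<integral>\<^sup>+x\<in>B. H t x \<partial>lborel) = (\<integral>\<^sup>+x. \<integral>\<^sup>+y. ennreal (f (P x t y)) * indicator B y * indicator B x \<partial>lborel \<partial>lborel)"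
        unfolding H_def P_def by (intro nn_integral_cong) (simp add: nn_integral_multc)
      also have "\<dots> = (\<integral>\<^sup>+y. \<integral>\<^sup>+x. ennreal (f (P x t y)) * indicator B y * indicator B x \<partial>lborel \<partial>lborel)"
        unfolding P_def by (intro lborel_pair.Fubini') measurable
      also have "\<dots> \<le> (\<integral>\<^sup>+y. ennreal (2 ^ n) * indicator B y \<partial>lborel)"
      proof (intro nn_integral_mono)
        fix y
        have "(\<integral>\<^sup>+x. ennreal (f (P x t y)) * indicator B y * indicator B x \<partial>lborel)
            \<le> (\<integral>\<^sup>+x. ennreal (f (t\<^sup>2 *\<^sub>R y + a *\<^sub>R x)) * indicator B y \<partial>lborel)"
          by (intro nn_integral_mono) (auto simp: indicator_def P_def a_def algebra_simps)
        also have "\<dots> = (\<integral>\<^sup>+x. ennreal (f (t\<^sup>2 *\<^sub>R y + a *\<^sub>R x)) \<partial>lborel) * indicator B y"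
          by (intro nn_integral_multc) measurable
        also have "\<dots> \<le> ennreal (inverse (a ^ n)) * indicator B y"
          using a by (intro mult_right_mono scale) auto
        also have "\<dots> \<le> ennreal (2 ^ n) * indicator B y"
        proof (intro mult_right_mono ennreal_leI)
          have "inverse (a ^ n) \<le> inverse ((1/2) ^ n)"
            using a by (intro le_imp_inverse_le power_mono) auto
          then show "inverse (a ^ n) \<le> 2 ^ n" by (simp add: power_divide)
        qed auto
        finally show "(\<integral>\<^sup>+x. ennreal (f (P x t y)) * indicator B y * indicator B x \<partial>lborel) \<le> ennreal (2 ^ n) * indicator B y" .
      qed
      also have "\<dots> = ennreal (2 ^ n * \<beta>)"
        using \<beta> by (simp add: nn_integral_cmult_indicator eB flip: ennreal_mult)
      finally show ?thesis .
    qed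
    \<comment> \<open>\<open>\<beta>\<close> times the deviation from the mean is the integral of
      \<open>v x - v y\<close> over \<open>y\<close>.\<close>
    have pw1: "ennreal (\<beta> * w x) \<le> (\<integral>\<^sup>+y\<in>B. ennreal (norm (v x - v y)) \<partial>lborel)" for x
    proof -
      have "bounded (v ` cball c r)"
        using cv by (intro compact_imp_bounded compact_continuous_image compact_cball) (auto intro: continuous_on_subset)
      then obtain M where "\<forall>y\<in>v ` cball c r. norm y \<le> M" unfolding bounded_iff by blast
      then have M: "norm (v y) \<le> M" if "y \<in> B" for y using that by (simp add: B_def)
      have iv: "integrable lborel (\<lambda>y. indicator B y *\<^sub>R v y)"
      proof (rule integrableI_bounded_set_indicator)
        show "AE x in lborel. x \<in> B \<longrightarrow> norm (v x) \<le> M" using M by simp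
      qed (auto simp: eB)
      have ic: "integrable lborel (\<lambda>y. indicator B y *\<^sub>R v x)"
        by (rule integrable_scaleR_left) (auto simp: eB)
      have "(LINT y|lborel. indicator B y *\<^sub>R (v x - v y)) = \<beta> *\<^sub>R v x - (LINT y|lborel. indicator B y *\<^sub>R v y)"
        using iv ic by (simp add: scaleR_diff_right \<beta>_def) (simp add: eB)
      also have "\<dots> = \<beta> *\<^sub>R (v x - mean_value B v)"
        using \<beta> by (simp add: mean_value_def set_lebesgue_integral_def \<beta>_def[symmetric] scaleR_diff_right)
      finally have "ennreal (\<beta> * w x) = ennreal (norm (LINT y|lborel. indicator B y *\<^sub>R (v x - v y)))"
        using \<beta> by (simp add: w_def)
      also have "\<dots> \<le> (\<integral>\<^sup>+y. ennreal (norm (indicator B y *\<^sub>R (v x - v y))) \<partial>lborel)"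
        using iv ic by (intro integral_norm_bound_ennreal) (simp add: scaleR_diff_right)
      also have "\<dots> = (\<integral>\<^sup>+y\<in>B. ennreal (norm (v x - v y)) \<partial>lborel)"
        by (intro nn_integral_cong) (auto simp: indicator_def)
      finally show ?thesis .
    qed
    define \<Phi> where "\<Phi> x z = 2 * fst z * D * g (P x (fst z) (snd z))" for x and z :: "real \<times> (real^'n)"
    have \<Phi>m[measurable]: "\<Phi> x \<in> borel_measurable (lborel \<Otimes>\<^sub>M lborel)" for x
    proof -
      have "\<Phi> x \<in> borel_measurable (borel \<Otimes>\<^sub>M borel)"
        unfolding \<Phi>_def P_def by measurable
      then show ?thesis by (simp cong: measurable_cong_sets sets_pair_measure_cong)
    qed
    have SB[measurable]: "{0..1::real} \<times> B \<in> sets (lborel \<Otimes>\<^sub>M lborel)"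
      by (intro pair_measureI) auto
    have mq: "(\<lambda>u::real. ennreal (u powr q)) \<in> borel_measurable borel"
      by measurable
    have pw2: "ennreal (\<beta> * w x) \<le> (\<integral>\<^sup>+z\<in>{0..1} \<times> B. ennreal (\<Phi> x z) \<partial>(lborel \<Otimes>\<^sub>M lborel))"
      if x: "x \<in> B" for x
    proof -
      have "ennreal (\<beta> * w x) \<le> (\<integral>\<^sup>+y\<in>B. ennreal (norm (v x - v y)) \<partial>lborel)" by (rule pw1)
      also have "\<dots> \<le> (\<integral>\<^sup>+y. \<integral>\<^sup>+t. ennreal (\<Phi> x (t, y)) * indicator ({0..1} \<times> B) (t, y) \<partial>lborel \<partial>lborel)"
      proof (intro nn_integral_mono)
        fix y
        show "ennreal (norm (v x - v y)) * indicator B y \<le> (\<integral>\<^sup>+t. ennreal (\<Phi> x (t, y)) * indicator ({0..1} \<times> B) (t, y) \<partial>lborel)"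
        proof (cases "y \<in> B")
          case True
          have "norm (x - y) \<le> D"
            using x True norm_triangle_ineq4[of "x - c" "y - c"] by (simp add: B_def D_def dist_norm norm_minus_commute)
          then have *: "ennreal (2 * t * norm (x - y) * g (P x t y)) * indicator {0..1} t \<le> ennreal (\<Phi> x (t, y)) * indicator ({0..1} \<times> B) (t, y)" for t
            using True by (auto simp: \<Phi>_def indicator_def g_def intro!: ennreal_leI mult_right_mono mult_left_mono)
          have "ennreal (norm (v x - v y)) \<le> (\<integral>\<^sup>+t\<in>{0..1}. ennreal (2 * t * norm (x - y) * g (P x t y)) \<partial>lborel)"
            using smooth_segment_bound[OF sm, of x y] by (simp add: g_def P_def)
          also have "\<dots> \<le> (\<integral>\<^sup>+t. ennreal (\<Phi> x (t, y)) * indicator ({0..1} \<times> B) (t, y) \<partial>lborel)"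
            by (intro nn_integral_mono *)
          finally show ?thesis using True by simp
        qed simp
      qed
      also have "\<dots> = (\<integral>\<^sup>+z\<in>{0..1} \<times> B. ennreal (\<Phi> x z) \<partial>(lborel \<Otimes>\<^sub>M lborel))"
        by (rule lborel_pair.nn_integral_snd) (intro borel_measurable_times_ennreal borel_measurable_indicator SB measurable_compose[OF \<Phi>m measurable_ennreal])
      finally show ?thesis .
    qed
    \<comment> \<open>Jensen on the product of the time interval and the ball, which has measure
      \<open>\<beta>\<close>. By convexity the path stays in the ball, so the cut-off density
      \<open>f\<close> sees the full gradient power, and the integral over \<open>y\<close> is
      \<open>H\<close>.\<close>
    have pw3: "ennreal (\<beta> * w x powr q) \<le> (\<integral>\<^sup>+t\<in>{0..1}. ennreal ((2 * t * D) powr q) * H t x \<partial>lborel)" if x: "x \<in> B" for x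
    proof -
      have e1: "emeasure (lborel \<Otimes>\<^sub>M lborel) ({0..1::real} \<times> B) = ennreal \<beta>"
        by (subst lborel.emeasure_pair_measure_Times) (auto simp: eB)
      have "ennreal ((\<beta> * w x) powr q) \<le> ennreal (\<beta> powr (q - 1)) *
          (\<integral>\<^sup>+z\<in>{0..1} \<times> B. ennreal (\<Phi> x z powr q) \<partial>(lborel \<Otimes>\<^sub>M lborel))"
      proof (rule nn_integral_power_mean[OF q SB e1 \<beta> \<Phi>m _ _ pw2[OF x]])
        show "0 \<le> \<Phi> x z" if "z \<in> {0..1} \<times> B" for z
          using that r by (auto simp: \<Phi>_def D_def g_def)
      qed (use \<beta> in \<open>simp add: w_def\<close>)
      also have "(\<integral>\<^sup>+z\<in>{0..1} \<times> B. ennreal (\<Phi> x z powr q) \<partial>(lborel \<Otimes>\<^sub>M lborel))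
          = (\<integral>\<^sup>+t. \<integral>\<^sup>+y. ennreal (\<Phi> x (t, y) powr q) * indicator ({0..1} \<times> B) (t, y) \<partial>lborel \<partial>lborel)"
        by (rule lborel.nn_integral_fst[symmetric])
          (intro borel_measurable_times_ennreal borel_measurable_indicator SB measurable_compose[OF \<Phi>m mq])
      also have "\<dots> = (\<integral>\<^sup>+t\<in>{0..1}. ennreal ((2 * t * D) powr q) * H t x \<partial>lborel)"
      proof (intro nn_integral_cong)
        fix t :: real
        show "(\<integral>\<^sup>+y. ennreal (\<Phi> x (t, y) powr q) * indicator ({0..1} \<times> B) (t, y) \<partial>lborel)
            = ennreal ((2 * t * D) powr q) * H t x * indicator {0..1} t"
        proof (cases "t \<in> {0..1}")
          case True
          have "(\<integral>\<^sup>+y. ennreal (\<Phi> x (t, y) powr q) * indicator ({0..1} \<times> B) (t, y) \<partial>lborel)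
              = (\<integral>\<^sup>+y. ennreal ((2 * t * D) powr q) * (ennreal (f (P x t y)) * indicator B y) \<partial>lborel)"
          proof (intro nn_integral_cong)
            fix y
            show "ennreal (\<Phi> x (t, y) powr q) * indicator ({0..1} \<times> B) (t, y)
                = ennreal ((2 * t * D) powr q) * (ennreal (f (P x t y)) * indicator B y)"
              using True r PB[OF x, of y t]
              by (cases "y \<in> B") (simp_all add: f_def \<Phi>_def powr_mult g_def D_def flip: ennreal_mult)
          qed
          also have "\<dots> = ennreal ((2 * t * D) powr q) * H t x"
            unfolding H_def P_def by (intro nn_integral_cmult) measurable
          finally show ?thesis using True by simp
        next
          case False
          then have "indicator ({0..1} \<times> B) (t, y) = (0::ennreal)" for y by (auto simp: indicator_def)
          then show ?thesis using False by simp
        qed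
      qed
      finally have "ennreal ((\<beta> * w x) powr q) \<le> ennreal (\<beta> powr (q - 1)) *
          (\<integral>\<^sup>+t\<in>{0..1}. ennreal ((2 * t * D) powr q) * H t x \<partial>lborel)" .
      then have "ennreal (\<beta> powr (1 - q)) * ennreal ((\<beta> * w x) powr q) \<le> ennreal (\<beta> powr (1 - q)) * (ennreal (\<beta> powr (q - 1)) *
          (\<integral>\<^sup>+t\<in>{0..1}. ennreal ((2 * t * D) powr q) * H t x \<partial>lborel))"
        by (intro mult_left_mono) auto
      also have "\<dots> = (\<integral>\<^sup>+t\<in>{0..1}. ennreal ((2 * t * D) powr q) * H t x \<partial>lborel)"
        using \<beta> by (simp add: mult.assoc[symmetric] flip: ennreal_mult powr_add)
      also have "ennreal (\<beta> powr (1 - q)) * ennreal ((\<beta> * w x) powr q) = ennreal (\<beta> * w x powr q)"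
        using \<beta> by (simp add: powr_mult w_def powr_diff flip: ennreal_mult)
      finally show ?thesis .
    qed
    have pw4: "ennreal (\<beta> powr k * w x powr (q * k)) \<le> ennreal ((2 * D) powr (q * k)) * (\<integral>\<^sup>+t\<in>{0..1}. H t x \<partial>lborel)" if x: "x \<in> B" for x
    proof -
      \<comment> \<open>Real values are required for Jensen in \<open>t\<close>. Finiteness of
        \<open>H\<close> comes from \<open>H_le\<close>, which covers \<open>t > 0\<close>; at
        \<open>t = 0\<close> the speed factor vanishes.\<close>
      define h where "h t = enn2real (H t x)" for t
      have [measurable]: "h \<in> borel_measurable borel" unfolding h_def by measurable
      have hH: "ennreal (h t) = H t x" if "t > 0" for t
        using H_le[OF that, of x] unfolding h_def by (metis ennreal_enn2real ennreal_less_top le_less_trans)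
      have "ennreal (\<beta> * w x powr q) \<le> (\<integral>\<^sup>+t\<in>{0..1}. ennreal ((2 * t * D) powr q * h t) \<partial>lborel)"
      proof (rule order_trans[OF pw3[OF x]], intro nn_integral_mono)
        fix t :: real
        show "ennreal ((2 * t * D) powr q) * H t x * indicator {0..1} t \<le> ennreal ((2 * t * D) powr q * h t) * indicator {0..1} t"
          using hH[of t] by (cases "t > 0") (auto simp: ennreal_mult' indicator_def)
      qed
      then have "ennreal ((\<beta> * w x powr q) powr k) \<le> ennreal (1 powr (k - 1)) * (\<integral>\<^sup>+t\<in>{0..1}. ennreal (((2 * t * D) powr q * h t) powr k) \<partial>lborel)"
        using k \<beta> by (intro nn_integral_power_mean) (auto simp: h_def)
      also have "\<dots> \<le> (\<integral>\<^sup>+t. ennreal ((2 * D) powr (q * k)) * (H t x * indicator {0..1} t) \<partial>lborel)"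
        unfolding powr_one_eq_one ennreal_1 mult_1_left
      proof (intro nn_integral_mono)
        fix t :: real
        show "ennreal (((2 * t * D) powr q * h t) powr k) * indicator {0..1} t \<le> ennreal ((2 * D) powr (q * k)) * (H t x * indicator {0..1} t)"
        proof (cases "t \<in> {0<..1}")
          case True
          then have t: "0 < t" "t \<le> 1" by auto
          \<comment> \<open>Of the \<open>k\<close> powers of \<open>h t\<close> one is kept for the
            integration over \<open>x\<close>, and the remaining \<open>k - 1\<close> are replaced
            by the pointwise bound \<open>H_le\<close>.\<close>
          have hk: "h t powr k \<le> h t * t powr (- 2 * real n * (k - 1))"
          proof (cases "h t = 0")
            case False
            then have h0: "h t > 0" by (simp add: h_def less_le)
            have "ennreal (h t) \<le> ennreal (inverse ((t\<^sup>2) ^ n))" using hH H_le t by simp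
            then have "h t \<le> inverse ((t\<^sup>2) ^ n)" using t by (simp add: ennreal_le_iff)
            also have "\<dots> = t powr (- 2 * real n)"
              using powr_realpow[OF t(1), of "2 * n"] powr_minus[of t "2 * real n"] by (simp add: power_mult)
            finally have "h t powr (k - 1) \<le> (t powr (- 2 * real n)) powr (k - 1)"
              using h0 k by (intro powr_mono2) auto
            then have "h t * h t powr (k - 1) \<le> h t * t powr (- 2 * real n * (k - 1))"
              using h0 by (simp add: powr_powr)
            moreover have "h t * h t powr (k - 1) = h t powr k" using h0 by (simp add: powr_diff)
            ultimately show ?thesis by simp
          qed simp
          have "((2 * t * D) powr q * h t) powr k = (2 * D) powr (q * k) * (t powr (q * k) * h t powr k)"
            using t r by (simp add: powr_mult powr_powr D_def h_def mult_ac)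
          also have "\<dots> \<le> (2 * D) powr (q * k) * (t powr (q * k) * (h t * t powr (- 2 * real n * (k - 1))))"
            using hk by (intro mult_left_mono) auto
          also have "\<dots> = (2 * D) powr (q * k) * (h t * t powr (q * k - 2 * real n * (k - 1)))"
            using powr_add[of t "q * k" "- 2 * real n * (k - 1)"] by (simp add: mult_ac)
          also have "\<dots> \<le> (2 * D) powr (q * k) * (h t * 1)"
            using t k(2) by (intro mult_left_mono powr_le1) (auto simp: h_def n_def)
          finally have X: "((2 * t * D) powr q * h t) powr k \<le> (2 * D) powr (q * k) * h t" by simp
          have "h t \<ge> 0" by (simp add: h_def)
          then show ?thesis
            using True ennreal_leI[OF X] by (simp add: ennreal_mult hH[OF t(1)])
        next
          case False
          then show ?thesis using q k by (cases "t = 0") (auto simp: indicator_def)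
        qed
      qed
      also have "\<dots> = ennreal ((2 * D) powr (q * k)) * (\<integral>\<^sup>+t\<in>{0..1}. H t x \<partial>lborel)"
        by (intro nn_integral_cmult) measurable
      finally show ?thesis using \<beta> by (simp add: powr_mult powr_powr w_def)
    qed
    have "(\<integral>\<^sup>+x. \<integral>\<^sup>+t. H t x * indicator {0..1} t * indicator B x \<partial>lborel \<partial>lborel)
        = (\<integral>\<^sup>+t. \<integral>\<^sup>+x. H t x * indicator {0..1} t * indicator B x \<partial>lborel \<partial>lborel)"
      by (intro lborel_pair.Fubini') measurable
    also have "\<dots> \<le> (\<integral>\<^sup>+t. ennreal (2 ^ n * \<beta>) * indicator {0..1::real} t \<partial>lborel)"
    proof (rule nn_integral_mono)
      fix t :: real
      have "(\<integral>\<^sup>+x. H t x * indicator {0..1} t * indicator B x \<partial>lborel) = (\<integral>\<^sup>+x\<in>B. H t x \<partial>lborel) * indicator {0..1} t"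
        by (cases "t \<in> {0..1}") simp_all
      then show "(\<integral>\<^sup>+x. H t x * indicator {0..1} t * indicator B x \<partial>lborel) \<le> ennreal (2 ^ n * \<beta>) * indicator {0..1} t"
        using H_int[of t] by (cases "t \<in> {0..1}") simp_all
    qed
    also have "\<dots> = ennreal (2 ^ n * \<beta>)"
      by (simp add: nn_integral_cmult_indicator)
    finally have I: "(\<integral>\<^sup>+x. \<integral>\<^sup>+t. H t x * indicator {0..1} t * indicator B x \<partial>lborel \<partial>lborel) \<le> ennreal (2 ^ n * \<beta>)" .
    have "(\<integral>\<^sup>+x\<in>B. ennreal (\<beta> powr k * w x powr (q * k)) \<partial>lborel)
        \<le> (\<integral>\<^sup>+x. ennreal ((2 * D) powr (q * k)) * (\<integral>\<^sup>+t. H t x * indicator {0..1} t * indicator B x \<partial>lborel) \<partial>lborel)"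
    proof (rule nn_integral_mono)
      fix x
      show "ennreal (\<beta> powr k * w x powr (q * k)) * indicator B x
          \<le> ennreal ((2 * D) powr (q * k)) * (\<integral>\<^sup>+t. H t x * indicator {0..1} t * indicator B x \<partial>lborel)"
        using pw4[of x] by (cases "x \<in> B") simp_all
    qed
    also have "\<dots> = ennreal ((2 * D) powr (q * k)) * (\<integral>\<^sup>+x. \<integral>\<^sup>+t. H t x * indicator {0..1} t * indicator B x \<partial>lborel \<partial>lborel)"
      by (rule nn_integral_cmult) measurable
    finally have "(\<integral>\<^sup>+x\<in>B. ennreal (\<beta> powr k * w x powr (q * k)) \<partial>lborel) \<le> ennreal ((2 * D) powr (q * k)) * ennreal (2 ^ n * \<beta>)"
      using mult_left_mono[OF I, of "ennreal ((2 * D) powr (q * k))"] by (meson order_trans zero_le)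
    then have "ennreal (\<beta> powr - k) * (\<integral>\<^sup>+x\<in>B. ennreal (\<beta> powr k * w x powr (q * k)) \<partial>lborel)
        \<le> ennreal (\<beta> powr - k) * (ennreal ((2 * D) powr (q * k)) * ennreal (2 ^ n * \<beta>))"
      by (intro mult_left_mono) auto
    also have "\<dots> = ennreal C"
      using \<beta> by (simp add: C_def powr_diff powr_minus field_simps flip: ennreal_mult)
    also have "ennreal (\<beta> powr - k) * (\<integral>\<^sup>+x\<in>B. ennreal (\<beta> powr k * w x powr (q * k)) \<partial>lborel)
        = (\<integral>\<^sup>+x. ennreal (\<beta> powr - k) * (ennreal (\<beta> powr k * w x powr (q * k)) * indicator B x) \<partial>lborel)"
      by (intro nn_integral_cmult[symmetric]) measurable
    also have "\<dots> = (\<integral>\<^sup>+x\<in>B. ennreal (w x powr (q * k)) \<partial>lborel)"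
      using \<beta> by (intro nn_integral_cong) (simp add: mult.assoc[symmetric] powr_minus flip: ennreal_mult)
    finally show ?thesis by (simp add: w_def)
  qed
  then show ?thesis using that[of C] C0 unfolding B_def by blast
qed

subsection \<open>A reverse Hoelder inequality for smooth maps\<close>

lemma gradient_scaleR:
  fixes v :: "real^'n \<Rightarrow> real^'m"
  assumes "smooth v"
  shows "gradient (\<lambda>x. a *\<^sub>R v x) x = a *\<^sub>R gradient v x"
proof -
  have "((\<lambda>x. a *\<^sub>R v x) has_derivative (\<lambda>h. a *\<^sub>R frechet_derivative v (at x) h)) (at x)"
    by (intro has_derivative_scaleR_right smooth_has_derivative assms)
  from gradient_eq[OF this] show ?thesis
    by (simp add: vec_eq_iff gradient_nth matrix_def)
qed

lemma gradient_diff_const: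
  fixes v :: "real^'n \<Rightarrow> real^'m"
  assumes "smooth v"
  shows "gradient (\<lambda>x. v x - a) x = gradient v x"
proof -
  have "((\<lambda>x. v x - a) has_derivative (\<lambda>h. frechet_derivative v (at x) h)) (at x)"
    using has_derivative_diff[OF smooth_has_derivative[OF assms] has_derivative_const[of a "at x"]] by simp
  from gradient_eq[OF this] show ?thesis
    by (simp add: gradient_def)
qed

definition scalar_gradient :: "(real^'n \<Rightarrow> real) \<Rightarrow> real^'n \<Rightarrow> real^'n"
  where "scalar_gradient \<eta> x = (\<chi> j. frechet_derivative \<eta> (at x) (axis j 1))"

text \<open>The difference is the rank-one matrix \<open>T\<close> with rows \<open>v x $ i\<close>
  times the gradient of the cutoff; its Euclidean norm is exactly the product on the right.\<close>

lemma gradient_cutoff: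
  fixes v :: "real^'n \<Rightarrow> real^'m"
  assumes "smooth \<eta>" "smooth v"
  shows "norm (gradient (\<lambda>x. \<eta> x *\<^sub>R v x) x - \<eta> x *\<^sub>R gradient v x) \<le> norm (v x) * norm (scalar_gradient \<eta> x)"
proof -
  define T :: "real^'n^'m" where "T = (\<chi> i. v x $ i *\<^sub>R scalar_gradient \<eta> x)"
  have "((\<lambda>x. \<eta> x *\<^sub>R v x) has_derivative
      (\<lambda>h. \<eta> x *\<^sub>R frechet_derivative v (at x) h + frechet_derivative \<eta> (at x) h *\<^sub>R v x)) (at x)"
    by (intro has_derivative_scaleR smooth_has_derivative assms)
  from gradient_eq[OF this]
  have "gradient (\<lambda>x. \<eta> x *\<^sub>R v x) x = \<eta> x *\<^sub>R gradient v x + T"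
    by (simp add: vec_eq_iff gradient_nth matrix_def T_def scalar_gradient_def mult.commute)
  moreover have "norm T = norm (v x) * norm (scalar_gradient \<eta> x)"
    unfolding norm_vec_def[of T] norm_vec_def[of "v x"] by (simp add: T_def L2_set_left_distrib)
  ultimately show ?thesis by simp
qed

lemma lipschitz_growth_continuous:
  fixes F :: "'a::euclidean_space \<Rightarrow> real"
  assumes p: "p > 1" and L: "L > 0" "\<And>x y. \<bar>F y - F x\<bar> \<le> L * norm (y - x) * (norm x + norm y) powr (p - 1)"
  shows "continuous_on UNIV F"
proof -
  have "isCont F x" for x
  proof -
    have "((\<lambda>y. F y - F x) \<longlongrightarrow> 0) (at x)"
    proof (rule Lim_null_comparison)
      have "norm (F y - F x) \<le> L * norm (y - x) * (2 * norm x + 1) powr (p - 1)" if "dist y x < 1" for y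
      proof -
        have "norm y \<le> norm x + 1" using that norm_triangle_ineq2[of y x] by (simp add: dist_norm)
        then have "(norm x + norm y) powr (p - 1) \<le> (2 * norm x + 1) powr (p - 1)"
          using p by (intro powr_mono2) auto
        then have "L * norm (y - x) * (norm x + norm y) powr (p - 1) \<le> L * norm (y - x) * (2 * norm x + 1) powr (p - 1)"
          using L by (intro mult_left_mono) auto
        then show ?thesis using L(2)[of y x] by simp
      qed
      then show "\<forall>\<^sub>F y in at x. norm (F y - F x) \<le> L * norm (y - x) * (2 * norm x + 1) powr (p - 1)"
        by (auto simp: eventually_at intro: exI[of _ 1])
      have "((\<lambda>y. norm (y - x)) \<longlongrightarrow> 0) (at x)"
        by (rule tendsto_norm_zero) (simp add: LIM_zero_iff)
      then show "((\<lambda>y. L * norm (y - x) * (2 * norm x + 1) powr (p - 1)) \<longlongrightarrow> 0) (at x)"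
        by (intro tendsto_mult_left_zero tendsto_mult_right_zero)
    qed
    then show ?thesis unfolding isCont_def by (simp add: LIM_zero_iff)
  qed
  then show ?thesis by (simp add: continuous_on_eq_continuous_at)
qed

text \<open>A Young inequality with the conjugate exponents
  \<open>(p - \<delta>) / (1 - \<delta>)\<close> and \<open>(p - \<delta>) / (p - 1)\<close>. The
  first is the Sobolev exponent available for the function, and the second turns the gradient power
  \<open>p - 1\<close> into \<open>p - \<delta>\<close>. The summand 1 takes care of small
  \<open>a\<close>, where \<open>a powr p\<close> is not controlled by the higher power.\<close>

lemma product_powr_le_sum:
  fixes a b p \<delta> :: real
  assumes "a \<ge> 0" "b \<ge> 0" "p > 1" "0 < \<delta>" "\<delta> < 1" "\<delta> \<le> p - 1"
  shows "a * (b + a) powr (p - 1) \<le> 2 powr p * (1 + a powr ((p - \<delta>) / (1 - \<delta>)) + b powr (p - \<delta>))"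
proof -
  define s where "s = (p - \<delta>) / (1 - \<delta>)"
  have s: "s \<ge> p" "s > 0"
    using assms mult_left_mono[of 1 p \<delta>] by (simp_all add: s_def field_simps)
  have one: "(2 * m) powr (p - 1) \<le> 2 powr p * m powr (p - 1)" if "m \<ge> 0" for m
    using that by (simp add: powr_mult mult_right_mono)
  have "a * (max a b) powr (p - 1) \<le> 1 + a powr s + b powr (p - \<delta>)"
  proof (cases "b \<le> a")
    case True
    have "a * a powr (p - 1) = a powr p" using assms by (cases "a = 0") (auto simp: powr_diff)
    moreover have "a powr p \<le> 1 + a powr s"
    proof (cases "a \<le> 1")
      case True
      then have "a powr p \<le> 1" using assms by (intro powr_le1) auto
      then show ?thesis using powr_ge_zero[of a s] by linarith
    next
      case False
      then have "a powr p \<le> a powr s" using s by (intro powr_mono) auto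
      then show ?thesis by simp
    qed
    ultimately show ?thesis
      unfolding max_absorb1[OF True] using powr_ge_zero[of b "p - \<delta>"] by linarith
  next
    case False
    then have b: "b > 0" "max a b = b" using assms by auto
    have "a * b powr (p - 1) \<le> a powr s + b powr (p - \<delta>)"
    proof (cases "a = 0")
      case a: False
      show ?thesis
      proof (cases "a \<le> b powr (1 - \<delta>)")
        case True
        then have "a * b powr (p - 1) \<le> b powr (1 - \<delta>) * b powr (p - 1)" by (intro mult_right_mono) auto
        also have "\<dots> = b powr (p - \<delta>)" by (simp flip: powr_add)
        finally show ?thesis using powr_ge_zero[of a s] by linarith
      next
        case False
        then have "(b powr (1 - \<delta>)) powr (1 / (1 - \<delta>)) \<le> a powr (1 / (1 - \<delta>))"
          using assms by (intro powr_mono2) auto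
        then have "b \<le> a powr (1 / (1 - \<delta>))" using assms b by (simp add: powr_powr)
        then have "b powr (p - 1) \<le> (a powr (1 / (1 - \<delta>))) powr (p - 1)" using assms by (intro powr_mono2) auto
        then have "a * b powr (p - 1) \<le> a powr 1 * a powr ((p - 1) / (1 - \<delta>))"
          using assms by (simp add: powr_powr mult_left_mono)
        also have "\<dots> = a powr s"
        proof -
          have "1 + (p - 1) / (1 - \<delta>) = s" using assms by (simp add: s_def field_simps)
          then show ?thesis by (simp only: powr_add[symmetric])
        qed
        finally show ?thesis using powr_ge_zero[of b "p - \<delta>"] by linarith
      qed
    qed simp
    then show ?thesis using b by simp
  qed
  then have A: "2 powr p * (a * (max a b) powr (p - 1)) \<le> 2 powr p * (1 + a powr s + b powr (p - \<delta>))"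
    by (intro mult_left_mono) auto
  have B: "a * (b + a) powr (p - 1) \<le> a * (2 * max a b) powr (p - 1)"
    using assms by (intro mult_left_mono powr_mono2) auto
  have C: "a * (2 * max a b) powr (p - 1) \<le> a * (2 powr p * (max a b) powr (p - 1))"
    using assms by (intro mult_left_mono one) auto
  show ?thesis
    using order_trans[OF B order_trans[OF C A[folded mult.left_commute[of a]]]] unfolding s_def .
qed

text \<open>Only the ball supplied by the quasiconcavity test is treated; other balls follow by
  affine substitution. The integral on the left is signed, since \<open>F (gradient v)\<close> may
  be negative somewhere. The case of gradient mass at most 1 is proved first, and both sides scale
  with the power \<open>p\<close> of \<open>v\<close>.\<close>

lemma smooth_reverse_hoelder:
  fixes F :: "real^'n^'m \<Rightarrow> real"
  assumes p: "p > 1" and F: "quasiconcave F" "pos_homogeneous p F"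
    and \<delta>: "0 < \<delta>" "\<delta> < 1" "\<delta> \<le> p - 1" "2 * real CARD('n) * \<delta> \<le> p - \<delta>"
  obtains c :: "real^'n" and r K where "r > 0" "K > 0"
    "\<And>(v :: real^'n \<Rightarrow> real^'m) N. smooth v \<Longrightarrow> N > 0 \<Longrightarrow>
       (\<integral>\<^sup>+x\<in>ball c r. ennreal (norm (gradient v x) powr (p - \<delta>)) \<partial>lborel) \<le> ennreal N \<Longrightarrow>
       (LINT x|lborel. bump ((2 / r) *\<^sub>R (x - c)) powr p * F (gradient v x)) \<le> K * N powr (p / (p - \<delta>))"
proof -
  define q where "q = p - \<delta>"
  \<comment> \<open>Makes \<open>q * k\<close> the exponent of the first term in
    \<open>product_powr_le_sum\<close>; the last condition on \<open>\<delta>\<close> is exactly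
    what the Sobolev-Poincare inequality asks of this \<open>k\<close>.\<close>
  define k where "k = 1 / (1 - \<delta>)"
  have q: "q \<ge> 1" using \<delta> by (simp add: q_def)
  have k: "k \<ge> 1" "2 * real CARD('n) * (k - 1) \<le> q * k"
  proof -
    show "k \<ge> 1" using \<delta> by (simp add: k_def)
    have "k - 1 = \<delta> * k" using \<delta> by (simp add: k_def field_simps)
    then have "2 * real CARD('n) * (k - 1) = (2 * real CARD('n) * \<delta>) * k" by simp
    also have "\<dots> \<le> q * k" using \<delta>(4) \<open>k \<ge> 1\<close> by (intro mult_right_mono) (auto simp: q_def)
    finally show "2 * real CARD('n) * (k - 1) \<le> q * k" .
  qed
  have F0: "F 0 = 0" using pos_homogeneous_0[OF p F(2)] .
  obtain L where L: "L > 0" "\<And>x y. \<bar>F y - F x\<bar> \<le> L * norm (y - x) * (norm x + norm y) powr (p - 1)"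
    using quasiconcave_homogeneous_lipschitz[OF p F] by blast
  have contF: "continuous_on UNIV F" using lipschitz_growth_continuous[OF p L] .
  obtain c :: "real^'n" and r where r: "r > 0"
    and test: "\<And>\<phi> :: real^'n \<Rightarrow> real^'m. smooth \<phi> \<Longrightarrow> (\<And>x. norm (x - c) \<ge> r \<Longrightarrow> \<phi> x = 0) \<Longrightarrow>
       (LINT x|lborel. F (gradient \<phi> x)) \<le> 0"
  proof (rule quasiconcave_compact_support[OF F(1) F0])
    fix c :: "real^'n" and r
    assume "r > 0" and "\<And>\<phi> :: real^'n \<Rightarrow> real^'m. smooth \<phi> \<Longrightarrow> (\<And>x. norm (x - c) \<ge> r \<Longrightarrow> \<phi> x = 0) \<Longrightarrow>
       (LINT x|lborel. F (gradient \<phi> x)) \<le> 0"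
    then show thesis by (rule that)
  qed
  define B where "B = ball c r"
  obtain C where C: "C \<ge> 0" "\<And>v :: real^'n \<Rightarrow> real^'m. smooth v \<Longrightarrow>
      (\<integral>\<^sup>+x\<in>B. ennreal (norm (gradient v x) powr q) \<partial>lborel) \<le> 1 \<Longrightarrow>
      (\<integral>\<^sup>+x\<in>B. ennreal (norm (v x - mean_value B v) powr (q * k)) \<partial>lborel) \<le> ennreal C"
  proof (rule poincare_sobolev_ball[OF r q k, where c = c, folded B_def])
    fix C assume "C \<ge> 0" "\<And>v :: real^'n \<Rightarrow> real^'m. smooth v \<Longrightarrow>
      (\<integral>\<^sup>+x\<in>B. ennreal (norm (gradient v x) powr q) \<partial>lborel) \<le> 1 \<Longrightarrow>
      (\<integral>\<^sup>+x\<in>B. ennreal (norm (v x - mean_value B v) powr (q * k)) \<partial>lborel) \<le> ennreal C"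
    then show thesis by (rule that)
  qed
  define \<beta> where "\<beta> = measure lborel B"
  have eB: "emeasure lborel B = ennreal \<beta>"
    unfolding \<beta>_def B_def using emeasure_lborel_ball_finite[of c r] by (intro emeasure_eq_ennreal_measure) auto
  have [measurable]: "B \<in> sets borel" by (simp add: B_def)
  \<comment> \<open>Supported in the ball of radius \<open>r / 2\<close>, so that the test map has
    its support well inside the ball \<open>B\<close>.\<close>
  define \<eta> where "\<eta> x = bump ((2 / r) *\<^sub>R (x - c))" for x
  have sm_\<eta>: "smooth \<eta>"
  proof -
    have sb: "Ck j (bump :: real^'n \<Rightarrow> real)" for j
      using smooth_bump unfolding smooth_def by blast
    have "Ck j (\<lambda>x. bump (- (2 / r) *\<^sub>R c + (2 / r) *\<^sub>R x))" for j
      by (rule Ck_comp_affine[OF bounded_linear_scaleR_right sb])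
    then show ?thesis unfolding smooth_def \<eta>_def by (simp add: scaleR_diff_right)
  qed
  have \<eta>0: "\<eta> x = 0" if "norm (x - c) \<ge> r / 2" for x
    unfolding \<eta>_def bump_eq_0_iff norm_scaleR using that r by (simp add: field_simps)
  have \<eta>_bounds: "0 \<le> \<eta> x" "\<eta> x \<le> 1" for x
    by (simp_all add: \<eta>_def bump_nonneg bump_le_1)
  have grad0: "scalar_gradient \<eta> x = 0" if "norm (x - c) > r / 2" for x
  proof -
    have "(\<eta> has_derivative (\<lambda>_. 0)) (at x)"
    proof (rule has_derivative_transform_within_open)
      show "((\<lambda>_. 0) has_derivative (\<lambda>_. 0)) (at x)" by simp
      show "open {x. norm (x - c) > r / 2}" by (intro open_Collect_less continuous_intros)
    qed (use that \<eta>0 in auto)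
    then have "frechet_derivative \<eta> (at x) = (\<lambda>_. 0)" using frechet_derivative_at by metis
    then show ?thesis by (simp add: scalar_gradient_def vec_eq_iff)
  qed
  have "continuous_on UNIV (scalar_gradient \<eta>)"
    unfolding scalar_gradient_def by (intro continuous_intros smooth_continuous_frechet sm_\<eta>)
  then obtain \<Gamma>0 where \<Gamma>0: "\<Gamma>0 \<ge> 0" "\<And>x. norm (scalar_gradient \<eta> x) \<le> \<Gamma>0"
    by (rule compact_support_bounded[where c = c and r = r]) (use grad0 r in auto)
  \<comment> \<open>Besides bounding the gradient of the cutoff, \<open>\<Gamma> \<ge> 2\<close>
    absorbs the two copies of \<open>g x\<close> in the sum of norms estimated in
    \<open>n2\<close>.\<close>
  define \<Gamma> where "\<Gamma> = max 2 \<Gamma>0"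
  have \<Gamma>: "\<Gamma> \<ge> 2" "\<And>x. norm (scalar_gradient \<eta> x) \<le> \<Gamma>"
    using \<Gamma>0(2) by (simp_all add: \<Gamma>_def le_max_iff_disj)
  define A where "A = L * \<Gamma> powr p * 2 powr p"
  define K where "K = A * (\<beta> + C + 1) + 1"
  have A0: "A \<ge> 0" using L by (simp add: A_def)
  have "\<beta> \<ge> 0" by (simp add: \<beta>_def)
  then have K0: "K > 0" using A0 C(1) by (simp add: K_def add_nonneg_pos)
  have homF: "F (\<eta> x *\<^sub>R z) = \<eta> x powr p * F z" for x z
    using F(2) \<eta>_bounds(1)[of x] F0 unfolding pos_homogeneous_def by (cases "\<eta> x = 0") auto
  have unit: "(LINT x|lborel. \<eta> x powr p * F (gradient v x)) \<le> K"
    if sm: "smooth v" and N: "(\<integral>\<^sup>+x\<in>B. ennreal (norm (gradient v x) powr q) \<partial>lborel) \<le> 1" for v :: "real^'n \<Rightarrow> real^'m"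
  proof -
    define g where "g x = norm (gradient v x)" for x
    define w where "w x = v x - mean_value B v" for x
    define \<phi> where "\<phi> x = \<eta> x *\<^sub>R w x" for x
    have sm_w: "smooth w"
      using sm unfolding smooth_def w_def by (intro allI Ck_diff Ck_const) auto
    have grw: "gradient w x = gradient v x" for x
      unfolding w_def by (rule gradient_diff_const[OF sm])
    have sm_\<phi>: "smooth \<phi>"
      using sm_w sm_\<eta> unfolding smooth_def \<phi>_def by (intro allI Ck_scaleR) auto
    have \<phi>0: "\<phi> x = 0" if "norm (x - c) \<ge> r / 2" for x
      using \<eta>0[OF that] by (simp add: \<phi>_def)
    have [measurable]: "w \<in> borel_measurable borel" "g \<in> borel_measurable borel"
      unfolding g_def
      using smooth_imp_continuous[OF sm_w] continuous_on_norm[OF smooth_continuous_gradient[OF sm]]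
      by (auto intro: borel_measurable_continuous_onI)
    define E where "E x = indicator B x * (1 + norm (w x) powr (q * k) + g x powr q)" for x
    have E_nn: "(\<integral>\<^sup>+x. ennreal (E x) \<partial>lborel) \<le> ennreal (\<beta> + C + 1)"
    proof -
      have "(\<integral>\<^sup>+x. ennreal (E x) \<partial>lborel) =
          (\<integral>\<^sup>+x. indicator B x + (ennreal (norm (w x) powr (q * k)) * indicator B x + ennreal (g x powr q) * indicator B x) \<partial>lborel)"
      proof (rule nn_integral_cong)
        fix x
        show "ennreal (E x) = indicator B x + (ennreal (norm (w x) powr (q * k)) * indicator B x + ennreal (g x powr q) * indicator B x)"
          by (cases "x \<in> B") (simp_all add: E_def add.assoc)
      qed
      also have "\<dots> = emeasure lborel B + ((\<integral>\<^sup>+x\<in>B. ennreal (norm (w x) powr (q * k)) \<partial>lborel) + (\<integral>\<^sup>+x\<in>B. ennreal (g x powr q) \<partial>lborel))"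
        by (simp add: nn_integral_add)
      also have "\<dots> \<le> ennreal \<beta> + (ennreal C + 1)"
        using C(2)[OF sm N] N by (intro add_mono) (auto simp: eB w_def g_def)
      also have "\<dots> = ennreal (\<beta> + C + 1)"
        using \<open>\<beta> \<ge> 0\<close> C(1) by (simp add: add.assoc)
      finally show ?thesis .
    qed
    have E_m[measurable]: "E \<in> borel_measurable lborel" unfolding E_def by measurable
    have E0: "E x \<ge> 0" for x by (simp add: E_def)
    have intE: "integrable lborel E"
      using E_nn E0 by (intro integrableI_nonneg) (auto intro: le_less_trans)
    have LE: "(LINT x|lborel. E x) \<le> \<beta> + C + 1"
    proof -
      have eq: "(\<integral>\<^sup>+x. ennreal (E x) \<partial>lborel) = ennreal (LINT x|lborel. E x)"
        by (rule nn_integral_eq_integral[OF intE]) (simp add: E0)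
      show ?thesis
        using E_nn \<open>\<beta> \<ge> 0\<close> C(1) unfolding eq by (subst (asm) ennreal_le_iff) auto
    qed
    have compact_int: "integrable lborel (\<lambda>x. F (G x))"
      if G: "continuous_on UNIV G" "\<And>x. norm (x - c) > r / 2 \<Longrightarrow> G x = 0" for G :: "real^'n \<Rightarrow> real^'n^'m"
    proof -
      have cFG: "continuous_on UNIV (\<lambda>x. F (G x))"
        using continuous_on_compose2[OF contF G(1)] by simp
      then obtain M where "\<And>x. norm (F (G x)) \<le> M"
        by (rule compact_support_bounded[where c = c and r = r]) (use G(2) r F0 in auto)
      then show ?thesis
        using borel_measurable_continuous_onI[OF cFG] G(2) F0
        by (intro integrable_bounded_support[where c = c and r = "r / 2"]) auto
    qed
    have g0: "gradient \<phi> x = 0" if "norm (x - c) > r / 2" for x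
      using \<phi>0 that by (rule gradient_outside_support)
    have i1: "integrable lborel (\<lambda>x. F (gradient \<phi> x))"
      by (rule compact_int[OF smooth_continuous_gradient[OF sm_\<phi>] g0])
    have i2: "integrable lborel (\<lambda>x. F (\<eta> x *\<^sub>R gradient v x))"
      using smooth_continuous_gradient[OF sm] smooth_imp_continuous[OF sm_\<eta>] \<eta>0
      by (intro compact_int continuous_intros) auto
    \<comment> \<open>Homogeneity moves the cutoff inside \<open>F\<close>. The two arguments of
      \<open>F\<close> then differ only by the cutoff term, and the Lipschitz bound produces the
      product that \<open>product_powr_le_sum\<close> splits. Outside \<open>B\<close> both
      arguments are zero.\<close>
    have pw: "F (\<eta> x *\<^sub>R gradient v x) \<le> F (gradient \<phi> x) + A * E x" for x
    proof (cases "x \<in> B")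
      case True
      define T where "T = gradient \<phi> x - \<eta> x *\<^sub>R gradient v x"
      have T: "norm T \<le> \<Gamma> * norm (w x)"
      proof -
        have "norm T \<le> norm (w x) * norm (scalar_gradient \<eta> x)"
          using gradient_cutoff[OF sm_\<eta> sm_w, of x] unfolding T_def \<phi>_def grw .
        also have "\<dots> \<le> norm (w x) * \<Gamma>" by (intro mult_left_mono \<Gamma>) auto
        finally show ?thesis by (simp add: mult.commute)
      qed
      have n1: "norm (\<eta> x *\<^sub>R gradient v x) \<le> g x"
        using \<eta>_bounds[of x] by (simp add: g_def mult_left_le_one_le)
      have "norm (gradient \<phi> x) \<le> g x + \<Gamma> * norm (w x)"
        using norm_triangle_ineq[of "\<eta> x *\<^sub>R gradient v x" T] n1 T by (simp add: T_def)
      then have n2: "norm (gradient \<phi> x) + norm (\<eta> x *\<^sub>R gradient v x) \<le> \<Gamma> * (g x + norm (w x))"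
        using n1 mult_right_mono[OF \<Gamma>(1), of "g x"] by (simp add: g_def distrib_left)
      have "F (\<eta> x *\<^sub>R gradient v x) - F (gradient \<phi> x)
          \<le> L * norm T * (norm (gradient \<phi> x) + norm (\<eta> x *\<^sub>R gradient v x)) powr (p - 1)"
        using L(2)[of "\<eta> x *\<^sub>R gradient v x" "gradient \<phi> x"] by (simp add: T_def norm_minus_commute)
      also have "\<dots> \<le> L * (\<Gamma> * norm (w x)) * (\<Gamma> * (g x + norm (w x))) powr (p - 1)"
        using L(1) T n2 p \<Gamma>(1) by (intro mult_mono powr_mono2 mult_nonneg_nonneg) auto
      also have "\<dots> = L * (\<Gamma> * \<Gamma> powr (p - 1)) * (norm (w x) * (g x + norm (w x)) powr (p - 1))"
        using \<Gamma>(1) by (simp add: powr_mult g_def mult_ac)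
      also have "\<Gamma> * \<Gamma> powr (p - 1) = \<Gamma> powr p"
        using \<Gamma>(1) by (simp add: powr_diff)
      also have "L * \<Gamma> powr p * (norm (w x) * (g x + norm (w x)) powr (p - 1))
          \<le> L * \<Gamma> powr p * (2 powr p * (1 + norm (w x) powr ((p - \<delta>) / (1 - \<delta>)) + g x powr (p - \<delta>)))"
        using L(1) p \<delta> by (intro mult_left_mono product_powr_le_sum) (auto simp: g_def)
      also have "\<dots> = A * E x"
        using True by (simp add: A_def E_def q_def k_def)
      finally show ?thesis by simp
    next
      case False
      then have x: "norm (x - c) > r / 2" using r by (simp add: B_def dist_norm norm_minus_commute)
      then have "gradient \<phi> x = 0" "\<eta> x = 0"
        using g0[OF x] \<eta>0[of x] by auto
      then show ?thesis using A0 E0[of x] by simp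
    qed
    have "(LINT x|lborel. F (\<eta> x *\<^sub>R gradient v x)) \<le> (LINT x|lborel. F (gradient \<phi> x) + A * E x)"
      using i1 i2 intE pw by (intro integral_mono) auto
    also have "\<dots> = (LINT x|lborel. F (gradient \<phi> x)) + A * (LINT x|lborel. E x)"
      using i1 intE by simp
    also have "\<dots> \<le> 0 + A * (\<beta> + C + 1)"
      using test[OF sm_\<phi>] \<phi>0 r A0 LE by (intro add_mono mult_left_mono) auto
    finally show ?thesis by (simp add: homF K_def)
  qed
  have "(LINT x|lborel. \<eta> x powr p * F (gradient v x)) \<le> K * N powr (p / q)"
    if sm: "smooth v" and N0: "N > 0"
      and N: "(\<integral>\<^sup>+x\<in>B. ennreal (norm (gradient v x) powr q) \<partial>lborel) \<le> ennreal N" for v :: "real^'n \<Rightarrow> real^'m" and N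
  proof -
    \<comment> \<open>The dilation factor that normalises the gradient mass from \<open>N\<close> to
      1.\<close>
    define a where "a = N powr (- (1 / q))"
    have a: "a > 0" using N0 by (simp add: a_def)
    have aq: "a powr q = inverse N"
    proof -
      have "- (1 / q) * q = - 1" using q by simp
      then show ?thesis using N0 unfolding a_def powr_powr by (simp add: powr_minus)
    qed
    have sm': "smooth (\<lambda>x. a *\<^sub>R v x)"
      using sm unfolding smooth_def by (intro allI Ck_scaleR Ck_const) auto
    have [measurable]: "gradient v \<in> borel_measurable borel"
      using smooth_continuous_gradient[OF sm] by (rule borel_measurable_continuous_onI)
    have "(\<integral>\<^sup>+x\<in>B. ennreal (norm (gradient (\<lambda>x. a *\<^sub>R v x) x) powr q) \<partial>lborel)
        = (\<integral>\<^sup>+x. ennreal (inverse N) * (ennreal (norm (gradient v x) powr q) * indicator B x) \<partial>lborel)"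
      using a N0 by (intro nn_integral_cong)
        (simp add: gradient_scaleR[OF sm] powr_mult aq ennreal_mult mult.assoc)
    also have "\<dots> = ennreal (inverse N) * (\<integral>\<^sup>+x\<in>B. ennreal (norm (gradient v x) powr q) \<partial>lborel)"
      by (intro nn_integral_cmult) measurable
    also have "\<dots> \<le> ennreal (inverse N) * ennreal N"
      by (intro mult_left_mono N) auto
    also have "\<dots> = 1" using N0 by (simp flip: ennreal_mult)
    finally have "(LINT x|lborel. \<eta> x powr p * F (gradient (\<lambda>x. a *\<^sub>R v x) x)) \<le> K"
      by (rule unit[OF sm'])
    moreover have "F (gradient (\<lambda>x. a *\<^sub>R v x) x) = a powr p * F (gradient v x)" for x
      using F(2) a unfolding gradient_scaleR[OF sm] pos_homogeneous_def by blast
    ultimately have "a powr p * (LINT x|lborel. \<eta> x powr p * F (gradient v x)) \<le> K"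
      by (simp add: mult.left_commute)
    moreover have "a powr p = inverse (N powr (p / q))"
    proof -
      have "- (1 / q) * p = - (p / q)" by simp
      then show ?thesis unfolding a_def powr_powr by (simp only: powr_minus)
    qed
    ultimately show ?thesis
      using N0 by (simp add: field_simps)
  qed
  then show ?thesis
    unfolding q_def B_def \<eta>_def by (rule that[OF r K0])
qed

subsection \<open>Mollification\<close>

definition mollifier :: "real \<Rightarrow> (real^'n \<Rightarrow> real) \<Rightarrow> bool"
  where "mollifier \<epsilon> k \<longleftrightarrow> smooth k \<and> (\<forall>z. 0 \<le> k z) \<and> (\<forall>z. norm z \<ge> \<epsilon> \<longrightarrow> k z = 0) \<and> (LINT z|lborel. k z) = 1"

definition conv :: "(real^'n \<Rightarrow> real) \<Rightarrow> (real^'n \<Rightarrow> 'b::{banach,second_countable_topology}) \<Rightarrow> real^'n \<Rightarrow> 'b"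
  where "conv k f x = (LINT y|lborel. k (x - y) *\<^sub>R f y)"

lemma smooth_compact_integrable:
  fixes k :: "real^'n \<Rightarrow> real"
  assumes "smooth k" "\<And>z. norm z \<ge> R \<Longrightarrow> k z = 0"
  shows "integrable lborel k"
proof -
  obtain B where "\<And>z. norm (k z) \<le> B"
    by (rule compact_support_bounded[OF smooth_imp_continuous[OF assms(1)], where c = 0 and r = R]) (use assms(2) in auto)
  then show ?thesis
    using borel_measurable_continuous_onI[OF smooth_imp_continuous[OF assms(1)]] assms(2)
    by (intro integrable_bounded_support[where c = 0 and r = R]) auto
qed

text \<open>A rescaled bump, divided by its integral; the lower bound on the half ball shows that
  this integral is positive.\<close>

lemma mollifier_exists:
  assumes "\<epsilon> > 0"
  shows "\<exists>k :: real^'n \<Rightarrow> real. mollifier \<epsilon> k"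
proof -
  define b :: "real^'n \<Rightarrow> real" where "b z = bump ((1 / \<epsilon>) *\<^sub>R z)" for z
  have sb: "Ck j (bump :: real^'n \<Rightarrow> real)" for j
    using smooth_bump unfolding smooth_def by blast
  have "Ck j (\<lambda>z :: real^'n. bump (0 + (1 / \<epsilon>) *\<^sub>R z))" for j
    by (rule Ck_comp_affine[OF bounded_linear_scaleR_right sb])
  then have sm: "smooth b" unfolding smooth_def b_def by simp
  have b0: "b z = 0" if "norm z \<ge> \<epsilon>" for z
    unfolding b_def bump_eq_0_iff norm_scaleR using that assms by (simp add: field_simps)
  have int: "integrable lborel b" using sm b0 by (rule smooth_compact_integrable)
  define J where "J = (LINT z|lborel. b z)"
  have "J \<ge> (LINT z|lborel. exp (-2) * indicator (ball 0 (\<epsilon> / 2)) (z :: real^'n))"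
    unfolding J_def
  proof (rule Bochner_Integration.integral_mono)
    show "integrable lborel (\<lambda>z :: real^'n. exp (-2 :: real) * indicator (ball 0 (\<epsilon> / 2)) z)"
      using emeasure_lborel_ball_finite[of "0 :: real^'n" "\<epsilon> / 2"] by (simp add: integrable_indicator_iff)
    show "exp (-2) * indicator (ball 0 (\<epsilon> / 2)) z \<le> b z" for z :: "real^'n"
    proof (cases "z \<in> ball 0 (\<epsilon> / 2)")
      case True
      then have "norm ((1 / \<epsilon>) *\<^sub>R z) \<le> 1 / 2" using assms by (simp add: field_simps)
      from bump_lower[OF this] show ?thesis using True by (simp add: b_def)
    qed (simp add: b_def bump_nonneg)
  qed (rule int)
  also have "(LINT z|lborel. exp (-2) * indicator (ball 0 (\<epsilon> / 2)) (z :: real^'n)) = exp (-2) * measure lborel (ball (0 :: real^'n) (\<epsilon> / 2))"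
    by simp
  finally have "exp (-2) * measure lborel (ball (0 :: real^'n) (\<epsilon> / 2)) \<le> J" .
  moreover have "0 < exp (-2) * measure lborel (ball (0 :: real^'n) (\<epsilon> / 2))"
    using content_ball_pos[of "\<epsilon> / 2" "0 :: real^'n"] assms by simp
  ultimately have "J > 0" by linarith
  have "mollifier \<epsilon> (\<lambda>z. b z * inverse J)"
    unfolding mollifier_def
  proof (intro conjI allI impI)
    show "smooth (\<lambda>z. b z * inverse J)"
      using sm unfolding smooth_def by (intro allI Ck_mult Ck_const) auto
    show "0 \<le> b z * inverse J" for z using \<open>J > 0\<close> by (simp add: b_def bump_nonneg)
    show "(LINT z|lborel. b z * inverse J) = 1"
      using \<open>J > 0\<close> by (simp add: J_def[symmetric])
  qed (use b0 in auto)
  then show ?thesis by blast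
qed

lemma mollifierD:
  assumes "mollifier \<epsilon> k"
  shows "smooth k" "\<And>z. 0 \<le> k z" "\<And>z. norm z \<ge> \<epsilon> \<Longrightarrow> k z = 0" "(LINT z|lborel. k z) = 1"
    "integrable lborel k" "k \<in> borel_measurable borel"
proof -
  show a: "smooth k" "\<And>z. 0 \<le> k z" "\<And>z. norm z \<ge> \<epsilon> \<Longrightarrow> k z = 0" "(LINT z|lborel. k z) = 1"
    using assms unfolding mollifier_def by auto
  show "integrable lborel k" using a(1,3) by (rule smooth_compact_integrable)
  show "k \<in> borel_measurable borel"
    using smooth_imp_continuous[OF a(1)] by (rule borel_measurable_continuous_onI)
qed

lemma mollifier_nn_integral:
  fixes x :: "real^'n"
  assumes "mollifier \<epsilon> k"
  shows "(\<integral>\<^sup>+y. ennreal (k (x - y)) \<partial>lborel) = 1" "(\<integral>\<^sup>+y. ennreal (k (y - x)) \<partial>lborel) = 1"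
proof -
  note k = mollifierD[OF assms]
  have m: "(\<lambda>z. ennreal (k z)) \<in> borel_measurable borel" using k(6) by measurable
  have 1: "(\<integral>\<^sup>+y. ennreal (k y) \<partial>lborel) = 1"
    using nn_integral_eq_integral[OF k(5)] k(2,4) by simp
  show "(\<integral>\<^sup>+y. ennreal (k (x - y)) \<partial>lborel) = 1"
    using nn_integral_lborel_affine[OF m, of "-1" x] 1 by simp
  show "(\<integral>\<^sup>+y. ennreal (k (y - x)) \<partial>lborel) = 1"
    using nn_integral_lborel_affine[OF m, of 1 "-x"] 1 by simp
qed

lemma integrable_mult_bounded:
  fixes f :: "'a::euclidean_space \<Rightarrow> 'b::{banach,second_countable_topology}"
  assumes "integrable lborel f" "a \<in> borel_measurable borel" "\<And>y. \<bar>a y\<bar> \<le> M"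
  shows "integrable lborel (\<lambda>y. a y *\<^sub>R f y)"
proof (rule Bochner_Integration.integrable_bound[where f = "\<lambda>y. M *\<^sub>R f y"])
  show "integrable lborel (\<lambda>y. M *\<^sub>R f y)" using assms(1) by (rule integrable_scaleR_right)
  show "(\<lambda>y. a y *\<^sub>R f y) \<in> borel_measurable lborel"
    using assms(2) borel_measurable_integrable[OF assms(1)] by measurable
  show "AE y in lborel. norm (a y *\<^sub>R f y) \<le> norm (M *\<^sub>R f y)"
    using order_trans[OF assms(3) abs_ge_self] by (intro AE_I2) (auto intro!: mult_right_mono)
qed

lemma conv_integrable:
  fixes f :: "real^'n \<Rightarrow> 'b::{banach,second_countable_topology}"
  assumes k: "continuous_on UNIV k" "\<And>z. norm z \<ge> R \<Longrightarrow> k z = 0" and f: "integrable lborel f"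
  shows "integrable lborel (\<lambda>y. k (x - y) *\<^sub>R f y)"
proof -
  obtain B where "\<And>z. norm (k z) \<le> B"
    by (rule compact_support_bounded[OF k(1), where c = 0 and r = R]) (use k(2) in auto)
  moreover have "(\<lambda>y. k (x - y)) \<in> borel_measurable borel"
    by (intro borel_measurable_continuous_onI continuous_on_compose2[OF k(1)] continuous_intros) auto
  ultimately show ?thesis using f by (intro integrable_mult_bounded[where M = B]) auto
qed

lemma frechet_eq_inner_scalar_gradient:
  assumes "smooth k" shows "frechet_derivative k (at z) h = scalar_gradient k z \<bullet> h"
proof -
  have l: "linear (frechet_derivative k (at z))"
    using smooth_has_derivative[OF assms] has_derivative_linear by blast
  have "frechet_derivative k (at z) h = frechet_derivative k (at z) (\<Sum>j\<in>UNIV. h $ j *\<^sub>R axis j 1)"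
    using basis_expansion[of h] by (simp add: scalar_mult_eq_scaleR)
  also have "\<dots> = scalar_gradient k z \<bullet> h"
    by (simp add: linear_sum[OF l] linear_scale[OF l] scalar_gradient_def inner_vec_def mult.commute)
  finally show ?thesis .
qed

lemma frechet_compact_support:
  fixes k :: "real^'n \<Rightarrow> real"
  assumes "smooth k" "\<And>z. norm z \<ge> R \<Longrightarrow> k z = 0" "norm z > R"
  shows "frechet_derivative k (at z) v = 0"
proof -
  have "(k has_derivative (\<lambda>_. 0)) (at z)"
  proof (rule has_derivative_transform_within_open)
    show "((\<lambda>_. 0) has_derivative (\<lambda>_. 0)) (at z)" by simp
    show "open {z :: real^'n. norm z > R}" by (intro open_Collect_less continuous_intros)
  qed (use assms in auto)
  then have "frechet_derivative k (at z) = (\<lambda>_. 0)" using frechet_derivative_at by metis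
  then show ?thesis by simp
qed

lemma smooth_compact_lipschitz:
  fixes k :: "real^'n \<Rightarrow> real"
  assumes "smooth k" "\<And>z. norm z \<ge> R \<Longrightarrow> k z = 0"
  obtains M where "M \<ge> 0" "\<And>z h. \<bar>frechet_derivative k (at z) h\<bar> \<le> M * norm h" "\<And>z h. \<bar>k (z + h) - k z\<bar> \<le> M * norm h"
proof -
  have "continuous_on UNIV (scalar_gradient k)"
    unfolding scalar_gradient_def by (intro continuous_intros smooth_continuous_frechet assms(1))
  then obtain M where M: "M \<ge> 0" "\<And>z. norm (scalar_gradient k z) \<le> M"
    by (rule compact_support_bounded[where c = 0 and r = "R + 1"])
      (use frechet_compact_support[OF assms] in \<open>auto simp: scalar_gradient_def vec_eq_iff\<close>)
  have 1: "\<bar>frechet_derivative k (at z) h\<bar> \<le> M * norm h" for z h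
    unfolding frechet_eq_inner_scalar_gradient[OF assms(1)]
    by (rule order_trans[OF Cauchy_Schwarz_ineq2 mult_right_mono[OF M(2)]]) simp
  have "norm (k (z + h) - k z) \<le> M * norm ((z + h) - z)" for z h
  proof (rule differentiable_bound[where S = UNIV and f' = "\<lambda>x. frechet_derivative k (at x)"])
    show "(k has_derivative frechet_derivative k (at x)) (at x within UNIV)" for x
      using smooth_has_derivative[OF assms(1)] by simp
    show "onorm (frechet_derivative k (at x)) \<le> M" for x
      using 1 by (intro onorm_le) simp
  qed auto
  then show ?thesis using that[OF M(1) 1] by simp
qed

text \<open>Differentiation under the integral. The normalised remainder of the kernel tends to 0
  pointwise and is at most \<open>2 * M\<close>, where \<open>M\<close> is a Lipschitz constant of
  \<open>k\<close>, so a multiple of \<open>norm (f y)\<close> dominates although \<open>f\<close>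
  is merely integrable.\<close>

lemma conv_has_derivative:
  fixes f :: "real^'n \<Rightarrow> real^'m"
  assumes k: "smooth k" "\<And>z. norm z \<ge> R \<Longrightarrow> k z = 0" and f: "integrable lborel f"
  shows "(conv k f has_derivative (\<lambda>h. conv (\<lambda>z. frechet_derivative k (at z) h) f x)) (at x)"
proof -
  obtain M where M: "M \<ge> 0" "\<And>z h. \<bar>frechet_derivative k (at z) h\<bar> \<le> M * norm h" "\<And>z h. \<bar>k (z + h) - k z\<bar> \<le> M * norm h"
  proof (rule smooth_compact_lipschitz[OF k])
    fix M assume "M \<ge> 0" "\<And>z h. \<bar>frechet_derivative k (at z) h\<bar> \<le> M * norm h" "\<And>z h. \<bar>k (z + h) - k z\<bar> \<le> M * norm h"
    then show thesis by (rule that)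
  qed
  have i0: "integrable lborel (\<lambda>y. k (x - y) *\<^sub>R f y)" for x
    by (rule conv_integrable[OF smooth_imp_continuous[OF k(1)] k(2) f])
  have k'0: "frechet_derivative k (at z) h = 0" if "norm z \<ge> R + 1" for z h
    using frechet_compact_support[OF k, where z = z and v = h] that by simp
  have i1: "integrable lborel (\<lambda>y. frechet_derivative k (at (x - y)) h *\<^sub>R f y)" for x h
    by (rule conv_integrable[OF smooth_continuous_frechet[OF k(1)] k'0 f])
  have lin: "linear (frechet_derivative k (at z))" for z
    using smooth_has_derivative[OF k(1)] has_derivative_linear by blast
  have "bounded_linear (\<lambda>h. conv (\<lambda>z. frechet_derivative k (at z) h) f x)"
  proof (rule bounded_linear_intro)
    show "conv (\<lambda>z. frechet_derivative k (at z) (h + h')) f x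
        = conv (\<lambda>z. frechet_derivative k (at z) h) f x + conv (\<lambda>z. frechet_derivative k (at z) h') f x" for h h'
      unfolding conv_def linear_add[OF lin] scaleR_add_left using i1 i1 by (rule Bochner_Integration.integral_add)
    show "conv (\<lambda>z. frechet_derivative k (at z) (r *\<^sub>R h)) f x = r *\<^sub>R conv (\<lambda>z. frechet_derivative k (at z) h) f x" for r h
      unfolding conv_def linear_scale[OF lin] real_scaleR_def scaleR_scaleR[symmetric]
      by (rule integral_scaleR_right)
    show "norm (conv (\<lambda>z. frechet_derivative k (at z) h) f x) \<le> norm h * (M * (LINT y|lborel. norm (f y)))" for h
    proof -
      have "norm (conv (\<lambda>z. frechet_derivative k (at z) h) f x) \<le> (LINT y|lborel. (M * norm h) * norm (f y))"
        unfolding conv_def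
      proof (rule Bochner_Integration.integral_norm_bound_integral[OF i1])
        show "integrable lborel (\<lambda>y. (M * norm h) * norm (f y))" using f by simp
        show "norm (frechet_derivative k (at (x - y)) h *\<^sub>R f y) \<le> (M * norm h) * norm (f y)" for y
          unfolding norm_scaleR using M(2)[of "x - y" h] by (intro mult_right_mono) auto
      qed
      then show ?thesis by (simp add: mult_ac)
    qed
  qed
  moreover have "((\<lambda>h. norm (conv k f (x + h) - conv k f x - conv (\<lambda>z. frechet_derivative k (at z) h) f x) / norm h) \<longlongrightarrow> 0) (at 0)"
    unfolding tendsto_at_iff_sequentially
  \<comment> \<open>The limit is tested along sequences because dominated convergence is a statement
    about sequences.\<close>
  proof (intro allI impI)
    fix h :: "nat \<Rightarrow> real^'n"
    assume hU: "\<forall>i. h i \<in> UNIV - {0}" and h0: "h \<longlonglongrightarrow> 0"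
    have hn: "h i \<noteq> 0" for i using hU by auto
    define q where "q i y = (k (x - y + h i) - k (x - y) - frechet_derivative k (at (x - y)) (h i)) / norm (h i)" for i y
    have pt: "(1 / norm (h i)) *\<^sub>R (k (x + h i - y) *\<^sub>R f y - k (x - y) *\<^sub>R f y - frechet_derivative k (at (x - y)) (h i) *\<^sub>R f y)
        = q i y *\<^sub>R f y" for i y
    proof -
      have e: "x + h i - y = x - y + h i" by simp
      show ?thesis unfolding e q_def scaleR_diff_left[symmetric] by simp
    qed
    have q_int: "integrable lborel (\<lambda>y. q i y *\<^sub>R f y)" for i
    proof -
      have "integrable lborel (\<lambda>y. (1 / norm (h i)) *\<^sub>R (k (x + h i - y) *\<^sub>R f y - k (x - y) *\<^sub>R f y - frechet_derivative k (at (x - y)) (h i) *\<^sub>R f y))"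
        by (intro integrable_scaleR_right Bochner_Integration.integrable_diff i0 i1)
      then show ?thesis unfolding pt .
    qed
    have eq: "(1 / norm (h i)) *\<^sub>R (conv k f (x + h i) - conv k f x - conv (\<lambda>z. frechet_derivative k (at z) (h i)) f x)
        = (LINT y|lborel. q i y *\<^sub>R f y)" for i
    proof -
      have D: "conv k f (x + h i) - conv k f x - conv (\<lambda>z. frechet_derivative k (at z) (h i)) f x
          = (LINT y|lborel. k (x + h i - y) *\<^sub>R f y - k (x - y) *\<^sub>R f y - frechet_derivative k (at (x - y)) (h i) *\<^sub>R f y)"
        unfolding conv_def by (simp add: i0 i1)
      show ?thesis
        unfolding D integral_scaleR_right[symmetric] pt ..
    qed
    have "(\<lambda>i. LINT y|lborel. q i y *\<^sub>R f y) \<longlonglongrightarrow> (LINT y|(lborel :: (real^'n) measure). (0 :: real^'m))"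
    proof (rule integral_dominated_convergence[where w = "\<lambda>y. (2 * M) * norm (f y)"])
      show "(\<lambda>y. q i y *\<^sub>R f y) \<in> borel_measurable lborel" for i
        by (rule borel_measurable_integrable[OF q_int])
      show "integrable lborel (\<lambda>y. (2 * M) * norm (f y))" using f by simp
      have "(\<lambda>i. q i y *\<^sub>R f y) \<longlonglongrightarrow> 0" for y
      proof -
        have "((\<lambda>h. norm (k ((x - y) + h) - k (x - y) - frechet_derivative k (at (x - y)) h) / norm h) \<longlongrightarrow> 0) (at 0)"
          using smooth_has_derivative[OF k(1), of "x - y"] unfolding has_derivative_at by blast
        then have "(\<lambda>i. norm (k ((x - y) + h i) - k (x - y) - frechet_derivative k (at (x - y)) (h i)) / norm (h i)) \<longlonglongrightarrow> 0"
          using hU h0 unfolding tendsto_at_iff_sequentially o_def by blast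
        then have "(\<lambda>i. \<bar>q i y\<bar>) \<longlonglongrightarrow> 0" by (simp add: q_def abs_divide)
        then have "(\<lambda>i. q i y) \<longlonglongrightarrow> 0" by (rule tendsto_rabs_zero_cancel)
        then show ?thesis using tendsto_scaleR[OF _ tendsto_const, of "\<lambda>i. q i y" 0 sequentially "f y"] by simp
      qed
      then show "AE y in lborel. (\<lambda>i. q i y *\<^sub>R f y) \<longlonglongrightarrow> 0" by simp
      have "\<bar>q i y\<bar> \<le> 2 * M" for i y
      proof -
        have "\<bar>k (x - y + h i) - k (x - y) - frechet_derivative k (at (x - y)) (h i)\<bar> \<le> 2 * M * norm (h i)"
          using M(2)[of "x - y" "h i"] M(3)[of "x - y" "h i"] by linarith
        then show ?thesis using hn[of i] by (simp add: q_def abs_divide pos_divide_le_eq)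
      qed
      then show "AE y in lborel. norm (q i y *\<^sub>R f y) \<le> (2 * M) * norm (f y)" for i
        unfolding norm_scaleR by (intro AE_I2 mult_right_mono) auto
    qed simp
    then have "(\<lambda>i. norm (LINT y|lborel. q i y *\<^sub>R f y)) \<longlonglongrightarrow> 0"
      by (simp add: tendsto_norm_zero)
    then show "((\<lambda>h. norm (conv k f (x + h) - conv k f x - conv (\<lambda>z. frechet_derivative k (at z) h) f x) / norm h) \<circ> h) \<longlonglongrightarrow> 0"
      unfolding eq[symmetric] o_def by simp
  qed
  ultimately show ?thesis unfolding has_derivative_at by blast
qed

text \<open>Each derivative falls on the kernel and leaves \<open>f\<close> untouched. The support
  radius is generalised in the induction: the derivative is known to vanish beyond \<open>R\<close>
  strictly, so it is passed on with radius \<open>R + 1\<close>.\<close>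

lemma conv_smooth:
  fixes f :: "real^'n \<Rightarrow> real^'m"
  assumes k: "smooth k" "\<And>z. norm z \<ge> R \<Longrightarrow> k z = 0" and f: "integrable lborel f"
  shows "smooth (conv k f)"
proof -
  have "Ck j (conv k f)" if "smooth k" "\<And>z. norm z \<ge> R \<Longrightarrow> k z = 0" for j k R
    using that
  proof (induction j arbitrary: k R)
    case 0
    have "isCont (conv k f) x" for x
      using conv_has_derivative[OF 0 f, where x = x] by (rule has_derivative_continuous)
    then show ?case by (simp add: continuous_on_eq_continuous_at)
  next
    case (Suc j)
    show ?case
    proof (rule Ck_SucI[OF conv_has_derivative[OF Suc.prems f]])
      fix v
      show "Ck j (\<lambda>x. conv (\<lambda>z. frechet_derivative k (at z) v) f x)"
      proof (rule Suc.IH)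
        show "smooth (\<lambda>z. frechet_derivative k (at z) v)"
          using Suc.prems(1) Ck_SucD(2) unfolding smooth_def by blast
        show "frechet_derivative k (at z) v = 0" if "norm z \<ge> R + 1" for z
          using frechet_compact_support[OF Suc.prems, where z = z and v = v] that by simp
      qed
    qed
  qed
  then show ?thesis using k unfolding smooth_def[of "conv k f"] by blast
qed

lemma conv_measurable:
  fixes f :: "real^'n \<Rightarrow> 'b::{banach,second_countable_topology}"
  assumes "k \<in> borel_measurable borel" "f \<in> borel_measurable borel"
  shows "conv k f \<in> borel_measurable borel"
proof -
  note [measurable] = assms
  have "(\<lambda>x. LINT y|lborel. k (x - y) *\<^sub>R f y) \<in> borel_measurable borel"
    by measurable
  then show ?thesis unfolding conv_def[abs_def] .
qed

text \<open>The convolution at \<open>x\<close> is the average of \<open>f\<close> with respect to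
  the probability density \<open>k (x - y)\<close>.\<close>

lemma conv_jensen:
  fixes f :: "real^'n \<Rightarrow> 'b::{banach,second_countable_topology}"
  assumes k: "mollifier \<epsilon> k" and f: "integrable lborel f" and p: "p \<ge> 1"
  shows "ennreal (norm (conv k f x) powr p) \<le> (\<integral>\<^sup>+y. ennreal (k (x - y)) * ennreal (norm (f y) powr p) \<partial>lborel)"
proof -
  note kD = mollifierD[OF k]
  have [measurable]: "k \<in> borel_measurable borel" "f \<in> borel_measurable borel"
    using kD(6) f by auto
  define M where "M = density lborel (\<lambda>y. ennreal (k (x - y)))"
  have M1: "emeasure M UNIV = ennreal 1"
    unfolding M_def using mollifier_nn_integral(1)[OF k, of x] by (subst emeasure_density) auto
  have i: "integrable lborel (\<lambda>y. k (x - y) *\<^sub>R f y)"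
    by (rule conv_integrable[OF smooth_imp_continuous[OF kD(1)] kD(3) f])
  have "ennreal (norm (conv k f x)) \<le> (\<integral>\<^sup>+y. ennreal (norm (k (x - y) *\<^sub>R f y)) \<partial>lborel)"
    unfolding conv_def by (rule integral_norm_bound_ennreal[OF i])
  also have "\<dots> = (\<integral>\<^sup>+y. ennreal (k (x - y)) * ennreal (norm (f y)) \<partial>lborel)"
    by (intro nn_integral_cong) (simp add: kD(2) ennreal_mult)
  also have "\<dots> = (\<integral>\<^sup>+y\<in>UNIV. ennreal (norm (f y)) \<partial>M)"
    unfolding M_def by (subst nn_integral_density) auto
  finally have "ennreal (norm (conv k f x) powr p) \<le> ennreal (1 powr (p - 1)) * (\<integral>\<^sup>+y\<in>UNIV. ennreal (norm (f y) powr p) \<partial>M)"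
    using p M1 by (intro nn_integral_power_mean) (auto simp: M_def)
  also have "\<dots> = (\<integral>\<^sup>+y. ennreal (k (x - y)) * ennreal (norm (f y) powr p) \<partial>lborel)"
    unfolding M_def by (subst nn_integral_density) auto
  finally show ?thesis .
qed

text \<open>After Jensen, the order of integration is exchanged and the kernel integrates to 1 in
  \<open>x\<close>. Keeping track of an \<epsilon>-neighbourhood \<open>A'\<close> of
  \<open>A\<close> gives a local bound, which the estimates on concentric balls require.\<close>

lemma conv_Lp_le:
  fixes f :: "real^'n \<Rightarrow> 'b::{banach,second_countable_topology}"
  assumes k: "mollifier \<epsilon> k" and f: "integrable lborel f" and p: "p \<ge> 1"
    and A: "A \<in> sets borel" "A' \<in> sets borel" "\<And>x y. x \<in> A \<Longrightarrow> norm (x - y) < \<epsilon> \<Longrightarrow> y \<in> A'"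
  shows "(\<integral>\<^sup>+x\<in>A. ennreal (norm (conv k f x) powr p) \<partial>lborel) \<le> (\<integral>\<^sup>+x\<in>A'. ennreal (norm (f x) powr p) \<partial>lborel)"
proof -
  note kD = mollifierD[OF k]
  have [measurable]: "k \<in> borel_measurable borel" "f \<in> borel_measurable borel" "A \<in> sets borel" "A' \<in> sets borel"
    using kD(6) f A by auto
  have "(\<integral>\<^sup>+x\<in>A. ennreal (norm (conv k f x) powr p) \<partial>lborel)
      \<le> (\<integral>\<^sup>+x. (\<integral>\<^sup>+y. ennreal (k (x - y)) * ennreal (norm (f y) powr p) * indicator A x \<partial>lborel) \<partial>lborel)"
  proof (rule nn_integral_mono)
    fix x
    show "ennreal (norm (conv k f x) powr p) * indicator A x
        \<le> (\<integral>\<^sup>+y. ennreal (k (x - y)) * ennreal (norm (f y) powr p) * indicator A x \<partial>lborel)"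
      using conv_jensen[OF k f p, of x] by (cases "x \<in> A") simp_all
  qed
  also have "\<dots> = (\<integral>\<^sup>+y. (\<integral>\<^sup>+x. ennreal (k (x - y)) * ennreal (norm (f y) powr p) * indicator A x \<partial>lborel) \<partial>lborel)"
    by (rule lborel_pair.Fubini') measurable
  also have "\<dots> \<le> (\<integral>\<^sup>+y. ennreal (norm (f y) powr p) * indicator A' y \<partial>lborel)"
  proof (rule nn_integral_mono)
    fix y
    have "(\<integral>\<^sup>+x. ennreal (k (x - y)) * ennreal (norm (f y) powr p) * indicator A x \<partial>lborel)
        \<le> (\<integral>\<^sup>+x. ennreal (k (x - y)) * (ennreal (norm (f y) powr p) * indicator A' y) \<partial>lborel)"
    proof (rule nn_integral_mono)
      fix x
      show "ennreal (k (x - y)) * ennreal (norm (f y) powr p) * indicator A x \<le> ennreal (k (x - y)) * (ennreal (norm (f y) powr p) * indicator A' y)"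
      proof (cases "x \<in> A \<and> norm (x - y) < \<epsilon>")
        case True
        then have "y \<in> A'" using A(3) by blast
        then show ?thesis using True by simp
      next
        case False
        then show ?thesis using kD(3)[of "x - y"] by (cases "x \<in> A") auto
      qed
    qed
    also have "\<dots> = (\<integral>\<^sup>+x. ennreal (k (x - y)) \<partial>lborel) * (ennreal (norm (f y) powr p) * indicator A' y)"
      by (rule nn_integral_multc) measurable
    finally show "(\<integral>\<^sup>+x. ennreal (k (x - y)) * ennreal (norm (f y) powr p) * indicator A x \<partial>lborel) \<le> ennreal (norm (f y) powr p) * indicator A' y"
      using mollifier_nn_integral(2)[OF k, of y] by simp
  qed
  finally show ?thesis .
qed

lemma conv_close:
  fixes h :: "real^'n \<Rightarrow> 'b::{banach,second_countable_topology}"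
  assumes k: "mollifier \<epsilon> k" and h: "integrable lborel h" and e: "\<And>y. norm (x - y) < \<epsilon> \<Longrightarrow> norm (h y - h x) \<le> e"
  shows "norm (conv k h x - h x) \<le> e"
proof -
  note kD = mollifierD[OF k]
  have i: "integrable lborel (\<lambda>y. k (x - y) *\<^sub>R h y)"
    by (rule conv_integrable[OF smooth_imp_continuous[OF kD(1)] kD(3) h])
  have ik: "integrable lborel (\<lambda>y. k (x - y))"
    using integrable_lborel_affine[OF kD(5), of "-1" x] by simp
  have k1: "(LINT y|lborel. k (x - y)) = 1"
    using integral_lborel_affine[OF kD(6), of "-1" x] kD(4) by simp
  have "conv k h x - h x = (LINT y|lborel. k (x - y) *\<^sub>R h y) - (LINT y|lborel. k (x - y) *\<^sub>R h x)"
    using k1 ik by (simp add: conv_def)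
  also have "\<dots> = (LINT y|lborel. k (x - y) *\<^sub>R (h y - h x))"
    using i ik by (simp add: scaleR_diff_right)
  also have "norm \<dots> \<le> (LINT y|lborel. k (x - y) * e)"
  proof (rule Bochner_Integration.integral_norm_bound_integral)
    show "integrable lborel (\<lambda>y. k (x - y) *\<^sub>R (h y - h x))" using i ik by (simp add: scaleR_diff_right)
    show "integrable lborel (\<lambda>y. k (x - y) * e)" using ik by simp
    show "norm (k (x - y) *\<^sub>R (h y - h x)) \<le> k (x - y) * e" for y
      using e[of y] kD(2)[of "x - y"] kD(3)[of "x - y"]
      by (cases "norm (x - y) < \<epsilon>") (auto intro: mult_left_mono)
  qed
  also have "\<dots> = e" using k1 by simp
  finally show ?thesis .
qed

section \<open>Approximation in Lp by continuous functions and by mollification\<close>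

lemma powr_add_le:
  fixes a b p :: real
  assumes "a \<ge> 0" "b \<ge> 0" "p \<ge> 0"
  shows "(a + b) powr p \<le> 2 powr p * (a powr p + b powr p)"
proof -
  have "(a + b) powr p \<le> (2 * max a b) powr p"
    using assms by (intro powr_mono2) auto
  also have "\<dots> = 2 powr p * max a b powr p"
    using assms by (simp add: powr_mult)
  also have "\<dots> \<le> 2 powr p * (a powr p + b powr p)"
    by (intro mult_left_mono) (auto simp: max_def)
  finally show ?thesis .
qed

lemma norm_add_powr_le:
  fixes a b :: "'a::real_normed_vector"
  assumes "p \<ge> 0"
  shows "norm (a + b) powr p \<le> 2 powr p * (norm a powr p + norm b powr p)"
proof -
  have "norm (a + b) powr p \<le> (norm a + norm b) powr p"
    using assms by (intro powr_mono2 norm_triangle_ineq) auto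
  also have "\<dots> \<le> 2 powr p * (norm a powr p + norm b powr p)"
    using assms by (intro powr_add_le) auto
  finally show ?thesis .
qed

lemma nn_integral_norm_add_powr_le:
  fixes f g :: "'a::euclidean_space \<Rightarrow> 'b::euclidean_space"
  assumes [measurable]: "f \<in> borel_measurable borel" "g \<in> borel_measurable borel" and p: "p \<ge> 0"
    and A: "(\<integral>\<^sup>+x. ennreal (norm (f x) powr p) \<partial>lborel) \<le> ennreal a" "a \<ge> 0"
    and B: "(\<integral>\<^sup>+x. ennreal (norm (g x) powr p) \<partial>lborel) \<le> ennreal b" "b \<ge> 0"
  shows "(\<integral>\<^sup>+x. ennreal (norm (f x + g x) powr p) \<partial>lborel) \<le> ennreal (2 powr p * (a + b))"
proof -
  have "(\<integral>\<^sup>+x. ennreal (norm (f x + g x) powr p) \<partial>lborel)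
      \<le> (\<integral>\<^sup>+x. ennreal (2 powr p) * (ennreal (norm (f x) powr p) + ennreal (norm (g x) powr p)) \<partial>lborel)"
  proof (rule nn_integral_mono)
    fix x
    have "ennreal (norm (f x + g x) powr p) \<le> ennreal (2 powr p * (norm (f x) powr p + norm (g x) powr p))"
      by (intro ennreal_leI norm_add_powr_le p)
    also have "\<dots> = ennreal (2 powr p) * (ennreal (norm (f x) powr p) + ennreal (norm (g x) powr p))"
      by (simp add: ennreal_mult)
    finally show "ennreal (norm (f x + g x) powr p) \<le> ennreal (2 powr p) * (ennreal (norm (f x) powr p) + ennreal (norm (g x) powr p))" .
  qed
  also have "\<dots> = ennreal (2 powr p) * ((\<integral>\<^sup>+x. ennreal (norm (f x) powr p) \<partial>lborel) + (\<integral>\<^sup>+x. ennreal (norm (g x) powr p) \<partial>lborel))"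
    by (subst nn_integral_cmult) (auto simp: nn_integral_add)
  also have "\<dots> \<le> ennreal (2 powr p) * (ennreal a + ennreal b)"
    by (intro mult_left_mono add_mono A B) auto
  also have "\<dots> = ennreal (2 powr p * (a + b))"
    using A B by (simp add: ennreal_mult)
  finally show ?thesis .
qed

text \<open>A continuous retraction onto the closed ball of radius \<open>M\<close>, which preserves
  directions.\<close>

definition clamp_norm :: "real \<Rightarrow> 'a::real_normed_vector \<Rightarrow> 'a"
  where "clamp_norm M z = (M / max M (norm z)) *\<^sub>R z"

lemma clamp_norm:
  assumes "M > 0"
  shows "norm (clamp_norm M z) \<le> M" "norm z \<le> M \<Longrightarrow> clamp_norm M z = z"
    "norm (clamp_norm M z - z) \<le> norm z" "continuous_on UNIV (clamp_norm M :: 'a \<Rightarrow> 'a::real_normed_vector)"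
proof -
  have m: "max M (norm z) > 0" using assms by simp
  show "norm (clamp_norm M z) \<le> M"
    using assms m by (simp add: clamp_norm_def field_simps)
  show "norm z \<le> M \<Longrightarrow> clamp_norm M z = z"
    using assms by (simp add: clamp_norm_def max_absorb1)
  have "clamp_norm M z - z = (M / max M (norm z) - 1) *\<^sub>R z"
    by (simp add: clamp_norm_def scaleR_diff_left)
  moreover have "\<bar>M / max M (norm z) - 1\<bar> \<le> 1"
    using assms m by (simp add: abs_le_iff field_simps)
  ultimately show "norm (clamp_norm M z - z) \<le> norm z"
    by (simp add: mult_left_le_one_le)
  show "continuous_on UNIV (clamp_norm M :: 'a \<Rightarrow> 'a)"
    unfolding clamp_norm_def using assms by (intro continuous_intros) (auto simp: max_def)
qed

text \<open>Clamping first makes the function bounded. Almost everywhere approximation by continuous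
  functions, clamped and cut off in turn, then converges in the mean by dominated convergence; the
  cutoff keeps control of the support.\<close>

lemma continuous_dense_Lp:
  fixes G :: "real^'n \<Rightarrow> 'b::euclidean_space"
  assumes G[measurable]: "G \<in> borel_measurable borel" and p: "p > 0" and R: "R > 0"
    and supp: "\<And>x. norm (x - x0) > R \<Longrightarrow> G x = 0"
    and fin: "(\<integral>\<^sup>+x. ennreal (norm (G x) powr p) \<partial>lborel) < \<infinity>" and e: "e > 0"
  shows "\<exists>h. continuous_on UNIV h \<and> (\<forall>x. norm (x - x0) \<ge> R + 1 \<longrightarrow> h x = 0) \<and>
    (\<integral>\<^sup>+x. ennreal (norm (h x - G x) powr p) \<partial>lborel) \<le> ennreal e"
proof -
  \<comment> \<open>Each of the two approximations receives half of \<open>e\<close>, up to the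
    factor \<open>2 powr p\<close> from the inequality for the power of a sum.\<close>
  define d where "d = e / (2 powr p * 2)"
  have d: "d > 0" using e by (simp add: d_def)
  have [measurable]: "clamp_norm M \<in> borel_measurable (borel :: 'b measure)" if "M > 0" for M
    using clamp_norm(4)[OF that] by (rule borel_measurable_continuous_onI)
  have pos: "real (Suc i) > 0" for i by simp
  have "(\<lambda>i. \<integral>\<^sup>+x. ennreal (norm (clamp_norm (real (Suc i)) (G x) - G x) powr p) \<partial>lborel) \<longlonglongrightarrow> (\<integral>\<^sup>+x. ennreal 0 \<partial>(lborel :: (real^'n) measure))"
  proof (rule nn_integral_dominated_convergence[where w = "\<lambda>x. ennreal (norm (G x) powr p)"])
    show "(\<lambda>x. ennreal (norm (clamp_norm (real (Suc i)) (G x) - G x) powr p)) \<in> borel_measurable lborel" for i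
      using pos[of i] by measurable
    show "AE x in lborel. ennreal (norm (clamp_norm (real (Suc i)) (G x) - G x) powr p) \<le> ennreal (norm (G x) powr p)" for i
      using p by (intro AE_I2 ennreal_leI powr_mono2 clamp_norm(3)) auto
    have "(\<lambda>i. ennreal (norm (clamp_norm (real (Suc i)) (G x) - G x) powr p)) \<longlonglongrightarrow> ennreal 0" for x
    proof (rule tendsto_eventually)
      obtain i0 :: nat where "norm (G x) \<le> real i0" using real_arch_simple by blast
      then have "norm (G x) \<le> real (Suc i)" if "i \<ge> i0" for i
        using that by (meson le_SucI of_nat_le_iff order_trans)
      then show "\<forall>\<^sub>F i in sequentially. ennreal (norm (clamp_norm (real (Suc i)) (G x) - G x) powr p) = ennreal 0"
        unfolding eventually_sequentially by (intro exI[of _ i0]) (simp add: clamp_norm(2)[OF pos, simplified])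
    qed
    then show "AE x in lborel. (\<lambda>i. ennreal (norm (clamp_norm (real (Suc i)) (G x) - G x) powr p)) \<longlonglongrightarrow> ennreal 0"
      by simp
  qed (use fin in auto)
  then have "(\<lambda>i. \<integral>\<^sup>+x. ennreal (norm (clamp_norm (real (Suc i)) (G x) - G x) powr p) \<partial>lborel) \<longlonglongrightarrow> 0" by simp
  then have "\<forall>\<^sub>F i in sequentially. (\<integral>\<^sup>+x. ennreal (norm (clamp_norm (real (Suc i)) (G x) - G x) powr p) \<partial>lborel) < ennreal d"
    using d by (intro order_tendstoD(2)) auto
  then obtain i where i: "(\<integral>\<^sup>+x. ennreal (norm (clamp_norm (real (Suc i)) (G x) - G x) powr p) \<partial>lborel) < ennreal d"
    unfolding eventually_sequentially by blast
  define M where "M = real (Suc i)"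
  have M: "M > 0" by (simp add: M_def)
  define G' where "G' x = clamp_norm M (G x)" for x
  have cm[measurable]: "clamp_norm M \<in> borel_measurable (borel :: 'b measure)"
    using clamp_norm(4)[OF M] by (rule borel_measurable_continuous_onI)
  have G'm[measurable]: "G' \<in> borel_measurable borel" unfolding G'_def by measurable
  have "G' \<in> borel_measurable lebesgue"
    using G'm by (simp add: measurable_completion)
  then have "G' measurable_on UNIV"
    by (intro lebesgue_measurable_imp_measurable_on) auto
  \<comment> \<open>Unfolding \<open>measurable_on\<close> yields continuous functions that converge
    outside a negligible set.\<close>
  then obtain N g where N: "negligible N" and g: "\<And>n. continuous_on UNIV (g n)"
    and lim: "\<And>x. x \<notin> N \<Longrightarrow> (\<lambda>n. g n x) \<longlonglongrightarrow> G' x"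
    unfolding measurable_on_def by auto
  have aeN: "AE x in lborel. x \<notin> N"
  proof -
    have "AE x in lebesgue. x \<notin> N"
      using N by (auto simp: negligible_iff_null_sets intro: AE_not_in)
    then show ?thesis by (simp add: AE_completion_iff)
  qed
  \<comment> \<open>Equal to 1 on the support of \<open>G\<close> and to 0 outside the ball of
    radius \<open>R + 1\<close>, so that it does not disturb the limit.\<close>
  define \<theta> where "\<theta> x = max 0 (min 1 (R + 1 - norm (x - x0)))" for x
  have \<theta>: "0 \<le> \<theta> x" "\<theta> x \<le> 1" "norm (x - x0) \<le> R \<Longrightarrow> \<theta> x = 1" "norm (x - x0) \<ge> R + 1 \<Longrightarrow> \<theta> x = 0" for x
    by (auto simp: \<theta>_def)
  define h where "h n x = \<theta> x *\<^sub>R clamp_norm M (g n x)" for n x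
  have ch: "continuous_on UNIV (h n)" for n
    unfolding h_def \<theta>_def
    by (intro continuous_intros continuous_on_compose2[OF clamp_norm(4)[OF M] g]) auto
  have [measurable]: "h n \<in> borel_measurable borel" for n
    using ch by (rule borel_measurable_continuous_onI)
  have G'0: "norm (x - x0) > R \<Longrightarrow> G' x = 0" for x
    using supp by (simp add: G'_def clamp_norm_def)
  have "(\<lambda>n. \<integral>\<^sup>+x. ennreal (norm (h n x - G' x) powr p) \<partial>lborel) \<longlonglongrightarrow> (\<integral>\<^sup>+x. ennreal 0 \<partial>(lborel :: (real^'n) measure))"
  proof (rule nn_integral_dominated_convergence[where w = "\<lambda>x. ennreal ((2 * M) powr p) * indicator (cball x0 (R + 1)) x"])
    show "(\<lambda>x. ennreal (norm (h n x - G' x) powr p)) \<in> borel_measurable lborel" for n by measurable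
    show "(\<lambda>x. ennreal ((2 * M) powr p) * indicator (cball x0 (R + 1)) x) \<in> borel_measurable lborel"
      by (intro borel_measurable_times_ennreal borel_measurable_indicator) auto
    show "(\<integral>\<^sup>+x. ennreal ((2 * M) powr p) * indicator (cball x0 (R + 1)) x \<partial>lborel) < \<infinity>"
      using emeasure_lborel_cball_finite[of x0 "R + 1"]
      by (simp add: nn_integral_cmult_indicator ennreal_mult_less_top)
    show "AE x in lborel. ennreal (norm (h n x - G' x) powr p) \<le> ennreal ((2 * M) powr p) * indicator (cball x0 (R + 1)) x" for n
    proof (rule AE_I2)
      fix x
      show "ennreal (norm (h n x - G' x) powr p) \<le> ennreal ((2 * M) powr p) * indicator (cball x0 (R + 1)) x"
      proof (cases "x \<in> cball x0 (R + 1)")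
        case True
        have "norm (h n x) \<le> 1 * M"
          unfolding h_def norm_scaleR using \<theta>(1,2)[of x] clamp_norm(1)[OF M] by (intro mult_mono) auto
        moreover have "norm (G' x) \<le> M" unfolding G'_def by (rule clamp_norm(1)[OF M])
        ultimately have "norm (h n x - G' x) \<le> 2 * M"
          using norm_triangle_ineq4[of "h n x" "G' x"] by linarith
        then have "norm (h n x - G' x) powr p \<le> (2 * M) powr p" using p by (intro powr_mono2) auto
        then show ?thesis using True by (simp add: ennreal_leI)
      next
        case False
        then have "norm (x - x0) > R + 1" by (simp add: dist_norm norm_minus_commute)
        then have "h n x = 0" "G' x = 0" using \<theta>(4)[of x] G'0[of x] by (auto simp: h_def)
        then show ?thesis by simp
      qed
    qed
    show "AE x in lborel. (\<lambda>n. ennreal (norm (h n x - G' x) powr p)) \<longlonglongrightarrow> ennreal 0"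
      using aeN
    proof eventually_elim
      case (elim x)
      have "(\<lambda>n. clamp_norm M (g n x)) \<longlonglongrightarrow> clamp_norm M (G' x)"
        using continuous_on_tendsto_compose[OF clamp_norm(4)[OF M] lim[OF elim]] by simp
      then have "(\<lambda>n. h n x - G' x) \<longlonglongrightarrow> \<theta> x *\<^sub>R clamp_norm M (G' x) - G' x"
        unfolding h_def by (intro tendsto_intros)
      moreover have "clamp_norm M (G' x) = G' x"
        unfolding G'_def by (intro clamp_norm M)
      moreover have "\<theta> x *\<^sub>R G' x = G' x"
        using \<theta>(3)[of x] G'0[of x] by (cases "norm (x - x0) \<le> R") auto
      ultimately have "(\<lambda>n. norm (h n x - G' x)) \<longlonglongrightarrow> 0"
        by (simp add: tendsto_norm_zero)
      then have "(\<lambda>n. norm (h n x - G' x) powr p) \<longlonglongrightarrow> 0"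
        using p tendsto_powr2[of "\<lambda>n. norm (h n x - G' x)" 0 sequentially "\<lambda>_. p" p] by simp
      then show ?case by (rule tendsto_ennrealI)
    qed
  qed simp
  then have "(\<lambda>n. \<integral>\<^sup>+x. ennreal (norm (h n x - G' x) powr p) \<partial>lborel) \<longlonglongrightarrow> 0" by simp
  then have "\<forall>\<^sub>F n in sequentially. (\<integral>\<^sup>+x. ennreal (norm (h n x - G' x) powr p) \<partial>lborel) < ennreal d"
    using d by (intro order_tendstoD(2)) auto
  then obtain n where n: "(\<integral>\<^sup>+x. ennreal (norm (h n x - G' x) powr p) \<partial>lborel) < ennreal d"
    unfolding eventually_sequentially by blast
  have "(\<integral>\<^sup>+x. ennreal (norm ((h n x - G' x) + (G' x - G x)) powr p) \<partial>lborel) \<le> ennreal (2 powr p * (d + d))"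
    using n i d p by (intro nn_integral_norm_add_powr_le) (auto simp: G'_def M_def)
  also have "2 powr p * (d + d) = e" by (simp add: d_def)
  finally show ?thesis
    using ch[of n] \<theta>(4) by (intro exI[of _ "h n"]) (auto simp: h_def)
qed

lemma conv_add:
  fixes f g :: "real^'n \<Rightarrow> 'b::{banach,second_countable_topology}"
  assumes k: "mollifier \<epsilon> k" and "integrable lborel f" "integrable lborel g"
  shows "conv k (\<lambda>x. f x + g x) x = conv k f x + conv k g x"
proof -
  note kD = mollifierD[OF k]
  show ?thesis
    unfolding conv_def scaleR_add_right
    by (intro Bochner_Integration.integral_add conv_integrable[OF smooth_imp_continuous[OF kD(1)] kD(3)] assms)
qed

text \<open>Replace \<open>G\<close> by a continuous function \<open>h\<close>: convolution does not
  increase the Lp distance between them, and for \<open>h\<close> uniform continuity applies. The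
  smoothing scale works for every kernel of that size, so no particular family of mollifiers is
  fixed.\<close>

lemma conv_Lp_tendsto:
  fixes G :: "real^'n \<Rightarrow> 'b::euclidean_space"
  assumes intG: "integrable lborel G" and p: "p \<ge> 1" and R: "R > 0"
    and supp: "\<And>x. norm (x - x0) > R \<Longrightarrow> G x = 0"
    and fin: "(\<integral>\<^sup>+x. ennreal (norm (G x) powr p) \<partial>lborel) < \<infinity>" and e: "e > 0"
  shows "\<exists>\<epsilon>0>0. \<forall>\<epsilon> k. \<epsilon> \<le> \<epsilon>0 \<and> mollifier \<epsilon> k \<longrightarrow>
    (\<integral>\<^sup>+x. ennreal (norm (conv k G x - G x) powr p) \<partial>lborel) \<le> ennreal e"
proof -
  have [measurable]: "G \<in> borel_measurable borel" using intG by auto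
  define V where "V = measure lborel (cball x0 (R + 2))"
  have V: "emeasure lborel (cball x0 (R + 2)) = ennreal V"
    unfolding V_def using emeasure_lborel_cball_finite[of x0 "R + 2"] by (intro emeasure_eq_ennreal_measure) auto
  have V0: "V \<ge> 0" by (simp add: V_def)
  define T where "T = (2::real) powr p"
  have T: "T \<ge> 1" using p by (simp add: T_def ge_one_powr_ge_zero)
  \<comment> \<open>Adding the three errors with factor \<open>T\<close> at each addition gives at
    most \<open>3 * (T * T) * e1\<close>.\<close>
  define e1 where "e1 = e / (4 * (T * T))"
  have e1: "e1 > 0" using e T by (simp add: e1_def)
  \<comment> \<open>A uniform error \<open>e2\<close> on a set of measure \<open>V\<close> has
    integrated power at most \<open>e1\<close>. The ball of radius \<open>R + 2\<close> suffices,
    because \<open>h\<close> lives within \<open>R + 1\<close> and the smoothing scale is at most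
    1.\<close>
  define e2 where "e2 = (e1 / (V + 1)) powr (1 / p)"
  have e2: "e2 > 0" using e1 V0 by (simp add: e2_def)
  have e2V: "e2 powr p * V \<le> e1"
  proof -
    have "e2 powr p = e1 / (V + 1)" using e1 V0 p by (simp add: e2_def powr_powr)
    then have "e2 powr p * V + e2 powr p = e1" using V0 by (simp add: field_simps)
    then show ?thesis using powr_ge_zero[of e2 p] by linarith
  qed
  obtain h where ch: "continuous_on UNIV h" and h0: "\<And>x. norm (x - x0) \<ge> R + 1 \<Longrightarrow> h x = 0"
    and hG: "(\<integral>\<^sup>+x. ennreal (norm (h x - G x) powr p) \<partial>lborel) \<le> ennreal e1"
    using continuous_dense_Lp[of G p R x0 e1] supp fin e1 p R by auto
  have [measurable]: "h \<in> borel_measurable borel" using ch by (rule borel_measurable_continuous_onI)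
  obtain Bh where "\<And>x. norm (h x) \<le> Bh"
    by (rule compact_support_bounded[OF ch, where c = x0 and r = "R + 1"]) (use h0 in auto)
  then have inth: "integrable lborel h"
    by (intro integrable_bounded_support[where c = x0 and r = "R + 1"]) (auto intro: h0)
  have "uniformly_continuous_on (cball x0 (R + 3)) h"
    by (intro compact_uniformly_continuous continuous_on_subset[OF ch]) auto
  then obtain d where d: "d > 0" "\<And>x y. x \<in> cball x0 (R + 3) \<Longrightarrow> y \<in> cball x0 (R + 3) \<Longrightarrow> dist y x < d \<Longrightarrow> dist (h y) (h x) < e2"
    unfolding uniformly_continuous_on_def using e2 by metis
  define \<epsilon>0 where "\<epsilon>0 = min d 1"
  have "(\<integral>\<^sup>+x. ennreal (norm (conv k G x - G x) powr p) \<partial>lborel) \<le> ennreal e"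
    if k: "mollifier \<epsilon> k" and \<epsilon>: "\<epsilon> \<le> \<epsilon>0" for \<epsilon> k
  proof -
    note kD = mollifierD[OF k]
    have [measurable]: "conv k (\<lambda>x. G x - h x) \<in> borel_measurable borel" "conv k h \<in> borel_measurable borel"
      by (intro conv_measurable kD(6); measurable)+
    have intd: "integrable lborel (\<lambda>x. G x - h x)" using intG inth by (rule Bochner_Integration.integrable_diff)
    have 1: "(\<integral>\<^sup>+x. ennreal (norm (conv k (\<lambda>x. G x - h x) x) powr p) \<partial>lborel) \<le> ennreal e1"
    proof -
      have "(\<integral>\<^sup>+x\<in>UNIV. ennreal (norm (conv k (\<lambda>x. G x - h x) x) powr p) \<partial>lborel) \<le> (\<integral>\<^sup>+x\<in>UNIV. ennreal (norm (G x - h x) powr p) \<partial>lborel)"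
        by (rule conv_Lp_le[OF k intd p]) auto
      then show ?thesis using hG by (simp add: norm_minus_commute)
    qed
    have 2: "(\<integral>\<^sup>+x. ennreal (norm (conv k h x - h x) powr p) \<partial>lborel) \<le> ennreal e1"
    proof -
      have "(\<integral>\<^sup>+x. ennreal (norm (conv k h x - h x) powr p) \<partial>lborel)
          \<le> (\<integral>\<^sup>+x. ennreal (e2 powr p) * indicator (cball x0 (R + 2)) x \<partial>lborel)"
      proof (rule nn_integral_mono)
        fix x
        show "ennreal (norm (conv k h x - h x) powr p) \<le> ennreal (e2 powr p) * indicator (cball x0 (R + 2)) x"
        proof (cases "x \<in> cball x0 (R + 2)")
          case True
          have "norm (conv k h x - h x) \<le> e2"
          proof (rule conv_close[OF k inth])
            fix y assume y: "norm (x - y) < \<epsilon>"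
            have "dist x0 y \<le> dist x0 x + dist x y" by (rule dist_triangle)
            then have "y \<in> cball x0 (R + 3)" "dist y x < d"
              using True y \<epsilon> by (auto simp: \<epsilon>0_def dist_norm norm_minus_commute)
            then show "norm (h y - h x) \<le> e2"
              using d(2)[of x y] True by (simp add: dist_norm less_imp_le)
          qed
          then have "norm (conv k h x - h x) powr p \<le> e2 powr p" using p by (intro powr_mono2) auto
          then show ?thesis using True by (simp add: ennreal_leI)
        next
          case False
          then have x: "norm (x - x0) > R + 2" by (simp add: dist_norm norm_minus_commute)
          have "norm (conv k h x - h x) \<le> 0"
          proof (rule conv_close[OF k inth])
            fix y assume y: "norm (x - y) < \<epsilon>"
            have "norm (x - x0) \<le> norm (x - y) + norm (y - x0)"
              using norm_triangle_ineq[of "x - y" "y - x0"] by simp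
            then have "norm (y - x0) \<ge> R + 1" using x y \<epsilon> by (simp add: \<epsilon>0_def)
            then show "norm (h y - h x) \<le> 0" using h0 x by simp
          qed
          then show ?thesis by simp
        qed
      qed
      also have "\<dots> = ennreal (e2 powr p * V)"
        using V0 by (simp add: nn_integral_cmult_indicator V ennreal_mult)
      also have "\<dots> \<le> ennreal e1" using e2V by (rule ennreal_leI)
      finally show ?thesis .
    qed
    have 3: "(\<integral>\<^sup>+x. ennreal (norm (conv k h x - h x + (h x - G x)) powr p) \<partial>lborel) \<le> ennreal (T * (e1 + e1))"
      unfolding T_def using 2 hG e1 p by (intro nn_integral_norm_add_powr_le) auto
    have "(\<integral>\<^sup>+x. ennreal (norm (conv k (\<lambda>x. G x - h x) x + (conv k h x - h x + (h x - G x))) powr p) \<partial>lborel)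
        \<le> ennreal (T * (e1 + T * (e1 + e1)))"
      unfolding T_def
      by (rule nn_integral_norm_add_powr_le) (use 1 3 e1 p T in \<open>auto simp: T_def\<close>)
    moreover have eqx: "conv k (\<lambda>x. G x - h x) x + (conv k h x - h x + (h x - G x)) = conv k G x - G x" for x
      using conv_add[OF k intd inth, of x] by simp
    moreover have "T * (e1 + T * (e1 + e1)) \<le> e"
    proof -
      have "T * e1 \<le> T * (T * e1)" using T e1 by (intro mult_left_mono) auto
      moreover have "4 * (T * (T * e1)) = e" using T by (simp add: e1_def)
      moreover have "T * (T * e1) > 0" using T e1 by simp
      ultimately show ?thesis by (simp add: distrib_left)
    qed
    ultimately show ?thesis unfolding eqx by (blast intro: order_trans ennreal_leI)
  qed
  moreover have "\<epsilon>0 > 0" using d by (simp add: \<epsilon>0_def)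
  ultimately show ?thesis by blast
qed

subsection \<open>The reverse Hoelder inequality for weak gradients\<close>

text \<open>The substitution and Fubini arguments are carried out for Borel functions and
  \<open>lborel\<close>, while weak gradients are given up to Lebesgue null sets. The representative
  is built coordinate by coordinate and cut off outside \<open>K\<close>.\<close>

lemma borel_representative:
  fixes f :: "real^'n \<Rightarrow> 'b::euclidean_space"
  assumes K: "closed K" and f: "set_integrable lebesgue K f"
  obtains g where "g \<in> borel_measurable borel" "integrable lborel g" "\<And>x. x \<notin> K \<Longrightarrow> g x = 0"
    "AE x in lebesgue. x \<in> K \<longrightarrow> g x = f x"
proof -
  have Kb[measurable]: "K \<in> sets borel" using K by simp
  define f0 where "f0 x = indicat_real K x *\<^sub>R f x" for x
  have if0: "integrable lebesgue f0"
    using f unfolding set_integrable_def f0_def .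
  have "\<exists>g. g \<in> borel_measurable lborel \<and> (AE x in lborel. f0 x \<bullet> b = g x)" if "b \<in> Basis" for b
  proof -
    have "(\<lambda>x. f0 x \<bullet> b) \<in> borel_measurable lebesgue" using if0 by measurable
    then show ?thesis using completion_ex_borel_measurable_real by blast
  qed
  then obtain g where g: "\<And>b. b \<in> Basis \<Longrightarrow> g b \<in> borel_measurable lborel"
    "\<And>b. b \<in> Basis \<Longrightarrow> AE x in lborel. f0 x \<bullet> b = g b x" by metis
  define G where "G x = (\<Sum>b\<in>Basis. (indicat_real K x * g b x) *\<^sub>R b)" for x
  have Gm: "G \<in> borel_measurable borel"
    unfolding G_def using g(1) by (intro borel_measurable_sum borel_measurable_scaleR borel_measurable_times borel_measurable_indicator Kb) auto
  have "AE x in lborel. \<forall>b\<in>Basis. f0 x \<bullet> b = g b x"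
    using g(2) by (intro AE_finite_allI) auto
  then have "AE x in lborel. f0 x = G x"
  proof eventually_elim
    case (elim x)
    have "G x = (\<Sum>b\<in>Basis. (f0 x \<bullet> b) *\<^sub>R b)"
      unfolding G_def
    proof (rule sum.cong)
      fix b :: 'b assume "b \<in> Basis"
      then show "(indicat_real K x * g b x) *\<^sub>R b = (f0 x \<bullet> b) *\<^sub>R b"
        using elim by (cases "x \<in> K") (auto simp: f0_def)
    qed simp
    then show ?case by (simp add: euclidean_representation)
  qed
  then have ae: "AE x in lebesgue. f0 x = G x" by (rule AE_completion)
  have "integrable lebesgue G"
    using if0 ae Gm by (subst integrable_cong_AE[of G _ f0]) (auto intro: measurable_completion)
  then have "integrable lborel G"
    using Gm by (simp add: integrable_completion)
  moreover have "AE x in lebesgue. x \<in> K \<longrightarrow> G x = f x"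
    using ae by eventually_elim (auto simp: f0_def)
  moreover have "x \<notin> K \<Longrightarrow> G x = 0" for x by (simp add: G_def)
  ultimately show ?thesis using that Gm by blast
qed

lemma lebesgue_set_integral_eq_lborel:
  fixes f :: "real^'n \<Rightarrow> real"
  assumes g: "g \<in> borel_measurable borel" and ae: "AE x in lebesgue. indicat_real S x * f x = g x"
  shows "(LINT x:S|lebesgue. f x) = (LINT x|lborel. g x)"
proof -
  have gl: "g \<in> borel_measurable lebesgue" using g by (simp add: measurable_completion)
  have "AE x in lebesgue. g x = indicat_real S x * f x" using ae by eventually_elim simp
  then have "(\<lambda>x. indicat_real S x * f x) \<in> borel_measurable lebesgue"
    by (rule borel_measurable_AE[OF gl])
  then have "(LINT x|lebesgue. indicat_real S x * f x) = (LINT x|lebesgue. g x)"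
    using gl ae by (rule integral_cong_AE)
  also have "\<dots> = (LINT x|lborel. g x)" using g by (simp add: integral_completion)
  finally show ?thesis by (simp add: set_lebesgue_integral_def)
qed

text \<open>The reflected kernel \<open>y \<mapsto> k (x - y)\<close> is an admissible test function
  as long as its support stays in the ball where \<open>U\<close> and \<open>G\<close> represent the
  map and its weak gradient. The sign from the reflection cancels the sign in the definition of the
  weak gradient.\<close>

lemma gradient_conv_weak_gradient:
  fixes u :: "real^'n \<Rightarrow> real^'m"
  assumes wg: "weak_gradient \<Omega> u Du" and sub: "cball z R \<subseteq> \<Omega>" and k: "mollifier \<epsilon> k"
    and U: "integrable lborel U" "\<And>x. x \<notin> cball z R \<Longrightarrow> U x = 0" "AE x in lebesgue. x \<in> cball z R \<longrightarrow> U x = u x"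
    and G: "integrable lborel G" "\<And>x. x \<notin> cball z R \<Longrightarrow> G x = 0" "AE x in lebesgue. x \<in> cball z R \<longrightarrow> G x = Du x"
    and x: "norm (x - z) + \<epsilon> < R"
  shows "gradient (conv k U) x = conv k G x"
proof -
  note kD = mollifierD[OF k]
  have [measurable]: "U \<in> borel_measurable borel" "G \<in> borel_measurable borel" using U G by auto
  have mU[measurable]: "(\<lambda>y. U y $ i) \<in> borel_measurable borel" for i
    by (intro borel_measurable_continuous_on[of "\<lambda>w. w $ i"] continuous_intros) measurable
  have mG[measurable]: "(\<lambda>y. G y $ i $ j) \<in> borel_measurable borel" for i j
    by (intro borel_measurable_continuous_on[of "\<lambda>w. w $ i $ j"] continuous_intros) measurable
  define \<psi> where "\<psi> y = k (x - y)" for y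
  have "Ck j (\<lambda>y. k (x + (- y)))" for j
    using kD(1) unfolding smooth_def
    by (intro Ck_comp_affine[OF bounded_linear_minus[OF bounded_linear_ident]]) blast
  then have sm: "smooth \<psi>" unfolding smooth_def \<psi>_def by simp
  have \<psi>': "frechet_derivative \<psi> (at y) v = - frechet_derivative k (at (x - y)) v" for y v
  proof -
    have "((\<lambda>y. x - y) has_derivative (\<lambda>h. - h)) (at y)" by (auto intro!: derivative_eq_intros)
    from has_derivative_compose[OF this smooth_has_derivative[OF kD(1)]]
    have "(\<psi> has_derivative (\<lambda>h. frechet_derivative k (at (x - y)) (- h))) (at y)" unfolding \<psi>_def .
    then have "frechet_derivative \<psi> (at y) = (\<lambda>h. frechet_derivative k (at (x - y)) (- h))"
      by (rule frechet_derivative_at[symmetric])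
    then show ?thesis
      using linear_neg[OF has_derivative_linear[OF smooth_has_derivative[OF kD(1)]]] by simp
  qed
  have far: "norm (x - y) > \<epsilon>" if "y \<notin> cball z R" for y
  proof -
    have "norm (y - z) \<le> norm (x - z) + norm (x - y)"
      using norm_triangle_ineq4[of "x - z" "x - y"] by simp
    then show ?thesis using that x by (simp add: dist_norm norm_minus_commute)
  qed
  have \<psi>0: "\<psi> y = 0" "frechet_derivative \<psi> (at y) v = 0" if "y \<notin> cball z R" for y v
    using far[OF that] kD(3)[of "x - y"] frechet_compact_support[OF kD(1,3), where z = "x - y"] unfolding \<psi>'
    by (auto simp: \<psi>_def)
  have tf: "test_function \<Omega> \<psi>"
  proof -
    have "{y. \<psi> y \<noteq> 0} \<subseteq> cball z R" using \<psi>0(1) by blast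
    then have c: "closure {y. \<psi> y \<noteq> 0} \<subseteq> cball z R" by (rule closure_minimal) simp
    then have "compact (closure {y. \<psi> y \<noteq> 0})"
      using compact_cball[of z R] compact_Int_closed[of "cball z R" "closure {y. \<psi> y \<noteq> 0}"] by (simp add: Int_absorb1)
    then show ?thesis using c sub sm unfolding test_function_def compactly_contained_def by blast
  qed
  have m\<psi>[measurable]: "\<psi> \<in> borel_measurable borel" "(\<lambda>y. frechet_derivative \<psi> (at y) v) \<in> borel_measurable borel" for v
    using smooth_imp_continuous[OF sm] smooth_continuous_frechet[OF sm] by (auto intro: borel_measurable_continuous_onI)
  have "gradient (conv k U) x $ i $ j = conv k G x $ i $ j" for i j
  proof -
    have iU: "integrable lborel (\<lambda>y. frechet_derivative k (at (x - y)) (axis j 1) *\<^sub>R U y)"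
      by (rule conv_integrable[OF smooth_continuous_frechet[OF kD(1)] _ U(1), where R = "\<epsilon> + 1"])
        (rule frechet_compact_support[OF kD(1,3)], auto)
    have iG: "integrable lborel (\<lambda>y. k (x - y) *\<^sub>R G y)"
      by (rule conv_integrable[OF smooth_imp_continuous[OF kD(1)] kD(3) G(1)])
    have "frechet_derivative (conv k U) (at x) = (\<lambda>h. conv (\<lambda>z. frechet_derivative k (at z) h) U x)"
      by (rule frechet_derivative_at[symmetric], rule conv_has_derivative[OF kD(1,3) U(1)])
    then have "gradient (conv k U) x $ i $ j = conv (\<lambda>z. frechet_derivative k (at z) (axis j 1)) U x $ i"
      by (simp add: gradient_nth)
    also have "\<dots> = (LINT y|lborel. (frechet_derivative k (at (x - y)) (axis j 1) *\<^sub>R U y) $ i)"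
      unfolding conv_def by (rule integral_bounded_linear[OF bounded_linear_vec_nth iU, symmetric])
    also have "\<dots> = - (LINT y|lborel. U y $ i * frechet_derivative \<psi> (at y) (axis j 1))"
      unfolding \<psi>' by (simp add: mult.commute)
    also have "(LINT y|lborel. U y $ i * frechet_derivative \<psi> (at y) (axis j 1))
        = (LINT y:\<Omega>|lebesgue. u y $ i * frechet_derivative \<psi> (at y) (axis j 1))"
    proof (rule lebesgue_set_integral_eq_lborel[symmetric])
      show "AE y in lebesgue. indicat_real \<Omega> y * (u y $ i * frechet_derivative \<psi> (at y) (axis j 1)) = U y $ i * frechet_derivative \<psi> (at y) (axis j 1)"
        using U(3)
      proof eventually_elim
        case (elim y)
        then show ?case using \<psi>0(2)[of y] sub by (cases "y \<in> cball z R") auto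
      qed
    qed (intro borel_measurable_times mU m\<psi>)
    also have "\<dots> = - (LINT y:\<Omega>|lebesgue. Du y $ i $ j * \<psi> y)"
      using wg tf unfolding weak_gradient_def by blast
    also have "(LINT y:\<Omega>|lebesgue. Du y $ i $ j * \<psi> y) = (LINT y|lborel. G y $ i $ j * \<psi> y)"
    proof (rule lebesgue_set_integral_eq_lborel)
      show "AE y in lebesgue. indicat_real \<Omega> y * (Du y $ i $ j * \<psi> y) = G y $ i $ j * \<psi> y"
        using G(3)
      proof eventually_elim
        case (elim y)
        then show ?case using \<psi>0(1)[of y] sub by (cases "y \<in> cball z R") auto
      qed
    qed (intro borel_measurable_times mG m\<psi>)
    also have "(LINT y|lborel. G y $ i $ j * \<psi> y) = (LINT y|lborel. (k (x - y) *\<^sub>R G y) $ i $ j)"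
      by (simp add: \<psi>_def mult.commute)
    also have "\<dots> = conv k G x $ i $ j"
      unfolding conv_def
      using integral_bounded_linear[OF bounded_linear_compose[OF bounded_linear_vec_nth bounded_linear_vec_nth] iG] .
    finally show ?thesis by simp
  qed
  then show ?thesis by (simp add: vec_eq_iff)
qed

lemma gradient_affine:
  fixes v :: "real^'n \<Rightarrow> real^'m"
  assumes "smooth v"
  shows "gradient (\<lambda>y. v (t + s *\<^sub>R y)) y = s *\<^sub>R gradient v (t + s *\<^sub>R y)"
proof -
  have "((\<lambda>y. t + s *\<^sub>R y) has_derivative (\<lambda>h. s *\<^sub>R h)) (at y)"
    by (auto intro!: derivative_eq_intros)
  from has_derivative_compose[OF this smooth_has_derivative[OF assms]]
  have "((\<lambda>y. v (t + s *\<^sub>R y)) has_derivative (\<lambda>h. frechet_derivative v (at (t + s *\<^sub>R y)) (s *\<^sub>R h))) (at y)" .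
  from gradient_eq[OF this] show ?thesis
    using linear_scale[OF has_derivative_linear[OF smooth_has_derivative[OF assms]]]
    by (simp add: vec_eq_iff gradient_nth matrix_def)
qed

text \<open>Pure scaling. With dilation factor \<open>s\<close>, homogeneity and the change of
  variables give \<open>s powr (p - n)\<close> on the left and
  \<open>s powr ((q - n) * (p / q))\<close> on the right, whose quotient is the power
  \<open>n * (1 - p / q)\<close> of the radius.\<close>

lemma smooth_reverse_hoelder_ball:
  fixes F :: "real^'n^'m \<Rightarrow> real"
  assumes p: "p > 1" and F: "quasiconcave F" "pos_homogeneous p F"
    and \<delta>: "0 < \<delta>" "\<delta> < 1" "\<delta> \<le> p - 1" "2 * real CARD('n) * \<delta> \<le> p - \<delta>"
  obtains K where "K > 0"
    "\<And>(v :: real^'n \<Rightarrow> real^'m) x \<rho> N. smooth v \<Longrightarrow> \<rho> > 0 \<Longrightarrow> N > 0 \<Longrightarrow>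
       (\<integral>\<^sup>+z\<in>ball x (4 * \<rho>). ennreal (norm (gradient v z) powr (p - \<delta>)) \<partial>lborel) \<le> ennreal N \<Longrightarrow>
       (LINT z|lborel. bump ((1 / (2 * \<rho>)) *\<^sub>R (z - x)) powr p * F (gradient v z))
       \<le> K * \<rho> powr (real CARD('n) * (1 - p / (p - \<delta>))) * N powr (p / (p - \<delta>))"
proof -
  define n where "n = CARD('n)"
  define q where "q = p - \<delta>"
  have q: "q \<ge> 1" using \<delta> by (simp add: q_def)
  obtain c :: "real^'n" and r K where r: "r > 0" and K: "K > 0"
    and main: "\<And>(v :: real^'n \<Rightarrow> real^'m) N. smooth v \<Longrightarrow> N > 0 \<Longrightarrow>
       (\<integral>\<^sup>+x\<in>ball c r. ennreal (norm (gradient v x) powr q) \<partial>lborel) \<le> ennreal N \<Longrightarrow>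
       (LINT x|lborel. bump ((2 / r) *\<^sub>R (x - c)) powr p * F (gradient v x)) \<le> K * N powr (p / q)"
  proof (rule smooth_reverse_hoelder[OF p F \<delta>, folded q_def])
    fix c :: "real^'n" and r K
    assume "r > 0" "K > 0" "\<And>(v :: real^'n \<Rightarrow> real^'m) N. smooth v \<Longrightarrow> N > 0 \<Longrightarrow>
       (\<integral>\<^sup>+x\<in>ball c r. ennreal (norm (gradient v x) powr q) \<partial>lborel) \<le> ennreal N \<Longrightarrow>
       (LINT x|lborel. bump ((2 / r) *\<^sub>R (x - c)) powr p * F (gradient v x)) \<le> K * N powr (p / q)"
    then show thesis by (rule that)
  qed
  have Fm[measurable]: "F \<in> borel_measurable borel" using F(1) by (simp add: quasiconcave_def)
  have bm[measurable]: "(bump :: real^'n \<Rightarrow> real) \<in> borel_measurable borel"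
    using smooth_imp_continuous[OF smooth_bump] by (rule borel_measurable_continuous_onI)
  define a where "a = real n * (1 - p / q)"
  define K' where "K' = K * (4 / r) powr a"
  have "(LINT z|lborel. bump ((1 / (2 * \<rho>)) *\<^sub>R (z - x)) powr p * F (gradient v z)) \<le> K' * \<rho> powr a * N powr (p / q)"
    if sm: "smooth v" and \<rho>: "\<rho> > 0" and N: "N > 0"
      and le: "(\<integral>\<^sup>+z\<in>ball x (4 * \<rho>). ennreal (norm (gradient v z) powr q) \<partial>lborel) \<le> ennreal N"
    for v :: "real^'n \<Rightarrow> real^'m" and x \<rho> N
  proof -
    \<comment> \<open>The affine map \<open>y \<mapsto> t + s *\<^sub>R y\<close> carries the ball
      of radius \<open>r\<close> about \<open>c\<close> to the ball of radius
      \<open>4 * \<rho>\<close> about \<open>x\<close>; the cutoff then lives on the ball of radius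
      \<open>2 * \<rho>\<close>.\<close>
    define s where "s = 4 * \<rho> / r"
    define t where "t = x - s *\<^sub>R c"
    define V where "V y = v (t + s *\<^sub>R y)" for y
    have s: "s > 0" using \<rho> r by (simp add: s_def)
    have [measurable]: "gradient v \<in> borel_measurable borel"
      using smooth_continuous_gradient[OF sm] by (rule borel_measurable_continuous_onI)
    have "Ck j (\<lambda>y. v (t + s *\<^sub>R y))" for j
      using sm unfolding smooth_def by (intro Ck_comp_affine[OF bounded_linear_scaleR_right]) blast
    then have smV: "smooth V" unfolding smooth_def V_def by simp
    have gV: "gradient V y = s *\<^sub>R gradient v (t + s *\<^sub>R y)" for y
      unfolding V_def by (rule gradient_affine[OF sm])
    have pt: "t + s *\<^sub>R y - x = s *\<^sub>R (y - c)" for y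
      by (simp add: t_def algebra_simps)
    have ball: "t + s *\<^sub>R y \<in> ball x (4 * \<rho>) \<longleftrightarrow> y \<in> ball c r" for y
    proof -
      have "dist x (t + s *\<^sub>R y) = s * dist c y"
        using pt[of y] s by (simp add: dist_norm norm_minus_commute[of x] norm_minus_commute[of c])
      moreover have "4 * \<rho> = s * r" using r by (simp add: s_def)
      ultimately show ?thesis using s by simp
    qed
    define H where "H z = ennreal (norm (gradient v z) powr q) * indicator (ball x (4 * \<rho>)) z" for z
    have Hm[measurable]: "H \<in> borel_measurable borel"
    proof -
      have [measurable]: "ball x (4 * \<rho>) \<in> sets borel" by simp
      show ?thesis unfolding H_def by measurable
    qed
    have sn: "s ^ n * s powr (- real n) = 1"
      using s by (simp add: powr_minus powr_realpow)
    have "(\<integral>\<^sup>+y\<in>ball c r. ennreal (norm (gradient V y) powr q) \<partial>lborel) = (\<integral>\<^sup>+y. ennreal (s powr q) * H (t + s *\<^sub>R y) \<partial>lborel)"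
    proof (rule nn_integral_cong)
      fix y
      show "ennreal (norm (gradient V y) powr q) * indicator (ball c r) y = ennreal (s powr q) * H (t + s *\<^sub>R y)"
        using ball[of y] s unfolding H_def gV
        by (cases "y \<in> ball c r") (simp_all add: powr_mult ennreal_mult)
    qed
    also have "\<dots> = ennreal (s powr q) * (\<integral>\<^sup>+y. H (t + s *\<^sub>R y) \<partial>lborel)"
      by (rule nn_integral_cmult) measurable
    also have "\<dots> = ennreal (s powr q * s powr (- real n)) * (ennreal (s ^ n) * (\<integral>\<^sup>+y. H (t + s *\<^sub>R y) \<partial>lborel))"
      using s sn by (simp add: mult.assoc[symmetric] ennreal_mult[symmetric] mult.commute[of "s ^ n"])
        (simp add: mult.assoc sn mult.commute[of "s powr - real n"])
    also have "ennreal (s ^ n) * (\<integral>\<^sup>+y. H (t + s *\<^sub>R y) \<partial>lborel) = (\<integral>\<^sup>+z. H z \<partial>lborel)"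
      using nn_integral_lborel_affine[OF Hm, of s t] s by (simp add: n_def)
    also have "ennreal (s powr q * s powr (- real n)) * (\<integral>\<^sup>+z. H z \<partial>lborel) \<le> ennreal (s powr q * s powr (- real n)) * ennreal N"
      using le by (intro mult_left_mono) (auto simp: H_def)
    also have "\<dots> = ennreal (s powr (q - real n) * N)"
      using N by (simp add: powr_diff powr_minus divide_inverse flip: ennreal_mult)
    finally have m1: "(LINT y|lborel. bump ((2 / r) *\<^sub>R (y - c)) powr p * F (gradient V y)) \<le> K * (s powr (q - real n) * N) powr (p / q)"
      using N s by (intro main[OF smV]) auto
    have m2: "(LINT y|lborel. bump ((2 / r) *\<^sub>R (y - c)) powr p * F (gradient V y))
        = s powr p * (s powr (- real n) * (LINT z|lborel. bump ((1 / (2 * \<rho>)) *\<^sub>R (z - x)) powr p * F (gradient v z)))"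
    proof -
      define \<Phi> where "\<Phi> z = bump ((1 / (2 * \<rho>)) *\<^sub>R (z - x)) powr p * F (gradient v z)" for z
      have [measurable]: "\<Phi> \<in> borel_measurable borel" unfolding \<Phi>_def by measurable
      have "bump ((2 / r) *\<^sub>R (y - c)) powr p * F (gradient V y) = s powr p * \<Phi> (t + s *\<^sub>R y)" for y
      proof -
        have "F (gradient V y) = s powr p * F (gradient v (t + s *\<^sub>R y))"
          using F(2) s unfolding gV pos_homogeneous_def by blast
        moreover have "(1 / (2 * \<rho>)) *\<^sub>R (t + s *\<^sub>R y - x) = (2 / r) *\<^sub>R (y - c)"
          unfolding pt using \<rho> by (simp add: s_def)
        ultimately show ?thesis by (simp add: \<Phi>_def)
      qed
      moreover have "(LINT z|lborel. \<Phi> z) = s ^ n * (LINT y|lborel. \<Phi> (t + s *\<^sub>R y))"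
        using integral_lborel_affine[of \<Phi> s t] s by (simp add: n_def)
      ultimately show ?thesis
        using sn unfolding \<Phi>_def[symmetric] by (simp add: mult.assoc[symmetric] mult.commute[of "s powr - real n"])
    qed
    have "s powr (p - real n) * (LINT z|lborel. bump ((1 / (2 * \<rho>)) *\<^sub>R (z - x)) powr p * F (gradient v z))
        \<le> K * (s powr (q - real n) * N) powr (p / q)"
    proof -
      have e: "s powr (p - real n) = s powr p * s powr (- real n)" by (simp flip: powr_add)
      show ?thesis using m1 unfolding m2 e mult.assoc .
    qed
    then have "s powr (real n - p) * (s powr (p - real n) * (LINT z|lborel. bump ((1 / (2 * \<rho>)) *\<^sub>R (z - x)) powr p * F (gradient v z)))
        \<le> s powr (real n - p) * (K * (s powr (q - real n) * N) powr (p / q))"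
      by (intro mult_left_mono) auto
    also have "s powr (real n - p) * (K * (s powr (q - real n) * N) powr (p / q)) = K * (s powr (real n - p) * s powr ((q - real n) * (p / q))) * N powr (p / q)"
      using N s by (simp add: powr_mult powr_powr mult_ac)
    also have "s powr (real n - p) * s powr ((q - real n) * (p / q)) = s powr a"
    proof -
      have "real n - p + (q - real n) * (p / q) = a" using q by (simp add: a_def field_simps)
      then show ?thesis by (simp only: powr_add[symmetric])
    qed
    also have "s powr a = (4 / r) powr a * \<rho> powr a"
      using \<rho> r by (simp add: s_def flip: powr_mult)
    finally show ?thesis
      using s unfolding K'_def by (simp add: mult.assoc[symmetric] flip: powr_add)
  qed
  moreover have "K' > 0" using K r by (simp add: K'_def)
  ultimately show ?thesis
    unfolding q_def a_def n_def by (rule that[rotated])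
qed

text \<open>A Young inequality with a free parameter, proved by comparing \<open>X\<close> with
  \<open>\<kappa> * Y\<close>. It shows that the error made in \<open>F\<close> by mollification is
  small: \<open>Y\<close> stays bounded in Lp, and \<open>X\<close> tends to 0 there.\<close>

lemma mult_powr_le_split:
  fixes X Y \<kappa> p :: real
  assumes "X \<ge> 0" "Y \<ge> 0" "\<kappa> > 0" "p > 1"
  shows "X * Y powr (p - 1) \<le> \<kappa> * Y powr p + \<kappa> powr (1 - p) * X powr p"
proof (cases "X \<le> \<kappa> * Y")
  case True
  then have "X * Y powr (p - 1) \<le> \<kappa> * Y * Y powr (p - 1)" by (intro mult_right_mono) auto
  also have "\<dots> = \<kappa> * Y powr p" using assms by (cases "Y = 0") (auto simp: powr_diff)
  moreover have "0 \<le> \<kappa> powr (1 - p) * X powr p" by simp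
  ultimately show ?thesis by linarith
next
  case False
  then have X: "X > 0" using assms by (meson le_less_trans mult_nonneg_nonneg not_le less_imp_le)
  have "Y \<le> X / \<kappa>" using False assms by (simp add: field_simps)
  then have "X * Y powr (p - 1) \<le> X * (X / \<kappa>) powr (p - 1)"
    using assms by (intro mult_left_mono powr_mono2) auto
  also have "\<dots> = \<kappa> powr (1 - p) * X powr p"
    using X assms by (simp add: powr_divide powr_diff)
  moreover have "0 \<le> \<kappa> * Y powr p" using assms by simp
  ultimately show ?thesis by linarith
qed

lemma integrable_of_nn_integral_le:
  fixes f :: "'a::euclidean_space \<Rightarrow> real"
  assumes "f \<in> borel_measurable borel" "\<And>x. f x \<ge> 0" "(\<integral>\<^sup>+x. ennreal (f x) \<partial>lborel) \<le> ennreal a" "a \<ge> 0"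
  shows "integrable lborel f" "(LINT x|lborel. f x) \<le> a"
proof -
  show i: "integrable lborel f"
    using assms by (intro integrableI_nonneg) (auto intro: le_less_trans)
  have "(\<integral>\<^sup>+x. ennreal (f x) \<partial>lborel) = ennreal (LINT x|lborel. f x)"
    using assms(2) by (intro nn_integral_eq_integral[OF i]) simp
  then show "(LINT x|lborel. f x) \<le> a" using assms by (simp add: ennreal_le_iff)
qed

text \<open>The smooth estimate is applied to the mollified map. Convolution does not increase the
  mass of order \<open>q\<close>, at the price of a larger ball, and the cut-off integral of
  \<open>F\<close> converges to that of \<open>F (G x)\<close>. The sign of \<open>F (G x)\<close>
  enters only in the last step, where the cutoff is discarded.\<close>

lemma weak_reverse_hoelder:
  fixes F :: "real^'n^'m \<Rightarrow> real"
  assumes p: "p > 1" and F: "quasiconcave F" "pos_homogeneous p F"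
    and \<delta>: "0 < \<delta>" "\<delta> < 1" "\<delta> \<le> p - 1" "2 * real CARD('n) * \<delta> \<le> p - \<delta>"
  obtains K where "K > 0"
    "\<And>\<Omega> (u :: real^'n \<Rightarrow> real^'m) Du z R G x \<rho> N.
       weak_gradient \<Omega> u Du \<Longrightarrow> cball z R \<subseteq> \<Omega> \<Longrightarrow> integrable lborel G \<Longrightarrow> (\<And>x. x \<notin> cball z R \<Longrightarrow> G x = 0) \<Longrightarrow>
       (AE x in lebesgue. x \<in> cball z R \<longrightarrow> G x = Du x) \<Longrightarrow>
       (\<integral>\<^sup>+x. ennreal (norm (G x) powr p) \<partial>lborel) < \<infinity> \<Longrightarrow> (\<And>x. F (G x) \<ge> 0) \<Longrightarrow>
       \<rho> > 0 \<Longrightarrow> cball x (8 * \<rho>) \<subseteq> cball z R \<Longrightarrow> N > 0 \<Longrightarrow>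
       (\<integral>\<^sup>+y\<in>ball x (8 * \<rho>). ennreal (norm (G y) powr (p - \<delta>)) \<partial>lborel) \<le> ennreal N \<Longrightarrow>
       (\<integral>\<^sup>+y\<in>ball x \<rho>. ennreal (F (G y)) \<partial>lborel)
       \<le> ennreal (K * \<rho> powr (real CARD('n) * (1 - p / (p - \<delta>))) * N powr (p / (p - \<delta>)))"
proof -
  define q where "q = p - \<delta>"
  have q: "q \<ge> 1" using \<delta> by (simp add: q_def)
  define a where "a = real CARD('n) * (1 - p / q)"
  obtain K where K: "K > 0" and main: "\<And>(v :: real^'n \<Rightarrow> real^'m) x \<rho> N. smooth v \<Longrightarrow> \<rho> > 0 \<Longrightarrow> N > 0 \<Longrightarrow>
       (\<integral>\<^sup>+z\<in>ball x (4 * \<rho>). ennreal (norm (gradient v z) powr q) \<partial>lborel) \<le> ennreal N \<Longrightarrow>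
       (LINT z|lborel. bump ((1 / (2 * \<rho>)) *\<^sub>R (z - x)) powr p * F (gradient v z)) \<le> K * \<rho> powr a * N powr (p / q)"
  proof (rule smooth_reverse_hoelder_ball[OF p F \<delta>, folded q_def, folded a_def])
    fix K assume "K > 0" "\<And>(v :: real^'n \<Rightarrow> real^'m) x \<rho> N. smooth v \<Longrightarrow> \<rho> > 0 \<Longrightarrow> N > 0 \<Longrightarrow>
       (\<integral>\<^sup>+z\<in>ball x (4 * \<rho>). ennreal (norm (gradient v z) powr q) \<partial>lborel) \<le> ennreal N \<Longrightarrow>
       (LINT z|lborel. bump ((1 / (2 * \<rho>)) *\<^sub>R (z - x)) powr p * F (gradient v z))
       \<le> K * \<rho> powr a * N powr (p / q)"
    then show thesis by (rule that)
  qed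
  have Fm[measurable]: "F \<in> borel_measurable borel" using F(1) by (simp add: quasiconcave_def)
  have bm[measurable]: "(bump :: real^'n \<Rightarrow> real) \<in> borel_measurable borel"
    using smooth_imp_continuous[OF smooth_bump] by (rule borel_measurable_continuous_onI)
  have F0: "F 0 = 0" using pos_homogeneous_0[OF p F(2)] .
  obtain L where L: "L > 0" "\<And>x y. \<bar>F y - F x\<bar> \<le> L * norm (y - x) * (norm x + norm y) powr (p - 1)"
    using quasiconcave_homogeneous_lipschitz[OF p F] by blast
  have growth: "\<bar>F w\<bar> \<le> L * norm w powr p" for w
    using L(2)[of w 0] F0 by (cases "w = 0") (auto simp: powr_diff)
  define K' where "K' = exp (2 * p) * K"
  have "(\<integral>\<^sup>+y\<in>ball x \<rho>. ennreal (F (G y)) \<partial>lborel) \<le> ennreal (K' * \<rho> powr a * N powr (p / q))"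
    if wg: "weak_gradient \<Omega> u Du" and sub: "cball z R \<subseteq> \<Omega>" and G: "integrable lborel G" "\<And>x. x \<notin> cball z R \<Longrightarrow> G x = 0"
      and ae: "AE x in lebesgue. x \<in> cball z R \<longrightarrow> G x = Du x"
      and fin: "(\<integral>\<^sup>+x. ennreal (norm (G x) powr p) \<partial>lborel) < \<infinity>" and FG: "\<And>x. F (G x) \<ge> 0"
      and \<rho>: "\<rho> > 0" and xz: "cball x (8 * \<rho>) \<subseteq> cball z R" and N: "N > 0"
      and le: "(\<integral>\<^sup>+y\<in>ball x (8 * \<rho>). ennreal (norm (G y) powr q) \<partial>lborel) \<le> ennreal N"
    for \<Omega> and u :: "real^'n \<Rightarrow> real^'m" and Du z R G x \<rho> N
  proof -
    have Gm[measurable]: "G \<in> borel_measurable borel" using G(1) by auto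
    have dR: "dist x z + 8 * \<rho> \<le> R"
      using xz \<rho> by (simp add: cball_subset_cball_iff)
    have R: "R > 0" using dR \<rho> zero_le_dist[of x z] by linarith
    have "L1_loc \<Omega> u" using wg by (simp add: weak_gradient_def)
    then have "set_integrable lebesgue (cball z R) u" using sub by (simp add: L1_loc_def)
    then obtain U :: "real^'n \<Rightarrow> real^'m" where U: "integrable lborel U" "\<And>x. x \<notin> cball z R \<Longrightarrow> U x = 0" "AE x in lebesgue. x \<in> cball z R \<longrightarrow> U x = u x"
    proof (rule borel_representative[OF closed_cball])
      fix g :: "real^'n \<Rightarrow> real^'m"
      assume "integrable lborel g" "\<And>x. x \<notin> cball z R \<Longrightarrow> g x = 0" "AE x in lebesgue. x \<in> cball z R \<longrightarrow> g x = u x"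
      then show thesis by (rule that)
    qed
    \<comment> \<open>The weight of the smooth estimate; it vanishes outside the ball of radius
      \<open>4 * \<rho>\<close>, on which the gradient of the mollified map equals the mollified
      \<open>G\<close>.\<close>
    define \<theta> where "\<theta> y = bump ((1 / (2 * \<rho>)) *\<^sub>R (y - x)) powr p" for y
    have [measurable]: "\<theta> \<in> borel_measurable borel" unfolding \<theta>_def by measurable
    have \<theta>: "0 \<le> \<theta> y" "\<theta> y \<le> 1" for y
      using p by (auto simp: \<theta>_def bump_nonneg bump_le_1 intro: powr_le1)
    have \<theta>0: "\<theta> y = 0" if "y \<notin> ball x (4 * \<rho>)" for y
    proof -
      have "norm ((1 / (2 * \<rho>)) *\<^sub>R (y - x)) \<ge> 1"
        unfolding norm_scaleR using that \<rho> by (simp add: dist_norm norm_minus_commute field_simps)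
      then have "bump ((1 / (2 * \<rho>)) *\<^sub>R (y - x)) = 0" by (simp only: bump_eq_0_iff)
      then show ?thesis by (simp add: \<theta>_def)
    qed
    obtain S where S: "(\<integral>\<^sup>+x. ennreal (norm (G x) powr p) \<partial>lborel) = ennreal S" "S \<ge> 0"
      using fin by (cases "(\<integral>\<^sup>+x. ennreal (norm (G x) powr p) \<partial>lborel)") auto
    have iG: "integrable lborel (\<lambda>y. norm (G y) powr p)" "(LINT y|lborel. norm (G y) powr p) \<le> S"
      using integrable_of_nn_integral_le[of "\<lambda>y. norm (G y) powr p" S] S by auto
    have iF: "integrable lborel (\<lambda>y. \<theta> y * F (H y))"
      if "H \<in> borel_measurable borel" "integrable lborel (\<lambda>y. norm (H y) powr p)" for H
    proof (rule Bochner_Integration.integrable_bound[where f = "\<lambda>y. L * norm (H y) powr p"])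
      show "AE y in lborel. norm (\<theta> y * F (H y)) \<le> norm (L * norm (H y) powr p)"
      proof (rule AE_I2)
        fix y
        have "\<bar>\<theta> y\<bar> * \<bar>F (H y)\<bar> \<le> 1 * (L * norm (H y) powr p)"
          using \<theta>[of y] growth by (intro mult_mono) auto
        then show "norm (\<theta> y * F (H y)) \<le> norm (L * norm (H y) powr p)" using L(1) by (simp add: abs_mult)
      qed
    qed (use that in auto)
    define I where "I = (LINT y|lborel. \<theta> y * F (G y))"
    \<comment> \<open>Chosen so that the integral of the error \<open>W\<close> below is at most
      \<open>\<kappa> * Z\<close>; it depends neither on \<open>\<kappa>\<close> nor on the
      smoothing scale.\<close>
    define Z where "Z = L * (2 powr p * (S + S) + 1)"
    have Z: "Z > 0" using L(1) S(2) by (simp add: Z_def add_nonneg_pos)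
    have step: "I \<le> K * \<rho> powr a * N powr (p / q) + \<kappa> * Z" if \<kappa>: "\<kappa> > 0" for \<kappa>
    proof -
      \<comment> \<open>The accuracy in Lp for which the second error term
        \<open>\<kappa> powr (1 - p) * e\<close> is again equal to \<open>\<kappa>\<close>.\<close>
      define e where "e = \<kappa> powr p"
      have e: "e > 0" using \<kappa> by (simp add: e_def)
      have supp: "G y = 0" if "norm (y - z) > R" for y
        using that by (intro G(2)) (simp add: dist_norm norm_minus_commute)
      obtain \<epsilon>0 where \<epsilon>0: "\<epsilon>0 > 0" "\<forall>\<epsilon> k. \<epsilon> \<le> \<epsilon>0 \<and> mollifier \<epsilon> k \<longrightarrow> (\<integral>\<^sup>+x. ennreal (norm (conv k G x - G x) powr p) \<partial>lborel) \<le> ennreal e"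
      proof -
        have "\<exists>\<epsilon>0>0. \<forall>\<epsilon> k. \<epsilon> \<le> \<epsilon>0 \<and> mollifier \<epsilon> k \<longrightarrow> (\<integral>\<^sup>+x. ennreal (norm (conv k G x - G x) powr p) \<partial>lborel) \<le> ennreal e"
          using G(1) less_imp_le[OF p] R supp fin e by (rule conv_Lp_tendsto)
        then show thesis using that by (elim exE conjE)
      qed
      \<comment> \<open>Besides accuracy, a scale of at most \<open>\<rho>\<close> keeps the
        smoothing neighbourhood of the ball of radius \<open>4 * \<rho>\<close> inside the ball of
        radius \<open>8 * \<rho>\<close>, and so inside \<open>cball z R\<close>.\<close>
      define \<epsilon> where "\<epsilon> = min \<epsilon>0 \<rho>"
      have \<epsilon>: "\<epsilon> > 0" "\<epsilon> \<le> \<epsilon>0" "\<epsilon> \<le> \<rho>" using \<epsilon>0(1) \<rho> by (auto simp: \<epsilon>_def)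
      obtain k :: "real^'n \<Rightarrow> real" where k: "mollifier \<epsilon> k" using mollifier_exists[OF \<epsilon>(1)] by blast
      note kD = mollifierD[OF k]
      define E where "E = conv k G"
      have Em[measurable]: "E \<in> borel_measurable borel" unfolding E_def by (rule conv_measurable[OF kD(6) Gm])
      have sm: "smooth (conv k U)" by (rule conv_smooth[OF kD(1,3) U(1)])
      have grad: "gradient (conv k U) y = E y" if "y \<in> ball x (4 * \<rho>)" for y
      proof -
        have "norm (y - z) \<le> dist x y + dist x z"
          using dist_triangle[of y z x] by (simp add: dist_norm norm_minus_commute)
        then have "norm (y - z) + \<epsilon> < R" using that dR \<epsilon>(3) \<rho> by simp
        with wg sub k U G ae show ?thesis
          unfolding E_def by (rule gradient_conv_weak_gradient)
      qed
      have "(\<integral>\<^sup>+y\<in>ball x (4 * \<rho>). ennreal (norm (gradient (conv k U) y) powr q) \<partial>lborel)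
          = (\<integral>\<^sup>+y\<in>ball x (4 * \<rho>). ennreal (norm (conv k G y) powr q) \<partial>lborel)"
      proof (rule nn_integral_cong)
        fix y
        show "ennreal (norm (gradient (conv k U) y) powr q) * indicator (ball x (4 * \<rho>)) y
            = ennreal (norm (conv k G y) powr q) * indicator (ball x (4 * \<rho>)) y"
          using grad[of y] by (cases "y \<in> ball x (4 * \<rho>)") (simp_all add: E_def)
      qed
      also have "\<dots> \<le> (\<integral>\<^sup>+y\<in>ball x (8 * \<rho>). ennreal (norm (G y) powr q) \<partial>lborel)"
      proof (rule conv_Lp_le[OF k G(1) q])
        fix y w assume "y \<in> ball x (4 * \<rho>)" "norm (y - w) < \<epsilon>"
        then show "w \<in> ball x (8 * \<rho>)"
          using dist_triangle[of x w y] \<epsilon>(3) \<rho> by (simp add: dist_norm)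
      qed auto
      also have "\<dots> \<le> ennreal N" by (rule le)
      finally have A: "(LINT y|lborel. \<theta> y * F (gradient (conv k U) y)) \<le> K * \<rho> powr a * N powr (p / q)"
        unfolding \<theta>_def by (rule main[OF sm \<rho> N])
      have \<theta>E: "\<theta> y * F (gradient (conv k U) y) = \<theta> y * F (E y)" for y
        using grad[of y] \<theta>0[of y] by (cases "y \<in> ball x (4 * \<rho>)") simp_all
      have "(\<integral>\<^sup>+y\<in>UNIV. ennreal (norm (conv k G y) powr p) \<partial>lborel) \<le> (\<integral>\<^sup>+y\<in>UNIV. ennreal (norm (G y) powr p) \<partial>lborel)"
        by (rule conv_Lp_le[OF k G(1) less_imp_le[OF p]]) auto
      then have "(\<integral>\<^sup>+y. ennreal (norm (E y) powr p) \<partial>lborel) \<le> ennreal S"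
        using S by (simp add: E_def)
      then have iE: "integrable lborel (\<lambda>y. norm (E y) powr p)" "(LINT y|lborel. norm (E y) powr p) \<le> S"
        using integrable_of_nn_integral_le[of "\<lambda>y. norm (E y) powr p" S] S(2) by auto
      have "(\<integral>\<^sup>+y. ennreal (norm (E y - G y) powr p) \<partial>lborel) \<le> ennreal e"
        unfolding E_def by (rule \<epsilon>0(2)[rule_format, OF conjI[OF \<epsilon>(2) k]])
      then have iD: "integrable lborel (\<lambda>y. norm (E y - G y) powr p)" "(LINT y|lborel. norm (E y - G y) powr p) \<le> e"
        using integrable_of_nn_integral_le[of "\<lambda>y. norm (E y - G y) powr p" e] e by auto
      define W where "W y = L * (\<kappa> * (2 powr p * (norm (G y) powr p + norm (E y) powr p)) + \<kappa> powr (1 - p) * norm (E y - G y) powr p)" for y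
      have pw: "\<theta> y * F (G y) \<le> \<theta> y * F (E y) + W y" for y
      proof -
        have "F (G y) - F (E y) \<le> L * norm (G y - E y) * (norm (E y) + norm (G y)) powr (p - 1)"
          using L(2)[where x = "E y" and y = "G y"] by simp
        also have "\<dots> = L * (norm (E y - G y) * (norm (G y) + norm (E y)) powr (p - 1))"
          by (simp add: norm_minus_commute add.commute)
        also have "\<dots> \<le> L * (\<kappa> * (norm (G y) + norm (E y)) powr p + \<kappa> powr (1 - p) * norm (E y - G y) powr p)"
          using L(1) \<kappa> p by (intro mult_left_mono mult_powr_le_split) auto
        also have "\<dots> \<le> W y"
          unfolding W_def using L(1) \<kappa> p by (intro mult_left_mono add_right_mono powr_add_le) auto
        finally have d: "F (G y) - F (E y) \<le> W y" .
        have "W y \<ge> 0" unfolding W_def using L(1) \<kappa> by simp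
        then have "\<theta> y * (F (G y) - F (E y)) \<le> W y"
          using mult_left_mono[OF d \<theta>(1)[of y]] mult_right_mono[OF \<theta>(2)[of y] \<open>W y \<ge> 0\<close>] by linarith
        then show ?thesis by (simp add: right_diff_distrib)
      qed
      have iW: "integrable lborel W" unfolding W_def using iG iE iD by simp
      have "(LINT y|lborel. W y) = L * (\<kappa> * (2 powr p * ((LINT y|lborel. norm (G y) powr p) + (LINT y|lborel. norm (E y) powr p)))
          + \<kappa> powr (1 - p) * (LINT y|lborel. norm (E y - G y) powr p))"
        unfolding W_def using iG iE iD by simp
      also have "\<dots> \<le> L * (\<kappa> * (2 powr p * (S + S)) + \<kappa> powr (1 - p) * e)"
        using L(1) \<kappa> iG(2) iE(2) iD(2) by (intro mult_left_mono add_mono) auto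
      also have "\<kappa> powr (1 - p) * e = \<kappa>"
        using \<kappa> by (simp add: e_def flip: powr_add)
      also have "L * (\<kappa> * (2 powr p * (S + S)) + \<kappa>) = \<kappa> * Z" by (simp add: Z_def algebra_simps)
      finally have B: "(LINT y|lborel. W y) \<le> \<kappa> * Z" .
      have "I \<le> (LINT y|lborel. \<theta> y * F (E y) + W y)"
        unfolding I_def using iF[OF Gm iG(1)] iF[OF Em iE(1)] iW pw by (intro Bochner_Integration.integral_mono) auto
      also have "\<dots> = (LINT y|lborel. \<theta> y * F (E y)) + (LINT y|lborel. W y)"
        using iF[OF Em iE(1)] iW by simp
      finally show ?thesis using A B unfolding \<theta>E by linarith
    qed
    have I: "I \<le> K * \<rho> powr a * N powr (p / q)"
    proof (rule field_le_epsilon)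
      fix e :: real assume "e > 0"
      then show "I \<le> K * \<rho> powr a * N powr (p / q) + e"
        using step[of "e / Z"] Z by simp
    qed
    \<comment> \<open>On the ball of radius \<open>\<rho>\<close> the bump has argument of norm at
      most 1/2, so the weight is at least \<open>exp (-2) powr p\<close>; the factor
      \<open>exp (2 * p)\<close> compensates it.\<close>
    have "(\<integral>\<^sup>+y\<in>ball x \<rho>. ennreal (F (G y)) \<partial>lborel) \<le> (\<integral>\<^sup>+y. ennreal (exp (2 * p) * (\<theta> y * F (G y))) \<partial>lborel)"
    proof (rule nn_integral_mono)
      fix y
      show "ennreal (F (G y)) * indicator (ball x \<rho>) y \<le> ennreal (exp (2 * p) * (\<theta> y * F (G y)))"
      proof (cases "y \<in> ball x \<rho>")
        case True
        then have "norm ((1 / (2 * \<rho>)) *\<^sub>R (y - x)) \<le> 1 / 2"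
          unfolding norm_scaleR using \<rho> by (simp add: dist_norm norm_minus_commute field_simps)
        then have "exp (-2) \<le> bump ((1 / (2 * \<rho>)) *\<^sub>R (y - x))" by (rule bump_lower)
        then have "exp (-2) powr p \<le> \<theta> y"
          unfolding \<theta>_def using p by (intro powr_mono2) auto
        then have "exp (2 * p) * exp (-2) powr p \<le> exp (2 * p) * \<theta> y" by (intro mult_left_mono) auto
        then have "1 \<le> exp (2 * p) * \<theta> y" by (simp add: powr_def mult.commute flip: exp_add)
        then have "1 * F (G y) \<le> exp (2 * p) * \<theta> y * F (G y)" using FG by (intro mult_right_mono) auto
        then show ?thesis using True by (simp add: ennreal_leI mult.assoc)
      qed simp
    qed
    also have "\<dots> = ennreal (LINT y|lborel. exp (2 * p) * (\<theta> y * F (G y)))"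
      using iF[OF Gm iG(1)] \<theta>(1) FG by (intro nn_integral_eq_integral) auto
    also have "\<dots> = ennreal (exp (2 * p) * I)" by (simp add: I_def)
    also have "\<dots> \<le> ennreal (K' * \<rho> powr a * N powr (p / q))"
      unfolding K'_def mult.assoc by (intro ennreal_leI mult_left_mono I[unfolded mult.assoc]) auto
    finally show ?thesis .
  qed
  moreover have "K' > 0" using K by (simp add: K'_def)
  ultimately show ?thesis
    unfolding q_def a_def by (rule that[rotated])
qed

subsection \<open>Level sets and covering\<close>

lemma emeasure_ball_power:
  assumes "\<rho> > 0"
  shows "emeasure lborel (ball (x :: real^'n) \<rho>) = ennreal (unit_ball_vol CARD('n) * \<rho> ^ CARD('n))"
  using assms emeasure_lborel_ball_finite[of x \<rho>] content_ball[of \<rho> x]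
  by (subst emeasure_eq_ennreal_measure) auto

text \<open>The half of Lebesgue's differentiation theorem that the covering argument requires. On
  the exceptional set \<open>E\<close> all ball means are at most \<open>l\<close> although
  \<open>f\<close> exceeds \<open>l\<close>. Covering \<open>E\<close> by disjoint balls inside an
  open set of almost the same measure bounds the integral of \<open>f\<close> over \<open>E\<close>
  by \<open>l\<close> times the measure of \<open>E\<close>, which forces \<open>E\<close> to be
  null.\<close>

lemma AE_ball_mean_gt:
  fixes f :: "real^'n \<Rightarrow> real"
  assumes f[measurable]: "f \<in> borel_measurable borel" and f0: "\<And>x. f x \<ge> 0"
    and fin: "(\<integral>\<^sup>+x. ennreal (f x) \<partial>lborel) < \<infinity>" and l: "l > 0"
  shows "AE x in lborel. l < f x \<longrightarrow> (\<exists>\<rho>>0. ennreal (l * unit_ball_vol CARD('n) * \<rho> ^ CARD('n)) < (\<integral>\<^sup>+y\<in>ball x \<rho>. ennreal (f y) \<partial>lborel))"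
proof -
  define w where "w = unit_ball_vol CARD('n)"
  have w: "w > 0" by (simp add: w_def)
  define h where "h \<rho> x = (\<integral>\<^sup>+y\<in>ball x \<rho>. ennreal (f y) \<partial>lborel)" for \<rho> x
  have hm[measurable]: "h \<rho> \<in> borel_measurable borel" for \<rho>
  proof -
    \<comment> \<open>Writing the moving ball as a condition on \<open>dist x y\<close> makes joint
      measurability in both variables visible.\<close>
    have "h \<rho> = (\<lambda>x. \<integral>\<^sup>+y. ennreal (f y) * indicator {..<\<rho>} (dist x y) \<partial>lborel)"
      unfolding h_def by (intro ext nn_integral_cong) (auto simp: indicator_def)
    also have "\<dots> \<in> borel_measurable borel" by measurable
    finally show ?thesis .
  qed
  \<comment> \<open>Only rational radii are tested, so that \<open>E\<close> is a countable
    intersection of Borel sets; a point outside \<open>E\<close> with \<open>l < f x\<close> still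
    has a good radius.\<close>
  define E where "E = {x. l < f x \<and> (\<forall>q::rat. 0 < q \<longrightarrow> h (of_rat q) x \<le> ennreal (l * w * of_rat q ^ CARD('n)))}"
  have Em[measurable]: "E \<in> sets borel" unfolding E_def by measurable
  define m where "m = measure lborel E"
  have Efin: "emeasure lborel E = ennreal m"
  proof -
    have "ennreal l * emeasure lborel E = (\<integral>\<^sup>+x. ennreal l * indicator E x \<partial>lborel)"
      by (simp add: nn_integral_cmult_indicator)
    also have "\<dots> \<le> (\<integral>\<^sup>+x. ennreal (f x) \<partial>lborel)"
      by (intro nn_integral_mono) (auto simp: E_def indicator_def intro: ennreal_leI)
    finally have "ennreal l * emeasure lborel E < \<infinity>" using fin by (rule le_less_trans)
    then have "emeasure lborel E < \<infinity>" using l by (auto simp: ennreal_mult_less_top)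
    then show ?thesis unfolding m_def by (intro emeasure_eq_ennreal_measure) auto
  qed
  have m0: "m \<ge> 0" by (simp add: m_def)
  define \<nu> where "\<nu> = density lborel (\<lambda>x. ennreal (f x))"
  have \<nu>: "emeasure \<nu> A = (\<integral>\<^sup>+x\<in>A. ennreal (f x) \<partial>lborel)" if "A \<in> sets borel" for A
    unfolding \<nu>_def using that by (subst emeasure_density) auto
  have \<nu>s: "sets \<nu> = sets borel" by (simp add: \<nu>_def)
  have key: "emeasure \<nu> E \<le> ennreal (l * (m + e))" if e: "e > 0" for e
  proof -
    \<comment> \<open>Outer regularity: the covering balls stay in \<open>T\<close>, so their total
      volume exceeds the measure of \<open>E\<close> by less than \<open>e\<close>.\<close>
    obtain T where T: "open T" "E \<subseteq> T" "T - E \<in> lmeasurable" "emeasure lebesgue (T - E) < ennreal e"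
      using sets_lebesgue_outer_open[of E e] e Em by (metis sets_completionI_sets sets_lborel)
    define X where "X i = ball (fst i) (of_rat (snd i))" for i :: "(real^'n) \<times> rat"
    define I where "I = {i. fst i \<in> E \<and> 0 < snd i \<and> X i \<subseteq> T}"
    have fine: "\<exists>i. i \<in> I \<and> x \<in> ball (fst i) (of_rat (snd i)) \<and> of_rat (snd i) < d" if x: "x \<in> E" and d: "0 < d" for x and d :: real
    proof -
      obtain \<epsilon> where \<epsilon>: "\<epsilon> > 0" "ball x \<epsilon> \<subseteq> T" using T x openE by blast
      obtain q :: rat where q: "0 < (of_rat q :: real)" "of_rat q < min d \<epsilon>"
        using of_rat_dense[of 0 "min d \<epsilon>"] d \<epsilon> by auto
      have "X (x, q) \<subseteq> ball x \<epsilon>" using q by (simp add: X_def subset_ball)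
      then have "(x, q) \<in> I" using x q \<epsilon> by (auto simp: I_def)
      then show ?thesis using q by (intro exI[of _ "(x, q)"]) auto
    qed
    obtain C where C: "countable C" "C \<subseteq> I"
      "pairwise (\<lambda>i j. disjnt (ball (fst i) (of_rat (snd i))) (ball (fst j) (of_rat (snd j)))) C"
      "negligible (E - (\<Union>i\<in>C. ball (fst i) (of_rat (snd i))))"
      by (rule Vitali_covering_theorem_balls[of E I fst "\<lambda>i. of_rat (snd i)", OF fine])
    have disj: "disjoint_family_on X C"
      using C(3) unfolding disjoint_family_on_def pairwise_def disjnt_def X_def by blast
    have Xm: "X i \<in> sets borel" for i by (simp add: X_def)
    have Um: "(\<Union>i\<in>C. X i) \<in> sets borel" using C(1) Xm by (intro sets.countable_UN') auto
    have UT: "(\<Union>i\<in>C. X i) \<subseteq> T" using C(2) by (auto simp: I_def)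
    have Tm: "T \<in> sets borel" using T(1) by simp
    have "AE x in lebesgue. x \<notin> E - (\<Union>i\<in>C. X i)"
      by (rule AE_not_in) (use C(4) in \<open>simp add: negligible_iff_null_sets X_def\<close>)
    then have ae: "AE x in lborel. x \<notin> E - (\<Union>i\<in>C. X i)" by (simp add: AE_completion_iff)
    have "emeasure \<nu> E \<le> emeasure \<nu> (\<Union>i\<in>C. X i)"
      unfolding \<nu>[OF Em] \<nu>[OF Um]
      by (rule nn_integral_mono_AE) (use ae in eventually_elim, auto simp: indicator_def)
    also have "\<dots> = (\<integral>\<^sup>+i. emeasure \<nu> (X i) \<partial>count_space C)"
      using C(1) disj Xm \<nu>s by (intro emeasure_UN_countable) auto
    also have "\<dots> \<le> (\<integral>\<^sup>+i. ennreal l * emeasure lborel (X i) \<partial>count_space C)"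
    proof (rule nn_integral_mono)
      fix i assume "i \<in> space (count_space C)"
      then have i: "fst i \<in> E" "0 < snd i" using C(2) by (auto simp: I_def)
      have "emeasure \<nu> (X i) = h (of_rat (snd i)) (fst i)" using \<nu>[OF Xm, of i] by (simp add: h_def X_def)
      also have "\<dots> \<le> ennreal (l * w * of_rat (snd i) ^ CARD('n))" using i by (auto simp: E_def)
      also have "\<dots> = ennreal l * emeasure lborel (X i)"
        using i l w unfolding X_def w_def by (subst emeasure_ball_power) (auto simp: ennreal_mult mult.assoc)
      finally show "emeasure \<nu> (X i) \<le> ennreal l * emeasure lborel (X i)" .
    qed
    also have "\<dots> = ennreal l * (\<integral>\<^sup>+i. emeasure lborel (X i) \<partial>count_space C)"
      by (rule nn_integral_cmult) simp
    also have "(\<integral>\<^sup>+i. emeasure lborel (X i) \<partial>count_space C) = emeasure lborel (\<Union>i\<in>C. X i)"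
      using C(1) disj Xm by (intro emeasure_UN_countable[symmetric]) auto
    also have "ennreal l * emeasure lborel (\<Union>i\<in>C. X i) \<le> ennreal l * (ennreal m + ennreal e)"
    proof (rule mult_left_mono)
      have "emeasure lborel (\<Union>i\<in>C. X i) \<le> emeasure lborel (E \<union> (T - E))"
        using UT T(2) Tm Em by (intro emeasure_mono) auto
      also have "\<dots> \<le> emeasure lborel E + emeasure lborel (T - E)"
        using Tm Em by (intro emeasure_subadditive) auto
      also have "emeasure lborel (T - E) = emeasure lebesgue (T - E)"
        using Tm Em by simp
      finally show "emeasure lborel (\<Union>i\<in>C. X i) \<le> ennreal m + ennreal e"
        using add_mono[OF eq_refl[OF Efin] less_imp_le[OF T(4)]] by (rule order_trans)
    qed simp
    also have "\<dots> = ennreal (l * (m + e))"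
      using m0 e l by (simp add: ennreal_mult)
    finally show ?thesis .
  qed
  \<comment> \<open>The integrated excess of \<open>f\<close> over the level. It is at most
    \<open>l * e\<close> for every \<open>e\<close>, hence zero, while its integrand is positive on
    \<open>E\<close>.\<close>
  define D where "D = (\<integral>\<^sup>+x. ennreal (f x - l) * indicator E x \<partial>lborel)"
  have split: "emeasure \<nu> E = ennreal (l * m) + D"
  proof -
    have "emeasure \<nu> E = (\<integral>\<^sup>+x. ennreal l * indicator E x + ennreal (f x - l) * indicator E x \<partial>lborel)"
      unfolding \<nu>[OF Em]
    proof (rule nn_integral_cong)
      fix x
      show "ennreal (f x) * indicator E x = ennreal l * indicator E x + ennreal (f x - l) * indicator E x"
        using l by (cases "x \<in> E") (auto simp: E_def simp flip: ennreal_plus)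
    qed
    also have "\<dots> = ennreal (l * m) + D"
      using l m0 by (subst nn_integral_add) (auto simp: D_def nn_integral_cmult_indicator Efin ennreal_mult)
    finally show ?thesis .
  qed
  have "D \<le> ennreal (l * e)" if e: "e > 0" for e
  proof -
    have "ennreal (l * m) + D \<le> ennreal (l * m) + ennreal (l * e)"
      using key[OF e] split l m0 e by (simp add: distrib_left)
    then show ?thesis by (simp add: ennreal_add_left_cancel_le)
  qed
  then have De: "D \<le> ennreal e" if "e > 0" for e
    using that l \<open>\<And>e. e > 0 \<Longrightarrow> D \<le> ennreal (l * e)\<close>[of "e / l"] by simp
  have "D = 0"
  proof (rule ccontr)
    assume "D \<noteq> 0"
    have "D < top" using le_less_trans[OF De[of 1] ennreal_less_top] by simp
    then obtain d where d: "D = ennreal d" "d > 0"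
      using \<open>D \<noteq> 0\<close> by (cases D) (auto simp: less_le)
    then show False using De[of "d / 2"] by (simp add: ennreal_le_iff)
  qed
  then have "AE x in lborel. ennreal (f x - l) * indicator E x = 0"
    unfolding D_def by (subst (asm) nn_integral_0_iff_AE) auto
  then have "AE x in lborel. x \<notin> E"
    by eventually_elim (auto simp: E_def indicator_def)
  then show ?thesis
  proof eventually_elim
    case (elim x)
    show ?case
    proof
      assume "l < f x"
      then obtain q :: rat where q: "0 < q" "\<not> h (of_rat q) x \<le> ennreal (l * w * of_rat q ^ CARD('n))"
        using elim by (auto simp: E_def)
      then show "\<exists>\<rho>>0. ennreal (l * unit_ball_vol CARD('n) * \<rho> ^ CARD('n)) < (\<integral>\<^sup>+y\<in>ball x \<rho>. ennreal (f y) \<partial>lborel)"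
        by (intro exI[of _ "of_rat q"]) (simp add: h_def w_def not_le)
    qed
  qed
qed

text \<open>Countable subadditivity with the sum written as an integral over the counting measure,
  to match \<open>emeasure_UN_countable\<close> for disjoint families.\<close>

lemma emeasure_UN_countable_le:
  assumes "countable I" "\<And>i. i \<in> I \<Longrightarrow> X i \<in> sets M"
  shows "emeasure M (\<Union>i\<in>I. X i) \<le> (\<integral>\<^sup>+i. emeasure M (X i) \<partial>count_space I)"
proof -
  have "(\<Union>i\<in>I. X i) \<in> sets M" using assms by (intro sets.countable_UN') auto
  then have "emeasure M (\<Union>i\<in>I. X i) = (\<integral>\<^sup>+x. indicator (\<Union>i\<in>I. X i) x \<partial>M)" by simp
  also have "\<dots> \<le> (\<integral>\<^sup>+x. \<integral>\<^sup>+i. indicator (X i) x \<partial>count_space I \<partial>M)"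
  proof (rule nn_integral_mono)
    fix x
    show "(indicator (\<Union>i\<in>I. X i) x :: ennreal) \<le> (\<integral>\<^sup>+i. indicator (X i) x \<partial>count_space I)"
    proof (cases "x \<in> (\<Union>i\<in>I. X i)")
      case True
      then obtain j where j: "j \<in> I" "x \<in> X j" by blast
      have "(1::ennreal) = (\<integral>\<^sup>+i. indicator {j} i \<partial>count_space I)"
        using j by simp
      also have "\<dots> \<le> (\<integral>\<^sup>+i. indicator (X i) x \<partial>count_space I)"
        using j by (intro nn_integral_mono) (auto simp: indicator_def)
      finally show ?thesis using True by simp
    qed simp
  qed
  also have "\<dots> = (\<integral>\<^sup>+i. \<integral>\<^sup>+x. indicator (X i) x \<partial>M \<partial>count_space I)"
    using assms by (intro nn_integral_count_space_nn_integral) auto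
  also have "\<dots> = (\<integral>\<^sup>+i. emeasure M (X i) \<partial>count_space I)"
    using assms by (intro nn_integral_cong) auto
  finally show ?thesis .
qed

text \<open>A bound of the mean of \<open>f\<close> by a constant times the power
  \<open>\<sigma>\<close> of the mean of \<open>\<psi>\<close> on the ball eight times as large,
  with the volumes collected in the power of \<open>\<rho>\<close>. In the application
  \<open>f\<close> is \<open>F (D u)\<close>, \<open>\<psi>\<close> is the power
  \<open>p / \<sigma>\<close> of the norm of the gradient. The real bound \<open>N\<close> replaces
  a power of an extended real.\<close>

definition reverse_hoelder_on :: "real^'n \<Rightarrow> real \<Rightarrow> real \<Rightarrow> real \<Rightarrow> (real^'n \<Rightarrow> real) \<Rightarrow> (real^'n \<Rightarrow> real) \<Rightarrow> bool"
  where "reverse_hoelder_on z R \<sigma> K f \<psi> \<longleftrightarrow>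
    (\<forall>x \<rho> N. \<rho> > 0 \<and> cball x (8 * \<rho>) \<subseteq> cball z R \<and> N > 0 \<and> (\<integral>\<^sup>+y\<in>ball x (8 * \<rho>). ennreal (\<psi> y) \<partial>lborel) \<le> ennreal N \<longrightarrow>
       (\<integral>\<^sup>+y\<in>ball x \<rho>. ennreal (f y) \<partial>lborel) \<le> ennreal (K * \<rho> powr (real CARD('n) * (1 - \<sigma>)) * N powr \<sigma>))"

text \<open>At almost every point of the level set there is a largest scale, up to a factor 2, at which the
  mean of \<open>f\<close> exceeds \<open>l\<close>; at eight times that scale the mean is at most \<open>l\<close>, and the reverse Hoelder
  inequality bounds the mean of \<open>\<psi>\<close> there from below.\<close>

lemma level_set_estimate:
  fixes f \<psi> :: "real^'n \<Rightarrow> real" and z :: "real^'n"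
  defines "n \<equiv> CARD('n)" and "w \<equiv> unit_ball_vol CARD('n)"
  assumes f[measurable]: "f \<in> borel_measurable borel" and f0: "\<And>x. f x \<ge> 0"
    and \<psi>[measurable]: "\<psi> \<in> borel_measurable borel" and \<psi>0: "\<And>x. \<psi> x \<ge> 0"
    and I: "(\<integral>\<^sup>+x. ennreal (f x) \<partial>lborel) \<le> ennreal I"
    and \<sigma>: "\<sigma> > 1" and K: "K > 0" and RH: "reverse_hoelder_on z R \<sigma> K f \<psi>"
    and r: "r1 < r2" "r2 \<le> R" and l: "l > 0" "I * 48 ^ n \<le> l * w * (r2 - r1) ^ n"
  shows "(\<integral>\<^sup>+x\<in>{x \<in> ball z r1. l < f x}. ennreal (f x) \<partial>lborel)
    \<le> ennreal (2 * w * 48 ^ n * (K / w) powr (1 / \<sigma>) * l powr (1 - 1 / \<sigma>)) *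
      (\<integral>\<^sup>+x\<in>{x \<in> ball z r2. (w / K) powr (1 / \<sigma>) / (2 * w * 8 ^ n) * l powr (1 / \<sigma>) < \<psi> x}. ennreal (\<psi> x) \<partial>lborel)"
proof -
  have w: "w > 0" by (simp add: w_def)
  have n: "n > 0" by (simp add: n_def)
  define P where "P x \<rho> \<longleftrightarrow> \<rho> > 0 \<and> ennreal (l * w * \<rho> ^ n) < (\<integral>\<^sup>+y\<in>ball x \<rho>. ennreal (f y) \<partial>lborel)" for x \<rho>
  define S where "S = {x \<in> ball z r1. l < f x \<and> (\<exists>\<rho>. P x \<rho>)}"
  \<comment> \<open>The covering sets have radius \<open>5 * (8 * \<rho>)\<close>, enlarged to the
    open ball of radius \<open>48 * \<rho>\<close>. The lower bound on \<open>l\<close> is what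
    forces every admissible \<open>\<rho>\<close> below \<open>d\<close>.\<close>
  define d where "d = (r2 - r1) / 48"
  \<comment> \<open>Solves \<open>K * \<mu> powr \<sigma> = l * w\<close>: a mass of
    \<open>\<psi>\<close> at most \<open>\<mu> * \<rho> ^ n\<close> near a point would force the
    mean of \<open>f\<close> down to \<open>l\<close>.\<close>
  define \<mu> where "\<mu> = (l * w / K) powr (1 / \<sigma>)"
  \<comment> \<open>The values of \<open>\<psi>\<close> below \<open>t\<close> contribute at most
    half of \<open>\<mu> * \<rho> ^ n\<close> on the ball of radius \<open>8 * \<rho>\<close>, so
    the values above \<open>t\<close> carry at least the other half.\<close>
  define t where "t = \<mu> / (2 * w * 8 ^ n)"
  have \<mu>: "\<mu> > 0" using l w K by (simp add: \<mu>_def)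
  have t: "t > 0" using \<mu> w by (simp add: t_def)
  define \<nu>f where "\<nu>f = density lborel (\<lambda>x. ennreal (f x))"
  define \<nu>\<psi> where "\<nu>\<psi> = density lborel (\<lambda>x. ennreal (\<psi> x))"
  have \<nu>f: "emeasure \<nu>f A = (\<integral>\<^sup>+x\<in>A. ennreal (f x) \<partial>lborel)" if "A \<in> sets borel" for A
    unfolding \<nu>f_def using that by (subst emeasure_density) auto
  have \<nu>\<psi>: "emeasure \<nu>\<psi> A = (\<integral>\<^sup>+x\<in>A. ennreal (\<psi> x) \<partial>lborel)" if "A \<in> sets borel" for A
    unfolding \<nu>\<psi>_def using that by (subst emeasure_density) auto
  have sf: "sets \<nu>f = sets borel" "sets \<nu>\<psi> = sets borel" by (simp_all add: \<nu>f_def \<nu>\<psi>_def)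
  have Pd: "\<rho> < d" if "P x \<rho>" for x \<rho>
  proof -
    have "(\<integral>\<^sup>+y\<in>ball x \<rho>. ennreal (f y) \<partial>lborel) \<le> (\<integral>\<^sup>+y. ennreal (f y) \<partial>lborel)"
      by (intro nn_integral_mono) (auto simp: indicator_def)
    then have "ennreal (l * w * \<rho> ^ n) < ennreal I" using that I by (auto simp: P_def)
    moreover have "0 \<le> l * w * \<rho> ^ n" using that l w by (simp add: P_def)
    ultimately have "l * w * \<rho> ^ n < I" by (simp add: ennreal_less_iff)
    also have "I \<le> l * w * d ^ n" using l by (simp add: d_def power_divide field_simps)
    finally have "\<rho> ^ n < d ^ n" using l w by simp
    then show ?thesis using r by (intro power_less_imp_less_base[of \<rho> n d]) (auto simp: d_def)
  qed
  \<comment> \<open>The supremum of the admissible radii need not be attained; a radius above half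
    of it serves instead.\<close>
  have "\<exists>\<rho>. P x \<rho> \<and> (\<forall>r'\<ge>2 * \<rho>. \<not> P x r')" if x: "x \<in> S" for x
  proof -
    define A where "A = {\<rho>. P x \<rho>}"
    obtain \<rho>0 where \<rho>0: "\<rho>0 \<in> A" "\<rho>0 > 0" using x by (auto simp: S_def A_def P_def)
    have bA: "bdd_above A" using Pd by (auto simp: A_def intro!: bdd_aboveI[of _ d] less_imp_le)
    have "\<rho>0 \<le> Sup A" using \<rho>0 bA by (intro cSup_upper)
    then have "Sup A / 2 < Sup A" using \<rho>0 by simp
    then obtain \<rho> where \<rho>: "\<rho> \<in> A" "Sup A / 2 < \<rho>" using less_cSupD[of A] \<rho>0 by blast
    have "\<not> P x r'" if "r' \<ge> 2 * \<rho>" for r'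
      using cSup_upper[of r' A] bA that \<rho>(2) by (auto simp: A_def)
    then show ?thesis using \<rho> by (auto simp: A_def)
  qed
  then obtain \<rho> where \<rho>: "\<And>x. x \<in> S \<Longrightarrow> P x (\<rho> x)" "\<And>x r'. x \<in> S \<Longrightarrow> r' \<ge> 2 * \<rho> x \<Longrightarrow> \<not> P x r'"
    by metis
  have \<rho>0: "\<rho> x > 0" if "x \<in> S" for x using \<rho>(1)[OF that] by (simp add: P_def)
  obtain C where C: "countable C" "C \<subseteq> S"
    "pairwise (\<lambda>i j. disjnt (cball i (8 * \<rho> i)) (cball j (8 * \<rho> j))) C"
    "S \<subseteq> (\<Union>i\<in>C. cball i (5 * (8 * \<rho> i)))"
  proof (rule Vitali_covering_lemma_cballs[where S = S and K = S and a = "\<lambda>i. i" and r = "\<lambda>i. 8 * \<rho> i" and B = "8 * d"])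
    show "S \<subseteq> (\<Union>i\<in>S. cball i (8 * \<rho> i))" using \<rho>0 by (force intro: less_imp_le)
    show "0 < 8 * \<rho> i \<and> 8 * \<rho> i \<le> 8 * d" if "i \<in> S" for i
      using \<rho>0[OF that] Pd[OF \<rho>(1)[OF that]] by simp
    fix C assume "countable C" "C \<subseteq> S"
      "pairwise (\<lambda>i j. disjnt (cball i (8 * \<rho> i)) (cball j (8 * \<rho> j))) C"
      "S \<subseteq> (\<Union>i\<in>C. cball i (5 * (8 * \<rho> i)))"
    then show thesis by (rule that)
  qed
  define Y where "Y i = {x \<in> ball i (8 * \<rho> i). t < \<psi> x}" for i
  have Ym: "Y i \<in> sets borel" for i
  proof -
    have "Y i = ball i (8 * \<rho> i) \<inter> {x. t < \<psi> x}" by (auto simp: Y_def)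
    also have "\<dots> \<in> sets borel" by (intro sets.Int) auto
    finally show ?thesis .
  qed
  have small: "ennreal (\<rho> i ^ n) \<le> ennreal (2 / \<mu>) * emeasure \<nu>\<psi> (Y i)" if i: "i \<in> S" for i
  proof -
    have pos: "\<rho> i > 0" by (rule \<rho>0[OF i])
    have di: "dist z i < r1" using i by (simp add: S_def)
    have sub: "cball i (8 * \<rho> i) \<subseteq> cball z R"
      using di Pd[OF \<rho>(1)[OF i]] r pos by (simp add: cball_subset_cball_iff d_def dist_commute)
    \<comment> \<open>The contrapositive of the reverse Hoelder hypothesis at a radius where the
      mean of \<open>f\<close> exceeds \<open>l\<close>.\<close>
    have big: "ennreal (\<mu> * \<rho> i ^ n) \<le> (\<integral>\<^sup>+y\<in>ball i (8 * \<rho> i). ennreal (\<psi> y) \<partial>lborel)"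
    proof (rule ccontr)
      assume "\<not> ?thesis"
      then have "(\<integral>\<^sup>+y\<in>ball i (8 * \<rho> i). ennreal (\<psi> y) \<partial>lborel) \<le> ennreal (\<mu> * \<rho> i ^ n)" by simp
      then have "(\<integral>\<^sup>+y\<in>ball i (\<rho> i). ennreal (f y) \<partial>lborel) \<le> ennreal (K * \<rho> i powr (real n * (1 - \<sigma>)) * (\<mu> * \<rho> i ^ n) powr \<sigma>)"
        using RH pos sub \<mu> unfolding reverse_hoelder_on_def n_def by auto
      also have "K * \<rho> i powr (real n * (1 - \<sigma>)) * (\<mu> * \<rho> i ^ n) powr \<sigma> = l * w * \<rho> i ^ n"
      proof -
        have "\<mu> powr \<sigma> = l * w / K" using \<sigma> l w K by (simp add: \<mu>_def powr_powr)
        moreover have "(\<rho> i ^ n) powr \<sigma> = \<rho> i powr (real n * \<sigma>)"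
          using pos by (simp add: powr_powr flip: powr_realpow)
        moreover have "\<rho> i powr (real n * (1 - \<sigma>)) * \<rho> i powr (real n * \<sigma>) = \<rho> i ^ n"
          using pos by (simp add: algebra_simps powr_realpow flip: powr_add)
        moreover have "(\<mu> * \<rho> i ^ n) powr \<sigma> = \<mu> powr \<sigma> * (\<rho> i ^ n) powr \<sigma>"
          using \<mu> pos by (simp add: powr_mult)
        ultimately show ?thesis using K by (simp add: mult.left_commute)
      qed
      finally have "(\<integral>\<^sup>+y\<in>ball i (\<rho> i). ennreal (f y) \<partial>lborel) \<le> ennreal (l * w * \<rho> i ^ n)" .
      then show False using \<rho>(1)[OF i] unfolding P_def by (meson leD)
    qed
    have "(\<integral>\<^sup>+y\<in>ball i (8 * \<rho> i). ennreal (\<psi> y) \<partial>lborel) \<le> (\<integral>\<^sup>+y. ennreal t * indicator (ball i (8 * \<rho> i)) y + ennreal (\<psi> y) * indicator (Y i) y \<partial>lborel)"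
      by (intro nn_integral_mono) (auto simp: indicator_def Y_def not_less intro: ennreal_leI)
    also have "\<dots> = ennreal t * emeasure lborel (ball i (8 * \<rho> i)) + emeasure \<nu>\<psi> (Y i)"
    proof -
      have 1: "(\<lambda>y. ennreal t * indicator (ball i (8 * \<rho> i)) y) \<in> borel_measurable lborel"
        by (intro borel_measurable_times_ennreal borel_measurable_indicator) auto
      have 2: "(\<lambda>y. ennreal (\<psi> y) * indicator (Y i) y) \<in> borel_measurable lborel"
        using Ym by (intro borel_measurable_times_ennreal borel_measurable_indicator) auto
      show ?thesis
        by (simp add: nn_integral_add[OF 1 2] nn_integral_cmult_indicator \<nu>\<psi>[OF Ym])
    qed
    also have "ennreal t * emeasure lborel (ball i (8 * \<rho> i)) = ennreal (\<mu> * \<rho> i ^ n / 2)"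
    proof -
      have e: "t * (w * (8 * \<rho> i) ^ n) = \<mu> * \<rho> i ^ n / 2" using w by (simp add: t_def power_mult_distrib)
      have "ennreal t * emeasure lborel (ball i (8 * \<rho> i)) = ennreal (t * (w * (8 * \<rho> i) ^ n))"
        using pos t w unfolding w_def n_def by (subst emeasure_ball_power) (auto simp: ennreal_mult)
      then show ?thesis unfolding e .
    qed
    finally have le: "ennreal (\<mu> * \<rho> i ^ n) \<le> ennreal (\<mu> * \<rho> i ^ n / 2) + emeasure \<nu>\<psi> (Y i)"
      using big by (rule order_trans[rotated])
    show ?thesis
    proof (cases "emeasure \<nu>\<psi> (Y i)")
      case (real j)
      then have "ennreal (\<mu> * \<rho> i ^ n) \<le> ennreal (\<mu> * \<rho> i ^ n / 2 + j)"
        using le \<mu> pos by simp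
      then have "\<mu> * \<rho> i ^ n \<le> \<mu> * \<rho> i ^ n / 2 + j"
        using \<mu> pos real by (subst (asm) ennreal_le_iff) auto
      then have "\<rho> i ^ n \<le> 2 / \<mu> * j" using \<mu> by (simp add: field_simps)
      then show ?thesis using real \<mu> by (simp add: ennreal_leI flip: ennreal_mult)
    next
      case top
      then show ?thesis using \<mu> by (simp add: ennreal_mult_top)
    qed
  qed
  have "AE x in lborel. l < f x \<longrightarrow> (\<exists>\<rho>>0. ennreal (l * w * \<rho> ^ n) < (\<integral>\<^sup>+y\<in>ball x \<rho>. ennreal (f y) \<partial>lborel))"
    unfolding w_def n_def using I by (intro AE_ball_mean_gt f f0 l(1)) (auto intro: le_less_trans)
  then have "AE x in lborel. x \<in> {x \<in> ball z r1. l < f x} \<longrightarrow> x \<in> (\<Union>i\<in>C. cball i (5 * (8 * \<rho> i)))"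
  proof eventually_elim
    case (elim x)
    show ?case
    proof
      assume "x \<in> {x \<in> ball z r1. l < f x}"
      then have "x \<in> S" using elim by (auto simp: S_def P_def)
      then show "x \<in> (\<Union>i\<in>C. cball i (5 * (8 * \<rho> i)))" using C(4) by blast
    qed
  qed
  then have "(\<integral>\<^sup>+x\<in>{x \<in> ball z r1. l < f x}. ennreal (f x) \<partial>lborel) \<le> (\<integral>\<^sup>+x\<in>(\<Union>i\<in>C. cball i (5 * (8 * \<rho> i))). ennreal (f x) \<partial>lborel)"
    by (intro nn_integral_mono_AE) (auto simp: indicator_def)
  also have "\<dots> = emeasure \<nu>f (\<Union>i\<in>C. cball i (5 * (8 * \<rho> i)))"
    using C(1) by (intro \<nu>f[symmetric] sets.countable_UN') auto
  also have "\<dots> \<le> (\<integral>\<^sup>+i. emeasure \<nu>f (cball i (5 * (8 * \<rho> i))) \<partial>count_space C)"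
    using C(1) sf by (intro emeasure_UN_countable_le) auto
  \<comment> \<open>Upper and lower scale meet here: the mean of \<open>f\<close> over the large
    ball is at most \<open>l\<close>, while the volume is bounded by the mass of
    \<open>\<psi>\<close> on \<open>Y i\<close>. These sets are disjoint, so their masses can be
    summed.\<close>
  also have "\<dots> \<le> (\<integral>\<^sup>+i. ennreal (l * w * 48 ^ n * (2 / \<mu>)) * emeasure \<nu>\<psi> (Y i) \<partial>count_space C)"
  proof (rule nn_integral_mono)
    fix i assume "i \<in> space (count_space C)"
    then have i: "i \<in> S" using C(2) by auto
    have pos: "\<rho> i > 0" by (rule \<rho>0[OF i])
    have "emeasure \<nu>f (cball i (5 * (8 * \<rho> i))) \<le> emeasure \<nu>f (ball i (48 * \<rho> i))"
      using pos sf by (intro emeasure_mono) auto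
    also have "\<dots> \<le> ennreal (l * w * (48 * \<rho> i) ^ n)"
      using \<rho>(2)[OF i, of "48 * \<rho> i"] pos by (simp add: \<nu>f P_def not_less)
    also have "\<dots> = ennreal (l * w * 48 ^ n) * ennreal (\<rho> i ^ n)"
      using l w pos by (simp add: power_mult_distrib mult.assoc flip: ennreal_mult)
    also have "\<dots> \<le> ennreal (l * w * 48 ^ n) * (ennreal (2 / \<mu>) * emeasure \<nu>\<psi> (Y i))"
      by (intro mult_left_mono small[OF i]) simp
    also have "\<dots> = ennreal (l * w * 48 ^ n * (2 / \<mu>)) * emeasure \<nu>\<psi> (Y i)"
      using l w \<mu> by (simp add: mult.assoc[symmetric] ennreal_mult[symmetric])
    finally show "emeasure \<nu>f (cball i (5 * (8 * \<rho> i))) \<le> ennreal (l * w * 48 ^ n * (2 / \<mu>)) * emeasure \<nu>\<psi> (Y i)" .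
  qed
  also have "\<dots> = ennreal (l * w * 48 ^ n * (2 / \<mu>)) * (\<integral>\<^sup>+i. emeasure \<nu>\<psi> (Y i) \<partial>count_space C)"
    by (rule nn_integral_cmult) simp
  also have "(\<integral>\<^sup>+i. emeasure \<nu>\<psi> (Y i) \<partial>count_space C) = emeasure \<nu>\<psi> (\<Union>i\<in>C. Y i)"
  proof (rule emeasure_UN_countable[symmetric])
    show "disjoint_family_on Y C"
      unfolding disjoint_family_on_def
    proof (intro ballI impI)
      fix i j assume "i \<in> C" "j \<in> C" "i \<noteq> j"
      then have "cball i (8 * \<rho> i) \<inter> cball j (8 * \<rho> j) = {}"
        using C(3) by (auto simp: pairwise_def disjnt_def)
      moreover have "Y i \<subseteq> cball i (8 * \<rho> i)" "Y j \<subseteq> cball j (8 * \<rho> j)" by (auto simp: Y_def)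
      ultimately show "Y i \<inter> Y j = {}" by blast
    qed
  qed (use C(1) Ym sf in auto)
  also have "ennreal (l * w * 48 ^ n * (2 / \<mu>)) * emeasure \<nu>\<psi> (\<Union>i\<in>C. Y i)
      \<le> ennreal (l * w * 48 ^ n * (2 / \<mu>)) * emeasure \<nu>\<psi> (ball z r2 \<inter> {x. t < \<psi> x})"
  proof (intro mult_left_mono emeasure_mono)
    show "(\<Union>i\<in>C. Y i) \<subseteq> ball z r2 \<inter> {x. t < \<psi> x}"
    proof (intro UN_least subsetI)
      fix i x assume i: "i \<in> C" and x: "x \<in> Y i"
      then have iS: "i \<in> S" using C(2) by blast
      have "dist z x \<le> dist z i + dist i x" by (rule dist_triangle)
      moreover have "dist z i < r1" "\<rho> i < d" "\<rho> i > 0" "dist i x < 8 * \<rho> i"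
        using iS Pd[OF \<rho>(1)[OF iS]] \<rho>0[OF iS] x by (auto simp: S_def Y_def)
      ultimately show "x \<in> ball z r2 \<inter> {x. t < \<psi> x}" using x r by (simp add: d_def Y_def)
    qed
  qed (simp_all add: sf)
  also have "emeasure \<nu>\<psi> (ball z r2 \<inter> {x. t < \<psi> x}) = (\<integral>\<^sup>+x\<in>ball z r2 \<inter> {x. t < \<psi> x}. ennreal (\<psi> x) \<partial>lborel)"
    by (intro \<nu>\<psi> sets.Int) auto
  also have "ball z r2 \<inter> {x. t < \<psi> x} = {x \<in> ball z r2. (w / K) powr (1 / \<sigma>) / (2 * w * 8 ^ n) * l powr (1 / \<sigma>) < \<psi> x}"
  proof -
    have "\<mu> = (w / K) powr (1 / \<sigma>) * l powr (1 / \<sigma>)"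
      using l w K by (simp add: \<mu>_def mult.commute flip: powr_mult)
    then show ?thesis by (auto simp: t_def)
  qed
  also have "l * w * 48 ^ n * (2 / \<mu>) = 2 * w * 48 ^ n * (K / w) powr (1 / \<sigma>) * l powr (1 - 1 / \<sigma>)"
  proof -
    have e1: "1 / \<mu> = (K / w) powr (1 / \<sigma>) * l powr (- (1 / \<sigma>))"
      using l w K by (simp add: \<mu>_def powr_divide powr_mult powr_minus field_simps)
    have e2: "l * l powr (- (1 / \<sigma>)) = l powr (1 - 1 / \<sigma>)"
      using l by (simp add: powr_diff powr_minus divide_inverse)
    have "l * w * 48 ^ n * (2 / \<mu>) = 2 * w * 48 ^ n * (l * (1 / \<mu>))" by simp
    also have "\<dots> = 2 * w * 48 ^ n * (K / w) powr (1 / \<sigma>) * (l * l powr (- (1 / \<sigma>)))"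
      unfolding e1 by (simp add: mult_ac)
    finally show ?thesis unfolding e2 .
  qed
  finally show ?thesis .
qed

subsection \<open>Integration over the levels\<close>

text \<open>The level inequality is integrated against \<open>w l\<close> over \<open>L\<close>, and
  Tonelli on both sides turns the level sets into inner integrals over the levels at a fixed
  point.\<close>

lemma layer_cake_estimate:
  fixes f \<psi> :: "'a::euclidean_space \<Rightarrow> real" and w k b :: "real \<Rightarrow> real"
  assumes [measurable]: "f \<in> borel_measurable borel" "\<psi> \<in> borel_measurable borel" "A \<in> sets borel" "B \<in> sets borel"
    "L \<in> sets borel" "w \<in> borel_measurable borel" "k \<in> borel_measurable borel" "b \<in> borel_measurable borel"
    and le: "\<And>l. l \<in> L \<Longrightarrow> (\<integral>\<^sup>+x\<in>{x \<in> A. l < f x}. ennreal (f x) \<partial>lborel) \<le> ennreal (k l) * (\<integral>\<^sup>+x\<in>{x \<in> B. b l < \<psi> x}. ennreal (\<psi> x) \<partial>lborel)"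
  shows "(\<integral>\<^sup>+x\<in>A. ennreal (f x) * (\<integral>\<^sup>+l\<in>L \<inter> {l. l < f x}. ennreal (w l) \<partial>lborel) \<partial>lborel)
    \<le> (\<integral>\<^sup>+x\<in>B. ennreal (\<psi> x) * (\<integral>\<^sup>+l\<in>L \<inter> {l. b l < \<psi> x}. ennreal (w l) * ennreal (k l) \<partial>lborel) \<partial>lborel)"
proof -
  have indL: "indicator (L \<inter> {l. l < s}) l = (indicator L l * indicator {..<s} l :: ennreal)" for s l
    by (auto simp: indicator_def)
  have indB: "indicator (L \<inter> {l. b l < s}) l = (indicator L l * indicator {..<s} (b l) :: ennreal)" for s l
    by (auto simp: indicator_def)
  have indA: "indicator {x \<in> A. l < f x} x = (indicator A x * indicator {..<f x} l :: ennreal)" for x l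
    by (auto simp: indicator_def)
  have indC: "indicator {x \<in> B. b l < \<psi> x} x = (indicator B x * indicator {..<\<psi> x} (b l) :: ennreal)" for x l
    by (auto simp: indicator_def)
  have i1: "(\<lambda>(x, l). indicator {..<f x} l :: ennreal) \<in> borel_measurable (lborel \<Otimes>\<^sub>M lborel)"
  proof -
    have "(\<lambda>(x, l). indicator {..<f x} l :: ennreal) = (\<lambda>p. indicator {0<..} (f (fst p) - snd p))"
      by (auto simp: indicator_def fun_eq_iff)
    also have "\<dots> \<in> borel_measurable (lborel \<Otimes>\<^sub>M lborel)" by measurable
    finally show ?thesis .
  qed
  have i2: "(\<lambda>(x, l). indicator {..<\<psi> x} (b l) :: ennreal) \<in> borel_measurable (lborel \<Otimes>\<^sub>M lborel)"
  proof -
    have "(\<lambda>(x, l). indicator {..<\<psi> x} (b l) :: ennreal) = (\<lambda>p. indicator {0<..} (\<psi> (fst p) - b (snd p)))"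
      by (auto simp: indicator_def fun_eq_iff)
    also have "\<dots> \<in> borel_measurable (lborel \<Otimes>\<^sub>M lborel)" by measurable
    finally show ?thesis .
  qed
  have m1: "(\<lambda>(x, l). ennreal (f x) * indicator A x * (ennreal (w l) * indicator L l) * indicator {..<f x} l) \<in> borel_measurable (lborel \<Otimes>\<^sub>M lborel)"
    using i1 unfolding split_beta by measurable
  have m2: "(\<lambda>(x, l). ennreal (\<psi> x) * indicator B x * (ennreal (w l) * ennreal (k l) * indicator L l) * indicator {..<\<psi> x} (b l)) \<in> borel_measurable (lborel \<Otimes>\<^sub>M lborel)"
    using i2 unfolding split_beta by measurable
  have s1: "(\<lambda>l. indicator {..<f x} l :: ennreal) \<in> borel_measurable lborel" for x by measurable
  have s2: "(\<lambda>l. indicator {..<\<psi> x} (b l) :: ennreal) \<in> borel_measurable lborel" for x by measurable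
  have s3: "(\<lambda>x. indicator {..<f x} l :: ennreal) \<in> borel_measurable lborel" for l
    using measurable_compose[OF measurable_Pair2'[of l lborel lborel] i1] by simp
  have s4: "(\<lambda>x. indicator {..<\<psi> x} (b l) :: ennreal) \<in> borel_measurable lborel" for l
    using measurable_compose[OF measurable_Pair2'[of l lborel lborel] i2] by simp
  have "(\<integral>\<^sup>+x\<in>A. ennreal (f x) * (\<integral>\<^sup>+l\<in>L \<inter> {l. l < f x}. ennreal (w l) \<partial>lborel) \<partial>lborel)
      = (\<integral>\<^sup>+x. \<integral>\<^sup>+l. ennreal (f x) * indicator A x * (ennreal (w l) * indicator L l) * indicator {..<f x} l \<partial>lborel \<partial>lborel)"
  proof (rule nn_integral_cong)
    fix x
    have "(\<integral>\<^sup>+l. ennreal (f x) * indicator A x * (ennreal (w l) * indicator L l) * indicator {..<f x} l \<partial>lborel)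
        = (\<integral>\<^sup>+l. (ennreal (f x) * indicator A x) * ((ennreal (w l) * indicator L l) * indicator {..<f x} l) \<partial>lborel)"
      by (simp only: mult.assoc)
    also have "\<dots> = (ennreal (f x) * indicator A x) * (\<integral>\<^sup>+l. (ennreal (w l) * indicator L l) * indicator {..<f x} l \<partial>lborel)"
      by (rule nn_integral_cmult) (use s1 in measurable)
    finally show "ennreal (f x) * (\<integral>\<^sup>+l\<in>L \<inter> {l. l < f x}. ennreal (w l) \<partial>lborel) * indicator A x
        = (\<integral>\<^sup>+l. ennreal (f x) * indicator A x * (ennreal (w l) * indicator L l) * indicator {..<f x} l \<partial>lborel)"
      unfolding indL by (simp only: mult.assoc mult.commute[of _ "indicator A x"])
  qed
  also have "\<dots> = (\<integral>\<^sup>+l. \<integral>\<^sup>+x. ennreal (f x) * indicator A x * (ennreal (w l) * indicator L l) * indicator {..<f x} l \<partial>lborel \<partial>lborel)"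
    by (rule lborel_pair.Fubini'[OF m1, symmetric])
  also have "\<dots> \<le> (\<integral>\<^sup>+l. \<integral>\<^sup>+x. ennreal (\<psi> x) * indicator B x * (ennreal (w l) * ennreal (k l) * indicator L l) * indicator {..<\<psi> x} (b l) \<partial>lborel \<partial>lborel)"
  proof (rule nn_integral_mono)
    fix l
    have "(\<integral>\<^sup>+x. ennreal (f x) * indicator A x * (ennreal (w l) * indicator L l) * indicator {..<f x} l \<partial>lborel)
        = (\<integral>\<^sup>+x. (ennreal (w l) * indicator L l) * (ennreal (f x) * indicator {x \<in> A. l < f x} x) \<partial>lborel)"
      unfolding indA by (simp only: mult_ac)
    also have "\<dots> = (ennreal (w l) * indicator L l) * (\<integral>\<^sup>+x\<in>{x \<in> A. l < f x}. ennreal (f x) \<partial>lborel)"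
      unfolding indA by (rule nn_integral_cmult) (use s3 in measurable)
    also have "\<dots> \<le> (ennreal (w l) * indicator L l) * (ennreal (k l) * (\<integral>\<^sup>+x\<in>{x \<in> B. b l < \<psi> x}. ennreal (\<psi> x) \<partial>lborel))"
      using le[of l] by (cases "l \<in> L") (auto intro: mult_left_mono)
    also have "\<dots> = (ennreal (w l) * indicator L l * ennreal (k l)) * (\<integral>\<^sup>+x\<in>{x \<in> B. b l < \<psi> x}. ennreal (\<psi> x) \<partial>lborel)"
      by (simp only: mult.assoc)
    also have "\<dots> = (\<integral>\<^sup>+x. (ennreal (w l) * indicator L l * ennreal (k l)) * (ennreal (\<psi> x) * indicator {x \<in> B. b l < \<psi> x} x) \<partial>lborel)"
      unfolding indC by (rule nn_integral_cmult[symmetric]) (use s4 in measurable)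
    also have "\<dots> = (\<integral>\<^sup>+x. ennreal (\<psi> x) * indicator B x * (ennreal (w l) * ennreal (k l) * indicator L l) * indicator {..<\<psi> x} (b l) \<partial>lborel)"
      unfolding indC by (simp only: mult_ac)
    finally show "(\<integral>\<^sup>+x. ennreal (f x) * indicator A x * (ennreal (w l) * indicator L l) * indicator {..<f x} l \<partial>lborel)
        \<le> (\<integral>\<^sup>+x. ennreal (\<psi> x) * indicator B x * (ennreal (w l) * ennreal (k l) * indicator L l) * indicator {..<\<psi> x} (b l) \<partial>lborel)" .
  qed
  also have "\<dots> = (\<integral>\<^sup>+x. \<integral>\<^sup>+l. ennreal (\<psi> x) * indicator B x * (ennreal (w l) * ennreal (k l) * indicator L l) * indicator {..<\<psi> x} (b l) \<partial>lborel \<partial>lborel)"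
    by (rule lborel_pair.Fubini'[OF m2])
  also have "\<dots> = (\<integral>\<^sup>+x\<in>B. ennreal (\<psi> x) * (\<integral>\<^sup>+l\<in>L \<inter> {l. b l < \<psi> x}. ennreal (w l) * ennreal (k l) \<partial>lborel) \<partial>lborel)"
  proof (rule nn_integral_cong)
    fix x
    have "(\<integral>\<^sup>+l. ennreal (\<psi> x) * indicator B x * (ennreal (w l) * ennreal (k l) * indicator L l) * indicator {..<\<psi> x} (b l) \<partial>lborel)
        = (\<integral>\<^sup>+l. (ennreal (\<psi> x) * indicator B x) * ((ennreal (w l) * ennreal (k l)) * (indicator L l * indicator {..<\<psi> x} (b l))) \<partial>lborel)"
      by (simp only: mult.assoc)
    also have "\<dots> = (ennreal (\<psi> x) * indicator B x) * (\<integral>\<^sup>+l. (ennreal (w l) * ennreal (k l)) * (indicator L l * indicator {..<\<psi> x} (b l)) \<partial>lborel)"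
      by (rule nn_integral_cmult) (use s2 in measurable)
    finally show "(\<integral>\<^sup>+l. ennreal (\<psi> x) * indicator B x * (ennreal (w l) * ennreal (k l) * indicator L l) * indicator {..<\<psi> x} (b l) \<partial>lborel)
        = ennreal (\<psi> x) * (\<integral>\<^sup>+l\<in>L \<inter> {l. b l < \<psi> x}. ennreal (w l) * ennreal (k l) \<partial>lborel) * indicator B x"
      unfolding indB by (simp only: mult.assoc mult.commute[of _ "indicator B x"])
  qed
  finally show ?thesis .
qed

lemma nn_integral_powr:
  fixes a b k :: real
  assumes "0 < a" "a \<le> b" "k > 0"
  shows "(\<integral>\<^sup>+l\<in>{a..b}. ennreal (l powr (k - 1)) \<partial>lborel) = ennreal (b powr k / k - a powr k / k)"
  by (rule nn_integral_FTC_Icc[where F = "\<lambda>x. x powr k / k"])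
    (use assms in \<open>auto intro!: derivative_eq_intros\<close>)

lemma nn_integral_inverse:
  fixes a b :: real
  assumes "0 < a" "a \<le> b"
  shows "(\<integral>\<^sup>+l\<in>{a..b}. ennreal (1 / l) \<partial>lborel) = ennreal (ln b - ln a)"
  by (rule nn_integral_FTC_Icc[where F = ln])
    (use assms in \<open>auto intro!: derivative_eq_intros\<close>)

lemma nn_integral_Icc_le_of_less:
  fixes w :: "real \<Rightarrow> real"
  assumes "{a..<s} \<subseteq> T"
  shows "(\<integral>\<^sup>+l\<in>{a..s}. ennreal (w l) \<partial>lborel) \<le> (\<integral>\<^sup>+l\<in>T. ennreal (w l) \<partial>lborel)"
proof (rule nn_integral_mono_AE)
  have "AE l in lborel. l \<noteq> s" by (rule AE_lborel_singleton)
  then show "AE l in lborel. ennreal (w l) * indicator {a..s} l \<le> ennreal (w l) * indicator T l"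
  proof eventually_elim
    case (elim l)
    then have "l \<in> {a..s} \<Longrightarrow> l \<in> T" using assms by (auto simp: subset_iff)
    then show ?case by (auto simp: indicator_def)
  qed
qed

lemma powr_level_less:
  fixes c \<sigma> l s :: real
  assumes c: "c > 0" and \<sigma>: "\<sigma> > 0" and l: "l > 0" and less: "c * l powr (1 / \<sigma>) < s"
  shows "l \<le> (s / c) powr \<sigma>"
proof -
  have "l powr (1 / \<sigma>) \<le> s / c" using c less by (simp add: field_simps)
  then have "(l powr (1 / \<sigma>)) powr \<sigma> \<le> (s / c) powr \<sigma>" using \<sigma> by (intro powr_mono2) auto
  then show ?thesis using \<sigma> l by (simp add: powr_powr)
qed

text \<open>The inner integral on the \<psi>-side, in a form common to both weights:
  \<open>1 / l\<close> with \<open>\<kappa> = \<theta>\<close> for the logarithm, and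
  \<open>l powr (e - 1)\<close> with \<open>\<kappa> = \<theta> + e\<close> for higher powers. The
  condition \<open>b l < s\<close> bounds the levels from above by \<open>S\<close>.\<close>

lemma level_integral_le:
  fixes w :: "real \<Rightarrow> real" and c \<sigma> \<theta> \<kappa> k l0 s S :: real
  assumes l0: "l0 > 0" "L \<subseteq> {l0..}" and \<kappa>: "\<kappa> > 0" and k: "k \<ge> 0"
    and w: "\<And>l. l \<in> L \<Longrightarrow> w l \<ge> 0 \<and> w l * l powr \<theta> = l powr (\<kappa> - 1)"
    and S: "\<And>l. l \<in> L \<Longrightarrow> b l < s \<Longrightarrow> l \<le> S"
  shows "(\<integral>\<^sup>+l\<in>L \<inter> {l. b l < s}. ennreal (w l) * ennreal (k * l powr \<theta>) \<partial>lborel) \<le> ennreal (k * (S powr \<kappa> / \<kappa>))"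
proof -
  have "(\<integral>\<^sup>+l\<in>L \<inter> {l. b l < s}. ennreal (w l) * ennreal (k * l powr \<theta>) \<partial>lborel)
      \<le> (\<integral>\<^sup>+l. ennreal k * (ennreal (l powr (\<kappa> - 1)) * indicator {l0..S} l) \<partial>lborel)"
  proof (rule nn_integral_mono)
    fix l
    show "ennreal (w l) * ennreal (k * l powr \<theta>) * indicator (L \<inter> {l. b l < s}) l
        \<le> ennreal k * (ennreal (l powr (\<kappa> - 1)) * indicator {l0..S} l)"
    proof (cases "l \<in> L \<inter> {l. b l < s}")
      case True
      then have l: "l0 \<le> l" "l \<le> S" using l0 S by auto
      have "ennreal (w l) * ennreal (k * l powr \<theta>) = ennreal (k * (w l * l powr \<theta>))"
        using w[of l] True k by (subst ennreal_mult[symmetric]) (auto simp: mult.left_commute)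
      also have "\<dots> = ennreal k * ennreal (l powr (\<kappa> - 1))"
        using w[of l] True k by (subst ennreal_mult[symmetric]) auto
      finally show ?thesis using True l by simp
    qed simp
  qed
  also have "\<dots> = ennreal k * (\<integral>\<^sup>+l\<in>{l0..S}. ennreal (l powr (\<kappa> - 1)) \<partial>lborel)"
    by (rule nn_integral_cmult) measurable
  also have "\<dots> \<le> ennreal k * ennreal (S powr \<kappa> / \<kappa>)"
  proof (rule mult_left_mono)
    show "(\<integral>\<^sup>+l\<in>{l0..S}. ennreal (l powr (\<kappa> - 1)) \<partial>lborel) \<le> ennreal (S powr \<kappa> / \<kappa>)"
    proof (cases "l0 \<le> S")
      case True
      show ?thesis unfolding nn_integral_powr[OF l0(1) True \<kappa>] using \<kappa> by (intro ennreal_leI) simp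
    qed simp
  qed simp
  also have "\<dots> = ennreal (k * (S powr \<kappa> / \<kappa>))"
    using k \<kappa> by (subst ennreal_mult) auto
  finally show ?thesis .
qed

text \<open>The weight \<open>1 / l\<close> from \<open>l0\<close> up to \<open>f x\<close>
  integrates to \<open>ln (f x / l0)\<close>. On the other side the levels reach a multiple of
  \<open>\<psi> x powr \<sigma>\<close>, and with \<open>\<theta> = 1 - 1 / \<sigma>\<close> the
  powers combine to \<open>\<psi> x powr \<sigma>\<close>, with no logarithm left.\<close>

lemma LlogL_of_reverse_hoelder:
  fixes f \<psi> :: "real^'n \<Rightarrow> real" and z :: "real^'n"
  assumes \<sigma>: "\<sigma> > 1" and K: "K > 0"
  obtains C where "C \<ge> 0" "\<And>(f :: real^'n \<Rightarrow> real) \<psi> z R I l0.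
    f \<in> borel_measurable borel \<Longrightarrow> (\<And>x. f x \<ge> 0) \<Longrightarrow> \<psi> \<in> borel_measurable borel \<Longrightarrow> (\<And>x. \<psi> x \<ge> 0) \<Longrightarrow>
    (\<integral>\<^sup>+x. ennreal (f x) \<partial>lborel) \<le> ennreal I \<Longrightarrow> reverse_hoelder_on z R \<sigma> K f \<psi> \<Longrightarrow> R > 0 \<Longrightarrow> l0 > 0 \<Longrightarrow>
    I * 48 ^ CARD('n) \<le> l0 * unit_ball_vol CARD('n) * (R / 2) ^ CARD('n) \<Longrightarrow>
    (\<integral>\<^sup>+x\<in>ball z (R / 2). ennreal (f x * max 0 (ln (f x / l0))) \<partial>lborel) \<le> ennreal C * (\<integral>\<^sup>+x\<in>ball z R. ennreal (\<psi> x powr \<sigma>) \<partial>lborel)"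
proof -
  define n where "n = CARD('n)"
  define w where "w = unit_ball_vol CARD('n)"
  define k where "k = 2 * w * 48 ^ n * (K / w) powr (1 / \<sigma>)"
  define c where "c = (w / K) powr (1 / \<sigma>) / (2 * w * 8 ^ n)"
  have w: "w > 0" by (simp add: w_def)
  have k0: "k \<ge> 0" using w by (simp add: k_def)
  have c0: "c > 0" using w K by (simp add: c_def)
  define \<theta> where "\<theta> = 1 - 1 / \<sigma>"
  have \<theta>: "\<theta> > 0" using \<sigma> by (simp add: \<theta>_def)
  define C where "C = k / \<theta> * c powr (1 - \<sigma>)"
  have C: "C \<ge> 0" using k0 \<theta> by (simp add: C_def)
  have "(\<integral>\<^sup>+x\<in>ball z (R / 2). ennreal (f x * max 0 (ln (f x / l0))) \<partial>lborel) \<le> ennreal C * (\<integral>\<^sup>+x\<in>ball z R. ennreal (\<psi> x powr \<sigma>) \<partial>lborel)"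
    if f[measurable]: "f \<in> borel_measurable borel" and f0: "\<And>x. f x \<ge> 0" and \<psi>[measurable]: "\<psi> \<in> borel_measurable borel"
      and \<psi>0: "\<And>x. \<psi> x \<ge> 0" and I: "(\<integral>\<^sup>+x. ennreal (f x) \<partial>lborel) \<le> ennreal I"
      and RH: "reverse_hoelder_on z R \<sigma> K f \<psi>" and R: "R > 0" and l0: "l0 > 0"
      and Il: "I * 48 ^ n \<le> l0 * w * (R / 2) ^ n" for f :: "real^'n \<Rightarrow> real" and \<psi> z R I l0
  proof -
    have lev: "(\<integral>\<^sup>+x\<in>{x \<in> ball z (R / 2). l < f x}. ennreal (f x) \<partial>lborel)
        \<le> ennreal (k * l powr \<theta>) * (\<integral>\<^sup>+x\<in>{x \<in> ball z R. c * l powr (1 / \<sigma>) < \<psi> x}. ennreal (\<psi> x) \<partial>lborel)"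
      if "l \<in> {l0..}" for l
    proof -
      \<comment> \<open>The radii \<open>R / 2\<close> and \<open>R\<close> are kept fixed, so a
        single lower threshold for the levels suffices.\<close>
      have "l0 * w * (R / 2) ^ n \<le> l * w * (R / 2) ^ n" using that w R by (intro mult_right_mono) auto
      then have "I * 48 ^ n \<le> l * w * (R - R / 2) ^ n" using Il by simp
      then show ?thesis
        using level_set_estimate[OF f f0 \<psi> \<psi>0 I \<sigma> K RH, of "R / 2" R l] that R l0
        unfolding k_def c_def \<theta>_def n_def w_def by simp
    qed
    have "(\<integral>\<^sup>+x\<in>ball z (R / 2). ennreal (f x * max 0 (ln (f x / l0))) \<partial>lborel)
        \<le> (\<integral>\<^sup>+x\<in>ball z (R / 2). ennreal (f x) * (\<integral>\<^sup>+l\<in>{l0..} \<inter> {l. l < f x}. ennreal (1 / l) \<partial>lborel) \<partial>lborel)"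
    proof (intro nn_integral_mono mult_right_mono)
      fix x
      have "ennreal (max 0 (ln (f x / l0))) \<le> (\<integral>\<^sup>+l\<in>{l0..} \<inter> {l. l < f x}. ennreal (1 / l) \<partial>lborel)"
      proof (cases "l0 \<le> f x")
        case True
        have "ennreal (ln (f x) - ln l0) = (\<integral>\<^sup>+l\<in>{l0..f x}. ennreal (1 / l) \<partial>lborel)"
          by (rule nn_integral_inverse[OF l0 True, symmetric])
        also have "\<dots> \<le> (\<integral>\<^sup>+l\<in>{l0..} \<inter> {l. l < f x}. ennreal (1 / l) \<partial>lborel)"
          by (rule nn_integral_Icc_le_of_less) auto
        finally show ?thesis using True l0 by (simp add: ln_div max_def)
      next
        case False
        then have "ln (f x / l0) \<le> 0" using f0[of x] l0 by (cases "f x = 0") (auto simp: ln_le_zero_iff)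
        then show ?thesis by (simp add: max_def)
      qed
      then show "ennreal (f x * max 0 (ln (f x / l0))) \<le> ennreal (f x) * (\<integral>\<^sup>+l\<in>{l0..} \<inter> {l. l < f x}. ennreal (1 / l) \<partial>lborel)"
        using f0 by (simp add: ennreal_mult mult_left_mono)
    qed simp
    also have "\<dots> \<le> (\<integral>\<^sup>+x\<in>ball z R. ennreal (\<psi> x) * (\<integral>\<^sup>+l\<in>{l0..} \<inter> {l. c * l powr (1 / \<sigma>) < \<psi> x}. ennreal (1 / l) * ennreal (k * l powr \<theta>) \<partial>lborel) \<partial>lborel)"
      by (rule layer_cake_estimate) (use lev in auto)
    also have "\<dots> \<le> (\<integral>\<^sup>+x. ennreal C * (ennreal (\<psi> x powr \<sigma>) * indicator (ball z R) x) \<partial>lborel)"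
    proof (rule nn_integral_mono)
      fix x
      define T where "T = (\<psi> x / c) powr \<sigma>"
      have V: "(\<integral>\<^sup>+l\<in>{l0..} \<inter> {l. c * l powr (1 / \<sigma>) < \<psi> x}. ennreal (1 / l) * ennreal (k * l powr \<theta>) \<partial>lborel) \<le> ennreal (k * (T powr \<theta> / \<theta>))"
      proof (rule level_integral_le[OF l0 order_refl \<theta> k0])
        show "1 / l \<ge> 0 \<and> 1 / l * l powr \<theta> = l powr (\<theta> - 1)" if "l \<in> {l0..}" for l
          using that l0 by (simp add: powr_diff)
        show "l \<le> T" if "l \<in> {l0..}" "c * l powr (1 / \<sigma>) < \<psi> x" for l
          unfolding T_def using that l0 \<sigma> c0 by (intro powr_level_less) auto
      qed
      have "T powr \<theta> = (\<psi> x / c) powr (\<sigma> - 1)"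
      proof -
        have "\<sigma> * \<theta> = \<sigma> - 1" using \<sigma> by (simp add: \<theta>_def right_diff_distrib)
        then show ?thesis unfolding T_def powr_powr by simp
      qed
      also have "\<dots> = \<psi> x powr (\<sigma> - 1) * c powr (1 - \<sigma>)"
        unfolding powr_divide using powr_minus[of c "\<sigma> - 1"] by (simp add: divide_inverse)
      finally have T\<theta>: "T powr \<theta> = \<psi> x powr (\<sigma> - 1) * c powr (1 - \<sigma>)" .
      have "\<psi> x powr \<sigma> = \<psi> x * \<psi> x powr (\<sigma> - 1)"
        using \<psi>0[of x] powr_add[of "\<psi> x" 1 "\<sigma> - 1"] by simp
      then have "\<psi> x * (k * (T powr \<theta> / \<theta>)) = C * \<psi> x powr \<sigma>"
        unfolding T\<theta> C_def by simp
      then have "ennreal (\<psi> x) * ennreal (k * (T powr \<theta> / \<theta>)) = ennreal C * ennreal (\<psi> x powr \<sigma>)"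
        using \<psi>0 C k0 \<theta> by (simp flip: ennreal_mult)
      then have "ennreal (\<psi> x) * (\<integral>\<^sup>+l\<in>{l0..} \<inter> {l. c * l powr (1 / \<sigma>) < \<psi> x}. ennreal (1 / l) * ennreal (k * l powr \<theta>) \<partial>lborel) \<le> ennreal C * ennreal (\<psi> x powr \<sigma>)"
        using mult_left_mono[OF V, of "ennreal (\<psi> x)"] by simp
      then show "ennreal (\<psi> x) * (\<integral>\<^sup>+l\<in>{l0..} \<inter> {l. c * l powr (1 / \<sigma>) < \<psi> x}. ennreal (1 / l) * ennreal (k * l powr \<theta>) \<partial>lborel) * indicator (ball z R) x
          \<le> ennreal C * (ennreal (\<psi> x powr \<sigma>) * indicator (ball z R) x)"
        by (cases "x \<in> ball z R") simp_all
    qed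
    also have "\<dots> = ennreal C * (\<integral>\<^sup>+x\<in>ball z R. ennreal (\<psi> x powr \<sigma>) \<partial>lborel)"
      by (intro nn_integral_cmult borel_measurable_times_ennreal borel_measurable_indicator) auto
    finally show ?thesis .
  qed
  then show ?thesis unfolding n_def w_def by (rule that[OF C])
qed

text \<open>Along radii increasing to \<open>R\<close> with gaps that are halved at each step, the
  factor \<open>2 powr b\<close> lost in the first term is outweighed by \<open>\<theta>\<close>,
  which leaves a geometric series of ratio at most 1/2. Boundedness of \<open>\<Phi>\<close> makes
  the remainder vanish, and its bound \<open>M\<close> disappears from the result.\<close>

lemma radius_iteration:
  fixes \<Phi> :: "real \<Rightarrow> real"
  assumes R: "R > 0" and bd: "\<And>r. \<Phi> r \<le> M" and A: "A \<ge> 0" and \<theta>: "0 \<le> \<theta>" "\<theta> * 2 powr b \<le> 1 / 2" and b: "b \<ge> 0"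
    and step: "\<And>r1 r2. R / 2 \<le> r1 \<Longrightarrow> r1 < r2 \<Longrightarrow> r2 \<le> R \<Longrightarrow> \<Phi> r1 \<le> A * (r2 - r1) powr (- b) + \<theta> * \<Phi> r2"
  shows "\<Phi> (R / 2) \<le> 2 * (A * (R / 4) powr (- b))"
proof -
  \<comment> \<open>Starts at \<open>R / 2\<close>; the gap from step \<open>j\<close> to the next
    is \<open>R / 4\<close> times the power \<open>j\<close> of 1/2.\<close>
  define r where "r j = R - R / 2 * (1 / 2) ^ j" for j :: nat
  define Q where "Q = A * (R / 4) powr (- b)"
  have Q: "Q \<ge> 0" using A by (simp add: Q_def)
  have r_bounds: "R / 2 \<le> r j" "r j < r (Suc j)" "r (Suc j) \<le> R" "r (Suc j) - r j = R / 4 * (1 / 2) ^ j" for j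
  proof -
    have "(1 / 2 :: real) ^ j \<le> 1" by (simp add: power_le_one)
    then have "R / 2 * (1 / 2) ^ j \<le> R / 2" using R by (intro mult_left_le) auto
    then show "R / 2 \<le> r j" by (simp add: r_def)
    show "r j < r (Suc j)" "r (Suc j) \<le> R" "r (Suc j) - r j = R / 4 * (1 / 2) ^ j" using R by (simp_all add: r_def)
  qed
  have "\<Phi> (R / 2) \<le> Q * (\<Sum>i<j. (1 / 2) ^ i) + \<theta> ^ j * \<Phi> (r j)" for j
  proof (induction j)
    case 0
    then show ?case by (simp add: r_def)
  next
    case (Suc j)
    have "\<Phi> (r j) \<le> A * (R / 4 * (1 / 2) ^ j) powr (- b) + \<theta> * \<Phi> (r (Suc j))"
      using step[OF r_bounds(1,2,3)[of j]] r_bounds(4)[of j] by simp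
    also have "A * (R / 4 * (1 / 2) ^ j) powr (- b) = Q * (2 powr b) ^ j"
    proof -
      have "((1 / 2 :: real) ^ j) powr (- b) = (2 powr b) ^ j"
        by (simp add: power_one_over powr_minus powr_divide powr_powr flip: powr_realpow) (simp add: mult.commute)
      then show ?thesis using R powr_mult[of "R / 4" "(1 / 2) ^ j" "- b"] unfolding Q_def by simp
    qed
    finally have "\<theta> ^ j * \<Phi> (r j) \<le> \<theta> ^ j * (Q * (2 powr b) ^ j + \<theta> * \<Phi> (r (Suc j)))"
      using \<theta> by (intro mult_left_mono) auto
    also have "\<dots> = Q * (\<theta> * 2 powr b) ^ j + \<theta> ^ Suc j * \<Phi> (r (Suc j))"
      by (simp add: power_mult_distrib algebra_simps)
    also have "\<dots> \<le> Q * (1 / 2) ^ j + \<theta> ^ Suc j * \<Phi> (r (Suc j))"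
      using Q \<theta> by (intro add_right_mono mult_left_mono power_mono) auto
    finally show ?case using Suc by (simp add: distrib_left)
  qed
  moreover have "Q * (\<Sum>i<j. (1 / 2) ^ i) \<le> Q * 2" for j
    using Q by (intro mult_left_mono) (auto simp: sum_gp_strict)
  moreover have "\<theta> ^ j * \<Phi> (r j) \<le> (1 / 2) ^ j * max 0 M" for j
  proof -
    have "1 \<le> 2 powr b" using b by (simp add: ge_one_powr_ge_zero)
    then have "\<theta> \<le> 1 / 2" using \<theta> mult_left_mono[of 1 "2 powr b" \<theta>] by simp
    have "\<theta> ^ j * \<Phi> (r j) \<le> \<theta> ^ j * max 0 M" using \<theta> bd[of "r j"] by (intro mult_left_mono) auto
    also have "\<dots> \<le> (1 / 2) ^ j * max 0 M" using \<theta> \<open>\<theta> \<le> 1 / 2\<close> by (intro mult_right_mono power_mono) auto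
    finally show ?thesis .
  qed
  ultimately have "\<Phi> (R / 2) \<le> Q * 2 + (1 / 2) ^ j * max 0 M" for j by (meson add_mono order_trans)
  moreover have "(\<lambda>j. Q * 2 + (1 / 2) ^ j * max 0 M) \<longlonglongrightarrow> Q * 2 + 0 * max 0 M"
    by (intro tendsto_intros LIMSEQ_realpow_zero) auto
  ultimately have "\<Phi> (R / 2) \<le> Q * 2 + 0 * max 0 M" by (intro LIMSEQ_le_const) auto
  then show ?thesis by (simp add: Q_def)
qed

text \<open>Gehring's lemma. The integrand is replaced by \<open>f * min f \<Lambda> powr e\<close>,
  whose integral is finite beforehand, so absorption is legitimate. The resulting bound is
  independent of \<open>\<Lambda>\<close>, and monotone convergence removes the truncation.\<close>

lemma higher_integrability_of_reverse_hoelder: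
  fixes \<sigma> K B :: real
  defines "n \<equiv> CARD('n)" and "w \<equiv> unit_ball_vol CARD('n)"
  assumes \<sigma>: "\<sigma> > 1" and K: "K > 0" and B: "B > 0"
  obtains e0 where "e0 > 0" "\<And>(f :: real^'n \<Rightarrow> real) \<psi> z R I e.
    f \<in> borel_measurable borel \<Longrightarrow> (\<And>x. f x \<ge> 0) \<Longrightarrow> \<psi> \<in> borel_measurable borel \<Longrightarrow> (\<And>x. \<psi> x \<ge> 0) \<Longrightarrow>
    (\<And>x. \<psi> x powr \<sigma> \<le> B * f x) \<Longrightarrow> (\<integral>\<^sup>+x. ennreal (f x) \<partial>lborel) \<le> ennreal I \<Longrightarrow> I > 0 \<Longrightarrow>
    reverse_hoelder_on z R \<sigma> K f \<psi> \<Longrightarrow> R > 0 \<Longrightarrow> 0 < e \<Longrightarrow> e < e0 \<Longrightarrow>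
    (\<integral>\<^sup>+x\<in>ball z (R / 2). ennreal (f x powr (1 + e)) \<partial>lborel)
      \<le> ennreal (2 * ((I * 48 ^ n / w) powr e * I * (R / 4) powr (- (real n * e))))"
proof -
  define k where "k = 2 * w * 48 ^ n * (K / w) powr (1 / \<sigma>)"
  define c where "c = (w / K) powr (1 / \<sigma>) / (2 * w * 8 ^ n)"
  have w: "w > 0" by (simp add: w_def)
  have k0: "k \<ge> 0" using w by (simp add: k_def)
  have c0: "c > 0" using w K by (simp add: c_def)
  define \<theta> where "\<theta> = 1 - 1 / \<sigma>"
  have \<theta>: "\<theta> > 0" "\<theta> \<le> 1" using \<sigma> by (simp_all add: \<theta>_def)
  \<comment> \<open>The comparison of \<open>\<psi> powr \<sigma>\<close> with \<open>f\<close>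
    bounds the relevant levels by a multiple of \<open>X\<close>. Taking \<open>D \<ge> 1\<close>
    lets the same multiple cover the truncation at \<open>\<Lambda>\<close>.\<close>
  define D where "D = max 1 (B * c powr (- \<sigma>))"
  have D: "D \<ge> 1" by (simp add: D_def)
  define C where "C = B powr (1 / \<sigma>) * k * D ^ 2 / \<theta>"
  have C: "C \<ge> 0" using k0 \<theta> B by (simp add: C_def)
  \<comment> \<open>With \<open>e \<le> 1\<close> the loss \<open>2 powr (n * e)\<close> of the
    radius iteration is at most \<open>2 ^ n\<close>, so \<open>e * C\<close> times this loss is at
    most 1/2.\<close>
  define e0 where "e0 = min 1 (1 / (2 * 2 ^ n * (C + 1)))"
  have e0: "e0 > 0" using C by (simp add: e0_def)
  \<comment> \<open>Here \<open>X\<close> stands for \<open>f x\<close> and \<open>s\<close> for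
    \<open>\<psi> x\<close>. The factor \<open>s\<close> supplies the power
    \<open>1 / \<sigma>\<close> of \<open>X\<close> and the levels supply the power
    \<open>\<theta>\<close>; these add up to 1, and the truncated factor is left over.\<close>
  have pointwise: "ennreal s * (\<integral>\<^sup>+l\<in>{l0..\<Lambda>} \<inter> {l. c * l powr (1 / \<sigma>) < s}. ennreal (l powr (e - 1)) * ennreal (k * l powr \<theta>) \<partial>lborel)
      \<le> ennreal C * ennreal (X * min X \<Lambda> powr e)"
    if X: "X \<ge> 0" and s: "s \<ge> 0" "s powr \<sigma> \<le> B * X" and l0: "l0 > 0" and \<Lambda>: "\<Lambda> > 0" and e: "0 < e" "e \<le> 1"
    for X s l0 \<Lambda> e :: real
  proof -
    define m where "m = min X \<Lambda>"
    have m: "0 \<le> m" "m \<le> X" using X \<Lambda> by (auto simp: m_def)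
    have V: "(\<integral>\<^sup>+l\<in>{l0..\<Lambda>} \<inter> {l. c * l powr (1 / \<sigma>) < s}. ennreal (l powr (e - 1)) * ennreal (k * l powr \<theta>) \<partial>lborel)
        \<le> ennreal (k * ((D * m) powr (\<theta> + e) / (\<theta> + e)))"
    proof (rule level_integral_le[OF l0 _ _ k0])
      show "l powr (e - 1) \<ge> 0 \<and> l powr (e - 1) * l powr \<theta> = l powr (\<theta> + e - 1)" if "l \<in> {l0..\<Lambda>}" for l
        by (simp add: algebra_simps flip: powr_add)
      show "l \<le> D * m" if "l \<in> {l0..\<Lambda>}" "c * l powr (1 / \<sigma>) < s" for l
      proof -
        have "l \<le> (s / c) powr \<sigma>" using that l0 \<sigma> c0 by (intro powr_level_less) auto
        also have "\<dots> = s powr \<sigma> * c powr (- \<sigma>)"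
          unfolding powr_divide by (simp add: powr_minus divide_inverse)
        also have "\<dots> \<le> B * X * c powr (- \<sigma>)" using s by (intro mult_right_mono) auto
        also have "\<dots> = B * c powr (- \<sigma>) * X" by simp
        also have "\<dots> \<le> D * X" using X by (intro mult_right_mono) (auto simp: D_def)
        finally have "l \<le> D * X" .
        moreover have "1 * \<Lambda> \<le> D * \<Lambda>" using \<Lambda> D by (intro mult_right_mono) auto
          then have "l \<le> D * \<Lambda>" using that by simp
        ultimately show ?thesis by (simp add: m_def min_def)
      qed
    qed (use \<theta> e in auto)
    have "s = (s powr \<sigma>) powr (1 / \<sigma>)" using s \<sigma> by (simp add: powr_powr)
    also have "\<dots> \<le> (B * X) powr (1 / \<sigma>)" using s \<sigma> by (intro powr_mono2) auto
    also have "\<dots> = B powr (1 / \<sigma>) * X powr (1 / \<sigma>)" using B X by (simp add: powr_mult)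
    finally have sle: "s \<le> B powr (1 / \<sigma>) * X powr (1 / \<sigma>)" .
    have "(D * m) powr (\<theta> + e) / (\<theta> + e) \<le> (D * m) powr (\<theta> + e) / \<theta>"
      using \<theta> e by (intro divide_left_mono) auto
    also have "\<dots> = D powr (\<theta> + e) * (m powr \<theta> * m powr e) / \<theta>"
      using D m by (simp add: powr_mult powr_add)
    also have "\<dots> \<le> D powr 2 * (X powr \<theta> * m powr e) / \<theta>"
      using D m \<theta> e by (intro divide_right_mono mult_mono powr_mono powr_mono2) auto
    finally have "(D * m) powr (\<theta> + e) / (\<theta> + e) \<le> D powr 2 * (X powr \<theta> * m powr e) / \<theta>" .
    then have "s * (k * ((D * m) powr (\<theta> + e) / (\<theta> + e))) \<le> (B powr (1 / \<sigma>) * X powr (1 / \<sigma>)) * (k * (D powr 2 * (X powr \<theta> * m powr e) / \<theta>))"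
      using sle k0 s \<theta> e by (intro mult_mono) auto
    also have "\<dots> = C * ((X powr (1 / \<sigma>) * X powr \<theta>) * m powr e)"
      using D by (simp add: C_def)
    also have "X powr (1 / \<sigma>) * X powr \<theta> = X"
      using X by (simp add: \<theta>_def flip: powr_add)
    finally have *: "s * (k * ((D * m) powr (\<theta> + e) / (\<theta> + e))) \<le> C * (X * m powr e)" .
    have "ennreal s * (\<integral>\<^sup>+l\<in>{l0..\<Lambda>} \<inter> {l. c * l powr (1 / \<sigma>) < s}. ennreal (l powr (e - 1)) * ennreal (k * l powr \<theta>) \<partial>lborel)
        \<le> ennreal s * ennreal (k * ((D * m) powr (\<theta> + e) / (\<theta> + e)))"
      by (rule mult_left_mono[OF V]) simp
    also have "\<dots> = ennreal (s * (k * ((D * m) powr (\<theta> + e) / (\<theta> + e))))"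
      using s k0 \<theta> e by (subst ennreal_mult) auto
    also have "\<dots> \<le> ennreal (C * (X * m powr e))" by (rule ennreal_leI[OF *])
    also have "\<dots> = ennreal C * ennreal (X * m powr e)" using C X by (subst ennreal_mult) auto
    finally show ?thesis by (simp add: m_def)
  qed
  \<comment> \<open>The truncated power equals \<open>l0 powr e\<close> plus \<open>e\<close> times
    the integral of \<open>l powr (e - 1)\<close> from \<open>l0\<close> to
    \<open>min X \<Lambda>\<close>. This factor \<open>e\<close> becomes the small coefficient in
    the absorption.\<close>
  have lower: "ennreal (X * min X \<Lambda> powr e)
      \<le> ennreal (l0 powr e) * ennreal X + ennreal e * (ennreal X * (\<integral>\<^sup>+l\<in>{l0..\<Lambda>} \<inter> {l. l < X}. ennreal (l powr (e - 1)) \<partial>lborel))"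
    if X: "X \<ge> 0" and l0: "l0 > 0" and \<Lambda>: "\<Lambda> > 0" and e: "e > 0" for X l0 \<Lambda> e :: real
  proof -
    define m where "m = min X \<Lambda>"
    have m: "0 \<le> m" using X \<Lambda> by (auto simp: m_def)
    show ?thesis
    proof (cases "m \<le> l0")
      case True
      have "X * m powr e \<le> l0 powr e * X"
        using True m e X by (subst mult.commute) (intro mult_right_mono powr_mono2, auto)
      then have "ennreal (X * m powr e) \<le> ennreal (l0 powr e) * ennreal X"
        using X by (subst ennreal_mult[symmetric]) (auto intro: ennreal_leI)
      then show ?thesis unfolding m_def by (rule order_trans) simp
    next
      case False
      have "ennreal (m powr e / e - l0 powr e / e) = (\<integral>\<^sup>+l\<in>{l0..m}. ennreal (l powr (e - 1)) \<partial>lborel)"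
        using False l0 e by (intro nn_integral_powr[symmetric]) auto
      also have "\<dots> \<le> (\<integral>\<^sup>+l\<in>{l0..\<Lambda>} \<inter> {l. l < X}. ennreal (l powr (e - 1)) \<partial>lborel)"
        by (rule nn_integral_Icc_le_of_less) (auto simp: m_def)
      finally have W: "ennreal (m powr e / e - l0 powr e / e) \<le> (\<integral>\<^sup>+l\<in>{l0..\<Lambda>} \<inter> {l. l < X}. ennreal (l powr (e - 1)) \<partial>lborel)" .
      have d: "m powr e / e - l0 powr e / e \<ge> 0"
        using False l0 e powr_mono2[of e l0 m] by (simp add: divide_right_mono)
      have "X * m powr e = l0 powr e * X + e * (X * (m powr e / e - l0 powr e / e))"
        using e by (simp add: field_simps)
      then have "ennreal (X * m powr e) = ennreal (l0 powr e) * ennreal X + ennreal e * (ennreal X * ennreal (m powr e / e - l0 powr e / e))"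
        using X e d by (simp only: ennreal_plus ennreal_mult powr_ge_zero mult_nonneg_nonneg less_imp_le)
      also have "\<dots> \<le> ennreal (l0 powr e) * ennreal X + ennreal e * (ennreal X * (\<integral>\<^sup>+l\<in>{l0..\<Lambda>} \<inter> {l. l < X}. ennreal (l powr (e - 1)) \<partial>lborel))"
        by (intro add_left_mono mult_left_mono W) auto
      finally show ?thesis unfolding m_def .
    qed
  qed
  have "(\<integral>\<^sup>+x\<in>ball z (R / 2). ennreal (f x powr (1 + e)) \<partial>lborel)
      \<le> ennreal (2 * ((I * 48 ^ n / w) powr e * I * (R / 4) powr (- (real n * e))))"
    if f[measurable]: "f \<in> borel_measurable borel" and f0: "\<And>x. f x \<ge> 0" and \<psi>[measurable]: "\<psi> \<in> borel_measurable borel"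
      and \<psi>0: "\<And>x. \<psi> x \<ge> 0" and \<psi>f: "\<And>x. \<psi> x powr \<sigma> \<le> B * f x"
      and I: "(\<integral>\<^sup>+x. ennreal (f x) \<partial>lborel) \<le> ennreal I" and I0: "I > 0"
      and RH: "reverse_hoelder_on z R \<sigma> K f \<psi>" and R: "R > 0" and e: "0 < e" "e < e0"
    for f \<psi> :: "real^'n \<Rightarrow> real" and z R I e
  proof -
    define A where "A = (I * 48 ^ n / w) powr e * I"
    have A: "A \<ge> 0" using I0 by (simp add: A_def)
    have e1: "e \<le> 1" using e by (simp add: e0_def)
    have eC: "e * C * 2 powr (real n * e) \<le> 1 / 2"
    proof -
      have "real n * e \<le> real n" using e1 by (simp add: mult_left_le)
      then have "2 powr (real n * e) \<le> 2 powr real n" by (intro powr_mono) auto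
      then have "2 powr (real n * e) \<le> 2 ^ n" by (simp add: powr_realpow)
      then have "e * C * 2 powr (real n * e) \<le> (1 / (2 * 2 ^ n * (C + 1))) * (C + 1) * 2 ^ n"
        using e C by (intro mult_mono) (auto simp: e0_def)
      also have "\<dots> = 1 / 2"
      proof -
        have "C + 1 \<noteq> 0" using C by simp
        then show ?thesis by simp
      qed
      finally show ?thesis .
    qed
    have trunc: "(\<integral>\<^sup>+x\<in>ball z (R / 2). ennreal (f x * min (f x) \<Lambda> powr e) \<partial>lborel) \<le> ennreal (2 * (A * (R / 4) powr (- (real n * e))))"
      if \<Lambda>: "\<Lambda> > 0" for \<Lambda>
    proof -
      define P where "P r = (\<integral>\<^sup>+x\<in>ball z r. ennreal (f x * min (f x) \<Lambda> powr e) \<partial>lborel)" for r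
      have Pb: "P r \<le> ennreal (\<Lambda> powr e * I)" for r
      proof -
        have "P r \<le> (\<integral>\<^sup>+x. ennreal (\<Lambda> powr e) * ennreal (f x) \<partial>lborel)"
          unfolding P_def
        proof (rule nn_integral_mono)
          fix x
          have "f x * min (f x) \<Lambda> powr e \<le> \<Lambda> powr e * f x"
            using f0[of x] \<Lambda> e by (subst mult.commute) (intro mult_right_mono powr_mono2, auto)
          then have "ennreal (f x * min (f x) \<Lambda> powr e) \<le> ennreal (\<Lambda> powr e) * ennreal (f x)"
            using f0[of x] by (subst ennreal_mult[symmetric]) (auto intro: ennreal_leI)
          then show "ennreal (f x * min (f x) \<Lambda> powr e) * indicator (ball z r) x \<le> ennreal (\<Lambda> powr e) * ennreal (f x)"
            by (cases "x \<in> ball z r") auto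
        qed
        also have "\<dots> = ennreal (\<Lambda> powr e) * (\<integral>\<^sup>+x. ennreal (f x) \<partial>lborel)"
          by (rule nn_integral_cmult) measurable
        also have "\<dots> \<le> ennreal (\<Lambda> powr e) * ennreal I" by (intro mult_left_mono I) simp
        also have "\<dots> = ennreal (\<Lambda> powr e * I)" using I0 by (subst ennreal_mult) auto
        finally show ?thesis .
      qed
      \<comment> \<open>Truncation gives finiteness, so the estimates can be moved to the reals and
        the iteration can be applied to \<open>enn2real (P r)\<close>.\<close>
      then have Pfin: "P r < \<infinity>" for r using le_less_trans[OF Pb[of r] ennreal_less_top] by simp
      have Preal: "ennreal (enn2real (P r)) = P r" for r using Pfin[of r] by (intro ennreal_enn2real) simp
      have step: "enn2real (P r1) \<le> A * (r2 - r1) powr (- (real n * e)) + e * C * enn2real (P r2)"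
        if r: "r1 < r2" "r2 \<le> R" for r1 r2
      proof -
        \<comment> \<open>The smallest level allowed for this pair of radii. It grows like the power
          \<open>- n\<close> of the gap, and its power \<open>e\<close> gives the exponent
          \<open>n * e\<close> in the iteration.\<close>
        define l0 where "l0 = I * 48 ^ n / (w * (r2 - r1) ^ n)"
        have l0: "l0 > 0" using I0 w r by (simp add: l0_def)
        define V where "V x = (\<integral>\<^sup>+l\<in>{l0..\<Lambda>} \<inter> {l. l < f x}. ennreal (l powr (e - 1)) \<partial>lborel)" for x
        have lev: "(\<integral>\<^sup>+x\<in>{x \<in> ball z r1. l < f x}. ennreal (f x) \<partial>lborel)
            \<le> ennreal (k * l powr \<theta>) * (\<integral>\<^sup>+x\<in>{x \<in> ball z r2. c * l powr (1 / \<sigma>) < \<psi> x}. ennreal (\<psi> x) \<partial>lborel)"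
          if "l \<in> {l0..\<Lambda>}" for l
        proof -
          have "I * 48 ^ n = l0 * (w * (r2 - r1) ^ n)" using w r by (simp add: l0_def)
          also have "\<dots> \<le> l * (w * (r2 - r1) ^ n)" using that w r by (intro mult_right_mono) auto
          finally have "I * 48 ^ n \<le> l * w * (r2 - r1) ^ n" by (simp add: mult.assoc)
          moreover have "l > 0" using that l0 by simp
          ultimately show ?thesis
            using level_set_estimate[OF f f0 \<psi> \<psi>0 I \<sigma> K RH r, of l]
            unfolding k_def c_def \<theta>_def n_def w_def by simp
        qed
        have Vm: "(\<integral>\<^sup>+x\<in>ball z r1. ennreal (f x) * V x \<partial>lborel) \<le> ennreal C * P r2"
        proof -
          have "(\<integral>\<^sup>+x\<in>ball z r1. ennreal (f x) * V x \<partial>lborel)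
              \<le> (\<integral>\<^sup>+x\<in>ball z r2. ennreal (\<psi> x) * (\<integral>\<^sup>+l\<in>{l0..\<Lambda>} \<inter> {l. c * l powr (1 / \<sigma>) < \<psi> x}. ennreal (l powr (e - 1)) * ennreal (k * l powr \<theta>) \<partial>lborel) \<partial>lborel)"
            unfolding V_def by (rule layer_cake_estimate) (use lev in auto)
          also have "\<dots> \<le> (\<integral>\<^sup>+x. ennreal C * (ennreal (f x * min (f x) \<Lambda> powr e) * indicator (ball z r2) x) \<partial>lborel)"
          proof (rule nn_integral_mono)
            fix x
            show "ennreal (\<psi> x) * (\<integral>\<^sup>+l\<in>{l0..\<Lambda>} \<inter> {l. c * l powr (1 / \<sigma>) < \<psi> x}. ennreal (l powr (e - 1)) * ennreal (k * l powr \<theta>) \<partial>lborel) * indicator (ball z r2) x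
                \<le> ennreal C * (ennreal (f x * min (f x) \<Lambda> powr e) * indicator (ball z r2) x)"
              using pointwise[OF f0 \<psi>0 \<psi>f l0 \<Lambda> e(1) e1, of x] by (cases "x \<in> ball z r2") simp_all
          qed
          also have "\<dots> = ennreal C * P r2"
            unfolding P_def by (intro nn_integral_cmult borel_measurable_times_ennreal borel_measurable_indicator) auto
          finally show ?thesis .
        qed
        have "P r1 \<le> (\<integral>\<^sup>+x. ennreal (l0 powr e) * ennreal (f x) + ennreal e * (ennreal (f x) * V x * indicator (ball z r1) x) \<partial>lborel)"
          unfolding P_def
        proof (rule nn_integral_mono)
          fix x
          show "ennreal (f x * min (f x) \<Lambda> powr e) * indicator (ball z r1) x
              \<le> ennreal (l0 powr e) * ennreal (f x) + ennreal e * (ennreal (f x) * V x * indicator (ball z r1) x)"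
            using lower[OF f0 l0 \<Lambda> e(1), of x] unfolding V_def by (cases "x \<in> ball z r1") simp_all
        qed
        also have "\<dots> \<le> ennreal (l0 powr e) * (\<integral>\<^sup>+x. ennreal (f x) \<partial>lborel) + ennreal e * (\<integral>\<^sup>+x\<in>ball z r1. ennreal (f x) * V x \<partial>lborel)"
        proof -
          have Vmeas: "V \<in> borel_measurable borel"
          proof -
            have "(\<lambda>(x, l). ennreal (l powr (e - 1)) * indicator {l0..\<Lambda>} l * indicator {0<..} (f x - l)) \<in> borel_measurable (borel \<Otimes>\<^sub>M lborel)"
              unfolding split_beta by measurable
            then have "(\<lambda>x. \<integral>\<^sup>+l. ennreal (l powr (e - 1)) * indicator {l0..\<Lambda>} l * indicator {0<..} (f x - l) \<partial>lborel) \<in> borel_measurable borel"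
              by (rule lborel.borel_measurable_nn_integral)
            also have "(\<lambda>x. \<integral>\<^sup>+l. ennreal (l powr (e - 1)) * indicator {l0..\<Lambda>} l * indicator {0<..} (f x - l) \<partial>lborel) = V"
              unfolding V_def by (intro ext nn_integral_cong) (auto simp: indicator_def)
            finally show ?thesis .
          qed
          then have "(\<lambda>x. ennreal (f x) * V x * indicator (ball z r1) x) \<in> borel_measurable borel"
            by (intro borel_measurable_times_ennreal borel_measurable_indicator) auto
          then show ?thesis by (subst nn_integral_add) (simp_all add: nn_integral_cmult)
        qed
        also have "\<dots> \<le> ennreal (l0 powr e) * ennreal I + ennreal e * (ennreal C * P r2)"
          by (intro add_mono mult_left_mono I Vm) auto
        also have "\<dots> = ennreal (l0 powr e * I + e * C * enn2real (P r2))"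
          using I0 e C by (subst Preal[symmetric]) (simp add: ennreal_mult mult.assoc)
        finally have "enn2real (P r1) \<le> l0 powr e * I + e * C * enn2real (P r2)"
          using I0 e C by (intro enn2real_leI) auto
        moreover have "l0 powr e * I = A * (r2 - r1) powr (- (real n * e))"
        proof -
          have "l0 = (I * 48 ^ n / w) * inverse ((r2 - r1) ^ n)" by (simp add: l0_def divide_inverse)
          then have "l0 powr e = (I * 48 ^ n / w) powr e * inverse ((r2 - r1) ^ n) powr e"
            using I0 w r by (simp only: powr_mult)
          also have "inverse ((r2 - r1) ^ n) powr e = (r2 - r1) powr (- (real n * e))"
          proof -
            have "inverse ((r2 - r1) ^ n) = (r2 - r1) powr (- real n)" using r by (simp add: powr_minus powr_realpow)
            then show ?thesis by (simp add: powr_powr)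
          qed
          finally show ?thesis by (simp add: A_def)
        qed
        ultimately show ?thesis by simp
      qed
      have "enn2real (P r) \<le> \<Lambda> powr e * I" for r using Pb[of r] I0 by (intro enn2real_leI) auto
      then have "enn2real (P (R / 2)) \<le> 2 * (A * (R / 4) powr (- (real n * e)))"
        using eC e C step by (intro radius_iteration[OF R _ A, where \<theta> = "e * C" and M = "\<Lambda> powr e * I"]) auto
      then have "ennreal (enn2real (P (R / 2))) \<le> ennreal (2 * (A * (R / 4) powr (- (real n * e))))" by (rule ennreal_leI)
      then show ?thesis unfolding Preal unfolding P_def .
    qed
    define g where "g j x = ennreal (f x * min (f x) (real (Suc j)) powr e) * indicator (ball z (R / 2)) x" for j x
    have lim: "(\<lambda>j. \<integral>\<^sup>+x. g j x \<partial>lborel) \<longlonglongrightarrow> (\<integral>\<^sup>+x\<in>ball z (R / 2). ennreal (f x powr (1 + e)) \<partial>lborel)"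
    proof (rule nn_integral_LIMSEQ)
      show "incseq g"
        unfolding incseq_def le_fun_def g_def
        using f0 e by (intro allI impI mult_right_mono ennreal_leI mult_left_mono powr_mono2) auto
      show "g j \<in> borel_measurable lborel" for j unfolding g_def by (intro borel_measurable_times_ennreal borel_measurable_indicator) auto
      show "(\<lambda>j. g j x) \<longlonglongrightarrow> ennreal (f x powr (1 + e)) * indicator (ball z (R / 2)) x" for x
      proof (rule tendsto_eventually)
        obtain N where N: "f x \<le> real N" using real_arch_simple by blast
        have "f x powr (1 + e) = f x * f x powr e" using f0[of x] by (simp add: powr_add)
        then have "g j x = ennreal (f x powr (1 + e)) * indicator (ball z (R / 2)) x" if "N \<le> j" for j
          using that N by (simp add: g_def min_def)
        then show "eventually (\<lambda>j. g j x = ennreal (f x powr (1 + e)) * indicator (ball z (R / 2)) x) sequentially"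
          unfolding eventually_sequentially by blast
      qed
    qed
    show ?thesis
      using LIMSEQ_le_const2[OF lim, of "ennreal (2 * (A * (R / 4) powr (- (real n * e))))"] trunc
      unfolding g_def A_def by (simp add: mult.assoc)
  qed
  then show ?thesis by (rule that[OF e0])
qed

subsection \<open>Estimates on balls for weak gradients\<close>

text \<open>The integrability statements use the operator norm, the estimates in between the
  Euclidean norm of matrices. The constant is crude, as each entry is bounded by the operator
  norm.\<close>

lemma norm_le_op_norm:
  fixes A :: "real^'n^'m"
  shows "norm A \<le> real (CARD('m) * CARD('n)) * op_norm A"
proof -
  have "norm A \<le> (\<Sum>i\<in>UNIV. norm (A $ i))"
    unfolding norm_vec_def[of A] by (rule L2_set_le_sum) simp
  also have "\<dots> \<le> (\<Sum>i\<in>UNIV. \<Sum>j\<in>UNIV. \<bar>A $ i $ j\<bar>)"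
    by (intro sum_mono norm_le_l1_cart)
  also have "\<dots> \<le> (\<Sum>i\<in>(UNIV :: 'm set). \<Sum>j\<in>(UNIV :: 'n set). op_norm A)"
    unfolding op_norm_def by (intro sum_mono matrix_component_le_onorm)
  finally show ?thesis by simp
qed

lemma quasiconcave_homogeneous_growth:
  fixes F :: "real^'n^'m \<Rightarrow> real"
  assumes "p > 1" "quasiconcave F" "pos_homogeneous p F"
  obtains L where "L > 0" "\<And>z. F z \<le> L * norm z powr p"
proof (rule quasiconcave_homogeneous_lipschitz[OF assms])
  fix L assume L: "L > 0" "\<And>x y. \<bar>F y - F x\<bar> \<le> L * norm (y - x) * (norm x + norm y) powr (p - 1)"
  have "F z \<le> L * norm z powr p" for z
  proof -
    have "norm z * norm z powr (p - 1) = norm z powr p"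
      using powr_mult_base[of "norm z" "p - 1"] by simp
    moreover have "\<bar>F z - F 0\<bar> \<le> L * norm z * norm z powr (p - 1)" using L(2)[of z 0] by simp
    ultimately show ?thesis using pos_homogeneous_0[OF assms(1,3)] by (simp add: mult.assoc)
  qed
  then show thesis using L(1) by (rule that[rotated])
qed

text \<open>Common preparation of both parts, with \<open>c = 0\<close> for the first and
  \<open>c > 0\<close> for the second. It fixes the exponents before the map is given and replaces
  almost everywhere inequalities by everywhere inequalities.\<close>

lemma weak_gradient_representative:
  fixes F :: "real^'n^'m \<Rightarrow> real"
  assumes p: "p > 1" and F: "quasiconcave F" "pos_homogeneous p F"
  obtains \<sigma> K where "\<sigma> > 1" "K > 0"
    "\<And>\<Omega> (u :: real^'n \<Rightarrow> real^'m) Du z R c T. weak_gradient \<Omega> u Du \<Longrightarrow> cball z R \<subseteq> \<Omega> \<Longrightarrow>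
      (AE x in lebesgue. x \<in> cball z R \<longrightarrow> c * norm (Du x) powr p \<le> F (Du x)) \<Longrightarrow> c \<ge> 0 \<Longrightarrow>
      (\<integral>\<^sup>+x\<in>cball z R. ennreal (norm (Du x) powr p) \<partial>lebesgue) \<le> ennreal T \<Longrightarrow>
      \<exists>G. G \<in> borel_measurable borel \<and> (\<forall>x. c * norm (G x) powr p \<le> F (G x)) \<and>
        (AE x in lebesgue. x \<in> cball z R \<longrightarrow> G x = Du x) \<and>
        (\<integral>\<^sup>+x. ennreal (norm (G x) powr p) \<partial>lborel) \<le> ennreal T \<and>
        reverse_hoelder_on z R \<sigma> K (\<lambda>x. F (G x)) (\<lambda>x. norm (G x) powr (p / \<sigma>))"
proof -
  \<comment> \<open>Makes \<open>(2 * n + 1) * \<delta>\<close> equal to the smaller of 1 and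
    \<open>p - 1\<close>, which yields all four conditions of \<open>weak_reverse_hoelder\<close> at
    once.\<close>
  define \<delta> where "\<delta> = min 1 (p - 1) / (2 * real CARD('n) + 1)"
  have \<delta>0: "\<delta> > 0" using p by (simp add: \<delta>_def)
  have \<delta>m: "(2 * real CARD('n) + 1) * \<delta> = min 1 (p - 1)"
  proof -
    have "2 * real CARD('n) + 1 \<noteq> 0" by linarith
    then show ?thesis unfolding \<delta>_def by simp
  qed
  have n\<delta>: "2 * real CARD('n) * \<delta> \<le> p - \<delta>" using \<delta>m p by (simp add: distrib_right)
  have "\<delta> \<le> real CARD('n) * \<delta>" using \<delta>0 mult_right_mono[of 1 "real CARD('n)" \<delta>] by simp
  then have "3 * \<delta> \<le> (2 * real CARD('n) + 1) * \<delta>" unfolding distrib_right by simp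
  then have "3 * \<delta> \<le> min 1 (p - 1)" unfolding \<delta>m .
  then have \<delta>1: "\<delta> < 1" "\<delta> \<le> p - 1" using \<delta>0 by auto
  define \<sigma> where "\<sigma> = p / (p - \<delta>)"
  have \<sigma>: "\<sigma> > 1" using \<delta>0 \<delta>1 p by (simp add: \<sigma>_def)
  have p\<sigma>: "p - \<delta> = p / \<sigma>" using p by (simp add: \<sigma>_def)
  have Fm[measurable]: "F \<in> borel_measurable borel" using F(1) by (simp add: quasiconcave_def)
  have F0: "F 0 = 0" using pos_homogeneous_0[OF p F(2)] .
  show thesis
  proof (rule weak_reverse_hoelder[OF p F \<delta>0 \<delta>1 n\<delta>, folded \<sigma>_def, unfolded p\<sigma>])
    fix K assume K: "K > 0" and RH: "\<And>\<Omega> (u :: real^'n \<Rightarrow> real^'m) Du z R G x \<rho> N.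
       weak_gradient \<Omega> u Du \<Longrightarrow> cball z R \<subseteq> \<Omega> \<Longrightarrow> integrable lborel G \<Longrightarrow> (\<And>x. x \<notin> cball z R \<Longrightarrow> G x = 0) \<Longrightarrow>
       (AE x in lebesgue. x \<in> cball z R \<longrightarrow> G x = Du x) \<Longrightarrow>
       (\<integral>\<^sup>+x. ennreal (norm (G x) powr p) \<partial>lborel) < \<infinity> \<Longrightarrow> (\<And>x. F (G x) \<ge> 0) \<Longrightarrow>
       \<rho> > 0 \<Longrightarrow> cball x (8 * \<rho>) \<subseteq> cball z R \<Longrightarrow> N > 0 \<Longrightarrow>
       (\<integral>\<^sup>+y\<in>ball x (8 * \<rho>). ennreal (norm (G y) powr (p / \<sigma>)) \<partial>lborel) \<le> ennreal N \<Longrightarrow>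
       (\<integral>\<^sup>+y\<in>ball x \<rho>. ennreal (F (G y)) \<partial>lborel) \<le> ennreal (K * \<rho> powr (real CARD('n) * (1 - \<sigma>)) * N powr \<sigma>)"
    show thesis
    proof (rule that[OF \<sigma> K])
      fix \<Omega> and u :: "real^'n \<Rightarrow> real^'m" and Du :: "real^'n \<Rightarrow> real^'n^'m" and z :: "real^'n" and R c T :: real
      assume wg: "weak_gradient \<Omega> u Du" and sub: "cball z R \<subseteq> \<Omega>" and c: "c \<ge> 0"
        and ineq: "AE x in lebesgue. x \<in> cball z R \<longrightarrow> c * norm (Du x) powr p \<le> F (Du x)"
        and T: "(\<integral>\<^sup>+x\<in>cball z R. ennreal (norm (Du x) powr p) \<partial>lebesgue) \<le> ennreal T"
      have "set_integrable lebesgue (cball z R) Du"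
        using wg sub unfolding weak_gradient_def L1_loc_def by simp
      then obtain g where g[measurable]: "g \<in> borel_measurable borel" and ig: "integrable lborel g"
        and g0: "\<And>x. x \<notin> cball z R \<Longrightarrow> g x = 0" and gDu: "AE x in lebesgue. x \<in> cball z R \<longrightarrow> g x = Du x"
        by (rule borel_representative[OF closed_cball]) (rule that)
      \<comment> \<open>Where the inequality fails the value is reset to 0; there it holds because
        \<open>F 0 = 0\<close>. The resulting condition is Borel, and the change affects a null set
        of the ball only.\<close>
      define G where "G x = (if c * norm (g x) powr p \<le> F (g x) then g x else 0)" for x
      have G[measurable]: "G \<in> borel_measurable borel" unfolding G_def by measurable
      have iG: "integrable lborel G"
        by (rule Bochner_Integration.integrable_bound[OF ig]) (auto simp: G_def)
      have G0: "G x = 0" if "x \<notin> cball z R" for x using g0[OF that] by (simp add: G_def)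
      have GF: "c * norm (G x) powr p \<le> F (G x)" for x by (simp add: G_def F0)
      have F0G: "F (G x) \<ge> 0" for x
        using c by (intro order_trans[OF _ GF[of x]]) simp
      have GDu: "AE x in lebesgue. x \<in> cball z R \<longrightarrow> G x = Du x"
        using gDu ineq by eventually_elim (auto simp: G_def)
      have GT: "(\<integral>\<^sup>+x. ennreal (norm (G x) powr p) \<partial>lborel) \<le> ennreal T"
      proof -
        have "(\<integral>\<^sup>+x. ennreal (norm (G x) powr p) \<partial>lborel) = (\<integral>\<^sup>+x. ennreal (norm (G x) powr p) \<partial>lebesgue)"
          by (simp add: nn_integral_completion)
        also have "\<dots> \<le> (\<integral>\<^sup>+x\<in>cball z R. ennreal (norm (Du x) powr p) \<partial>lebesgue)"
        proof (rule nn_integral_mono_AE)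
          show "AE x in lebesgue. ennreal (norm (G x) powr p) \<le> ennreal (norm (Du x) powr p) * indicator (cball z R) x"
            using GDu
          proof eventually_elim
            case (elim x)
            then show ?case using G0[of x] by (cases "x \<in> cball z R") auto
          qed
        qed
        finally show ?thesis using T by (rule order_trans)
      qed
      then have Gfin: "(\<integral>\<^sup>+x. ennreal (norm (G x) powr p) \<partial>lborel) < \<infinity>"
        using le_less_trans[OF _ ennreal_less_top] by simp
      have "reverse_hoelder_on z R \<sigma> K (\<lambda>x. F (G x)) (\<lambda>x. norm (G x) powr (p / \<sigma>))"
        unfolding reverse_hoelder_on_def using RH[OF wg sub iG G0 GDu Gfin F0G] by simp
      then show "\<exists>G. G \<in> borel_measurable borel \<and> (\<forall>x. c * norm (G x) powr p \<le> F (G x)) \<and>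
        (AE x in lebesgue. x \<in> cball z R \<longrightarrow> G x = Du x) \<and>
        (\<integral>\<^sup>+x. ennreal (norm (G x) powr p) \<partial>lborel) \<le> ennreal T \<and>
        reverse_hoelder_on z R \<sigma> K (\<lambda>x. F (G x)) (\<lambda>x. norm (G x) powr (p / \<sigma>))"
        using G GF GDu GT by blast
    qed
  qed
qed

lemma nn_integral_representative:
  fixes h :: "'b::topological_space \<Rightarrow> ennreal" and G Du :: "'a::euclidean_space \<Rightarrow> 'b"
  assumes "AE x in lebesgue. x \<in> cball z R \<longrightarrow> G x = Du x"
  shows "(\<integral>\<^sup>+x\<in>ball z (R / 2). h (Du x) \<partial>lebesgue) = (\<integral>\<^sup>+x\<in>ball z (R / 2). h (G x) \<partial>lborel)"
proof -
  have "(\<integral>\<^sup>+x\<in>ball z (R / 2). h (Du x) \<partial>lebesgue) = (\<integral>\<^sup>+x\<in>ball z (R / 2). h (G x) \<partial>lebesgue)"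
  proof (rule nn_integral_cong_AE)
    show "AE x in lebesgue. h (Du x) * indicator (ball z (R / 2)) x = h (G x) * indicator (ball z (R / 2)) x"
      using assms
    proof eventually_elim
      case (elim x)
      show ?case
      proof (cases "x \<in> ball z (R / 2)")
        case True
        then have "dist z x < R / 2" by simp
        then have "dist z x \<le> R" using zero_le_dist[of z x] by linarith
        then show ?thesis using elim by simp
      qed simp
    qed
  qed
  then show ?thesis by (simp add: nn_integral_completion)
qed

text \<open>For \<open>s > l\<close> one has \<open>2 + s \<le> (s / l) * (2 + l)\<close>, so the
  weight \<open>ln (2 + s)\<close> exceeds the logarithm above level \<open>l\<close> by at most a
  constant.\<close>

lemma mult_ln_le:
  fixes s l :: real
  assumes "s \<ge> 0" "l > 0"
  shows "s * ln (2 + s) \<le> s * max 0 (ln (s / l)) + ln (2 + l) * s"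
proof (cases "s \<le> l")
  case True
  then have "ln (2 + s) \<le> ln (2 + l)" using assms by simp
  also have "\<dots> \<le> max 0 (ln (s / l)) + ln (2 + l)" by simp
  finally have "s * ln (2 + s) \<le> s * (max 0 (ln (s / l)) + ln (2 + l))" using assms(1) by (rule mult_left_mono)
  then show ?thesis by (simp add: distrib_left mult.commute)
next
  case False
  have "2 + s \<le> s / l * (2 + l)" using False assms by (simp add: field_simps)
  then have "ln (2 + s) \<le> ln (s / l * (2 + l))" using assms False by simp
  also have "\<dots> = ln (s / l) + ln (2 + l)" using assms False by (subst ln_mult) auto
  also have "\<dots> \<le> max 0 (ln (s / l)) + ln (2 + l)" by simp
  finally have "s * ln (2 + s) \<le> s * (max 0 (ln (s / l)) + ln (2 + l))" using assms(1) by (rule mult_left_mono)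
  then show ?thesis by (simp add: distrib_left mult.commute)
qed

text \<open>The bound \<open>B R T\<close> is fixed before the domain, the map and the centre of the
  ball, and keeps only the radius and the gradient mass. The growth of \<open>F\<close> turns the
  gradient mass into a bound for the integral of \<open>F (D u)\<close>.\<close>

lemma LlogL_ball:
  fixes F :: "real^'n^'m \<Rightarrow> real"
  assumes p: "p > 1" and F: "quasiconcave F" "pos_homogeneous p F"
  obtains B where "\<And>\<Omega> (u :: real^'n \<Rightarrow> real^'m) Du z R T. weak_gradient \<Omega> u Du \<Longrightarrow> cball z R \<subseteq> \<Omega> \<Longrightarrow> R > 0 \<Longrightarrow> T \<ge> 0 \<Longrightarrow>
      (AE x in lebesgue. x \<in> \<Omega> \<longrightarrow> F (Du x) \<ge> 0) \<Longrightarrow>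
      (\<integral>\<^sup>+x\<in>cball z R. ennreal (norm (Du x) powr p) \<partial>lebesgue) \<le> ennreal T \<Longrightarrow>
      (\<integral>\<^sup>+x\<in>ball z (R / 2). ennreal (\<bar>F (Du x)\<bar> * ln (2 + \<bar>F (Du x)\<bar>)) \<partial>lebesgue) \<le> ennreal (B R T)"
proof -
  obtain L where L: "L > 0" "\<And>z. F z \<le> L * norm z powr p"
    by (rule quasiconcave_homogeneous_growth[OF p F]) (rule that)
  have Fm[measurable]: "F \<in> borel_measurable borel" using F(1) by (simp add: quasiconcave_def)
  show thesis
  proof (rule weak_gradient_representative[OF p F])
    fix \<sigma> K assume \<sigma>: "\<sigma> > 1" and K: "K > 0" and rep: "\<And>\<Omega> (u :: real^'n \<Rightarrow> real^'m) Du z R c T. weak_gradient \<Omega> u Du \<Longrightarrow> cball z R \<subseteq> \<Omega> \<Longrightarrow>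
      (AE x in lebesgue. x \<in> cball z R \<longrightarrow> c * norm (Du x) powr p \<le> F (Du x)) \<Longrightarrow> c \<ge> 0 \<Longrightarrow>
      (\<integral>\<^sup>+x\<in>cball z R. ennreal (norm (Du x) powr p) \<partial>lebesgue) \<le> ennreal T \<Longrightarrow>
      \<exists>G. G \<in> borel_measurable borel \<and> (\<forall>x. c * norm (G x) powr p \<le> F (G x)) \<and>
        (AE x in lebesgue. x \<in> cball z R \<longrightarrow> G x = Du x) \<and>
        (\<integral>\<^sup>+x. ennreal (norm (G x) powr p) \<partial>lborel) \<le> ennreal T \<and>
        reverse_hoelder_on z R \<sigma> K (\<lambda>x. F (G x)) (\<lambda>x. norm (G x) powr (p / \<sigma>))"
    show thesis
    proof (rule LlogL_of_reverse_hoelder[OF \<sigma> K])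
      fix C assume C: "C \<ge> 0" and est: "\<And>(f :: real^'n \<Rightarrow> real) \<psi> z R I l0.
        f \<in> borel_measurable borel \<Longrightarrow> (\<And>x. f x \<ge> 0) \<Longrightarrow> \<psi> \<in> borel_measurable borel \<Longrightarrow> (\<And>x. \<psi> x \<ge> 0) \<Longrightarrow>
        (\<integral>\<^sup>+x. ennreal (f x) \<partial>lborel) \<le> ennreal I \<Longrightarrow> reverse_hoelder_on z R \<sigma> K f \<psi> \<Longrightarrow> R > 0 \<Longrightarrow> l0 > 0 \<Longrightarrow>
        I * 48 ^ CARD('n) \<le> l0 * unit_ball_vol CARD('n) * (R / 2) ^ CARD('n) \<Longrightarrow>
        (\<integral>\<^sup>+x\<in>ball z (R / 2). ennreal (f x * max 0 (ln (f x / l0))) \<partial>lborel) \<le> ennreal C * (\<integral>\<^sup>+x\<in>ball z R. ennreal (\<psi> x powr \<sigma>) \<partial>lborel)"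
      define w where "w = unit_ball_vol CARD('n)"
      have w: "w > 0" by (simp add: w_def)
      \<comment> \<open>The added 1 keeps the mass bound, and with it the level threshold
        \<open>l0\<close>, positive when \<open>T = 0\<close>.\<close>
      define I where "I T = L * T + 1" for T
      define l0 where "l0 R T = I T * 48 ^ CARD('n) / (w * (R / 2) ^ CARD('n))" for R T
      show thesis
      proof (rule that[where B = "\<lambda>R T. C * T + ln (2 + l0 R T) * I T"])
        fix \<Omega> and u :: "real^'n \<Rightarrow> real^'m" and Du :: "real^'n \<Rightarrow> real^'n^'m" and z :: "real^'n" and R T :: real
        assume wg: "weak_gradient \<Omega> u Du" and sub: "cball z R \<subseteq> \<Omega>" and R: "R > 0" and T0: "T \<ge> 0"
          and ineq: "AE x in lebesgue. x \<in> \<Omega> \<longrightarrow> F (Du x) \<ge> 0"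
          and T: "(\<integral>\<^sup>+x\<in>cball z R. ennreal (norm (Du x) powr p) \<partial>lebesgue) \<le> ennreal T"
        have "AE x in lebesgue. x \<in> cball z R \<longrightarrow> 0 * norm (Du x) powr p \<le> F (Du x)"
          using ineq sub by (auto elim!: eventually_mono)
        from rep[OF wg sub this order_refl T] obtain G where G[measurable]: "G \<in> borel_measurable borel"
          and FG: "\<And>x. F (G x) \<ge> 0" and GDu: "AE x in lebesgue. x \<in> cball z R \<longrightarrow> G x = Du x"
          and GT: "(\<integral>\<^sup>+x. ennreal (norm (G x) powr p) \<partial>lborel) \<le> ennreal T"
          and RH: "reverse_hoelder_on z R \<sigma> K (\<lambda>x. F (G x)) (\<lambda>x. norm (G x) powr (p / \<sigma>))"
          by auto
        have I: "I T > 0" using L(1) T0 by (simp add: I_def add_nonneg_pos)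
        have l0: "l0 R T > 0" using I w R by (simp add: l0_def)
        have FI: "(\<integral>\<^sup>+x. ennreal (F (G x)) \<partial>lborel) \<le> ennreal (I T)"
        proof -
          have "(\<integral>\<^sup>+x. ennreal (F (G x)) \<partial>lborel) \<le> (\<integral>\<^sup>+x. ennreal L * ennreal (norm (G x) powr p) \<partial>lborel)"
            using L by (intro nn_integral_mono) (simp flip: ennreal_mult)
          also have "\<dots> = ennreal L * (\<integral>\<^sup>+x. ennreal (norm (G x) powr p) \<partial>lborel)"
            by (rule nn_integral_cmult) measurable
          also have "\<dots> \<le> ennreal L * ennreal T" by (rule mult_left_mono[OF GT]) simp
          also have "\<dots> \<le> ennreal (I T)" using L T0 by (simp add: I_def flip: ennreal_mult)
          finally show ?thesis .
        qed
        have \<psi>\<sigma>: "(norm (G x) powr (p / \<sigma>)) powr \<sigma> = norm (G x) powr p" for x using \<sigma> by (simp add: powr_powr)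
        have Il: "I T * 48 ^ CARD('n) \<le> l0 R T * unit_ball_vol CARD('n) * (R / 2) ^ CARD('n)"
          using w R by (simp add: l0_def flip: w_def)
        have main: "(\<integral>\<^sup>+x\<in>ball z (R / 2). ennreal (F (G x) * max 0 (ln (F (G x) / l0 R T))) \<partial>lborel) \<le> ennreal C * ennreal T"
        proof -
          have "(\<integral>\<^sup>+x\<in>ball z (R / 2). ennreal (F (G x) * max 0 (ln (F (G x) / l0 R T))) \<partial>lborel)
              \<le> ennreal C * (\<integral>\<^sup>+x\<in>ball z R. ennreal (norm (G x) powr p) \<partial>lborel)"
            using est[OF _ FG _ _ FI RH R l0 Il, unfolded \<psi>\<sigma>] by simp
          also have "\<dots> \<le> ennreal C * (\<integral>\<^sup>+x. ennreal (norm (G x) powr p) \<partial>lborel)"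
            by (intro mult_left_mono nn_integral_mono) (auto simp: indicator_def)
          also have "\<dots> \<le> ennreal C * ennreal T" by (rule mult_left_mono[OF GT]) simp
          finally show ?thesis .
        qed
        have ln0: "ln (2 + l0 R T) \<ge> 0" using l0 by simp
        have "(\<integral>\<^sup>+x\<in>ball z (R / 2). ennreal (\<bar>F (Du x)\<bar> * ln (2 + \<bar>F (Du x)\<bar>)) \<partial>lebesgue)
            = (\<integral>\<^sup>+x\<in>ball z (R / 2). ennreal (\<bar>F (G x)\<bar> * ln (2 + \<bar>F (G x)\<bar>)) \<partial>lborel)"
          by (rule nn_integral_representative[OF GDu])
        also have "\<dots> \<le> (\<integral>\<^sup>+x. ennreal (F (G x) * max 0 (ln (F (G x) / l0 R T))) * indicator (ball z (R / 2)) x + ennreal (ln (2 + l0 R T)) * ennreal (F (G x)) \<partial>lborel)"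
        proof (rule nn_integral_mono)
          fix x
          have "ennreal (\<bar>F (G x)\<bar> * ln (2 + \<bar>F (G x)\<bar>)) \<le> ennreal (F (G x) * max 0 (ln (F (G x) / l0 R T)) + ln (2 + l0 R T) * F (G x))"
            using mult_ln_le[OF FG l0, of x] FG[of x] by (intro ennreal_leI) simp
          also have "\<dots> = ennreal (F (G x) * max 0 (ln (F (G x) / l0 R T))) + ennreal (ln (2 + l0 R T)) * ennreal (F (G x))"
            using FG[of x] ln0 by (simp add: ennreal_mult)
          finally show "ennreal (\<bar>F (G x)\<bar> * ln (2 + \<bar>F (G x)\<bar>)) * indicator (ball z (R / 2)) x
              \<le> ennreal (F (G x) * max 0 (ln (F (G x) / l0 R T))) * indicator (ball z (R / 2)) x + ennreal (ln (2 + l0 R T)) * ennreal (F (G x))"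
            by (cases "x \<in> ball z (R / 2)") simp_all
        qed
        also have "\<dots> = (\<integral>\<^sup>+x\<in>ball z (R / 2). ennreal (F (G x) * max 0 (ln (F (G x) / l0 R T))) \<partial>lborel) + ennreal (ln (2 + l0 R T)) * (\<integral>\<^sup>+x. ennreal (F (G x)) \<partial>lborel)"
          by (subst nn_integral_add) (auto simp: nn_integral_cmult intro!: borel_measurable_times_ennreal borel_measurable_indicator)
        also have "\<dots> \<le> ennreal C * ennreal T + ennreal (ln (2 + l0 R T)) * ennreal (I T)"
          by (intro add_mono main mult_left_mono FI) simp
        also have "\<dots> = ennreal (C * T + ln (2 + l0 R T) * I T)"
          using C T0 ln0 I by (simp add: ennreal_mult)
        finally show "(\<integral>\<^sup>+x\<in>ball z (R / 2). ennreal (\<bar>F (Du x)\<bar> * ln (2 + \<bar>F (Du x)\<bar>)) \<partial>lebesgue)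
            \<le> ennreal (C * T + ln (2 + l0 R T) * I T)" .
      qed
    qed
  qed
qed

lemma higher_integrability_ball:
  fixes F :: "real^'n^'m \<Rightarrow> real"
  assumes p: "p > 1" and F: "quasiconcave F" "pos_homogeneous p F" and c: "c > 0"
  obtains e0 B where "e0 > 0" "\<And>\<Omega> (u :: real^'n \<Rightarrow> real^'m) Du z R T e. weak_gradient \<Omega> u Du \<Longrightarrow> cball z R \<subseteq> \<Omega> \<Longrightarrow> R > 0 \<Longrightarrow> T \<ge> 0 \<Longrightarrow>
      (AE x in lebesgue. x \<in> \<Omega> \<longrightarrow> c * norm (Du x) powr p \<le> F (Du x)) \<Longrightarrow>
      (\<integral>\<^sup>+x\<in>cball z R. ennreal (norm (Du x) powr p) \<partial>lebesgue) \<le> ennreal T \<Longrightarrow> 0 < e \<Longrightarrow> e < e0 \<Longrightarrow>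
      (\<integral>\<^sup>+x\<in>ball z (R / 2). ennreal (F (Du x) powr (1 + e)) \<partial>lebesgue) \<le> ennreal (B e R T)"
proof -
  obtain L where L: "L > 0" "\<And>z. F z \<le> L * norm z powr p"
    by (rule quasiconcave_homogeneous_growth[OF p F]) (rule that)
  have Fm[measurable]: "F \<in> borel_measurable borel" using F(1) by (simp add: quasiconcave_def)
  show thesis
  proof (rule weak_gradient_representative[OF p F])
    fix \<sigma> K assume \<sigma>: "\<sigma> > 1" and K: "K > 0" and rep: "\<And>\<Omega> (u :: real^'n \<Rightarrow> real^'m) Du z R c T. weak_gradient \<Omega> u Du \<Longrightarrow> cball z R \<subseteq> \<Omega> \<Longrightarrow>
      (AE x in lebesgue. x \<in> cball z R \<longrightarrow> c * norm (Du x) powr p \<le> F (Du x)) \<Longrightarrow> c \<ge> 0 \<Longrightarrow>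
      (\<integral>\<^sup>+x\<in>cball z R. ennreal (norm (Du x) powr p) \<partial>lebesgue) \<le> ennreal T \<Longrightarrow>
      \<exists>G. G \<in> borel_measurable borel \<and> (\<forall>x. c * norm (G x) powr p \<le> F (G x)) \<and>
        (AE x in lebesgue. x \<in> cball z R \<longrightarrow> G x = Du x) \<and>
        (\<integral>\<^sup>+x. ennreal (norm (G x) powr p) \<partial>lborel) \<le> ennreal T \<and>
        reverse_hoelder_on z R \<sigma> K (\<lambda>x. F (G x)) (\<lambda>x. norm (G x) powr (p / \<sigma>))"
    \<comment> \<open>The comparison constant of Gehring's lemma: the power \<open>\<sigma>\<close>
      of \<open>\<psi>\<close> is \<open>norm (G x) powr p\<close>, which is at most
      \<open>F (G x) / c\<close>.\<close>
    have B: "1 / c > 0" using c by simp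
    show thesis
    proof (rule higher_integrability_of_reverse_hoelder[OF \<sigma> K B])
      fix e0 :: real assume e0: "e0 > 0" and est: "\<And>(f :: real^'n \<Rightarrow> real) \<psi> z R I e.
        f \<in> borel_measurable borel \<Longrightarrow> (\<And>x. f x \<ge> 0) \<Longrightarrow> \<psi> \<in> borel_measurable borel \<Longrightarrow> (\<And>x. \<psi> x \<ge> 0) \<Longrightarrow>
        (\<And>x. \<psi> x powr \<sigma> \<le> 1 / c * f x) \<Longrightarrow> (\<integral>\<^sup>+x. ennreal (f x) \<partial>lborel) \<le> ennreal I \<Longrightarrow> I > 0 \<Longrightarrow>
        reverse_hoelder_on z R \<sigma> K f \<psi> \<Longrightarrow> R > 0 \<Longrightarrow> 0 < e \<Longrightarrow> e < e0 \<Longrightarrow>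
        (\<integral>\<^sup>+x\<in>ball z (R / 2). ennreal (f x powr (1 + e)) \<partial>lborel)
          \<le> ennreal (2 * ((I * 48 ^ CARD('n) / unit_ball_vol CARD('n)) powr e * I * (R / 4) powr (- (real CARD('n) * e))))"
      define I where "I T = L * T + 1" for T
      define Bd where "Bd e R T = 2 * ((I T * 48 ^ CARD('n) / unit_ball_vol CARD('n)) powr e * I T * (R / 4) powr (- (real CARD('n) * e)))" for e R T
      show thesis
      proof (rule that[OF e0, of Bd])
        fix \<Omega> and u :: "real^'n \<Rightarrow> real^'m" and Du :: "real^'n \<Rightarrow> real^'n^'m" and z :: "real^'n" and R T e :: real
        assume wg: "weak_gradient \<Omega> u Du" and sub: "cball z R \<subseteq> \<Omega>" and R: "R > 0" and T0: "T \<ge> 0"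
          and ineq: "AE x in lebesgue. x \<in> \<Omega> \<longrightarrow> c * norm (Du x) powr p \<le> F (Du x)"
          and T: "(\<integral>\<^sup>+x\<in>cball z R. ennreal (norm (Du x) powr p) \<partial>lebesgue) \<le> ennreal T"
          and e: "0 < e" "e < e0"
        have "AE x in lebesgue. x \<in> cball z R \<longrightarrow> c * norm (Du x) powr p \<le> F (Du x)"
          using ineq sub by (auto elim!: eventually_mono)
        from rep[OF wg sub this less_imp_le[OF c] T] obtain G where G[measurable]: "G \<in> borel_measurable borel"
          and cG: "\<And>x. c * norm (G x) powr p \<le> F (G x)" and GDu: "AE x in lebesgue. x \<in> cball z R \<longrightarrow> G x = Du x"
          and GT: "(\<integral>\<^sup>+x. ennreal (norm (G x) powr p) \<partial>lborel) \<le> ennreal T"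
          and RH: "reverse_hoelder_on z R \<sigma> K (\<lambda>x. F (G x)) (\<lambda>x. norm (G x) powr (p / \<sigma>))"
          by auto
        have FG: "F (G x) \<ge> 0" for x using c by (intro order_trans[OF _ cG[of x]]) simp
        have I: "I T > 0" using L(1) T0 by (simp add: I_def add_nonneg_pos)
        have FI: "(\<integral>\<^sup>+x. ennreal (F (G x)) \<partial>lborel) \<le> ennreal (I T)"
        proof -
          have "(\<integral>\<^sup>+x. ennreal (F (G x)) \<partial>lborel) \<le> (\<integral>\<^sup>+x. ennreal L * ennreal (norm (G x) powr p) \<partial>lborel)"
            using L by (intro nn_integral_mono) (simp flip: ennreal_mult)
          also have "\<dots> = ennreal L * (\<integral>\<^sup>+x. ennreal (norm (G x) powr p) \<partial>lborel)"
            by (rule nn_integral_cmult) measurable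
          also have "\<dots> \<le> ennreal L * ennreal T" by (rule mult_left_mono[OF GT]) simp
          also have "\<dots> \<le> ennreal (I T)" using L T0 by (simp add: I_def flip: ennreal_mult)
          finally show ?thesis .
        qed
        have \<psi>f: "(norm (G x) powr (p / \<sigma>)) powr \<sigma> \<le> 1 / c * F (G x)" for x
          using \<sigma> cG[of x] c by (simp add: powr_powr field_simps)
        have "(\<integral>\<^sup>+x\<in>ball z (R / 2). ennreal (F (Du x) powr (1 + e)) \<partial>lebesgue) = (\<integral>\<^sup>+x\<in>ball z (R / 2). ennreal (F (G x) powr (1 + e)) \<partial>lborel)"
          by (rule nn_integral_representative[OF GDu])
        also have "\<dots> \<le> ennreal (Bd e R T)"
          unfolding Bd_def by (rule est[OF _ FG _ _ \<psi>f FI I RH R e]) auto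
        finally show "(\<integral>\<^sup>+x\<in>ball z (R / 2). ennreal (F (Du x) powr (1 + e)) \<partial>lebesgue) \<le> ennreal (Bd e R T)" .
      qed
    qed
  qed
qed

section \<open>From balls to compactly contained open sets\<close>

lemma compact_ball_cover:
  fixes S :: "'a::euclidean_space set"
  assumes "compact S" "open U" "S \<subseteq> U"
  obtains Z where "finite Z" "\<And>z R. (z, R) \<in> Z \<Longrightarrow> R > 0 \<and> cball z R \<subseteq> U" "S \<subseteq> (\<Union>(z, R)\<in>Z. ball z (R / 2))"
proof -
  define P where "P = {(z, R). R > 0 \<and> cball z R \<subseteq> U}"
  have "S \<subseteq> (\<Union>q\<in>P. ball (fst q) (snd q / 2))"
  proof
    fix x assume "x \<in> S"
    then obtain R where "R > 0" "cball x R \<subseteq> U" using assms open_contains_cball by blast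
    then have "(x, R) \<in> P" "x \<in> ball (fst (x, R)) (snd (x, R) / 2)" by (simp_all add: P_def)
    then show "x \<in> (\<Union>q\<in>P. ball (fst q) (snd q / 2))" by blast
  qed
  then obtain Z where "Z \<subseteq> P" "finite Z" "S \<subseteq> (\<Union>q\<in>Z. ball (fst q) (snd q / 2))"
    by (rule compactE_image[OF assms(1), rotated]) auto
  then show thesis by (intro that[of Z]) (auto simp: P_def split_beta)
qed

text \<open>A choice of cover as a function of the two sets. Selecting it before any map is given
  makes the final constants depend on the sets but not on the map.\<close>

lemma exists_ball_cover:
  "\<exists>Z. \<forall>\<omega> \<omega>' :: 'a::euclidean_space set. open \<omega>' \<and> \<omega> \<Subset> \<omega>' \<longrightarrow> finite (Z \<omega> \<omega>') \<and>
    (\<forall>(z, R)\<in>Z \<omega> \<omega>'. R > 0 \<and> cball z R \<subseteq> \<omega>') \<and> \<omega> \<subseteq> (\<Union>(z, R)\<in>Z \<omega> \<omega>'. ball z (R / 2))"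
proof -
  define P where "P \<omega> \<omega>' Z \<longleftrightarrow> finite Z \<and> (\<forall>(z, R)\<in>Z. R > 0 \<and> cball z R \<subseteq> \<omega>') \<and> \<omega> \<subseteq> (\<Union>(z, R)\<in>Z. ball z (R / 2))"
    for \<omega> \<omega>' :: "'a set" and Z
  have "\<exists>Z. P \<omega> \<omega>' Z" if "open \<omega>'" "\<omega> \<Subset> \<omega>'" for \<omega> \<omega>'
  proof -
    have "compact (closure \<omega>)" "closure \<omega> \<subseteq> \<omega>'" using that by (auto simp: compactly_contained_def)
    then obtain Z where "finite Z" "\<And>z R. (z, R) \<in> Z \<Longrightarrow> R > 0 \<and> cball z R \<subseteq> \<omega>'"
      "closure \<omega> \<subseteq> (\<Union>(z, R)\<in>Z. ball z (R / 2))"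
      by (rule compact_ball_cover[OF _ \<open>open \<omega>'\<close>]) (rule that)
    then have "P \<omega> \<omega>' Z" unfolding P_def using closure_subset[of \<omega>] by auto
    then show ?thesis ..
  qed
  then have "P \<omega> \<omega>' (SOME Z. P \<omega> \<omega>' Z)" if "open \<omega>'" "\<omega> \<Subset> \<omega>'" for \<omega> \<omega>' using that by (simp add: someI_ex)
  then have "\<exists>Z. \<forall>\<omega> \<omega>'. open \<omega>' \<and> \<omega> \<Subset> \<omega>' \<longrightarrow> P \<omega> \<omega>' (Z \<omega> \<omega>')"
    by (intro exI[of _ "\<lambda>\<omega> \<omega>'. SOME Z. P \<omega> \<omega>' Z"] allI impI) blast
  then show ?thesis unfolding P_def .
qed

text \<open>Local membership speaks of one open set, the estimates of two. The union of the half
  balls of a finite cover lies between, since its closure stays in the union of the full closed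
  balls.\<close>

lemma compactly_contained_interpolate:
  fixes \<omega> :: "'a::euclidean_space set"
  assumes "\<omega> \<Subset> \<Omega>" "open \<Omega>"
  obtains \<omega>' where "open \<omega>'" "\<omega> \<Subset> \<omega>'" "\<omega>' \<Subset> \<Omega>"
proof -
  have c: "compact (closure \<omega>)" "closure \<omega> \<subseteq> \<Omega>" using assms by (auto simp: compactly_contained_def)
  obtain Z where Z: "finite Z" "\<And>z R. (z, R) \<in> Z \<Longrightarrow> R > 0 \<and> cball z R \<subseteq> \<Omega>"
    "closure \<omega> \<subseteq> (\<Union>(z, R)\<in>Z. ball z (R / 2))"
    by (rule compact_ball_cover[OF c(1) assms(2) c(2)]) (rule that)
  define \<omega>' where "\<omega>' = (\<Union>(z, R)\<in>Z. ball z (R / 2))"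
  define S where "S = (\<Union>(z, R)\<in>Z. cball z R)"
  have S: "compact S" unfolding S_def using Z(1) by (intro compact_UN) auto
  have sub: "\<omega>' \<subseteq> S"
    unfolding \<omega>'_def S_def using Z(2) by (intro UN_mono) (fastforce simp: subset_iff)+
  then have cl: "closure \<omega>' \<subseteq> S" using S by (intro closure_minimal compact_imp_closed)
  have "compact (closure \<omega>')" using S sub by (meson bounded_subset compact_closure compact_imp_bounded)
  moreover have "S \<subseteq> \<Omega>" unfolding S_def using Z(2) by blast
  ultimately have "\<omega>' \<Subset> \<Omega>" using cl by (auto simp: compactly_contained_def)
  moreover have "open \<omega>'" unfolding \<omega>'_def by (intro open_UN) auto
  moreover have "\<omega> \<Subset> \<omega>'" using c Z(3) by (simp add: compactly_contained_def \<omega>'_def)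
  ultimately show thesis by (intro that)
qed

text \<open>The \<open>max 0\<close> turns the local bounds into nonnegative numbers, so that their
  sum can be moved inside \<open>ennreal\<close>. Multiplication by the indicator of
  \<open>U\<close> is where measurability is available.\<close>

lemma nn_integral_ball_cover_le:
  fixes g :: "'a::euclidean_space \<Rightarrow> ennreal" and B :: "real \<Rightarrow> real"
  assumes Z: "finite Z" "\<And>z R. (z, R) \<in> Z \<Longrightarrow> cball z R \<subseteq> U \<and> R > 0" "\<omega> \<subseteq> (\<Union>(z, R)\<in>Z. ball z (R / 2))"
    and g: "(\<lambda>x. g x * indicator U x) \<in> borel_measurable lebesgue"
    and B: "\<And>z R. (z, R) \<in> Z \<Longrightarrow> (\<integral>\<^sup>+x\<in>ball z (R / 2). g x \<partial>lebesgue) \<le> ennreal (B R)"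
  shows "(\<integral>\<^sup>+x\<in>\<omega>. g x \<partial>lebesgue) \<le> ennreal (\<Sum>(z, R)\<in>Z. max 0 (B R))"
proof -
  have "(\<integral>\<^sup>+x\<in>\<omega>. g x \<partial>lebesgue) \<le> (\<integral>\<^sup>+x. (\<Sum>(z, R)\<in>Z. (g x * indicator U x) * indicator (ball z (R / 2)) x) \<partial>lebesgue)"
  proof (rule nn_integral_mono)
    fix x
    show "g x * indicator \<omega> x \<le> (\<Sum>(z, R)\<in>Z. (g x * indicator U x) * indicator (ball z (R / 2)) x)"
    proof (cases "x \<in> \<omega>")
      case True
      then obtain z R where zR: "(z, R) \<in> Z" "x \<in> ball z (R / 2)" using Z(3) by blast
      then have "dist z x < R / 2" "R > 0" using Z(2) by auto
      then have "x \<in> cball z R" by simp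
      then have "x \<in> U" using zR Z(2) by blast
      then have "g x * indicator \<omega> x = (case (z, R) of (z, R) \<Rightarrow> (g x * indicator U x) * indicator (ball z (R / 2)) x)"
        using True zR by simp
      also have "\<dots> \<le> (\<Sum>(z, R)\<in>Z. (g x * indicator U x) * indicator (ball z (R / 2)) x)"
        by (rule member_le_sum[OF zR(1) _ Z(1)]) auto
      finally show ?thesis .
    qed simp
  qed
  also have "\<dots> = (\<Sum>(z, R)\<in>Z. (\<integral>\<^sup>+x. (g x * indicator U x) * indicator (ball z (R / 2)) x \<partial>lebesgue))"
    unfolding split_beta
    by (rule nn_integral_sum) (intro borel_measurable_times_ennreal g borel_measurable_indicator, auto)
  also have "\<dots> \<le> (\<Sum>(z, R)\<in>Z. ennreal (max 0 (B R)))"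
  proof (rule sum_mono)
    fix q assume "q \<in> Z"
    moreover obtain z R where q: "q = (z, R)" by (cases q)
    ultimately have "(\<integral>\<^sup>+x\<in>ball z (R / 2). g x \<partial>lebesgue) \<le> ennreal (max 0 (B R))"
      using B[of z R] by (auto intro: order_trans ennreal_leI)
    moreover have "(\<integral>\<^sup>+x. (g x * indicator U x) * indicator (ball z (R / 2)) x \<partial>lebesgue) \<le> (\<integral>\<^sup>+x\<in>ball z (R / 2). g x \<partial>lebesgue)"
      by (rule nn_integral_mono) (auto simp: indicator_def)
    ultimately show "(case q of (z, R) \<Rightarrow> \<integral>\<^sup>+x. (g x * indicator U x) * indicator (ball z (R / 2)) x \<partial>lebesgue) \<le> (case q of (z, R) \<Rightarrow> ennreal (max 0 (B R)))"
      unfolding q by (auto intro: order_trans)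
  qed
  also have "\<dots> = ennreal (\<Sum>(z, R)\<in>Z. max 0 (B R))"
    unfolding split_beta by (rule sum_ennreal) simp
  finally show ?thesis .
qed

text \<open>Translates the norm of the theorem, a Bochner integral of the operator norm, into the
  nonnegative integral of the Euclidean norm used on balls. Membership \<open>in_Lp\<close> excludes
  the default value 0 of a divergent Bochner integral.\<close>

lemma nn_integral_norm_powr_le_Lp_norm:
  fixes f :: "real^'n \<Rightarrow> real^'n^'m"
  assumes p: "p > 0" and f: "in_Lp p U f"
  shows "(\<integral>\<^sup>+x\<in>U. ennreal (norm (f x) powr p) \<partial>lebesgue) \<le> ennreal ((real (CARD('m) * CARD('n)) * Lp_norm p U f) powr p)"
proof -
  define \<kappa> where "\<kappa> = real (CARD('m) * CARD('n))"
  have si: "set_integrable lebesgue U (\<lambda>x. op_norm (f x) powr p)" using f by (simp add: in_Lp_def)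
  define J where "J = (LINT x:U|lebesgue. op_norm (f x) powr p)"
  have J: "J \<ge> 0" unfolding J_def set_lebesgue_integral_def by (rule Bochner_Integration.integral_nonneg) simp
  have m: "(\<lambda>x. ennreal (indicat_real U x *\<^sub>R op_norm (f x) powr p)) \<in> borel_measurable lebesgue"
    using si unfolding set_integrable_def by (intro measurable_compose[OF _ measurable_ennreal]) auto
  have "(\<integral>\<^sup>+x\<in>U. ennreal (norm (f x) powr p) \<partial>lebesgue) \<le> (\<integral>\<^sup>+x. ennreal (\<kappa> powr p) * ennreal (indicat_real U x *\<^sub>R op_norm (f x) powr p) \<partial>lebesgue)"
  proof (rule nn_integral_mono)
    fix x
    have "norm (f x) powr p \<le> (\<kappa> * op_norm (f x)) powr p"
      using p norm_le_op_norm[of "f x"] unfolding \<kappa>_def by (intro powr_mono2) auto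
    then have "norm (f x) powr p \<le> \<kappa> powr p * op_norm (f x) powr p" by (simp add: powr_mult)
    then have "ennreal (norm (f x) powr p) \<le> ennreal (\<kappa> powr p) * ennreal (op_norm (f x) powr p)"
      by (subst ennreal_mult[symmetric]) (auto intro: ennreal_leI)
    then show "ennreal (norm (f x) powr p) * indicator U x \<le> ennreal (\<kappa> powr p) * ennreal (indicat_real U x *\<^sub>R op_norm (f x) powr p)"
      by (cases "x \<in> U") auto
  qed
  also have "\<dots> = ennreal (\<kappa> powr p) * (\<integral>\<^sup>+x. ennreal (indicat_real U x *\<^sub>R op_norm (f x) powr p) \<partial>lebesgue)"
    by (rule nn_integral_cmult[OF m])
  also have "(\<integral>\<^sup>+x. ennreal (indicat_real U x *\<^sub>R op_norm (f x) powr p) \<partial>lebesgue) = ennreal J"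
    unfolding J_def set_lebesgue_integral_def
    by (rule nn_integral_eq_integral) (use si in \<open>auto simp: set_integrable_def\<close>)
  also have "ennreal (\<kappa> powr p) * ennreal J = ennreal ((\<kappa> * Lp_norm p U f) powr p)"
    using p J by (simp add: Lp_norm_def powr_mult powr_powr ennreal_mult flip: J_def)
  finally show ?thesis unfolding \<kappa>_def .
qed

text \<open>Division by \<open>s \<ge> 1\<close> only decreases the logarithm, so the modular at
  scale \<open>s\<close> is at most \<open>A / s\<close>. Hence \<open>max 1 A\<close> is admissible
  in the Luxemburg norm.\<close>

lemma LlogL_norm_le:
  assumes m: "(\<lambda>x. ennreal (\<bar>f x\<bar> * ln (2 + \<bar>f x\<bar>)) * indicator \<omega> x) \<in> borel_measurable lebesgue"
    and A: "(\<integral>\<^sup>+x\<in>\<omega>. ennreal (\<bar>f x\<bar> * ln (2 + \<bar>f x\<bar>)) \<partial>lebesgue) \<le> ennreal A"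
  shows "LlogL_norm \<omega> f \<le> ennreal (max 1 A)"
proof -
  define s where "s = max 1 A"
  have s: "s \<ge> 1" "A \<le> s" by (auto simp: s_def)
  have "(\<integral>\<^sup>+x\<in>\<omega>. ennreal (\<bar>f x\<bar> / s * ln (2 + \<bar>f x\<bar> / s)) \<partial>lebesgue)
      \<le> (\<integral>\<^sup>+x. ennreal (1 / s) * (ennreal (\<bar>f x\<bar> * ln (2 + \<bar>f x\<bar>)) * indicator \<omega> x) \<partial>lebesgue)"
  proof (rule nn_integral_mono)
    fix x
    have "\<bar>f x\<bar> / s \<le> \<bar>f x\<bar>" using s mult_left_mono[of 1 s "\<bar>f x\<bar>"] by (simp add: divide_le_eq)
    then have "ln (2 + \<bar>f x\<bar> / s) \<le> ln (2 + \<bar>f x\<bar>)" using s by (intro ln_mono) (auto intro!: add_pos_nonneg)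
    then have "\<bar>f x\<bar> / s * ln (2 + \<bar>f x\<bar> / s) \<le> \<bar>f x\<bar> / s * ln (2 + \<bar>f x\<bar>)"
      using s by (intro mult_left_mono) auto
    also have "\<dots> = 1 / s * (\<bar>f x\<bar> * ln (2 + \<bar>f x\<bar>))" by simp
    finally have "ennreal (\<bar>f x\<bar> / s * ln (2 + \<bar>f x\<bar> / s)) \<le> ennreal (1 / s) * ennreal (\<bar>f x\<bar> * ln (2 + \<bar>f x\<bar>))"
      using s by (subst ennreal_mult[symmetric]) (auto intro: ennreal_leI)
    then show "ennreal (\<bar>f x\<bar> / s * ln (2 + \<bar>f x\<bar> / s)) * indicator \<omega> x
        \<le> ennreal (1 / s) * (ennreal (\<bar>f x\<bar> * ln (2 + \<bar>f x\<bar>)) * indicator \<omega> x)"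
      by (cases "x \<in> \<omega>") auto
  qed
  also have "\<dots> = ennreal (1 / s) * (\<integral>\<^sup>+x\<in>\<omega>. ennreal (\<bar>f x\<bar> * ln (2 + \<bar>f x\<bar>)) \<partial>lebesgue)"
    by (rule nn_integral_cmult[OF m])
  also have "\<dots> \<le> ennreal (1 / s) * ennreal s"
    using s by (intro mult_left_mono order_trans[OF A] ennreal_leI) auto
  also have "\<dots> = 1" using s by (simp flip: ennreal_mult)
  finally show ?thesis
    unfolding LlogL_norm_def s_def[symmetric] using s by (intro Inf_lower) auto
qed

lemma weak_gradient_measurable:
  assumes "weak_gradient \<Omega> u Du" "\<omega> \<Subset> \<Omega>" "open \<omega>"
  shows "(\<lambda>x. indicat_real \<omega> x *\<^sub>R Du x) \<in> borel_measurable lebesgue"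
proof -
  have c: "compact (closure \<omega>)" "closure \<omega> \<subseteq> \<Omega>" using assms(2) unfolding compactly_contained_def by auto
  have "L1_loc \<Omega> Du" using assms(1) unfolding weak_gradient_def by (elim conjE)
  then have "set_integrable lebesgue (closure \<omega>) Du" unfolding L1_loc_def using c by blast
  moreover have "\<omega> \<in> sets lebesgue" using borel_open[OF assms(3)] by simp
  ultimately have "set_integrable lebesgue \<omega> Du" using closure_subset by (rule set_integrable_subset)
  then show ?thesis unfolding set_integrable_def by (rule borel_measurable_integrable)
qed

theorem theorem1:
  fixes F :: "real^'n^'m \<Rightarrow> real" and p :: real
  assumes "p > 1" and "quasiconcave F" and "pos_homogeneous p F"
  shows
    "(\<exists>C :: real \<Rightarrow> (real^'n) set \<Rightarrow> (real^'n) set \<Rightarrow> real.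
        \<forall>(\<Omega> :: (real^'n) set) (u :: real^'n \<Rightarrow> real^'m) (Du :: real^'n \<Rightarrow> real^'n^'m).
          open \<Omega> \<and> weak_gradient \<Omega> u Du \<and> in_Lp_loc p \<Omega> Du \<and>
          (AE x in lebesgue. x \<in> \<Omega> \<longrightarrow> F (Du x) \<ge> 0) \<longrightarrow>
            in_LlogL_loc \<Omega> (\<lambda>x. F (Du x)) \<and>
            (\<forall>\<omega> \<omega>'. open \<omega> \<and> open \<omega>' \<and> \<omega> \<Subset> \<omega>' \<and> \<omega>' \<Subset> \<Omega> \<longrightarrow>
               LlogL_norm \<omega> (\<lambda>x. F (Du x)) \<le> ennreal (C (Lp_norm p \<omega>' Du) \<omega> \<omega>'))) \<and>
     (\<forall>c>0. \<exists>\<epsilon>\<^sub>0>0. \<forall>\<epsilon>. 0 < \<epsilon> \<and> \<epsilon> < \<epsilon>\<^sub>0 \<longrightarrow>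
        (\<exists>C :: real \<Rightarrow> (real^'n) set \<Rightarrow> (real^'n) set \<Rightarrow> real.
           \<forall>(\<Omega> :: (real^'n) set) (u :: real^'n \<Rightarrow> real^'m) (Du :: real^'n \<Rightarrow> real^'n^'m).
             open \<Omega> \<and> weak_gradient \<Omega> u Du \<and> in_Lp_loc p \<Omega> Du \<and>
             (AE x in lebesgue. x \<in> \<Omega> \<longrightarrow> F (Du x) \<ge> c * op_norm (Du x) powr p) \<longrightarrow>
               in_Lp_loc (p + \<epsilon>) \<Omega> Du \<and>
               (\<forall>\<omega> \<omega>'. open \<omega> \<and> open \<omega>' \<and> \<omega> \<Subset> \<omega>' \<and> \<omega>' \<Subset> \<Omega> \<longrightarrow>
                  Lp_norm (p + \<epsilon>) \<omega> Du \<le> C (Lp_norm p \<omega>' Du) \<omega> \<omega>')))"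
proof (intro conjI allI impI)
  define \<kappa> where "\<kappa> = real (CARD('m) * CARD('n))"
  have \<kappa>: "\<kappa> > 0" by (simp add: \<kappa>_def)
  have Fm[measurable]: "F \<in> borel_measurable borel" using assms(2) by (simp add: quasiconcave_def)
  have F0: "F 0 = 0" using pos_homogeneous_0[OF assms(1,3)] .
  from exists_ball_cover[where 'a = "real^'n"] obtain Z where
    Z0: "\<forall>\<omega> \<omega>' :: (real^'n) set. open \<omega>' \<and> \<omega> \<Subset> \<omega>' \<longrightarrow> finite (Z \<omega> \<omega>') \<and>
      (\<forall>(z, R)\<in>Z \<omega> \<omega>'. R > 0 \<and> cball z R \<subseteq> \<omega>') \<and> \<omega> \<subseteq> (\<Union>(z, R)\<in>Z \<omega> \<omega>'. ball z (R / 2))" ..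
  note Z = Z0[THEN spec, THEN spec, THEN mp, OF conjI]
  \<comment> \<open>The gradient mass that a given Lp norm permits; \<open>\<kappa>\<close> passes
    from the operator norm to the Euclidean norm.\<close>
  define T where "T t = (\<kappa> * t) powr p" for t
  \<comment> \<open>The passage from balls to \<omega>, shared by both parts: \<open>h\<close> is
    the weight with the logarithm in the first and a power in the second.\<close>
  have cover: "(\<integral>\<^sup>+x\<in>\<omega>. h (F (Du x)) \<partial>lebesgue) \<le> ennreal (\<Sum>(z, R)\<in>Z \<omega> \<omega>'. max 0 (B R (T (Lp_norm p \<omega>' Du))))"
    if o: "open \<omega>'" "\<omega> \<Subset> \<omega>'" "\<omega>' \<Subset> \<Omega>" and wg: "weak_gradient \<Omega> u Du" and Lp: "in_Lp_loc p \<Omega> Du"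
      and h[measurable]: "h \<in> borel_measurable borel"
      and B: "\<And>z R T. cball z R \<subseteq> \<Omega> \<Longrightarrow> R > 0 \<Longrightarrow> T \<ge> 0 \<Longrightarrow>
        (\<integral>\<^sup>+x\<in>cball z R. ennreal (norm (Du x) powr p) \<partial>lebesgue) \<le> ennreal T \<Longrightarrow>
        (\<integral>\<^sup>+x\<in>ball z (R / 2). h (F (Du x)) \<partial>lebesgue) \<le> ennreal (B R T)"
    for \<Omega> \<omega> \<omega>' :: "(real^'n) set" and u :: "real^'n \<Rightarrow> real^'m" and Du :: "real^'n \<Rightarrow> real^'n^'m"
      and h :: "real \<Rightarrow> ennreal" and B :: "real \<Rightarrow> real \<Rightarrow> real"
  proof -
    have sub: "\<omega>' \<subseteq> \<Omega>" using o closure_subset[of \<omega>'] by (auto simp: compactly_contained_def)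
    have "in_Lp p \<omega>' Du" using Lp o by (simp add: in_Lp_loc_def)
    then have Tb: "(\<integral>\<^sup>+x\<in>\<omega>'. ennreal (norm (Du x) powr p) \<partial>lebesgue) \<le> ennreal (T (Lp_norm p \<omega>' Du))"
      unfolding T_def \<kappa>_def using assms(1) by (intro nn_integral_norm_powr_le_Lp_norm) auto
    have m: "(\<lambda>x. h (F (Du x)) * indicator \<omega>' x) \<in> borel_measurable lebesgue"
    proof -
      \<comment> \<open>Measurability of \<open>Du\<close> is known only on \<omega>', so the
        indicator is inserted inside \<open>F\<close> as well; the outer indicator makes both
        functions equal.\<close>
      have "(\<lambda>x. h (F (indicat_real \<omega>' x *\<^sub>R Du x)) * indicator \<omega>' x) \<in> borel_measurable lebesgue"
      proof (intro borel_measurable_times_ennreal borel_measurable_indicator)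
        have "(\<lambda>A. h (F A)) \<in> borel_measurable borel" by measurable
        then show "(\<lambda>x. h (F (indicat_real \<omega>' x *\<^sub>R Du x))) \<in> borel_measurable lebesgue"
          by (rule measurable_compose[OF weak_gradient_measurable[OF wg o(3,1)]])
      qed (use o in auto)
      also have "(\<lambda>x. h (F (indicat_real \<omega>' x *\<^sub>R Du x)) * indicator \<omega>' x) = (\<lambda>x. h (F (Du x)) * indicator \<omega>' x)"
        by (auto simp: indicator_def)
      finally show ?thesis .
    qed
    show ?thesis
    proof (rule nn_integral_ball_cover_le[of _ \<omega>'])
      show "finite (Z \<omega> \<omega>')" "\<omega> \<subseteq> (\<Union>(z, R)\<in>Z \<omega> \<omega>'. ball z (R / 2))" using Z[OF o(1,2)] by auto
      show ZR: "cball z R \<subseteq> \<omega>' \<and> R > 0" if "(z, R) \<in> Z \<omega> \<omega>'" for z R using Z[OF o(1,2)] that by auto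
      show "(\<integral>\<^sup>+x\<in>ball z (R / 2). h (F (Du x)) \<partial>lebesgue) \<le> ennreal (B R (T (Lp_norm p \<omega>' Du)))" if "(z, R) \<in> Z \<omega> \<omega>'" for z R
      proof (rule B)
        show "cball z R \<subseteq> \<Omega>" "R > 0" using ZR[OF that] sub by auto
        show "T (Lp_norm p \<omega>' Du) \<ge> 0" by (simp add: T_def)
        have "(\<integral>\<^sup>+x\<in>cball z R. ennreal (norm (Du x) powr p) \<partial>lebesgue) \<le> (\<integral>\<^sup>+x\<in>\<omega>'. ennreal (norm (Du x) powr p) \<partial>lebesgue)"
          using ZR[OF that] by (intro nn_integral_mono) (auto simp: indicator_def)
        then show "(\<integral>\<^sup>+x\<in>cball z R. ennreal (norm (Du x) powr p) \<partial>lebesgue) \<le> ennreal (T (Lp_norm p \<omega>' Du))"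
          using Tb by (rule order_trans)
      qed
    qed (rule m)
  qed
  show "\<exists>C :: real \<Rightarrow> (real^'n) set \<Rightarrow> (real^'n) set \<Rightarrow> real.
        \<forall>(\<Omega> :: (real^'n) set) (u :: real^'n \<Rightarrow> real^'m) (Du :: real^'n \<Rightarrow> real^'n^'m).
          open \<Omega> \<and> weak_gradient \<Omega> u Du \<and> in_Lp_loc p \<Omega> Du \<and>
          (AE x in lebesgue. x \<in> \<Omega> \<longrightarrow> F (Du x) \<ge> 0) \<longrightarrow>
            in_LlogL_loc \<Omega> (\<lambda>x. F (Du x)) \<and>
            (\<forall>\<omega> \<omega>'. open \<omega> \<and> open \<omega>' \<and> \<omega> \<Subset> \<omega>' \<and> \<omega>' \<Subset> \<Omega> \<longrightarrow>
               LlogL_norm \<omega> (\<lambda>x. F (Du x)) \<le> ennreal (C (Lp_norm p \<omega>' Du) \<omega> \<omega>'))"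
  proof (rule LlogL_ball[OF assms])
    fix B assume B: "\<And>\<Omega> (u :: real^'n \<Rightarrow> real^'m) Du z R T. weak_gradient \<Omega> u Du \<Longrightarrow> cball z R \<subseteq> \<Omega> \<Longrightarrow> R > 0 \<Longrightarrow> T \<ge> 0 \<Longrightarrow>
      (AE x in lebesgue. x \<in> \<Omega> \<longrightarrow> F (Du x) \<ge> 0) \<Longrightarrow>
      (\<integral>\<^sup>+x\<in>cball z R. ennreal (norm (Du x) powr p) \<partial>lebesgue) \<le> ennreal T \<Longrightarrow>
      (\<integral>\<^sup>+x\<in>ball z (R / 2). ennreal (\<bar>F (Du x)\<bar> * ln (2 + \<bar>F (Du x)\<bar>)) \<partial>lebesgue) \<le> ennreal (B R T)"
    define S where "S t \<omega> \<omega>' = (\<Sum>(z, R)\<in>Z \<omega> \<omega>'. max 0 (B R (T t)))" for t \<omega> \<omega>'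
    show ?thesis
    proof (intro exI[of _ "\<lambda>t \<omega> \<omega>'. max 1 (S t \<omega> \<omega>')"] allI impI)
      fix \<Omega> :: "(real^'n) set" and u :: "real^'n \<Rightarrow> real^'m" and Du :: "real^'n \<Rightarrow> real^'n^'m"
      assume asm: "open \<Omega> \<and> weak_gradient \<Omega> u Du \<and> in_Lp_loc p \<Omega> Du \<and> (AE x in lebesgue. x \<in> \<Omega> \<longrightarrow> F (Du x) \<ge> 0)"
      have est: "(\<integral>\<^sup>+x\<in>\<omega>. ennreal (\<bar>F (Du x)\<bar> * ln (2 + \<bar>F (Du x)\<bar>)) \<partial>lebesgue) \<le> ennreal (S (Lp_norm p \<omega>' Du) \<omega> \<omega>')"
        if "open \<omega>'" "\<omega> \<Subset> \<omega>'" "\<omega>' \<Subset> \<Omega>" for \<omega> \<omega>'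
        unfolding S_def
      proof (rule cover[OF that, where h = "\<lambda>s. ennreal (\<bar>s\<bar> * ln (2 + \<bar>s\<bar>))"])
        show "weak_gradient \<Omega> u Du" "in_Lp_loc p \<Omega> Du" using asm by auto
        show "(\<lambda>s::real. ennreal (\<bar>s\<bar> * ln (2 + \<bar>s\<bar>))) \<in> borel_measurable borel" by measurable
      qed (use asm B in blast)
      have m: "(\<lambda>x. indicat_real \<omega> x *\<^sub>R F (Du x)) \<in> borel_measurable lebesgue" if "open \<omega>" "\<omega> \<Subset> \<Omega>" for \<omega>
      proof -
        have "(\<lambda>x. F (indicat_real \<omega> x *\<^sub>R Du x)) \<in> borel_measurable lebesgue"
          using asm that by (intro measurable_compose[OF weak_gradient_measurable Fm]) auto
        also have "(\<lambda>x. F (indicat_real \<omega> x *\<^sub>R Du x)) = (\<lambda>x. indicat_real \<omega> x *\<^sub>R F (Du x))"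
          by (auto simp: indicator_def F0)
        finally show ?thesis .
      qed
      have "in_LlogL \<omega> (\<lambda>x. F (Du x))" if \<omega>: "open \<omega>" "\<omega> \<Subset> \<Omega>" for \<omega>
      proof -
        obtain \<omega>' where \<omega>': "open \<omega>'" "\<omega> \<Subset> \<omega>'" "\<omega>' \<Subset> \<Omega>"
          by (rule compactly_contained_interpolate[OF \<omega>(2) asm[THEN conjunct1]]) (rule that)
        show ?thesis
          unfolding in_LlogL_def set_borel_measurable_def
          using m[OF \<omega>] le_less_trans[OF est[OF \<omega>'] ennreal_less_top] by simp
      qed
      moreover have "LlogL_norm \<omega> (\<lambda>x. F (Du x)) \<le> ennreal (max 1 (S (Lp_norm p \<omega>' Du) \<omega> \<omega>'))"
        if o: "open \<omega>" "open \<omega>'" "\<omega> \<Subset> \<omega>'" "\<omega>' \<Subset> \<Omega>" for \<omega> \<omega>'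
      proof (rule LlogL_norm_le[OF _ est[OF o(2,3,4)]])
        have "\<omega> \<Subset> \<Omega>" using o(3,4) closure_subset[of \<omega>'] by (auto simp: compactly_contained_def)
        define k where "k x = indicat_real \<omega> x *\<^sub>R F (Du x)" for x
        have [measurable]: "k \<in> borel_measurable lebesgue" unfolding k_def using m[OF o(1) \<open>\<omega> \<Subset> \<Omega>\<close>] .
        have "(\<lambda>x. ennreal (\<bar>k x\<bar> * ln (2 + \<bar>k x\<bar>))) \<in> borel_measurable lebesgue" by measurable
        also have "(\<lambda>x. ennreal (\<bar>k x\<bar> * ln (2 + \<bar>k x\<bar>))) = (\<lambda>x. ennreal (\<bar>F (Du x)\<bar> * ln (2 + \<bar>F (Du x)\<bar>)) * indicator \<omega> x)"
          by (auto simp: k_def indicator_def)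
        finally show "(\<lambda>x. ennreal (\<bar>F (Du x)\<bar> * ln (2 + \<bar>F (Du x)\<bar>)) * indicator \<omega> x) \<in> borel_measurable lebesgue" .
      qed
      ultimately show "in_LlogL_loc \<Omega> (\<lambda>x. F (Du x)) \<and> (\<forall>\<omega> \<omega>'. open \<omega> \<and> open \<omega>' \<and> \<omega> \<Subset> \<omega>' \<and> \<omega>' \<Subset> \<Omega> \<longrightarrow>
               LlogL_norm \<omega> (\<lambda>x. F (Du x)) \<le> ennreal (max 1 (S (Lp_norm p \<omega>' Du) \<omega> \<omega>')))"
        by (simp add: in_LlogL_loc_def)
    qed
  qed
  fix c :: real assume c: "c > 0"
  \<comment> \<open>The constant for which the hypothesis in the operator norm implies the same
    inequality in the Euclidean norm.\<close>
  define c' where "c' = c * \<kappa> powr (- p)"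
  have c': "c' > 0" using c \<kappa> by (simp add: c'_def)
  show "\<exists>\<epsilon>\<^sub>0>0. \<forall>\<epsilon>. 0 < \<epsilon> \<and> \<epsilon> < \<epsilon>\<^sub>0 \<longrightarrow>
        (\<exists>C :: real \<Rightarrow> (real^'n) set \<Rightarrow> (real^'n) set \<Rightarrow> real.
           \<forall>(\<Omega> :: (real^'n) set) (u :: real^'n \<Rightarrow> real^'m) (Du :: real^'n \<Rightarrow> real^'n^'m).
             open \<Omega> \<and> weak_gradient \<Omega> u Du \<and> in_Lp_loc p \<Omega> Du \<and>
             (AE x in lebesgue. x \<in> \<Omega> \<longrightarrow> F (Du x) \<ge> c * op_norm (Du x) powr p) \<longrightarrow>
               in_Lp_loc (p + \<epsilon>) \<Omega> Du \<and>
               (\<forall>\<omega> \<omega>'. open \<omega> \<and> open \<omega>' \<and> \<omega> \<Subset> \<omega>' \<and> \<omega>' \<Subset> \<Omega> \<longrightarrow>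
                  Lp_norm (p + \<epsilon>) \<omega> Du \<le> C (Lp_norm p \<omega>' Du) \<omega> \<omega>'))"
  proof (rule higher_integrability_ball[OF assms c'])
    fix e0 :: real and B assume e0: "e0 > 0"
      and B: "\<And>\<Omega> (u :: real^'n \<Rightarrow> real^'m) Du z R T e. weak_gradient \<Omega> u Du \<Longrightarrow> cball z R \<subseteq> \<Omega> \<Longrightarrow> R > 0 \<Longrightarrow> T \<ge> 0 \<Longrightarrow>
      (AE x in lebesgue. x \<in> \<Omega> \<longrightarrow> c' * norm (Du x) powr p \<le> F (Du x)) \<Longrightarrow>
      (\<integral>\<^sup>+x\<in>cball z R. ennreal (norm (Du x) powr p) \<partial>lebesgue) \<le> ennreal T \<Longrightarrow> 0 < e \<Longrightarrow> e < e0 \<Longrightarrow>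
      (\<integral>\<^sup>+x\<in>ball z (R / 2). ennreal (F (Du x) powr (1 + e)) \<partial>lebesgue) \<le> ennreal (B e R T)"
    show ?thesis
    proof (intro exI[of _ "p * e0"] conjI allI impI)
      show "p * e0 > 0" using assms(1) e0 by simp
      fix \<epsilon> assume \<epsilon>: "0 < \<epsilon> \<and> \<epsilon> < p * e0"
      \<comment> \<open>Since \<open>F (Du x)\<close> dominates a multiple of the
        \<open>p\<close>-th power of the gradient, its power \<open>1 + e\<close> controls the power
        \<open>p + \<epsilon>\<close>.\<close>
      define e where "e = \<epsilon> / p"
      have e: "0 < e" "e < e0" "p * (1 + e) = p + \<epsilon>"
        using \<epsilon> assms(1) by (auto simp: e_def field_simps)
      define S where "S t \<omega> \<omega>' = c powr (- (1 + e)) * (\<Sum>(z, R)\<in>Z \<omega> \<omega>'. max 0 (B e R (T t)))" for t \<omega> \<omega>'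
      have S0: "S t \<omega> \<omega>' \<ge> 0" for t \<omega> \<omega>' unfolding S_def by (intro mult_nonneg_nonneg sum_nonneg) auto
      show "\<exists>C :: real \<Rightarrow> (real^'n) set \<Rightarrow> (real^'n) set \<Rightarrow> real.
           \<forall>(\<Omega> :: (real^'n) set) (u :: real^'n \<Rightarrow> real^'m) (Du :: real^'n \<Rightarrow> real^'n^'m).
             open \<Omega> \<and> weak_gradient \<Omega> u Du \<and> in_Lp_loc p \<Omega> Du \<and>
             (AE x in lebesgue. x \<in> \<Omega> \<longrightarrow> F (Du x) \<ge> c * op_norm (Du x) powr p) \<longrightarrow>
               in_Lp_loc (p + \<epsilon>) \<Omega> Du \<and>
               (\<forall>\<omega> \<omega>'. open \<omega> \<and> open \<omega>' \<and> \<omega> \<Subset> \<omega>' \<and> \<omega>' \<Subset> \<Omega> \<longrightarrow>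
                  Lp_norm (p + \<epsilon>) \<omega> Du \<le> C (Lp_norm p \<omega>' Du) \<omega> \<omega>')"
      proof (intro exI[of _ "\<lambda>t \<omega> \<omega>'. S t \<omega> \<omega>' powr (1 / (p + \<epsilon>))"] allI impI)
        fix \<Omega> :: "(real^'n) set" and u :: "real^'n \<Rightarrow> real^'m" and Du :: "real^'n \<Rightarrow> real^'n^'m"
        assume asm: "open \<Omega> \<and> weak_gradient \<Omega> u Du \<and> in_Lp_loc p \<Omega> Du \<and> (AE x in lebesgue. x \<in> \<Omega> \<longrightarrow> F (Du x) \<ge> c * op_norm (Du x) powr p)"
        have wg: "weak_gradient \<Omega> u Du" and Lp: "in_Lp_loc p \<Omega> Du"
          and ineq: "AE x in lebesgue. x \<in> \<Omega> \<longrightarrow> c * op_norm (Du x) powr p \<le> F (Du x)" using asm by auto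
        have ineq': "AE x in lebesgue. x \<in> \<Omega> \<longrightarrow> c' * norm (Du x) powr p \<le> F (Du x)"
          using ineq
        proof eventually_elim
          case (elim x)
          have "norm (Du x) powr p \<le> (\<kappa> * op_norm (Du x)) powr p"
            using assms(1) norm_le_op_norm[of "Du x"] unfolding \<kappa>_def by (intro powr_mono2) auto
          then have "c' * norm (Du x) powr p \<le> c' * (\<kappa> powr p * op_norm (Du x) powr p)"
            using c' by (intro mult_left_mono) (auto simp: powr_mult)
          also have "\<dots> = c * op_norm (Du x) powr p"
            using \<kappa> by (simp add: c'_def powr_minus)
          finally show ?case using elim by auto
        qed
        have est: "(\<integral>\<^sup>+x. ennreal (indicat_real \<omega> x *\<^sub>R op_norm (Du x) powr (p + \<epsilon>)) \<partial>lebesgue) \<le> ennreal (S (Lp_norm p \<omega>' Du) \<omega> \<omega>')"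
          if o: "open \<omega>" "open \<omega>'" "\<omega> \<Subset> \<omega>'" "\<omega>' \<Subset> \<Omega>" for \<omega> \<omega>'
        proof -
          have sub: "\<omega> \<Subset> \<Omega>" "\<omega> \<subseteq> \<Omega>"
            using o closure_subset[of \<omega>'] closure_subset[of \<omega>] by (auto simp: compactly_contained_def)
          define k where "k x = F (indicat_real \<omega> x *\<^sub>R Du x)" for x
          have [measurable]: "k \<in> borel_measurable lebesgue"
            unfolding k_def using wg sub(1) o(1) by (intro measurable_compose[OF weak_gradient_measurable Fm])
          have "(\<lambda>x. ennreal (k x powr (1 + e))) \<in> borel_measurable lebesgue" by measurable
          also have "(\<lambda>x. ennreal (k x powr (1 + e))) = (\<lambda>x. ennreal (F (Du x) powr (1 + e)) * indicator \<omega> x)"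
            by (auto simp: k_def indicator_def F0)
          finally have m: "(\<lambda>x. ennreal (F (Du x) powr (1 + e)) * indicator \<omega> x) \<in> borel_measurable lebesgue" .
          have "(\<integral>\<^sup>+x. ennreal (indicat_real \<omega> x *\<^sub>R op_norm (Du x) powr (p + \<epsilon>)) \<partial>lebesgue)
              \<le> (\<integral>\<^sup>+x. ennreal (c powr (- (1 + e))) * (ennreal (F (Du x) powr (1 + e)) * indicator \<omega> x) \<partial>lebesgue)"
          proof (rule nn_integral_mono_AE)
            show "AE x in lebesgue. ennreal (indicat_real \<omega> x *\<^sub>R op_norm (Du x) powr (p + \<epsilon>))
                \<le> ennreal (c powr (- (1 + e))) * (ennreal (F (Du x) powr (1 + e)) * indicator \<omega> x)"
              using ineq
            proof eventually_elim
              case (elim x)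
              show ?case
              proof (cases "x \<in> \<omega>")
                case True
                then have "(c * op_norm (Du x) powr p) powr (1 + e) \<le> F (Du x) powr (1 + e)"
                  using elim sub(2) c e by (intro powr_mono2) auto
                then have "c powr (1 + e) * op_norm (Du x) powr (p + \<epsilon>) \<le> F (Du x) powr (1 + e)"
                  by (simp add: powr_mult powr_powr e(3))
                then have "c powr (- (1 + e)) * (c powr (1 + e) * op_norm (Du x) powr (p + \<epsilon>)) \<le> c powr (- (1 + e)) * F (Du x) powr (1 + e)"
                  by (rule mult_left_mono) simp
                moreover have "c powr (- (1 + e)) * c powr (1 + e) = 1" using c by (simp flip: powr_add)
                ultimately have "op_norm (Du x) powr (p + \<epsilon>) \<le> c powr (- (1 + e)) * F (Du x) powr (1 + e)"
                  by (simp flip: mult.assoc)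
                then have "ennreal (op_norm (Du x) powr (p + \<epsilon>)) \<le> ennreal (c powr (- (1 + e))) * ennreal (F (Du x) powr (1 + e))"
                  by (subst ennreal_mult[symmetric]) (auto intro: ennreal_leI)
                then show ?thesis using True by simp
              qed simp
            qed
          qed
          also have "\<dots> = ennreal (c powr (- (1 + e))) * (\<integral>\<^sup>+x\<in>\<omega>. ennreal (F (Du x) powr (1 + e)) \<partial>lebesgue)"
            by (rule nn_integral_cmult[OF m])
          also have "\<dots> \<le> ennreal (c powr (- (1 + e))) * ennreal (\<Sum>(z, R)\<in>Z \<omega> \<omega>'. max 0 (B e R (T (Lp_norm p \<omega>' Du))))"
          proof (rule mult_left_mono)
            show "(\<integral>\<^sup>+x\<in>\<omega>. ennreal (F (Du x) powr (1 + e)) \<partial>lebesgue) \<le> ennreal (\<Sum>(z, R)\<in>Z \<omega> \<omega>'. max 0 (B e R (T (Lp_norm p \<omega>' Du))))"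
            proof (rule cover[OF o(2,3,4) wg Lp, where h = "\<lambda>s. ennreal (s powr (1 + e))"])
              show "(\<lambda>s::real. ennreal (s powr (1 + e))) \<in> borel_measurable borel" by measurable
            qed (rule B[OF wg _ _ _ ineq' _ e(1,2)])
          qed simp
          also have "\<dots> = ennreal (S (Lp_norm p \<omega>' Du) \<omega> \<omega>')"
            unfolding S_def by (rule ennreal_mult[symmetric]) (auto intro: sum_nonneg)
          finally show ?thesis .
        qed
        have m: "(\<lambda>x. indicat_real \<omega> x *\<^sub>R op_norm (Du x) powr (p + \<epsilon>)) \<in> borel_measurable lebesgue"
          if "open \<omega>" "\<omega> \<Subset> \<Omega>" for \<omega>
        proof -
          \<comment> \<open>Measurability of the higher power is obtained by raising the integrable
            \<open>p\<close>-th power to \<open>1 + e\<close>.\<close>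
          have "set_integrable lebesgue \<omega> (\<lambda>x. op_norm (Du x) powr p)"
            using Lp that by (simp add: in_Lp_loc_def in_Lp_def)
          then have [measurable]: "(\<lambda>x. indicat_real \<omega> x *\<^sub>R op_norm (Du x) powr p) \<in> borel_measurable lebesgue"
            unfolding set_integrable_def by (rule borel_measurable_integrable)
          have "(\<lambda>x. (indicat_real \<omega> x *\<^sub>R op_norm (Du x) powr p) powr (1 + e)) \<in> borel_measurable lebesgue" by measurable
          also have "(\<lambda>x. (indicat_real \<omega> x *\<^sub>R op_norm (Du x) powr p) powr (1 + e)) = (\<lambda>x. indicat_real \<omega> x *\<^sub>R op_norm (Du x) powr (p + \<epsilon>))"
            by (auto simp: indicator_def powr_powr e(3))
          finally show ?thesis .
        qed
        have "in_Lp (p + \<epsilon>) \<omega> Du" if \<omega>: "open \<omega>" "\<omega> \<Subset> \<Omega>" for \<omega>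
        proof -
          obtain \<omega>' where \<omega>': "open \<omega>'" "\<omega> \<Subset> \<omega>'" "\<omega>' \<Subset> \<Omega>"
            by (rule compactly_contained_interpolate[OF \<omega>(2) asm[THEN conjunct1]]) (rule that)
          have "(\<integral>\<^sup>+x. ennreal (indicat_real \<omega> x *\<^sub>R op_norm (Du x) powr (p + \<epsilon>)) \<partial>lebesgue) < \<infinity>"
            using le_less_trans[OF est[OF \<omega>(1) \<omega>'] ennreal_less_top] by simp
          then have "set_integrable lebesgue \<omega> (\<lambda>x. op_norm (Du x) powr (p + \<epsilon>))"
            unfolding set_integrable_def by (intro integrableI_nonneg m[OF \<omega>]) auto
          moreover have "set_borel_measurable lebesgue \<omega> Du"
            using Lp \<omega> by (simp add: in_Lp_loc_def in_Lp_def)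
          ultimately show ?thesis by (simp add: in_Lp_def)
        qed
        moreover have "Lp_norm (p + \<epsilon>) \<omega> Du \<le> S (Lp_norm p \<omega>' Du) \<omega> \<omega>' powr (1 / (p + \<epsilon>))"
          if o: "open \<omega>" "open \<omega>'" "\<omega> \<Subset> \<omega>'" "\<omega>' \<Subset> \<Omega>" for \<omega> \<omega>'
        proof -
          have "\<omega> \<Subset> \<Omega>" using o closure_subset[of \<omega>'] by (auto simp: compactly_contained_def)
          have "(LINT x:\<omega>|lebesgue. op_norm (Du x) powr (p + \<epsilon>)) = enn2real (\<integral>\<^sup>+x. ennreal (indicat_real \<omega> x *\<^sub>R op_norm (Du x) powr (p + \<epsilon>)) \<partial>lebesgue)"
            unfolding set_lebesgue_integral_def by (rule integral_eq_nn_integral[OF m[OF o(1) \<open>\<omega> \<Subset> \<Omega>\<close>]]) simp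
          also have "\<dots> \<le> S (Lp_norm p \<omega>' Du) \<omega> \<omega>'"
            by (rule enn2real_leI[OF S0 est[OF o]])
          finally show ?thesis
            unfolding Lp_norm_def[of "p + \<epsilon>"] using assms(1) \<epsilon>
            by (intro powr_mono2) (auto simp: set_lebesgue_integral_def intro!: Bochner_Integration.integral_nonneg)
        qed
        ultimately show "in_Lp_loc (p + \<epsilon>) \<Omega> Du \<and> (\<forall>\<omega> \<omega>'. open \<omega> \<and> open \<omega>' \<and> \<omega> \<Subset> \<omega>' \<and> \<omega>' \<Subset> \<Omega> \<longrightarrow>
                  Lp_norm (p + \<epsilon>) \<omega> Du \<le> S (Lp_norm p \<omega>' Du) \<omega> \<omega>' powr (1 / (p + \<epsilon>)))"
          by (simp add: in_Lp_loc_def)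
      qed
    qed
  qed
qed

end
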